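(* Let $\lambda=-1$ and let $b\in(0,1)$ be rational. Then for any connected graph $G$, we have $Z_G(\lambda,b)>0$ if $G$ has an even number of vertices, and $Z_G(\lambda,b)=0$ otherwise. Moreover, for all integers $\Delta\geq3$, $\#\mathsf{IsingNorm}(\lambda,b,\Delta)\equiv_{\mathsf{AP}}\#\mathsf{PerfectMatchings}$.
   Context: For a finite graph $G=(V,E)$, $Z_G(\lambda,b)=\sum_{\sigma:V\to\{+,-\}}\lambda^{|n_+(\sigma)|}b^{\delta(\sigma)}$, where $n_+(\sigma)$ is the set of vertices with spin $+$ and $\delta(\sigma)$ is the number of edges whose endpoints get different spins. $\#\mathsf{IsingNorm}(\lambda,b,\Delta)$ is the problem of computing $|Z_G(\lambda,b)|$ given a graph $G$ of maximum degree at most $\Delta$. $\#\mathsf{PerfectMatchings}$ is the problem of computing the number of perfect matchings of a given (arbitrary) graph. AP-reductions (in the sense of Dyer, Goldberg, Greenhill and Jerrum): a randomised approximation scheme (RAS) for a nonnegative function $f$ is a randomised algorithm that, on input $x$ and $\epsilon\in(0,1)$, outputs $z$ with $\Pr[e^{-\epsilon}f(x)\leq z\leq e^{\epsilon}f(x)]\geq 3/4$; it is an FPRAS if it runs in time polynomial in $|x|$ and $1/\epsilon$. An AP-reduction from $f$ to $g$ is a probabilistic oracle algorithm taking input $(x,\epsilon)$ such that every oracle call has the form $(w,\delta)$ with $w$ an instance of $g$ and $0<\delta<1$ with $\delta^{-1}$ bounded by a polynomial in $|x|$ and $\epsilon^{-1}$; the algorithm is a RAS for $f$ whenever the oracle is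 a RAS for $g$; and its running time is polynomial in $|x|$ and $\epsilon^{-1}$. Write $f\leq_{\mathsf{AP}}g$ if such a reduction exists, and $f\equiv_{\mathsf{AP}}g$ if both $f\leq_{\mathsf{AP}}g$ and $g\leq_{\mathsf{AP}}f$. *)

theory Defs
  imports "HOL-Probability.Probability_Mass_Function"
begin

section \<open>Graphs and the Ising model\<close>

definition finite_graph :: "'a set \<Rightarrow> 'a set set \<Rightarrow> bool" where
  "finite_graph V E \<longleftrightarrow> finite V \<and> (\<forall>e\<in>E. e \<subseteq> V \<and> card e = 2)"

definition connected_graph :: "'a set \<Rightarrow> 'a set set \<Rightarrow> bool" where
  "connected_graph V E \<longleftrightarrow>
     finite_graph V E \<and> (\<forall>u\<in>V. \<forall>v\<in>V. (u, v) \<in> {(x, y). {x, y} \<in> E}\<^sup>*)"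

definition degree :: "'a set set \<Rightarrow> 'a \<Rightarrow> nat" where
  "degree E v = card {e \<in> E. v \<in> e}"

datatype spin = Plus | Minus

definition num_plus :: "'a set \<Rightarrow> ('a \<Rightarrow> spin) \<Rightarrow> nat" where
  "num_plus V \<sigma> = card {v \<in> V. \<sigma> v = Plus}"

definition num_cut :: "'a set set \<Rightarrow> ('a \<Rightarrow> spin) \<Rightarrow> nat" where
  "num_cut E \<sigma> = card {e \<in> E. \<exists>u\<in>e. \<exists>v\<in>e. \<sigma> u \<noteq> \<sigma> v}"

definition ising_Z :: "'a set \<Rightarrow> 'a set set \<Rightarrow> 'c::comm_semiring_1 \<Rightarrow> 'c \<Rightarrow> 'c" where
  "ising_Z V E lam b = (\<Sum>\<sigma> \<in> V \<rightarrow>\<^sub>E UNIV. lam ^ num_plus V \<sigma> * b ^ num_cut E \<sigma>)"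

definition perfect_matchings :: "'a set \<Rightarrow> 'a set set \<Rightarrow> 'a set set set" where
  "perfect_matchings V E = {M. M \<subseteq> E \<and> (\<forall>v\<in>V. \<exists>!e. e \<in> M \<and> v \<in> e)}"


section \<open>Counting problems\<close>

record 'i problem =
  instances :: "'i set"
  encode :: "'i \<Rightarrow> bool list"
  answer :: "'i \<Rightarrow> real"

text \<open>A graph given as input has vertex set \<open>{..<n}\<close> and is written as
  \<open>n\<close> in unary followed by its adjacency matrix, row by row.\<close>

type_synonym input_graph = "nat \<times> nat set set"

definition encode_graph :: "input_graph \<Rightarrow> bool list" where
  "encode_graph = (\<lambda>(n, E).
     replicate n True @ [False] @ [{i, j} \<in> E. i \<leftarrow> [0..<n], j \<leftarrow> [0..<n]])"

definition IsingNorm :: "'c::real_normed_field \<Rightarrow> 'c \<Rightarrow> nat \<Rightarrow> input_graph problem" where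
  "IsingNorm lam b \<Delta> =
     \<lparr>instances = {(n, E). finite_graph {..<n} E \<and> (\<forall>v<n. degree E v \<le> \<Delta>)},
      encode = encode_graph,
      answer = (\<lambda>(n, E). norm (ising_Z {..<n} E lam b))\<rparr>"

definition PerfectMatchings :: "input_graph problem" where
  "PerfectMatchings =
     \<lparr>instances = {(n, E). finite_graph {..<n} E},
      encode = encode_graph,
      answer = (\<lambda>(n, E). real (card (perfect_matchings {..<n} E)))\<rparr>"


section \<open>Numbers in binary\<close>

text \<open>Error parameters and output values are written in binary positional notation, most
  significant digit first.  An output is a pair \<open>(ip, fp)\<close> of the digits before and
  after the binary point.  This format, unlike quotients of integers, lets a machine read a
  number to a given precision without reading its whole representation.  It matters because
  neither the length of \<open>\<epsilon>\<close> nor the length of an oracle answer is bounded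
  in terms of \<open>|x|\<close> and \<open>1/\<epsilon>\<close>, on which alone the running time of a
  reduction may depend.  For the same reason leading zeros are excluded.\<close>

definition frac_val :: "bool list \<Rightarrow> real" where
  "frac_val ds = horner_sum of_bool (1/2) ds / 2"

definition error_param :: "bool list \<Rightarrow> bool" where
  "error_param ds \<longleftrightarrow> 0 < frac_val ds \<and> frac_val ds < 1"

type_synonym numeral_rep = "bool list \<times> bool list"

definition valid_numeral :: "numeral_rep \<Rightarrow> bool" where
  "valid_numeral z \<longleftrightarrow> (fst z \<noteq> [] \<longrightarrow> hd (fst z))"

definition numeral_val :: "numeral_rep \<Rightarrow> real" where
  "numeral_val z = horner_sum of_bool 2 (rev (fst z)) + frac_val (snd z)"


section \<open>Probabilistic oracle machines\<close>

text \<open>Structured programs over finitely many stacks of bits: every elementary operation touches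
  one top-of-stack symbol and takes one step, so this is a multi-tape Turing machine (a tape is
  two stacks) up to a constant factor in time.  \<open>Toss r\<close> pushes a fair random bit.
  \<open>Query w d i f\<close> submits the instance on stack \<open>w\<close> and the error parameter
  on stack \<open>d\<close> to the oracle, whose answer replaces the contents of stacks
  \<open>i\<close> and \<open>f\<close>; it also takes one step, in addition to the steps spent
  on writing the query and on reading the answer.\<close>

datatype program =
    Nop
  | Push nat bool
  | Pop nat
  | Toss nat
  | Query nat nat nat nat
  | Seq program program
  | Branch nat program program program  \<comment> \<open>top of stack: none, \<open>False\<close>, \<open>True\<close>\<close>
  | While nat program  \<comment> \<open>loop as long as the stack is nonempty\<close>

type_synonym store = "nat \<Rightarrow> bool list"
type_synonym config = "program list \<times> store"  \<comment> \<open>programs still to be run; halted if none\<close>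

text \<open>The output distribution on an encoded instance and an error parameter.  An oracle is
  given by its output distributions; different calls are answered independently.\<close>

type_synonym scheme = "bool list \<Rightarrow> bool list \<Rightarrow> numeral_rep pmf"

fun step :: "scheme \<Rightarrow> config \<Rightarrow> config pmf" where
  "step Or ([], s) = return_pmf ([], s)"
| "step Or (Nop # k, s) = return_pmf (k, s)"
| "step Or (Push r x # k, s) = return_pmf (k, s(r := x # s r))"
| "step Or (Pop r # k, s) = return_pmf (k, s(r := tl (s r)))"
| "step Or (Toss r # k, s) = map_pmf (\<lambda>x. (k, s(r := x # s r))) (bernoulli_pmf (1/2))"
| "step Or (Query w d i f # k, s) =
     map_pmf (\<lambda>(ip, fp). (k, s(i := ip, f := fp))) (Or (s w) (s d))"
| "step Or (Seq c c' # k, s) = return_pmf (c # c' # k, s)"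
| "step Or (Branch r c\<^sub>e c\<^sub>f c\<^sub>t # k, s) =
     return_pmf ((case s r of [] \<Rightarrow> c\<^sub>e | x # _ \<Rightarrow> if x then c\<^sub>t else c\<^sub>f) # k, s)"
| "step Or (While r c # k, s) =
     return_pmf (if s r = [] then k else c # While r c # k, s)"

text \<open>The instance is supplied on stack 0 and the error parameter on stack 1.
  The output is read off stacks 2 and 3.\<close>

definition initial :: "program \<Rightarrow> bool list \<Rightarrow> bool list \<Rightarrow> config" where
  "initial M u e = ([M], (\<lambda>_. [])(0 := u, 1 := e))"

definition run :: "scheme \<Rightarrow> program \<Rightarrow> bool list \<Rightarrow> bool list \<Rightarrow> nat \<Rightarrow> config pmf" where
  "run Or M u e n = ((\<lambda>p. bind_pmf p (step Or)) ^^ n) (return_pmf (initial M u e))"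

definition result :: "config \<Rightarrow> numeral_rep" where
  "result cfg = (snd cfg 2, snd cfg 3)"


section \<open>AP-reductions\<close>

text \<open>The guarantee of a randomised approximation scheme.  It is stated for input-output
  behaviours, so that an oracle is a black box; a reduction has to work for every such oracle,
  in particular for those computed by a randomised algorithm.\<close>

definition RAS :: "'i problem \<Rightarrow> scheme \<Rightarrow> bool" where
  "RAS P A \<longleftrightarrow> (\<forall>x \<in> instances P. \<forall>e. error_param e \<longrightarrow>
     measure_pmf.prob (A (encode P x) e)
       {z. valid_numeral z \<and>
           exp (- frac_val e) * answer P x \<le> numeral_val z \<and>
           numeral_val z \<le> exp (frac_val e) * answer P x} \<ge> 3/4)"

text \<open>Since \<open>1/\<epsilon> > 1\<close>, every polynomial in \<open>|x|\<close> and
  \<open>1/\<epsilon>\<close> is bounded by one of the following form.\<close>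

definition poly_bound :: "nat \<Rightarrow> nat \<Rightarrow> bool list \<Rightarrow> bool list \<Rightarrow> real" where
  "poly_bound c k u e = real c * (real (length u) + 1 / frac_val e) ^ k"

definition legal_call :: "'j problem \<Rightarrow> real \<Rightarrow> config \<Rightarrow> bool" where
  "legal_call Q B cfg \<longleftrightarrow> (\<forall>w d i f k s. cfg = (Query w d i f # k, s) \<longrightarrow>
     s w \<in> encode Q ` instances Q \<and> error_param (s d) \<and> 1 / frac_val (s d) \<le> B)"

definition AP_reduction ::
    "program \<Rightarrow> nat \<Rightarrow> nat \<Rightarrow> 'i problem \<Rightarrow> 'j problem \<Rightarrow> bool" where
  "AP_reduction M c k P Q \<longleftrightarrow>
     (\<forall>Or. \<forall>x \<in> instances P. \<forall>e. error_param e \<longrightarrow>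
        (let u = encode P x; B = poly_bound c k u e in
          (\<forall>n. \<forall>cfg \<in> set_pmf (run Or M u e n). legal_call Q B cfg) \<and>
          (\<forall>cfg \<in> set_pmf (run Or M u e (nat \<lfloor>B\<rfloor>)). fst cfg = []))) \<and>
     (\<forall>Or. RAS Q Or \<longrightarrow>
        RAS P (\<lambda>u e. map_pmf result (run Or M u e (nat \<lfloor>poly_bound c k u e\<rfloor>))))"

definition AP_reducible :: "'i problem \<Rightarrow> 'j problem \<Rightarrow> bool"  (infix "\<le>\<^sub>A\<^sub>P" 50) where
  "P \<le>\<^sub>A\<^sub>P Q \<longleftrightarrow> (\<exists>M c k. AP_reduction M c k P Q)"

definition AP_equivalent :: "'i problem \<Rightarrow> 'j problem \<Rightarrow> bool"  (infix "\<equiv>\<^sub>A\<^sub>P" 50) where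
  "P \<equiv>\<^sub>A\<^sub>P Q \<longleftrightarrow> P \<le>\<^sub>A\<^sub>P Q \<and> Q \<le>\<^sub>A\<^sub>P P"

end

(*
  Write t = (1 - b) / (1 + b).  The high-temperature expansion at lambda = -1 keeps exactly the
  edge sets A in which every vertex has odd degree, so that |Z| is an explicit factor times the
  sum of t^|A| over these odd subgraphs.  A connected graph of even order has one, and a graph of
  odd order has none.

  Ising to matchings: t = p / q is rational.  Replacing every vertex by a chain of triangles,
  which checks parity, and every edge by a gadget with q perfect matchings, p of which remain
  when its end vertices are used, turns the sum over odd subgraphs into a number of perfect matchings.

  Matchings to Ising: the odd subgraphs with the fewest edges are the perfect matchings.
  Stretching every edge to a path whose inner vertices carry leaves replaces t by the tiny weight
  t^(2k+1), and spreading each vertex along a path bounds the degrees by 3; the sum over odd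
  subgraphs is then dominated by the perfect matchings.

  Both reductions make one query, scale the answer by an explicit rational number and round it
  to a sufficiently fine binary fraction, which leaves the answer 0 unchanged.
*)
theory Submission
  imports Defs
begin

section \<open>Timed deterministic runs of stack programs\<close>

section \<open>Deterministic execution\<close>

text \<open>Running time is counted on concrete machines. The query is therefore built from
  functions of unary numbers, a class closed under arithmetic and bounded sums. Exponentially large
  numbers occur only in the scaling of the answer, whose factor is a quotient of products of powers,
  applied one base at a time.

  The obstacle to the rounding is that a true value 0 has to be answered by 0 exactly. Keeping
  \<open>D\<close> binary places achieves this if nonzero values lie well above the last place and
  spurious contributions well below it. From Ising to matchings the value may be exponentially small
  but the correspondence is exact, so \<open>D\<close> grows with the number of edges. From
  matchings to Ising the value is an integer, so \<open>D\<close> depends on the error parameter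
  only; there the odd subgraphs other than perfect matchings contribute, and the stub length
  \<open>k\<close> is chosen to push their total below the last place.

  Oddness of the degrees comes from the sum over the two spins of a vertex,
  \<open>-1 + (-1) ^ degree A v\<close>, which vanishes for even degree.\<close>

inductive dstep :: "config \<Rightarrow> config \<Rightarrow> bool" where
  "dstep (Nop # k, s) (k, s)"
| "dstep (Push r x # k, s) (k, s(r := x # s r))"
| "dstep (Pop r # k, s) (k, s(r := tl (s r)))"
| "dstep (Seq c c' # k, s) (c # c' # k, s)"
| "dstep (Branch r ce cf ct # k, s)
     ((case s r of [] \<Rightarrow> ce | x # _ \<Rightarrow> if x then ct else cf) # k, s)"
| "dstep (While r c # k, s) (if s r = [] then k else c # While r c # k, s)"

inductive_cases dstep_NilE: "dstep ([], s) y"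
inductive_cases dstep_QueryE: "dstep (Query w d i f # k, s) y"

text \<open>\<open>Toss\<close> and \<open>Query\<close> have no rule in \<open>dstep\<close>.
  Result and running time of what runs by \<open>dstep\<close> alone thus do not depend on the
  oracle.\<close>

lemma dstep_step: "dstep x y \<Longrightarrow> step Or x = return_pmf y"
  by (induction rule: dstep.induct) auto

lemma dstep_legal: "dstep x y \<Longrightarrow> legal_call Q B x"
  by (induction rule: dstep.induct) (auto simp: legal_call_def)

lemma dstep_length: "dstep x y \<Longrightarrow> length (snd y r) \<le> Suc (length (snd x r))"
  by (induction rule: dstep.induct) auto

text \<open>Quantifying over the continuation \<open>k\<close> makes runs composable: whatever still
  has to be run afterwards stays untouched.\<close>

definition runs :: "program \<Rightarrow> store \<Rightarrow> nat \<Rightarrow> store \<Rightarrow> bool" where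
  "runs c s t s' \<longleftrightarrow> (\<forall>k. (dstep ^^ t) (c # k, s) (k, s'))"

definition exec :: "program \<Rightarrow> store \<Rightarrow> nat \<Rightarrow> store \<Rightarrow> bool" where
  "exec c s T s' \<longleftrightarrow> (\<exists>t\<le>T. runs c s t s')"

lemma exec_mono: "exec c s T s' \<Longrightarrow> T \<le> T' \<Longrightarrow> exec c s T' s'"
  unfolding exec_def by (meson order_trans)

lemma exec_cong: "exec c s T s' \<Longrightarrow> T \<le> T' \<Longrightarrow> s' = s'' \<Longrightarrow> exec c s T' s''"
  using exec_mono by blast

text \<open>A step pushes at most one symbol, so every time bound is also a bound on the growth of
  the stacks.\<close>

lemma exec_length:
  assumes "exec c s T s'"
  shows "length (s' r) \<le> length (s r) + T"
proof -
  obtain t where t: "t \<le> T" "(dstep ^^ t) ([c], s) ([], s')"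
    using assms unfolding exec_def runs_def by blast
  have "(dstep ^^ n) x y \<Longrightarrow> length (snd y r) \<le> length (snd x r) + n" for n x y
  proof (induction n arbitrary: y)
    case (Suc n)
    then obtain z where "(dstep ^^ n) x z" "dstep z y" by auto
    then show ?case using Suc.IH[of z] dstep_length[of z y r] by simp
  qed simp
  from this[OF t(2)] t(1) show ?thesis by simp
qed

lemma exec_single:
  assumes "\<And>k. dstep (c # k, s) (k, s')"
  shows "exec c s 1 s'"
  unfolding exec_def runs_def using assms by (intro exI[of _ 1]) auto

lemma exec_Nop: "exec Nop s 1 s"
  by (rule exec_single) (rule dstep.intros)

lemma exec_Push: "exec (Push r x) s 1 (s(r := x # s r))"
  by (rule exec_single) (rule dstep.intros)

lemma exec_Pop: "exec (Pop r) s 1 (s(r := tl (s r)))"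
  by (rule exec_single) (rule dstep.intros)

lemma exec_While_end: "s r = [] \<Longrightarrow> exec (While r c) s 1 s"
  by (rule exec_single) (metis dstep.intros(6))

lemma relpowp_step: "R x y \<Longrightarrow> (R ^^ n) y z \<Longrightarrow> (R ^^ Suc n) x z"
  by (rule relpowp_Suc_I2)

lemma relpowp_add: "(R ^^ m) x y \<Longrightarrow> (R ^^ n) y z \<Longrightarrow> (R ^^ (m + n)) x z"
  by (metis relpowp_trans)

lemma exec_Seq:
  assumes "exec c s T s'" "exec c' s' T' s''"
  shows "exec (Seq c c') s (Suc (T + T')) s''"
proof -
  obtain t t' where t: "t \<le> T" "t' \<le> T'" "runs c s t s'" "runs c' s' t' s''"
    using assms unfolding exec_def by blast
  have "(dstep ^^ Suc (t + t')) (Seq c c' # k, s) (k, s'')" for k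
    by (rule relpowp_step, rule dstep.intros(4), rule relpowp_add)
       (use t(3,4) in \<open>auto simp: runs_def\<close>)
  then show ?thesis unfolding exec_def runs_def using t(1,2)
    by (intro exI[of _ "Suc (t + t')"]) auto
qed

lemma exec_Branch:
  assumes "exec (case s r of [] \<Rightarrow> ce | x # _ \<Rightarrow> if x then ct else cf) s T s'"
  shows "exec (Branch r ce cf ct) s (Suc T) s'"
proof -
  obtain t where t: "t \<le> T" "runs (case s r of [] \<Rightarrow> ce | x # _ \<Rightarrow> if x then ct else cf) s t s'"
    using assms unfolding exec_def by blast
  have "(dstep ^^ Suc t) (Branch r ce cf ct # k, s) (k, s')" for k
    by (rule relpowp_step, rule dstep.intros(5)) (use t(2) in \<open>auto simp: runs_def\<close>)
  then show ?thesis unfolding exec_def runs_def using t(1)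
    by (intro exI[of _ "Suc t"]) auto
qed

lemma exec_While:
  assumes "s r \<noteq> []" "exec c s T s'" "exec (While r c) s' T' s''"
  shows "exec (While r c) s (Suc (T + T')) s''"
proof -
  obtain t t' where t: "t \<le> T" "t' \<le> T'" "runs c s t s'" "runs (While r c) s' t' s''"
    using assms unfolding exec_def by blast
  have "(dstep ^^ Suc (t + t')) (While r c # k, s) (k, s'')" for k
    by (rule relpowp_step, rule dstep.intros(6), rule relpowp_add)
       (use assms(1) t(3,4) in \<open>auto simp: runs_def\<close>)
  then show ?thesis unfolding exec_def runs_def using t(1,2)
    by (intro exI[of _ "Suc (t + t')"]) auto
qed

definition For :: "nat \<Rightarrow> program \<Rightarrow> program" where
  "For r c = While r (Seq (Pop r) c)"

text \<open>\<open>F i\<close> describes the store, apart from the counter, when \<open>i\<close>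
  rounds are left. The counter is popped before the body runs, so the body sees the values
  \<open>m - 1\<close> down to 0. The 3 extra steps per round are the loop test, \<open>Seq\<close>
  and \<open>Pop\<close>.\<close>

lemma exec_For:
  assumes "\<And>i. i < m \<Longrightarrow> exec c ((F (Suc i))(r := replicate i True)) T ((F i)(r := replicate i True))"
  shows "exec (For r c) ((F m)(r := replicate m True)) (m * (T + 3) + 1) ((F 0)(r := []))"
  using assms
proof (induction m)
  case 0
  show ?case unfolding For_def by (simp, rule exec_mono[OF exec_While_end]) auto
next
  case (Suc m)
  let ?s = "(F (Suc m))(r := replicate (Suc m) True)"
  have 1: "exec (Seq (Pop r) c) ?s (Suc (1 + T)) ((F m)(r := replicate m True))"
  proof (rule exec_Seq)
    show "exec (Pop r) ?s 1 ((F (Suc m))(r := replicate m True))"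
      using exec_Pop[of r ?s] by simp
    show "exec c ((F (Suc m))(r := replicate m True)) T ((F m)(r := replicate m True))"
      by (rule Suc.prems) simp
  qed
  have 2: "exec (For r c) ((F m)(r := replicate m True)) (m * (T + 3) + 1) ((F 0)(r := []))"
    by (rule Suc.IH, rule Suc.prems) simp
  have "exec (For r c) ?s (Suc (Suc (1 + T) + (m * (T + 3) + 1))) ((F 0)(r := []))"
    unfolding For_def by (rule exec_While[OF _ 1 2[unfolded For_def]]) simp
  then show ?case by (rule exec_mono) simp
qed

definition Clear :: "nat \<Rightarrow> program" where
  "Clear r = While r (Pop r)"

lemma exec_Clear: "exec (Clear r) s (2 * length (s r) + 1) (s(r := []))"
proof (induction "length (s r)" arbitrary: s)
  case 0
  then have "s r = []" by simp
  then have "s(r := []) = s" by auto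
  then show ?case unfolding Clear_def
    using exec_While_end[of s r "Pop r"] 0 by simp
next
  case (Suc m)
  have 1: "exec (Pop r) s 1 (s(r := tl (s r)))" by (rule exec_Pop)
  have m: "m = length ((s(r := tl (s r))) r)" using Suc(2) by simp
  have 2: "exec (Clear r) (s(r := tl (s r))) (2 * m + 1) (s(r := []))"
    using Suc(1)[of "s(r := tl (s r))", OF m] unfolding m[symmetric] by simp
  have "exec (While r (Pop r)) s (Suc (1 + (2 * m + 1))) (s(r := []))"
    by (rule exec_While[OF _ 1 2[unfolded Clear_def]]) (use Suc(2) in auto)
  then show ?case unfolding Clear_def using Suc(2) by (elim exec_mono) simp
qed

definition Move_onto :: "nat \<Rightarrow> nat \<Rightarrow> program" where
  "Move_onto r r' = For r (Push r' True)"

lemma exec_Move_onto: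
  assumes "r \<noteq> r'" "s r = replicate m True"
  shows "exec (Move_onto r r') s (4 * m + 1) (s(r := [], r' := replicate m True @ s r'))"
proof -
  define F where "F = (\<lambda>i. s(r' := replicate (m - i) True @ s r'))"
  have "exec (For r (Push r' True)) ((F m)(r := replicate m True)) (m * (1 + 3) + 1) ((F 0)(r := []))"
  proof (rule exec_For)
    fix i assume "i < m"
    then have "m - i = Suc (m - Suc i)" by simp
    then show "exec (Push r' True) ((F (Suc i))(r := replicate i True)) 1 ((F i)(r := replicate i True))"
      using exec_Push[of r' True "(F (Suc i))(r := replicate i True)"] assms(1)
      by (simp add: F_def fun_upd_twist)
  qed
  moreover have "s(r := replicate m True) = s" using assms(2) by auto
  ultimately show ?thesis using assms(1)
    by (simp add: Move_onto_def F_def mult.commute fun_upd_twist)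
qed

definition Shift :: "nat \<Rightarrow> nat \<Rightarrow> program" where
  "Shift r r' = Branch r Nop (Seq (Pop r) (Push r' False)) (Seq (Pop r) (Push r' True))"

lemma exec_Shift:
  assumes "s r = x # xs" "r \<noteq> r'"
  shows "exec (Shift r r') s 4 (s(r := xs, r' := x # s r'))"
proof -
  have "exec (Seq (Pop r) (Push r' x)) s (Suc (1 + 1)) (s(r := xs, r' := x # s r'))"
    using exec_Seq[OF exec_Pop[of r s] exec_Push[of r' x]] assms by simp
  then show ?thesis unfolding Shift_def using assms(1)
    by (intro exec_mono[OF exec_Branch, of _ _ _ _ _ 3]) (cases x, auto simp: numeral_3_eq_3)
qed

lemma exec_Shift_Nil:
  assumes "s r = []"
  shows "exec (Shift r r') s 4 s"
  unfolding Shift_def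
  by (rule exec_mono[OF exec_Branch[where T = 1]]) (simp_all add: assms exec_Nop[simplified])

text \<open>The time depends on \<open>m\<close> and not on the height of stack \<open>r\<close>, so
  a prefix of an arbitrarily long oracle answer can be read in this way. Moving symbols between
  stacks reverses them.\<close>

lemma exec_For_Shift:
  assumes "r \<noteq> r'" "c \<noteq> r" "c \<noteq> r'" "s c = replicate m True"
  shows "exec (For c (Shift r r')) s (m * 7 + 1)
           (s(c := [], r := drop m (s r), r' := rev (take m (s r)) @ s r'))"
proof -
  define F where "F = (\<lambda>i. s(r := drop (m - i) (s r), r' := rev (take (m - i) (s r)) @ s r'))"
  have "exec (For c (Shift r r')) ((F m)(c := replicate m True)) (m * (4 + 3) + 1) ((F 0)(c := []))"
  proof (rule exec_For)
    fix i assume i: "i < m"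
    define j where "j = m - Suc i"
    have j: "m - i = Suc j" "m - Suc i = j" using i by (auto simp: j_def)
    let ?t = "(F (Suc i))(c := replicate i True)"
    show "exec (Shift r r') ?t 4 ((F i)(c := replicate i True))"
    proof (cases "j < length (s r)")
      case True
      have eq: "?t(r := drop (Suc j) (s r), r' := (s r ! j) # ?t r') = (F i)(c := replicate i True)"
        using assms True by (auto simp: F_def j take_Suc_conv_app_nth fun_eq_iff)
      have "?t r = s r ! j # drop (Suc j) (s r)"
        using assms True by (simp add: F_def j Cons_nth_drop_Suc)
      from exec_Shift[of ?t, OF this assms(1)] show ?thesis unfolding eq .
    next
      case False
      have "?t r = []" using assms False by (simp add: F_def j)
      moreover have "(F i)(c := replicate i True) = ?t"
        using assms False by (auto simp: F_def j fun_eq_iff)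
      ultimately show ?thesis using exec_Shift_Nil[of ?t] by simp
    qed
  qed
  moreover have "(F m)(c := replicate m True) = s" using assms by (auto simp: F_def)
  moreover have "(F 0)(c := []) = s(c := [], r := drop m (s r), r' := rev (take m (s r)) @ s r')"
    using assms by (auto simp: F_def)
  ultimately show ?thesis by simp
qed

definition Move :: "nat \<Rightarrow> nat \<Rightarrow> program" where
  "Move r r' = While r (Shift r r')"

lemma exec_Move:
  assumes "r \<noteq> r'" "s r = xs"
  shows "exec (Move r r') s (5 * length xs + 1) (s(r := [], r' := rev xs @ s r'))"
  using assms(2)
proof (induction xs arbitrary: s)
  case Nil
  then have eq: "s(r := [], r' := rev [] @ s r') = s" by auto
  show ?case unfolding Move_def eq using exec_While_end[of s r, OF Nil] by (rule exec_mono) simp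
next
  case (Cons x xs)
  let ?t = "s(r := xs, r' := x # s r')"
  have eq: "?t(r := [], r' := rev xs @ ?t r') = s(r := [], r' := rev (x # xs) @ s r')"
    using assms(1) by (auto simp: fun_eq_iff)
  have "?t r = xs" using assms(1) by simp
  from Cons.IH[of ?t, OF this] have
    "exec (Move r r') ?t (5 * length xs + 1) (s(r := [], r' := rev (x # xs) @ s r'))"
    unfolding eq .
  from exec_While[OF _ exec_Shift[of s r x xs r', OF Cons.prems assms(1)] this[unfolded Move_def]] Cons.prems
  have "exec (While r (Shift r r')) s (Suc (4 + (5 * length xs + 1))) (s(r := [], r' := rev (x # xs) @ s r'))"
    by simp
  then show ?case unfolding Move_def by (rule exec_cong) auto
qed

section \<open>Polynomial growth, closed under composition\<close>

section \<open>Polynomial bounds\<close>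

text \<open>With base at least 2 a single power absorbs constants and sums, so no coefficients have
  to be carried along.\<close>

definition pbound :: "(nat \<Rightarrow> nat) \<Rightarrow> bool" where
  "pbound p \<longleftrightarrow> (\<exists>k. \<forall>S\<ge>2. p S \<le> S ^ k)"

lemma le_power_self: "2 \<le> (S::nat) \<Longrightarrow> a \<le> S ^ a"
proof -
  assume S: "2 \<le> S"
  have "a \<le> 2 ^ a" using less_exp[of a] by simp
  also have "\<dots> \<le> S ^ a" using S by (rule power_mono) simp
  finally show ?thesis .
qed

lemma pbound_const: "pbound (\<lambda>S. c)"
  unfolding pbound_def using le_power_self by blast

lemma pbound_id: "pbound (\<lambda>S. S)"
  unfolding pbound_def by (rule exI[of _ 1]) simp

lemma pbound_mult:
  assumes "pbound p" "pbound q"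
  shows "pbound (\<lambda>S. p S * q S)"
proof -
  obtain i j where "\<forall>S\<ge>2. p S \<le> S ^ i" "\<forall>S\<ge>2. q S \<le> S ^ j"
    using assms unfolding pbound_def by blast
  then show ?thesis unfolding pbound_def
    by (intro exI[of _ "i + j"]) (simp add: power_add mult_mono)
qed

lemma pbound_add:
  assumes "pbound p" "pbound q"
  shows "pbound (\<lambda>S. p S + q S)"
proof -
  obtain i j where ij: "\<forall>S\<ge>2. p S \<le> S ^ i" "\<forall>S\<ge>2. q S \<le> S ^ j"
    using assms unfolding pbound_def by blast
  have "p S + q S \<le> S ^ Suc (i + j)" if "S \<ge> 2" for S :: nat
  proof -
    have "p S \<le> S ^ (i + j)" "q S \<le> S ^ (i + j)"
      using order_trans[OF ij(1)[rule_format, OF that], of "S ^ (i + j)"]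
        order_trans[OF ij(2)[rule_format, OF that], of "S ^ (i + j)"] that
      by (simp_all add: power_increasing)
    then have "p S + q S \<le> 2 * S ^ (i + j)" by simp
    also have "\<dots> \<le> S ^ Suc (i + j)" using that by simp
    finally show ?thesis .
  qed
  then show ?thesis unfolding pbound_def by blast
qed

lemma pbound_Suc: "pbound p \<Longrightarrow> pbound (\<lambda>S. Suc (p S))"
  using pbound_add[OF pbound_const[of 1]] by simp

text \<open>The argument \<open>S + q S\<close> bounds the stack heights after \<open>q S\<close>
  further steps; this is the size at which the next program is started.\<close>

lemma pbound_comp:
  assumes "pbound p" "pbound q"
  shows "pbound (\<lambda>S. p (S + q S))"
proof -
  obtain i where i: "\<forall>S\<ge>2. p S \<le> S ^ i" using assms unfolding pbound_def by blast
  obtain j where j: "\<forall>S\<ge>2. S + q S \<le> S ^ j"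
    using pbound_add[OF pbound_id assms(2)] unfolding pbound_def by blast
  have "p (S + q S) \<le> S ^ (j * i)" if "S \<ge> 2" for S
  proof -
    have "p (S + q S) \<le> (S + q S) ^ i" using i that by simp
    also have "\<dots> \<le> (S ^ j) ^ i" using j that by (intro power_mono) auto
    finally show ?thesis by (simp add: power_mult)
  qed
  then show ?thesis unfolding pbound_def by blast
qed

lemmas pbound_intros = pbound_const pbound_id pbound_mult pbound_add pbound_Suc

section \<open>A class of polynomial-time functions on unary numbers\<close>

section \<open>Computable functions in unary\<close>

text \<open>Numbers are stored in unary: variable \<open>j\<close> is the height of stack \<open>vs j\<close>, the result is
  put on stack \<open>d\<close>, and the stacks from \<open>d\<close> on are free work space.  Variables are de Bruijn
  indices: the summation index of a bounded sum becomes variable 0.\<close>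

definition computes ::
    "(nat \<Rightarrow> (nat \<Rightarrow> nat) \<Rightarrow> program) \<Rightarrow> (nat \<Rightarrow> nat) \<Rightarrow> (bool list \<Rightarrow> (nat \<Rightarrow> nat) \<Rightarrow> nat) \<Rightarrow> bool" where
  "computes c p f \<longleftrightarrow> (\<forall>d vs s S. 2 \<le> S \<longrightarrow> 0 < d \<longrightarrow> (\<forall>j. vs j < d) \<longrightarrow>
     (\<forall>i\<ge>d. s i = []) \<longrightarrow> length (s 0) \<le> S \<longrightarrow> (\<forall>j. length (s (vs j)) \<le> S) \<longrightarrow>
     exec (c d vs) s (p S) (s(d := replicate (f (s 0) (\<lambda>j. length (s (vs j)))) True)))"

definition comp :: "(bool list \<Rightarrow> (nat \<Rightarrow> nat) \<Rightarrow> nat) \<Rightarrow> bool" where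
  "comp f \<longleftrightarrow> (\<exists>c p. pbound p \<and> computes c p f)"

lemma compI: "pbound p \<Longrightarrow> computes c p f \<Longrightarrow> comp f"
  unfolding comp_def by blast

lemma compE:
  assumes "comp f"
  obtains c p where "pbound p" "computes c p f"
  using assms unfolding comp_def by blast

lemma computesI:
  assumes "\<And>d vs s S. \<lbrakk>2 \<le> S; 0 < d; \<And>j. vs j < d; \<And>i. i \<ge> d \<Longrightarrow> s i = []; length (s 0) \<le> S;
      \<And>j. length (s (vs j)) \<le> S\<rbrakk> \<Longrightarrow>
      exec (c d vs) s (p S) (s(d := replicate (f (s 0) (\<lambda>j. length (s (vs j)))) True))"
  shows "computes c p f"
  unfolding computes_def using assms by blast

text \<open>The second conclusion holds because the result is written in unary, one step per symbol:
  the time bound also bounds the value. It controls the number of rounds of the loops below.\<close>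

lemma computesD:
  assumes "computes c p f" "2 \<le> S" "0 < d" "\<And>j. vs j < d" "\<And>i. i \<ge> d \<Longrightarrow> s i = []"
    "length (s 0) \<le> S" "\<And>j. length (s (vs j)) \<le> S" "u = s 0" "\<rho> = (\<lambda>j. length (s (vs j)))"
  shows "exec (c d vs) s (p S) (s(d := replicate (f u \<rho>) True))" and "f u \<rho> \<le> p S"
proof -
  show e: "exec (c d vs) s (p S) (s(d := replicate (f u \<rho>) True))"
    using assms unfolding computes_def by blast
  from exec_length[OF this, of d] assms(5)[of d] show "f u \<rho> \<le> p S" by simp
qed

text \<open>Renaming variables is renaming stacks. With \<open>Suc\<close> for the renaming it moves
  a function under a new summation index.\<close>

lemma comp_reindex:
  assumes "comp f"
  shows "comp (\<lambda>u \<rho>. f u (\<lambda>j. \<rho> (\<phi> j)))"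
proof -
  obtain c p where p: "pbound p" and c: "computes c p f" by (rule compE[OF assms])
  show ?thesis
    by (rule compI[OF p, of "\<lambda>d vs. c d (\<lambda>j. vs (\<phi> j))"], rule computesI, rule computesD(1)[OF c])
       auto
qed

primrec Pushes :: "nat \<Rightarrow> nat \<Rightarrow> program" where
  "Pushes r 0 = Nop"
| "Pushes r (Suc n) = Seq (Pushes r n) (Push r True)"

lemma exec_Pushes: "exec (Pushes r n) s (2 * n + 1) (s(r := replicate n True @ s r))"
proof (induction n)
  case 0
  show ?case using exec_Nop[of s] by simp
next
  case (Suc n)
  have "exec (Seq (Pushes r n) (Push r True)) s (2 * Suc n + 1) (s(r := replicate (Suc n) True @ s r))"
    by (rule exec_cong[OF exec_Seq[OF Suc exec_Push]]) (auto simp: fun_eq_iff)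
  then show ?case unfolding Pushes.simps .
qed

lemma comp_const: "comp (\<lambda>u \<rho>. n)"
proof (rule compI)
  show "pbound (\<lambda>S. 2 * n + 1)" by (rule pbound_const)
  show "computes (\<lambda>d vs. Pushes d n) (\<lambda>S. 2 * n + 1) (\<lambda>u \<rho>. n)"
    by (rule computesI, rule exec_cong[OF exec_Pushes]) auto
qed

text \<open>Reading a stack empties it. Its contents therefore go to the scratch stack
  \<open>d'\<close> and back, which restores their order, and one mark per symbol is left on
  \<open>d\<close> on the way back.\<close>

lemma exec_Copy:
  assumes "r \<noteq> d" "r \<noteq> d'" "d \<noteq> d'" "s d' = []"
  shows "exec (Seq (Move r d') (While d' (Seq (Push d True) (Shift d' r)))) s (13 * length (s r) + 3)
           (s(d := replicate (length (s r)) True @ s d))"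
proof -
  have loop: "exec (While d' (Seq (Push d True) (Shift d' r))) s (8 * length xs + 1)
      (s(d' := [], r := rev xs @ s r, d := replicate (length xs) True @ s d))"
    if "s d' = xs" for xs s using that
  proof (induction xs arbitrary: s)
    case Nil
    show ?case by (rule exec_cong[OF exec_While_end[of s d', OF Nil]]) (use Nil in auto)
  next
    case (Cons x xs)
    let ?s1 = "s(d := True # s d)"
    let ?s2 = "?s1(d' := xs, r := x # s r)"
    have 1: "exec (Seq (Push d True) (Shift d' r)) s (Suc (1 + 4)) ?s2"
      by (rule exec_Seq[OF exec_Push], rule exec_cong[OF exec_Shift[of _ d' x xs]])
         (use Cons.prems assms in \<open>auto simp: fun_eq_iff\<close>)
    have 2: "exec (While d' (Seq (Push d True) (Shift d' r))) ?s2 (8 * length xs + 1)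
       (?s2(d' := [], r := rev xs @ ?s2 r, d := replicate (length xs) True @ ?s2 d))"
      by (rule Cons.IH) (use assms in auto)
    show ?case
      by (rule exec_cong[OF exec_While[OF _ 1 2]])
         (use Cons.prems assms in \<open>auto simp: fun_eq_iff replicate_app_Cons_same\<close>)
  qed
  show ?thesis
    by (rule exec_cong[OF exec_Seq[OF exec_Move[OF _ refl] loop[OF refl]]])
       (use assms in \<open>auto simp: fun_eq_iff\<close>)
qed

lemma comp_var: "comp (\<lambda>u \<rho>. \<rho> j)"
proof (rule compI)
  show "pbound (\<lambda>S. 13 * S + 3)" by (intro pbound_intros)
  show "computes (\<lambda>d vs. Seq (Move (vs j) (d + 1))
      (While (d + 1) (Seq (Push d True) (Shift (d + 1) (vs j))))) (\<lambda>S. 13 * S + 3) (\<lambda>u \<rho>. \<rho> j)"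
  proof (rule computesI)
    fix d :: nat and vs :: "nat \<Rightarrow> nat" and s :: store and S :: nat
    assume *: "\<And>j. vs j < d" "\<And>i. i \<ge> d \<Longrightarrow> s i = []" "\<And>j. length (s (vs j)) \<le> S"
    show "exec (Seq (Move (vs j) (d + 1)) (While (d + 1) (Seq (Push d True) (Shift (d + 1) (vs j)))))
        s (13 * S + 3) (s(d := replicate (length (s (vs j))) True))"
      by (rule exec_cong[OF exec_Copy]) (use *(1)[of j] *(2)[of d] *(2)[of "d + 1"] *(3)[of j] in auto)
  qed
qed

lemma comp_add:
  assumes "comp f" "comp g"
  shows "comp (\<lambda>u \<rho>. f u \<rho> + g u \<rho>)"
proof -
  obtain c p where p: "pbound p" and c: "computes c p f" by (rule compE[OF assms(1)])
  obtain c' p' where p': "pbound p'" and c': "computes c' p' g" by (rule compE[OF assms(2)])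
  let ?p = "\<lambda>S. Suc (p S + Suc (p' S + (4 * p' S + 1)))"
  show ?thesis
  proof (rule compI)
    show "pbound ?p" by (intro pbound_intros p p')
    show "computes (\<lambda>d vs. Seq (c d vs) (Seq (c' (d + 1) vs) (Move_onto (d + 1) d))) ?p
      (\<lambda>u \<rho>. f u \<rho> + g u \<rho>)"
    proof (rule computesI)
      fix d :: nat and vs :: "nat \<Rightarrow> nat" and s :: store and S :: nat
      assume *: "2 \<le> S" "0 < d" "\<And>j. vs j < d" "\<And>i. i \<ge> d \<Longrightarrow> s i = []" "length (s 0) \<le> S"
        "\<And>j. length (s (vs j)) \<le> S"
      have vs: "vs j \<noteq> d" "vs j < d + 1" for j using *(3)[of j] by auto
      let ?f = "f (s 0) (\<lambda>j. length (s (vs j)))" and ?g = "g (s 0) (\<lambda>j. length (s (vs j)))"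
      let ?s = "s(d := replicate ?f True)"
      have 1: "exec (c d vs) s (p S) ?s"
        by (rule computesD(1)[OF c *]) auto
      have 2: "exec (c' (d + 1) vs) ?s (p' S) (?s(d + 1 := replicate ?g True))" and g: "?g \<le> p' S"
        by (rule computesD[OF c', of S]; use * vs in auto)+
      show "exec (Seq (c d vs) (Seq (c' (d + 1) vs) (Move_onto (d + 1) d))) s (?p S)
        (s(d := replicate (?f + ?g) True))"
        by (rule exec_cong[OF exec_Seq[OF 1 exec_Seq[OF 2 exec_Move_onto[where m = ?g]]]])
           (use g *(4)[of "d + 1"] in \<open>auto simp: fun_eq_iff replicate_add[symmetric] add.commute\<close>)
    qed
  qed
qed

text \<open>Popping an empty stack changes nothing, which yields exactly the truncated subtraction
  of natural numbers.\<close>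

lemma comp_diff:
  assumes "comp f" "comp g"
  shows "comp (\<lambda>u \<rho>. f u \<rho> - g u \<rho>)"
proof -
  obtain c p where p: "pbound p" and c: "computes c p f" by (rule compE[OF assms(1)])
  obtain c' p' where p': "pbound p'" and c': "computes c' p' g" by (rule compE[OF assms(2)])
  let ?p = "\<lambda>S. Suc (p S + Suc (p' S + (p' S * (1 + 3) + 1)))"
  show ?thesis
  proof (rule compI)
    show "pbound ?p" by (intro pbound_intros p p')
    show "computes (\<lambda>d vs. Seq (c d vs) (Seq (c' (d + 1) vs) (For (d + 1) (Pop d)))) ?p
      (\<lambda>u \<rho>. f u \<rho> - g u \<rho>)"
    proof (rule computesI)
      fix d :: nat and vs :: "nat \<Rightarrow> nat" and s :: store and S :: nat
      assume *: "2 \<le> S" "0 < d" "\<And>j. vs j < d" "\<And>i. i \<ge> d \<Longrightarrow> s i = []" "length (s 0) \<le> S"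
        "\<And>j. length (s (vs j)) \<le> S"
      have vs: "vs j \<noteq> d" "vs j < d + 1" for j using *(3)[of j] by auto
      let ?f = "f (s 0) (\<lambda>j. length (s (vs j)))" and ?g = "g (s 0) (\<lambda>j. length (s (vs j)))"
      let ?s = "s(d := replicate ?f True)"
      have 1: "exec (c d vs) s (p S) ?s"
        by (rule computesD(1)[OF c *]) auto
      have 2: "exec (c' (d + 1) vs) ?s (p' S) (?s(d + 1 := replicate ?g True))" and g: "?g \<le> p' S"
        by (rule computesD[OF c', of S]; use * vs in auto)+
      define F where "F = (\<lambda>i. s(d := replicate (?f - (?g - i)) True))"
      have 3: "exec (For (d + 1) (Pop d)) ((F ?g)(d + 1 := replicate ?g True)) (?g * (1 + 3) + 1)
          ((F 0)(d + 1 := []))"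
      proof (rule exec_For)
        fix i assume i: "i < ?g"
        show "exec (Pop d) ((F (Suc i))(d + 1 := replicate i True)) 1 ((F i)(d + 1 := replicate i True))"
          by (rule exec_cong[OF exec_Pop]) (use i in \<open>auto simp: F_def fun_eq_iff\<close>)
      qed
      have eq: "(F ?g)(d + 1 := replicate ?g True) = ?s(d + 1 := replicate ?g True)"
        by (auto simp: F_def)
      show "exec (Seq (c d vs) (Seq (c' (d + 1) vs) (For (d + 1) (Pop d)))) s (?p S)
        (s(d := replicate (?f - ?g) True))"
        by (rule exec_cong[OF exec_Seq[OF 1 exec_Seq[OF 2 3[unfolded eq]]]])
           (use g *(4)[of "d + 1"] in \<open>auto simp: F_def fun_eq_iff\<close>)
    qed
  qed
qed

text \<open>The loop counter on stack \<open>d\<close> doubles as the summation index, stack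
  \<open>d + 1\<close> collects the sum and the summand works from stack \<open>d + 2\<close> on.
  The index may be as large as \<open>p S\<close>, so the summand is charged at size
  \<open>S + p S\<close>.\<close>

lemma comp_sum:
  assumes "comp f" "comp (\<lambda>u \<rho>. g u (\<lambda>j. \<rho> (Suc j)) (\<rho> 0))"
  shows "comp (\<lambda>u \<rho>. \<Sum>i<f u \<rho>. g u \<rho> i)"
proof -
  let ?g = "\<lambda>u \<rho>. g u (\<lambda>j. \<rho> (Suc j)) (\<rho> 0)"
  obtain c p where p: "pbound p" and c: "computes c p f" by (rule compE[OF assms(1)])
  obtain c' p' where p': "pbound p'" and c': "computes c' p' ?g" by (rule compE[OF assms(2)])
  let ?q = "\<lambda>S. p' (S + p S)"
  let ?p = "\<lambda>S. Suc (p S + Suc ((p S * (Suc (?q S + (4 * ?q S + 1)) + 3) + 1) + (4 * (p S * ?q S) + 1)))"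
  let ?body = "\<lambda>d vs. Seq (c' (d + 2) (case_nat d vs)) (Move_onto (d + 2) (d + 1))"
  let ?c = "\<lambda>d vs. Seq (c d vs) (Seq (For d (?body d vs)) (Move_onto (d + 1) d))"
  show ?thesis
  proof (rule compI)
    show "pbound ?p" by (intro pbound_intros p pbound_comp[OF p' p])
    show "computes ?c ?p (\<lambda>u \<rho>. \<Sum>i<f u \<rho>. g u \<rho> i)"
    proof (rule computesI)
      fix d :: nat and vs :: "nat \<Rightarrow> nat" and s :: store and S :: nat
      assume *: "2 \<le> S" "0 < d" "\<And>j. vs j < d" "\<And>i. i \<ge> d \<Longrightarrow> s i = []" "length (s 0) \<le> S"
        "\<And>j. length (s (vs j)) \<le> S"
      define \<rho> where "\<rho> = (\<lambda>j. length (s (vs j)))"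
      define m where "m = f (s 0) \<rho>"
      define G where "G = g (s 0) \<rho>"
      have vs: "vs j \<noteq> d" "vs j \<noteq> d + 1" "vs j < d + 2" for j using *(3)[of j] by auto
      have 1: "exec (c d vs) s (p S) (s(d := replicate m True))" and m: "m \<le> p S"
        unfolding m_def \<rho>_def by (rule computesD[OF c *], auto)+
      \<comment> \<open>The counter runs down, so the terms collected when it stands at
        \<open>i\<close> are those from \<open>i\<close> on.\<close>
      define F where "F = (\<lambda>i. s(d + 1 := replicate (\<Sum>j\<in>{i..<m}. G j) True))"
      have body: "exec (c' (d + 2) (case_nat d vs)) ((F (Suc i))(d := replicate i True)) (?q S)
          ((F (Suc i))(d := replicate i True, d + 2 := replicate (G i) True))" "G i \<le> ?q S"
        if i: "i < m" for i
      proof -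
        have eq: "G i = ?g (((F (Suc i))(d := replicate i True)) 0)
            (\<lambda>j. length (((F (Suc i))(d := replicate i True)) (case_nat d vs j)))"
          using * vs by (auto simp: G_def \<rho>_def F_def)
        note r = computesD[OF c' _ _ _ _ _ _ refl refl, of "S + p S" "d + 2" "case_nat d vs" "(F (Suc i))(d := replicate i True)"]
        have len: "length (((F (Suc i))(d := replicate i True)) (case_nat d vs j)) \<le> S + p S" for j
          using * vs m i by (cases j) (auto simp: F_def intro: le_trans[OF *(6)])
        have vs': "case_nat d vs j < d + 2" for j using vs[of "j - 1"] by (cases j) auto
        show "exec (c' (d + 2) (case_nat d vs)) ((F (Suc i))(d := replicate i True)) (?q S)
          ((F (Suc i))(d := replicate i True, d + 2 := replicate (G i) True))" "G i \<le> ?q S"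
          unfolding eq by (rule r; use * vs' len in \<open>auto simp: F_def\<close>)+
      qed
      have 2: "exec (For d (?body d vs)) ((F m)(d := replicate m True))
          (m * (Suc (?q S + (4 * ?q S + 1)) + 3) + 1) ((F 0)(d := []))"
      proof (rule exec_For)
        fix i assume i: "i < m"
        have sum: "(\<Sum>j\<in>{i..<m}. G j) = G i + (\<Sum>j\<in>{Suc i..<m}. G j)"
          using i by (simp add: sum.atLeast_Suc_lessThan)
        show "exec (?body d vs) ((F (Suc i))(d := replicate i True)) (Suc (?q S + (4 * ?q S + 1)))
            ((F i)(d := replicate i True))"
          by (rule exec_cong[OF exec_Seq[OF body(1)[OF i] exec_Move_onto[where m = "G i"]]])
             (use body(2)[OF i] *(4)[of "d + 2"] in \<open>auto simp: F_def fun_eq_iff replicate_add sum\<close>)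
      qed
      have eq: "(F m)(d := replicate m True) = s(d := replicate m True)"
        using *(4)[of "d + 1"] by (auto simp: F_def fun_eq_iff)
      have sum: "(\<Sum>j\<in>{0..<m}. G j) \<le> p S * ?q S"
      proof -
        have "(\<Sum>j\<in>{0..<m}. G j) \<le> (\<Sum>j\<in>{0..<m}. ?q S)" by (rule sum_mono) (use body(2) in auto)
        also have "\<dots> \<le> p S * ?q S" using m by simp
        finally show ?thesis .
      qed
      have "exec (?c d vs) s (?p S) (s(d := replicate (\<Sum>i<m. G i) True))"
        by (rule exec_cong[OF exec_Seq[OF 1 exec_Seq[OF 2[unfolded eq]
              exec_Move_onto[where m = "\<Sum>j\<in>{0..<m}. G j"]]]])
           (use m sum *(4)[of "d + 1"] *(4)[of d] in
              \<open>auto simp: F_def fun_eq_iff atLeast0LessThan intro!: add_mono mult_mono\<close>)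
      then show "exec (?c d vs) s (?p S) (s(d := replicate (\<Sum>i<f (s 0) (\<lambda>j. length (s (vs j))).
          g (s 0) (\<lambda>j. length (s (vs j))) i) True))"
        unfolding m_def G_def \<rho>_def .
    qed
  qed
qed

text \<open>Random access to the input: the symbols in front of the position are set aside on stack
  \<open>d + 1\<close>, the top is inspected and they are put back. Beyond the end the branch finds
  an empty stack and leaves 0.\<close>

lemma comp_bit:
  assumes "comp f"
  shows "comp (\<lambda>u \<rho>. of_bool (f u \<rho> < length u \<and> u ! f u \<rho>))"
proof -
  obtain c p where p: "pbound p" and c: "computes c p f" by (rule compE[OF assms(1)])
  let ?p = "\<lambda>S. Suc (p S + Suc ((p S * 7 + 1) + Suc (Suc 1 + (5 * S + 1) + (4 * 1 + 1))))"
  let ?c = "\<lambda>d vs. Seq (c d vs) (Seq (For d (Shift 0 (d + 1))) (Seq (Seq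
    (Branch 0 Nop Nop (Push d True)) (Move (d + 1) 0)) Nop))"
  show ?thesis
  proof (rule compI)
    show "pbound ?p" by (intro pbound_intros p)
    show "computes ?c ?p (\<lambda>u \<rho>. of_bool (f u \<rho> < length u \<and> u ! f u \<rho>))"
    proof (rule computesI)
      fix d :: nat and vs :: "nat \<Rightarrow> nat" and s :: store and S :: nat
      assume *: "2 \<le> S" "0 < d" "\<And>j. vs j < d" "\<And>i. i \<ge> d \<Longrightarrow> s i = []" "length (s 0) \<le> S"
        "\<And>j. length (s (vs j)) \<le> S"
      define m where "m = f (s 0) (\<lambda>j. length (s (vs j)))"
      define x where "x = (of_bool (m < length (s 0) \<and> s 0 ! m) :: nat)"
      have 1: "exec (c d vs) s (p S) (s(d := replicate m True))" and m: "m \<le> p S"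
        unfolding m_def by (rule computesD[OF c *], auto)+
      let ?s = "s(d := [], 0 := drop m (s 0), d + 1 := rev (take m (s 0)))"
      have 2: "exec (For d (Shift 0 (d + 1))) (s(d := replicate m True)) (m * 7 + 1) ?s"
        by (rule exec_cong[OF exec_For_Shift[where m = m]])
           (use * in \<open>auto simp: fun_eq_iff\<close>)
      have 3: "exec (Branch 0 Nop Nop (Push d True)) ?s (Suc 1) (?s(d := replicate x True))"
      proof (rule exec_Branch)
        show "exec (case ?s 0 of [] \<Rightarrow> Nop | y # _ \<Rightarrow> if y then Push d True else Nop) ?s 1
            (?s(d := replicate x True))"
        proof (cases "m < length (s 0) \<and> s 0 ! m")
          case True
          then have "?s 0 = True # drop (Suc m) (s 0)" "x = 1"
            using * by (auto simp: x_def Cons_nth_drop_Suc[symmetric])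
          then show ?thesis using * by (auto intro!: exec_cong[OF exec_Push])
        next
          case False
          have "(case ?s 0 of [] \<Rightarrow> Nop | y # _ \<Rightarrow> if y then Push d True else Nop) = Nop"
          proof (cases "m < length (s 0)")
            case True
            then have "?s 0 = s 0 ! m # drop (Suc m) (s 0)"
              using * by (auto simp: Cons_nth_drop_Suc[symmetric])
            then show ?thesis using False True by simp
          qed (use * in auto)
          moreover have "x = 0" using False by (auto simp: x_def)
          ultimately show ?thesis using * by (auto intro!: exec_cong[OF exec_Nop] simp: fun_eq_iff)
        qed
      qed
      have 4: "exec (Move (d + 1) 0) (?s(d := replicate x True)) (5 * S + 1) (s(d := replicate x True))"
        by (rule exec_cong[OF exec_Move[OF _ refl]])
           (use * *(4)[of "d + 1"] in \<open>auto simp: fun_eq_iff\<close>)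
      have "exec (?c d vs) s (?p S) (s(d := replicate x True))"
        by (rule exec_cong[OF exec_Seq[OF 1 exec_Seq[OF 2 exec_Seq[OF exec_Seq[OF 3 4] exec_Nop]]]])
           (use m in auto)
      then show "exec (?c d vs) s (?p S) (s(d := replicate (of_bool
          (f (s 0) (\<lambda>j. length (s (vs j))) < length (s 0) \<and> s 0 ! f (s 0) (\<lambda>j. length (s (vs j))))) True))"
        unfolding x_def m_def .
    qed
  qed
qed

lemma comp_length: "comp (\<lambda>u \<rho>. length u)"
proof (rule compI)
  show "pbound (\<lambda>S. 13 * S + 3)" by (intro pbound_intros)
  show "computes (\<lambda>d vs. Seq (Move 0 (d + 1)) (While (d + 1) (Seq (Push d True) (Shift (d + 1) 0))))
      (\<lambda>S. 13 * S + 3) (\<lambda>u \<rho>. length u)"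
  proof (rule computesI)
    fix d :: nat and vs :: "nat \<Rightarrow> nat" and s :: store and S :: nat
    assume *: "0 < d" "\<And>i. i \<ge> d \<Longrightarrow> s i = []" "length (s 0) \<le> S"
    show "exec (Seq (Move 0 (d + 1)) (While (d + 1) (Seq (Push d True) (Shift (d + 1) 0))))
        s (13 * S + 3) (s(d := replicate (length (s 0)) True))"
      by (rule exec_cong[OF exec_Copy]) (use *(1) *(2)[of d] *(2)[of "d + 1"] *(3) in auto)
  qed
qed

lemma comp_mult:
  assumes "comp f" "comp g"
  shows "comp (\<lambda>u \<rho>. f u \<rho> * g u \<rho>)"
proof -
  have "comp (\<lambda>u \<rho>. \<Sum>i<f u \<rho>. g u \<rho>)"
    by (rule comp_sum[OF assms(1), of "\<lambda>u \<rho> i. g u \<rho>"]) (rule comp_reindex[OF assms(2)])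
  then show ?thesis by simp
qed

lemma comp_not:
  assumes "comp (\<lambda>u \<rho>. of_bool (P u \<rho>))"
  shows "comp (\<lambda>u \<rho>. of_bool (\<not> P u \<rho>))"
proof -
  have "(\<lambda>u \<rho>. of_bool (\<not> P u \<rho>)) = (\<lambda>u \<rho>. 1 - of_bool (P u \<rho>) :: nat)" by (simp add: fun_eq_iff)
  then show ?thesis using comp_diff[OF comp_const[of 1] assms] by simp
qed

lemma comp_conj:
  assumes "comp (\<lambda>u \<rho>. of_bool (P u \<rho>))" "comp (\<lambda>u \<rho>. of_bool (Q u \<rho>))"
  shows "comp (\<lambda>u \<rho>. of_bool (P u \<rho> \<and> Q u \<rho>))"
  using comp_mult[OF assms] by (simp add: of_bool_conj)

lemma comp_disj:
  assumes "comp (\<lambda>u \<rho>. of_bool (P u \<rho>))" "comp (\<lambda>u \<rho>. of_bool (Q u \<rho>))"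
  shows "comp (\<lambda>u \<rho>. of_bool (P u \<rho> \<or> Q u \<rho>))"
  using comp_not[OF comp_conj[OF comp_not[OF assms(1)] comp_not[OF assms(2)]]] by simp

text \<open>Truncated subtraction from 1, applied twice, collapses every positive number to 1;
  comparisons thus reduce to \<open>comp_diff\<close>.\<close>

lemma of_bool_less_eq: "of_bool (a < b) = 1 - (1 - (b - a))" for a b :: nat
  by (cases "a < b") (simp_all add: Suc_le_eq)

lemma comp_less:
  assumes "comp f" "comp g"
  shows "comp (\<lambda>u \<rho>. of_bool (f u \<rho> < g u \<rho>))"
  unfolding of_bool_less_eq by (intro comp_diff comp_const assms)

lemma comp_le:
  assumes "comp f" "comp g"
  shows "comp (\<lambda>u \<rho>. of_bool (f u \<rho> \<le> g u \<rho>))"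
  using comp_not[OF comp_less[OF assms(2,1)]] by (simp add: not_less)

lemma comp_eq:
  assumes "comp f" "comp g"
  shows "comp (\<lambda>u \<rho>. of_bool (f u \<rho> = g u \<rho>))"
  using comp_conj[OF comp_le[OF assms] comp_le[OF assms(2,1)]] by (simp add: eq_iff)

lemma sum_of_bool_less: "(\<Sum>i<m. of_bool (i < k)) = min m (k :: nat)"
  by (induction m) auto

text \<open>The quotient counts the positive multiples of \<open>b\<close> up to \<open>a\<close>.
  The guard \<open>0 < b\<close> reproduces the convention that division by 0 gives 0.\<close>

lemma div_eq_sum: "a div b = (\<Sum>i<a. of_bool (0 < b \<and> (i + 1) * b \<le> a))" for a b :: nat
proof (cases "b = 0")
  case False
  have "(\<Sum>i<a. of_bool (0 < b \<and> (i + 1) * b \<le> a)) = (\<Sum>i<a. of_bool (i < a div b) :: nat)"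
  proof (intro sum.cong refl)
    fix i
    have "(i + 1) * b \<le> a \<longleftrightarrow> i + 1 \<le> a div b"
      using less_eq_div_iff_mult_less_eq[of b "i + 1" a] False by simp
    then show "of_bool (0 < b \<and> (i + 1) * b \<le> a) = (of_bool (i < a div b) :: nat)"
      using False by (simp only: Suc_eq_plus1[symmetric] Suc_le_eq) simp
  qed
  then show ?thesis unfolding sum_of_bool_less by simp
qed simp

lemma comp_div:
  assumes "comp f" "comp g"
  shows "comp (\<lambda>u \<rho>. f u \<rho> div g u \<rho>)"
  unfolding div_eq_sum
  by (rule comp_sum[OF assms(1), of "\<lambda>u \<rho> i. of_bool (0 < g u \<rho> \<and> (i + 1) * g u \<rho> \<le> f u \<rho>)"])
     (intro comp_conj comp_less comp_le comp_mult comp_add comp_const comp_var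
        comp_reindex[OF assms(1)] comp_reindex[OF assms(2)])

lemma comp_mod:
  assumes "comp f" "comp g"
  shows "comp (\<lambda>u \<rho>. f u \<rho> mod g u \<rho>)"
  unfolding minus_div_mult_eq_mod[symmetric]
  by (intro comp_diff comp_mult comp_div assms)

lemma comp_Suc: "comp f \<Longrightarrow> comp (\<lambda>u \<rho>. Suc (f u \<rho>))"
  by (drule comp_add[OF _ comp_const[of 1]]) simp

lemma comp_power: "comp f \<Longrightarrow> comp (\<lambda>u \<rho>. f u \<rho> ^ k)"
proof (induction k)
  case 0
  show ?case using comp_const[of 1] by simp
next
  case (Suc k)
  show ?case using comp_mult[OF Suc.prems Suc.IH[OF Suc.prems]] by simp
qed

lemmas comp_intros = comp_const comp_var comp_add comp_diff comp_mult comp_div comp_mod comp_Suc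
  comp_power comp_not comp_conj comp_disj comp_less comp_le comp_eq comp_length

subsection \<open>Input graphs\<close>

text \<open>A graph on \<open>n\<close> vertices has a code of length \<open>n * n + n + 1\<close>,
  which increases with \<open>n\<close>. So \<open>n\<close> is the number of positive sizes whose
  code would fit into the given length, and the size is found from \<open>length u\<close>
  alone.\<close>

definition graph_size :: "bool list \<Rightarrow> nat" where
  "graph_size u = (\<Sum>i<length u. of_bool ((i + 1) * (i + 1) + (i + 1) + 1 \<le> length u))"

text \<open>The offset \<open>graph_size u + 1\<close> skips the unary size and the separator in
  front of the adjacency matrix.\<close>

definition graph_edge :: "bool list \<Rightarrow> nat \<Rightarrow> nat \<Rightarrow> bool" where
  "graph_edge u i j \<longleftrightarrow> graph_size u + 1 + (i * graph_size u + j) < length u \<and>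
     u ! (graph_size u + 1 + (i * graph_size u + j))"

lemma comp_graph_size: "comp (\<lambda>u \<rho>. graph_size u)"
  unfolding graph_size_def
  by (rule comp_sum[OF comp_length,
        of "\<lambda>u \<rho> i. of_bool ((i + 1) * (i + 1) + (i + 1) + 1 \<le> length u)"])
     (intro comp_intros)

lemma comp_graph_edge:
  assumes "comp f" "comp g"
  shows "comp (\<lambda>u \<rho>. of_bool (graph_edge u (f u \<rho>) (g u \<rho>)))"
  unfolding graph_edge_def by (rule comp_bit) (intro comp_intros comp_graph_size assms)

lemma concat_map_upt:
  "concat (map (\<lambda>i. map (f i) [0..<n]) [0..<m]) = map (\<lambda>x. f (x div n) (x mod n)) [0..<m * n]"
proof (induction m)
  case (Suc m)
  have 1: "[0..<Suc m * n] = [0..<m * n] @ map (\<lambda>j. j + m * n) [0..<n]"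
    using upt_add_eq_append[of 0 "m * n" n] map_add_upt[of "m * n" n] by (simp only: mult_Suc) (simp only: add.commute le0)
  have 2: "map (\<lambda>x. f (x div n) (x mod n)) (map (\<lambda>j. j + m * n) [0..<n]) = map (f m) [0..<n]"
    unfolding map_map o_def by (rule map_cong) auto
  show ?case unfolding 1 map_append 2 using Suc by simp
qed simp

lemma encode_graph_eq:
  "encode_graph (n, E) = replicate n True @ False # map (\<lambda>x. {x div n, x mod n} \<in> E) [0..<n * n]"
  using concat_map_upt[of "\<lambda>i j. {i, j} \<in> E" n n] by (simp add: encode_graph_def)

lemma length_encode_graph: "length (encode_graph (n, E)) = n * n + n + 1"
  by (simp add: encode_graph_eq)

lemma graph_size_encode: "graph_size (encode_graph (n, E)) = n"
proof -
  have "((i + 1) * (i + 1) + (i + 1) + 1 \<le> n * n + n + 1) \<longleftrightarrow> i < n" for i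
  proof
    assume *: "(i + 1) * (i + 1) + (i + 1) + 1 \<le> n * n + n + 1"
    show "i < n"
    proof (rule ccontr)
      assume "\<not> i < n"
      then have "n * n \<le> i * i" by (intro mult_mono) auto
      with * \<open>\<not> i < n\<close> show False by simp
    qed
  next
    assume "i < n"
    then have "(i + 1) * (i + 1) \<le> n * n" by (intro mult_mono) auto
    with \<open>i < n\<close> show "(i + 1) * (i + 1) + (i + 1) + 1 \<le> n * n + n + 1" by simp
  qed
  then show ?thesis unfolding graph_size_def length_encode_graph
    by (simp only: sum_of_bool_less)
qed

lemma graph_edge_encode:
  assumes "i < n" "j < n"
  shows "graph_edge (encode_graph (n, E)) i j \<longleftrightarrow> {i, j} \<in> E"
proof -
  have "i * n + j < Suc i * n" using assms by simp
  also have "Suc i * n \<le> n * n" using assms by (intro mult_right_mono) auto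
  finally have lt: "i * n + j < n * n" .
  then have "encode_graph (n, E) ! (n + 1 + (i * n + j)) \<longleftrightarrow> {i, j} \<in> E"
    using assms by (simp add: encode_graph_eq nth_append)
  then show ?thesis using lt
    unfolding graph_edge_def graph_size_encode length_encode_graph by auto
qed

section \<open>Multiplication and division by constants as finite-state transductions\<close>

section \<open>Binary arithmetic\<close>

abbreviation bits_val :: "bool list \<Rightarrow> nat" where
  "bits_val \<equiv> horner_sum of_bool 2"

text \<open>A Mealy machine. Multiplication by a constant reads the least significant digit first,
  with the carry as state; long division by a constant reads the most significant digit first, with
  the remainder as state. In both cases the state never exceeds the constant, so it can be kept in
  unary.\<close>

fun transduce :: "(nat \<Rightarrow> nat \<Rightarrow> bool) \<Rightarrow> (nat \<Rightarrow> nat \<Rightarrow> nat) \<Rightarrow> nat \<Rightarrow> bool list \<Rightarrow> bool list" where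
  "transduce out nxt q [] = []"
| "transduce out nxt q (x # xs) = out (of_bool x) q # transduce out nxt (nxt (of_bool x) q) xs"

lemma length_transduce [simp]: "length (transduce out nxt q xs) = length xs"
  by (induction xs arbitrary: q) auto

definition mul_bits :: "nat \<Rightarrow> bool list \<Rightarrow> bool list" where
  "mul_bits a = transduce (\<lambda>x c. (a * x + c) mod 2 = 1) (\<lambda>x c. (a * x + c) div 2) 0"

definition div_bits :: "nat \<Rightarrow> bool list \<Rightarrow> bool list" where
  "div_bits b = transduce (\<lambda>x r. b \<le> 2 * r + x) (\<lambda>x r. (2 * r + x) mod b) 0"

text \<open>The output is as long as the input and the last carry is dropped, hence the reduction
  modulo a power of 2. Overflow is later avoided by padding.\<close>

lemma bits_val_mul: "bits_val (mul_bits a ds) = (a * bits_val ds) mod 2 ^ length ds"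
proof -
  have "bits_val (transduce (\<lambda>x c. (a * x + c) mod 2 = 1) (\<lambda>x c. (a * x + c) div 2) c ds) =
      (a * bits_val ds + c) mod 2 ^ length ds" for c
  proof (induction ds arbitrary: c)
    case (Cons x xs)
    let ?y = "a * of_bool x + c"
    let ?V = "a * bits_val xs"
    have "bits_val (transduce (\<lambda>x c. (a * x + c) mod 2 = 1) (\<lambda>x c. (a * x + c) div 2) c (x # xs)) =
        ?y mod 2 + 2 * ((?V + ?y div 2) mod 2 ^ length xs)"
      unfolding transduce.simps horner_sum_simps Cons.IH by (cases "?y mod 2 = 0") auto
    also have "\<dots> = (?y + 2 * ?V) mod 2 ^ length (x # xs)"
      unfolding length_Cons power_Suc mod_mult2_eq by (simp add: add.commute)
    also have "?y + 2 * ?V = a * bits_val (x # xs) + c" by (simp add: algebra_simps)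
    finally show ?case .
  qed simp
  from this[of 0] show ?thesis by (simp add: mul_bits_def)
qed

lemma bits_val_append: "bits_val (xs @ ys) = bits_val xs + 2 ^ length xs * bits_val ys"
  by (simp add: horner_sum_append)

lemma bits_val_div:
  assumes "0 < b"
  shows "bits_val (rev (div_bits b ms)) = bits_val (rev ms) div b"
proof -
  have "r < b \<Longrightarrow> bits_val (rev (transduce (\<lambda>x r. b \<le> 2 * r + x) (\<lambda>x r. (2 * r + x) mod b) r ms)) =
      (r * 2 ^ length ms + bits_val (rev ms)) div b" for r
  proof (induction ms arbitrary: r)
    case Nil
    then show ?case by simp
  next
    case (Cons x xs)
    let ?y = "2 * r + of_bool x"
    \<comment> \<open>As \<open>r < b\<close>, the number \<open>2 * r + x\<close> stays below
      \<open>2 * b\<close>, so the next digit of the quotient is 0 or 1.\<close>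
    define q where "q = (of_bool (b \<le> ?y) :: nat)"
    have y: "?y = q * b + ?y mod b"
    proof (cases "b \<le> ?y")
      case True
      have "?y - b < b" using Cons.prems by (cases x) auto
      then have "?y mod b = ?y - b" using True by (metis le_mod_geq mod_less)
      then show ?thesis using True by (simp add: q_def)
    qed (simp add: q_def)
    have "r * 2 ^ length (x # xs) + bits_val (rev (x # xs)) = ?y * 2 ^ length xs + bits_val (rev xs)"
      by (simp add: bits_val_append algebra_simps)
    also have "\<dots> = (q * 2 ^ length xs) * b + ((?y mod b) * 2 ^ length xs + bits_val (rev xs))"
      by (subst (1) y) (simp add: algebra_simps)
    finally have "(r * 2 ^ length (x # xs) + bits_val (rev (x # xs))) div b =
        q * 2 ^ length xs + ((?y mod b) * 2 ^ length xs + bits_val (rev xs)) div b"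
      using assms by simp
    then show ?case using Cons.IH[of "?y mod b"] assms
      by (simp add: bits_val_append q_def)
  qed
  from this[of 0] assms show ?thesis by (simp add: div_bits_def)
qed

lemma bits_val_less: "bits_val xs < 2 ^ length xs"
  by (induction xs) (auto simp: of_bool_def)

definition scale_bits :: "nat \<Rightarrow> nat \<Rightarrow> bool list \<Rightarrow> bool list" where
  "scale_bits a b ds = rev (div_bits b (rev (mul_bits a ds)))"

lemma length_scale_bits [simp]: "length (scale_bits a b ds) = length ds"
  by (simp add: scale_bits_def div_bits_def mul_bits_def)

lemma length_scale_bits_iter [simp]: "length ((scale_bits a b ^^ m) ds) = length ds"
  by (induction m) auto

lemma bits_val_scale: "0 < b \<Longrightarrow> bits_val (scale_bits a b ds) = (a * bits_val ds) mod 2 ^ length ds div b"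
  by (simp add: scale_bits_def bits_val_div bits_val_mul)

text \<open>A power is applied one factor at a time, because the state of a transducer has to be
  bounded by a constant. As \<open>a\<close> is positive, no intermediate product exceeds the last
  one, so the hypothesis excludes overflow in every round.\<close>

lemma bits_val_scale_mul:
  assumes "bits_val ds * a ^ m < 2 ^ length ds" "0 < a"
  shows "bits_val ((scale_bits a 1 ^^ m) ds) = bits_val ds * a ^ m"
  using assms(1)
proof (induction m)
  case (Suc m)
  have "bits_val ds * a ^ m \<le> bits_val ds * a ^ Suc m" using assms(2) by simp
  then have IH: "bits_val ((scale_bits a 1 ^^ m) ds) = bits_val ds * a ^ m"
    using Suc.IH Suc.prems by linarith
  have "bits_val ((scale_bits a 1 ^^ Suc m) ds) = (a * (bits_val ds * a ^ m)) mod 2 ^ length ds"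
    by (simp add: bits_val_scale IH[simplified])
  also have "a * (bits_val ds * a ^ m) = bits_val ds * a ^ Suc m" by simp
  finally show ?case using Suc.prems by simp
qed simp

text \<open>Repeated truncated division loses no more than a single one.\<close>

lemma bits_val_scale_div:
  assumes "0 < b"
  shows "bits_val ((scale_bits 1 b ^^ m) ds) = bits_val ds div b ^ m"
proof (induction m)
  case (Suc m)
  have "bits_val ((scale_bits 1 b ^^ m) ds) < 2 ^ length ds"
    using bits_val_less[of "(scale_bits 1 b ^^ m) ds"] by simp
  then show ?case using Suc assms by (simp add: bits_val_scale div_mult2_eq[symmetric] mult.commute)
qed simp

section \<open>Program fragments common to both reductions\<close>

section \<open>Subroutines\<close>

lemma exec_test:
  assumes "s d = replicate (of_bool P) True" "r \<noteq> d"
  shows "exec (Branch d (Push r False) (Push r False) (Seq (Pop d) (Push r True))) s 4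
    (s(d := [], r := P # s r))"
proof (cases P)
  case True
  then have d: "s d = [True]" using assms by simp
  have "exec (Branch d (Push r False) (Push r False) (Seq (Pop d) (Push r True))) s (Suc (Suc (1 + 1)))
    (s(d := [], r := P # s r))"
    by (rule exec_Branch, simp only: d list.case if_True, rule exec_cong[OF exec_Seq[OF exec_Pop exec_Push]])
       (use assms d True in \<open>auto simp: fun_eq_iff\<close>)
  then show ?thesis by (rule exec_mono) simp
next
  case False
  then have d: "s d = []" using assms by simp
  have "exec (Branch d (Push r False) (Push r False) (Seq (Pop d) (Push r True))) s (Suc 1)
    (s(d := [], r := P # s r))"
    by (rule exec_Branch, simp only: d list.case, rule exec_cong[OF exec_Push])
       (use assms d False in \<open>auto simp: fun_eq_iff\<close>)
  then show ?thesis by (rule exec_mono) simp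
qed

lemma exec_read_bit:
  assumes "s r = x # xs" "s d = []" "r \<noteq> d"
  shows "exec (Branch r Nop (Pop r) (Seq (Pop r) (Push d True))) s 4
    (s(r := xs, d := replicate (of_bool x) True))"
proof (cases x)
  case True
  have "exec (Branch r Nop (Pop r) (Seq (Pop r) (Push d True))) s (Suc (Suc (1 + 1)))
    (s(r := xs, d := replicate (of_bool x) True))"
    by (rule exec_Branch, simp only: assms list.case True if_True, rule exec_cong[OF exec_Seq[OF exec_Pop exec_Push]])
       (use assms True in \<open>auto simp: fun_eq_iff\<close>)
  then show ?thesis by (rule exec_mono) simp
next
  case False
  have "exec (Branch r Nop (Pop r) (Seq (Pop r) (Push d True))) s (Suc 1)
    (s(r := xs, d := replicate (of_bool x) True))"
    by (rule exec_Branch, simp only: assms list.case False if_False, rule exec_cong[OF exec_Pop])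
       (use assms False in \<open>auto simp: fun_eq_iff\<close>)
  then show ?thesis by (rule exec_mono) simp
qed

text \<open>Stack 11 holds the current digit and stack 12 the state, both in unary, as the arguments
  of \<open>out\<close> and \<open>nxt\<close>, which work from stack 13 on. Stack 10 is left to the
  loop counter of a caller. The bound \<open>M\<close> on the states makes the cost of each round
  polynomial. Pushing the output reverses it.\<close>

lemma exec_transduce:
  assumes out: "comp (\<lambda>u \<rho>. of_bool (out (\<rho> 0) (\<rho> 1)))" and nxt: "comp (\<lambda>u \<rho>. nxt (\<rho> 0) (\<rho> 1))"
    and inv: "\<And>x q. x \<le> 1 \<Longrightarrow> q \<le> M \<Longrightarrow> nxt x q \<le> M"
    and src: "src \<in> {8, 9}" "dst \<in> {8, 9}" "src \<noteq> dst"
  shows "\<exists>c p. pbound p \<and> (\<forall>s S. 2 \<le> S \<longrightarrow> length (s 0) \<le> S \<longrightarrow> length (s src) \<le> S \<longrightarrow>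
    (\<forall>i\<ge>11. s i = []) \<longrightarrow>
    exec c s (p S) (s(src := [], dst := rev (transduce out nxt 0 (s src)) @ s dst)))"
proof -
  have neq: "src \<noteq> 0" "dst \<noteq> 0" "src \<noteq> 11" "dst \<noteq> 11" "src \<noteq> 12" "dst \<noteq> 12" "src \<noteq> 13" "dst \<noteq> 13"
    "src \<noteq> dst" "dst \<noteq> src" "src < 11" "dst < 11"
    using src by auto
  obtain co po where po: "pbound po" and co: "computes co po (\<lambda>u \<rho>. of_bool (out (\<rho> 0) (\<rho> 1)))"
    by (rule compE[OF out])
  obtain cn pn where pn: "pbound pn" and cn: "computes cn pn (\<lambda>u \<rho>. nxt (\<rho> 0) (\<rho> 1))"
    by (rule compE[OF nxt])
  define vs where "vs = (\<lambda>j::nat. if j = 0 then 11 else (12::nat))"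
  let ?body = "Seq (Branch src Nop (Pop src) (Seq (Pop src) (Push 11 True))) (Seq (co 13 vs)
      (Seq (Branch 13 (Push dst False) (Push dst False) (Seq (Pop 13) (Push dst True)))
      (Seq (cn 13 vs) (Seq (Clear 11) (Seq (Clear 12) (Move_onto 13 12))))))"
  let ?T = "\<lambda>S. Suc (4 + Suc (po (S + M) + Suc (4 + Suc (pn (S + M) + Suc (3 + Suc ((2 * M + 1) + (4 * M + 1)))))))"
  have body: "exec ?body s (?T S) (s(src := xs, dst := out (of_bool x) q # s dst,
      12 := replicate (nxt (of_bool x) q) True))"
    if "2 \<le> S" "length (s 0) \<le> S" "s src = x # xs" "s 11 = []" "s 12 = replicate q True" "q \<le> M"
      "\<And>i. i \<ge> 13 \<Longrightarrow> s i = []" for s S q x xs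
  proof -
    let ?x = "of_bool x :: nat"
    let ?s1 = "s(src := xs, 11 := replicate ?x True)"
    have 1: "exec (Branch src Nop (Pop src) (Seq (Pop src) (Push 11 True))) s 4 ?s1"
      by (rule exec_read_bit) (use that neq in auto)
    have len: "length (?s1 (vs j)) \<le> S + M" for j
      using that(1,5,6) neq by (cases x) (auto simp: vs_def)
    let ?s2 = "?s1(13 := replicate (of_bool (out ?x q)) True)"
    have 2: "exec (co 13 vs) ?s1 (po (S + M)) ?s2"
      by (rule exec_cong[OF computesD(1)[OF co _ _ _ _ _ _ refl refl, of "S + M" 13 vs ?s1]])
         (use that neq len in \<open>auto simp: vs_def\<close>)
    let ?s3 = "?s1(dst := out ?x q # s dst)"
    have 3: "exec (Branch 13 (Push dst False) (Push dst False) (Seq (Pop 13) (Push dst True))) ?s2 4 ?s3"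
      by (rule exec_cong[OF exec_test[where P = "out ?x q"]]) (use that neq in \<open>auto simp: fun_eq_iff\<close>)
    have len3: "length (?s3 (vs j)) \<le> S + M" for j using len[of j] neq by (auto simp: vs_def)
    let ?s4 = "?s3(13 := replicate (nxt ?x q) True)"
    have 4: "exec (cn 13 vs) ?s3 (pn (S + M)) ?s4"
      by (rule exec_cong[OF computesD(1)[OF cn _ _ _ _ _ _ refl refl, of "S + M" 13 vs ?s3]])
         (use that neq len3 in \<open>auto simp: vs_def\<close>)
    let ?s5 = "?s4(11 := [])"
    have 5: "exec (Clear 11) ?s4 3 ?s5"
      by (rule exec_cong[OF exec_Clear]) (use that neq in \<open>auto simp: of_bool_def\<close>)
    let ?s6 = "?s5(12 := [])"
    have 6: "exec (Clear 12) ?s5 (2 * M + 1) ?s6"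
      by (rule exec_cong[OF exec_Clear]) (use that neq in auto)
    have 7: "exec (Move_onto 13 12) ?s6 (4 * M + 1) (?s6(13 := [], 12 := replicate (nxt ?x q) True))"
      by (rule exec_cong[OF exec_Move_onto[where m = "nxt ?x q"]]) (use inv[of ?x q] that in auto)
    show ?thesis
      by (rule exec_cong[OF exec_Seq[OF 1 exec_Seq[OF 2 exec_Seq[OF 3 exec_Seq[OF 4 exec_Seq[OF 5
            exec_Seq[OF 6 7]]]]]]]) (use that neq in \<open>auto simp: fun_eq_iff\<close>)
  qed
  \<comment> \<open>The final state has to be followed because stack 12 is cleared after the loop,
    at a cost bounded by \<open>M\<close>.\<close>
  define fin where "fin = fold (\<lambda>x q. nxt (of_bool x) q)"
  have fin: "q \<le> M \<Longrightarrow> fin xs q \<le> M" for xs q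
    unfolding fin_def using inv by (induction xs arbitrary: q) auto
  have loop: "exec (While src ?body) s (length xs * (?T S + 1) + 1)
      (s(src := [], dst := rev (transduce out nxt q xs) @ s dst, 12 := replicate (fin xs q) True))"
    if "2 \<le> S" "length (s 0) \<le> S" "s src = xs" "s 11 = []" "s 12 = replicate q True" "q \<le> M"
      "\<And>i. i \<ge> 13 \<Longrightarrow> s i = []" for s S q xs
    using that
  proof (induction xs arbitrary: s q)
    case Nil
    show ?case
      by (rule exec_cong[OF exec_While_end]) (use Nil(3,5) in \<open>auto simp: fun_eq_iff fin_def\<close>)
  next
    case (Cons x xs)
    let ?q = "nxt (of_bool x) q"
    let ?s = "s(src := xs, dst := out (of_bool x) q # s dst, 12 := replicate ?q True)"
    have 1: "exec ?body s (?T S) ?s" by (rule body[OF Cons.prems])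
    have q: "?q \<le> M" using Cons.prems(6) by (intro inv) auto
    have 2: "exec (While src ?body) ?s (length xs * (?T S + 1) + 1)
      (?s(src := [], dst := rev (transduce out nxt ?q xs) @ ?s dst, 12 := replicate (fin xs ?q) True))"
    proof (rule Cons.IH[where s = ?s and q = ?q])
      show "2 \<le> S" by (rule Cons.prems(1))
      show "length (?s 0) \<le> S" using Cons.prems(2) neq by simp
      show "?s src = xs" using neq by simp
      show "?s 11 = []" using Cons.prems(4) neq by simp
      show "?s 12 = replicate ?q True" by simp
      show "?q \<le> M" by (rule q)
      show "?s i = []" if "i \<ge> 13" for i using Cons.prems(7)[OF that] that neq(11,12) by simp
    qed
    have 3: "s src \<noteq> []" using Cons.prems(3) by simp
    have 4: "?s(src := [], dst := rev (transduce out nxt ?q xs) @ ?s dst, 12 := replicate (fin xs ?q) True) =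
        s(src := [], dst := rev (transduce out nxt q (x # xs)) @ s dst, 12 := replicate (fin (x # xs) q) True)"
      using neq by (auto simp: fun_eq_iff fin_def)
    show ?case
      by (rule exec_cong[OF exec_While[OF 3 1 2] _ 4]) simp
  qed
  let ?p = "\<lambda>S. Suc ((S * (?T S + 1) + 1) + (2 * M + 1))"
  show ?thesis
  proof (intro exI conjI allI impI)
    show "pbound ?p" by (intro pbound_intros pbound_comp[OF po pbound_const[of M]] pbound_comp[OF pn pbound_const[of M]])
    fix s :: store and S :: nat
    assume *: "2 \<le> S" "length (s 0) \<le> S" "length (s src) \<le> S" "\<forall>i\<ge>11. s i = []"
    have 1: "exec (While src ?body) s (length (s src) * (?T S + 1) + 1)
      (s(src := [], dst := rev (transduce out nxt 0 (s src)) @ s dst, 12 := replicate (fin (s src) 0) True))"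
      by (rule loop) (use * in auto)
    have 3: "fin (s src) 0 \<le> M" by (rule fin) simp
    show "exec (Seq (While src ?body) (Clear 12)) s (?p S)
       (s(src := [], dst := rev (transduce out nxt 0 (s src)) @ s dst))"
    proof (rule exec_cong[OF exec_Seq[OF 1 exec_Clear]])
      have "Suc ((length (s src) * k + 1) + (2 * fin (s src) 0 + 1)) \<le> Suc ((S * k + 1) + (2 * M + 1))" for k
        using *(3) 3 by (simp add: add_mono mult_right_mono)
      from this[of "?T S + 1"] show "Suc (length (s src) * (?T S + 1) + 1 + (2 * length ((s(src := [],
          dst := rev (transduce out nxt 0 (s src)) @ s dst, 12 := replicate (fin (s src) 0) True)) 12) + 1)) \<le> ?p S"
        by simp
    qed (use *(4)[rule_format, of 12] neq in \<open>simp_all add: fun_eq_iff\<close>)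
  qed
qed

text \<open>Throughout a reduction stack 0 holds the instance, stack 1 the error parameter, stack 4 the
  query, stacks 5 and 6 the answer of the oracle and stack 7 in unary the number \<open>l\<close> of leading
  zeros of the error parameter.  The lengths of the error parameter and of the answer are not
  polynomially bounded, so stacks 1, 5 and 6 may never be traversed.\<close>

definition size_le :: "nat \<Rightarrow> store \<Rightarrow> bool" where
  "size_le S s \<longleftrightarrow> (\<forall>r. r \<notin> {1, 5, 6} \<longrightarrow> length (s r) \<le> S)"

definition subroutine :: "program \<Rightarrow> (store \<Rightarrow> bool) \<Rightarrow> (store \<Rightarrow> store) \<Rightarrow> bool" where
  "subroutine c P F \<longleftrightarrow> (\<exists>p. pbound p \<and>
     (\<forall>s S. 2 \<le> S \<longrightarrow> P s \<longrightarrow> size_le S s \<longrightarrow> exec c s (p S) (F s)))"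

lemma subroutineI:
  assumes "pbound p" "\<And>s S. \<lbrakk>2 \<le> S; P s; size_le S s\<rbrakk> \<Longrightarrow> exec c s (p S) (F s)"
  shows "subroutine c P F"
  using assms unfolding subroutine_def by blast

lemma size_le_exec: "exec c s T s' \<Longrightarrow> size_le S s \<Longrightarrow> size_le (S + T) s'"
  unfolding size_le_def using exec_length[of c s T s'] by (meson add_le_mono1 order_trans)

lemma subroutine_Seq:
  assumes "subroutine c P F" "subroutine c' Q G" "\<And>s. P s \<Longrightarrow> Q (F s)"
  shows "subroutine (Seq c c') P (\<lambda>s. G (F s))"
proof -
  obtain p where p: "pbound p" "\<And>s S. \<lbrakk>2 \<le> S; P s; size_le S s\<rbrakk> \<Longrightarrow> exec c s (p S) (F s)"
    using assms(1) unfolding subroutine_def by blast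
  obtain q where q: "pbound q" "\<And>s S. \<lbrakk>2 \<le> S; Q s; size_le S s\<rbrakk> \<Longrightarrow> exec c' s (q S) (G s)"
    using assms(2) unfolding subroutine_def by blast
  show ?thesis
  proof (rule subroutineI)
    show "pbound (\<lambda>S. Suc (p S + q (S + p S)))" by (intro pbound_intros p pbound_comp[OF q(1) p(1)])
    fix s S assume *: "2 \<le> S" "P s" "size_le S s"
    show "exec (Seq c c') s (Suc (p S + q (S + p S))) (G (F s))"
      by (rule exec_Seq[OF p(2)[OF *] q(2)]) (use * assms(3) size_le_exec[OF p(2)[OF *]] in auto)
  qed
qed

lemma subroutine_cong:
  assumes "subroutine c P F" "\<And>s. P' s \<Longrightarrow> P s" "\<And>s. P' s \<Longrightarrow> F s = F' s"
  shows "subroutine c P' F'"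
proof -
  obtain p where p: "pbound p" "\<And>s S. \<lbrakk>2 \<le> S; P s; size_le S s\<rbrakk> \<Longrightarrow> exec c s (p S) (F s)"
    using assms(1) unfolding subroutine_def by blast
  show ?thesis
    by (rule subroutineI[OF p(1)]) (use p(2) assms(2,3) in metis)
qed

definition clean :: "store \<Rightarrow> bool" where
  "clean s \<longleftrightarrow> (\<forall>i\<ge>10. s i = [])"

text \<open>All loop counts of a reduction are functions of the instance on stack 0 and of
  \<open>l\<close> on stack 7. The count is left in unary on stack 10 for \<open>c\<close> to
  consume.\<close>

lemma subroutine_assign:
  assumes f: "comp (\<lambda>u \<rho>. f u (\<rho> 0))" and q: "pbound q" and P: "\<And>s. P s \<Longrightarrow> clean s"
    and c: "\<And>s S. \<lbrakk>2 \<le> S; P s; size_le S s; f (s 0) (length (s 7)) \<le> S\<rbrakk> \<Longrightarrow>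
      exec c (s(10 := replicate (f (s 0) (length (s 7))) True)) (q S) (G s)"
  obtains c' where "subroutine c' P G"
proof -
  obtain cf pf where pf: "pbound pf" and cf: "computes cf pf (\<lambda>u \<rho>. f u (\<rho> 0))" by (rule compE[OF f])
  have "subroutine (Seq (cf 10 (\<lambda>_. 7)) c) P G"
  proof (rule subroutineI)
    show "pbound (\<lambda>S. Suc (pf S + q (S + pf S)))" by (intro pbound_intros pf pbound_comp[OF q pf])
    fix s S assume *: "2 \<le> S" "P s" "size_le S s"
    have 1: "exec (cf 10 (\<lambda>_. 7)) s (pf S) (s(10 := replicate (f (s 0) (length (s 7))) True))"
      and 2: "f (s 0) (length (s 7)) \<le> pf S"
      by (rule computesD[OF cf _ _ _ _ _ _ refl refl, of S 10 "\<lambda>_. 7" s];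
          use * P[OF *(2)] in \<open>auto simp: size_le_def clean_def\<close>)+
    have "size_le (S + pf S) s" using *(3) by (auto simp: size_le_def intro: trans_le_add1)
    then show "exec (Seq (cf 10 (\<lambda>_. 7)) c) s (Suc (pf S + q (S + pf S))) (G s)"
      by (intro exec_Seq[OF 1] c) (use * 2 in auto)
  qed
  then show thesis by (rule that)
qed

lemma subroutine_scale:
  assumes "0 < b"
  obtains c where "subroutine c (\<lambda>s. s 8 = [] \<and> (\<forall>i\<ge>11. s i = [])) (\<lambda>s. s(9 := scale_bits a b (s 9)))"
proof -
  have "\<exists>c p. pbound p \<and> (\<forall>s S. 2 \<le> S \<longrightarrow> length (s 0) \<le> S \<longrightarrow> length (s 9) \<le> S \<longrightarrow>
    (\<forall>i\<ge>11. s i = []) \<longrightarrow> exec c s (p S) (s(9 := [], 8 := rev (mul_bits a (s 9)) @ s 8)))"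
    unfolding mul_bits_def
  proof (rule exec_transduce[where M = a])
    fix x q :: nat assume "x \<le> 1" "q \<le> a"
    have "a * x \<le> a * 1" using \<open>x \<le> 1\<close> by (intro mult_left_mono) auto
    then have "a * x + q \<le> 2 * a" using \<open>q \<le> a\<close> by linarith
    then show "(a * x + q) div 2 \<le> a" by linarith
  qed (intro comp_intros | simp)+
  then obtain cm pm where pm: "pbound pm" and cm: "\<And>s S. 2 \<le> S \<Longrightarrow> length (s 0) \<le> S \<Longrightarrow>
      length (s 9) \<le> S \<Longrightarrow> (\<forall>i\<ge>11. s i = []) \<Longrightarrow>
      exec cm s (pm S) (s(9 := [], 8 := rev (mul_bits a (s 9)) @ s 8))"
    by blast
  have "\<exists>c p. pbound p \<and> (\<forall>s S. 2 \<le> S \<longrightarrow> length (s 0) \<le> S \<longrightarrow> length (s 8) \<le> S \<longrightarrow>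
    (\<forall>i\<ge>11. s i = []) \<longrightarrow> exec c s (p S) (s(8 := [], 9 := rev (div_bits b (s 8)) @ s 9)))"
    unfolding div_bits_def
  proof (rule exec_transduce[where M = b])
    fix x q :: nat assume "x \<le> 1" "q \<le> b"
    show "(2 * q + x) mod b \<le> b" using assms by (simp add: less_imp_le)
  qed (intro comp_intros | simp)+
  then obtain cd pd where pd: "pbound pd" and cd: "\<And>s S. 2 \<le> S \<Longrightarrow> length (s 0) \<le> S \<Longrightarrow>
      length (s 8) \<le> S \<Longrightarrow> (\<forall>i\<ge>11. s i = []) \<Longrightarrow>
      exec cd s (pd S) (s(8 := [], 9 := rev (div_bits b (s 8)) @ s 9))"
    by blast
  have "subroutine (Seq cm cd) (\<lambda>s. s 8 = [] \<and> (\<forall>i\<ge>11. s i = [])) (\<lambda>s. s(9 := scale_bits a b (s 9)))"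
  proof (rule subroutineI)
    show "pbound (\<lambda>S. Suc (pm S + pd S))" by (intro pbound_intros pm pd)
    fix s S assume *: "2 \<le> S" "s 8 = [] \<and> (\<forall>i\<ge>11. s i = [])" "size_le S s"
    let ?s = "s(9 := [], 8 := rev (mul_bits a (s 9)))"
    have 1: "exec cm s (pm S) ?s"
      by (rule exec_cong[OF cm]) (use * in \<open>auto simp: size_le_def\<close>)
    have 2: "exec cd ?s (pd S) (s(9 := scale_bits a b (s 9)))"
      by (rule exec_cong[OF cd])
         (use * in \<open>auto simp: size_le_def scale_bits_def mul_bits_def fun_eq_iff\<close>)
    show "exec (Seq cm cd) s (Suc (pm S + pd S)) (s(9 := scale_bits a b (s 9)))"
      by (rule exec_Seq[OF 1 2])
  qed
  then show thesis by (rule that)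
qed

lemma subroutine_scale_iter:
  assumes "0 < b" "comp (\<lambda>u \<rho>. f u (\<rho> 0))"
  obtains c where "subroutine c (\<lambda>s. s 8 = [] \<and> clean s)
    (\<lambda>s. s(9 := (scale_bits a b ^^ f (s 0) (length (s 7))) (s 9)))"
proof -
  obtain c where c: "subroutine c (\<lambda>s. s 8 = [] \<and> (\<forall>i\<ge>11. s i = [])) (\<lambda>s. s(9 := scale_bits a b (s 9)))"
    by (rule subroutine_scale[OF assms(1)])
  obtain p where p: "pbound p" "\<And>s S. \<lbrakk>2 \<le> S; s 8 = [] \<and> (\<forall>i\<ge>11. s i = []); size_le S s\<rbrakk> \<Longrightarrow>
      exec c s (p S) (s(9 := scale_bits a b (s 9)))"
    using c unfolding subroutine_def by blast
  show thesis
  proof (rule subroutine_assign[OF assms(2) _ _ _ that])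
    show "pbound (\<lambda>S. S * (p S + 3) + 1)" by (intro pbound_intros p)
    show "clean s" if "s 8 = [] \<and> clean s" for s using that by simp
    fix s S assume *: "2 \<le> S" "s 8 = [] \<and> clean s" "size_le S s" "f (s 0) (length (s 7)) \<le> S"
    define m where "m = f (s 0) (length (s 7))"
    define F where "F = (\<lambda>i. s(9 := (scale_bits a b ^^ (m - i)) (s 9)))"
    have "exec (For 10 c) ((F m)(10 := replicate m True)) (m * (p S + 3) + 1) ((F 0)(10 := []))"
    proof (rule exec_For)
      fix i assume i: "i < m"
      then have e: "m - i = Suc (m - Suc i)" by simp
      show "exec c ((F (Suc i))(10 := replicate i True)) (p S) ((F i)(10 := replicate i True))"
        by (rule exec_cong[OF p(2)])
           (use * i in \<open>auto simp: F_def e size_le_def clean_def m_def[symmetric] fun_eq_iff\<close>)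
    qed
    moreover have "m * (p S + 3) + 1 \<le> S * (p S + 3) + 1" using *(4) by (simp add: m_def)
    moreover have "(F m)(10 := replicate m True) = s(10 := replicate m True)"
      by (auto simp: F_def)
    moreover have "(F 0)(10 := []) = s(9 := (scale_bits a b ^^ m) (s 9))"
      using *(2) by (auto simp: F_def clean_def fun_eq_iff)
    ultimately show "exec (For 10 c) (s(10 := replicate (f (s 0) (length (s 7))) True))
        (S * (p S + 3) + 1) (s(9 := (scale_bits a b ^^ f (s 0) (length (s 7))) (s 9)))"
      unfolding m_def[symmetric] using exec_mono by metis
  qed
qed

type_synonym factor = "nat \<times> (bool list \<Rightarrow> nat \<Rightarrow> nat)"

text \<open>All multiplications precede the divisions, so that digits are lost only in the
  divisions, which together truncate once.\<close>

fun scale_all :: "factor list \<Rightarrow> factor list \<Rightarrow> bool list \<Rightarrow> nat \<Rightarrow> bool list \<Rightarrow> bool list" where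
  "scale_all ((a, f) # ms) ds u l xs = scale_all ms ds u l ((scale_bits a 1 ^^ f u l) xs)"
| "scale_all [] ((b, f) # ds) u l xs = scale_all [] ds u l ((scale_bits 1 b ^^ f u l) xs)"
| "scale_all [] [] u l xs = xs"

lemma subroutine_scale_all:
  assumes "\<And>a f. (a, f) \<in> set ms \<union> set ds \<Longrightarrow> 0 < a \<and> comp (\<lambda>u \<rho>. f u (\<rho> 0))"
  obtains c where "subroutine c (\<lambda>s. s 8 = [] \<and> clean s)
    (\<lambda>s. s(9 := scale_all ms ds (s 0) (length (s 7)) (s 9)))"
proof -
  let ?P = "\<lambda>s::store. s 8 = [] \<and> clean s"
  have ds: "\<exists>c. subroutine c ?P (\<lambda>s. s(9 := scale_all [] ds (s 0) (length (s 7)) (s 9)))"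
    if "\<And>a f. (a, f) \<in> set ds \<Longrightarrow> 0 < a \<and> comp (\<lambda>u \<rho>. f u (\<rho> 0))"
    using that
  proof (induction ds)
    case Nil
    have "subroutine Nop ?P (\<lambda>s. s(9 := scale_all [] [] (s 0) (length (s 7)) (s 9)))"
      by (rule subroutineI[OF pbound_const[of 1]], rule exec_cong[OF exec_Nop]) auto
    then show ?case by blast
  next
    case (Cons d ds)
    obtain b f where d: "d = (b, f)" by (cases d)
    have "0 < b" "comp (\<lambda>u \<rho>. f u (\<rho> 0))" using Cons.prems[of b f] by (auto simp: d)
    then obtain c1 where c1: "subroutine c1 ?P (\<lambda>s. s(9 := (scale_bits 1 b ^^ f (s 0) (length (s 7))) (s 9)))"
      by (rule subroutine_scale_iter)
    have "\<exists>c. subroutine c ?P (\<lambda>s. s(9 := scale_all [] ds (s 0) (length (s 7)) (s 9)))"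
      by (rule Cons.IH) (use Cons.prems in auto)
    then obtain c2 where c2: "subroutine c2 ?P (\<lambda>s. s(9 := scale_all [] ds (s 0) (length (s 7)) (s 9)))"
      by blast
    have "subroutine (Seq c1 c2) ?P (\<lambda>s. s(9 := scale_all [] (d # ds) (s 0) (length (s 7)) (s 9)))"
      by (rule subroutine_cong[OF subroutine_Seq[OF c1 c2]]) (auto simp: clean_def d)
    then show ?case by blast
  qed
  have "\<exists>c. subroutine c ?P (\<lambda>s. s(9 := scale_all ms ds (s 0) (length (s 7)) (s 9)))"
    using assms
  proof (induction ms)
    case Nil
    then show ?case by (intro ds) auto
  next
    case (Cons m ms)
    obtain b f where m: "m = (b, f)" by (cases m)
    have "comp (\<lambda>u \<rho>. f u (\<rho> 0))" using Cons.prems[of b f] by (auto simp: m)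
    then obtain c1
      where c1: "subroutine c1 ?P (\<lambda>s. s(9 := (scale_bits b 1 ^^ f (s 0) (length (s 7))) (s 9)))"
      by (rule subroutine_scale_iter[OF zero_less_one])
    have "\<exists>c. subroutine c ?P (\<lambda>s. s(9 := scale_all ms ds (s 0) (length (s 7)) (s 9)))"
      by (rule Cons.IH) (use Cons.prems in auto)
    then obtain c2 where c2: "subroutine c2 ?P (\<lambda>s. s(9 := scale_all ms ds (s 0) (length (s 7)) (s 9)))"
      by blast
    have "subroutine (Seq c1 c2) ?P (\<lambda>s. s(9 := scale_all (m # ms) ds (s 0) (length (s 7)) (s 9)))"
      by (rule subroutine_cong[OF subroutine_Seq[OF c1 c2]]) (auto simp: clean_def m)
    then show ?case by blast
  qed
  then show thesis using that by blast
qed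

lemma length_scale_all [simp]: "length (scale_all ms ds u l xs) = length xs"
  by (induction ms ds u l xs rule: scale_all.induct) auto

definition factor_prod :: "factor list \<Rightarrow> bool list \<Rightarrow> nat \<Rightarrow> nat" where
  "factor_prod fs u l = prod_list (map (\<lambda>(a, f). a ^ f u l) fs)"

lemma factor_prod_simps [simp]:
  "factor_prod [] u l = 1"
  "factor_prod ((a, f) # fs) u l = a ^ f u l * factor_prod fs u l"
  by (simp_all add: factor_prod_def)

lemma factor_prod_pos: "(\<And>a f. (a, f) \<in> set fs \<Longrightarrow> 0 < a) \<Longrightarrow> 0 < factor_prod fs u l"
proof (induction fs)
  case (Cons m fs)
  obtain a f where m: "m = (a, f)" by (cases m)
  have "0 < a" using Cons.prems[of a f] by (simp add: m)
  moreover have "0 < factor_prod fs u l" by (rule Cons.IH) (use Cons.prems in auto)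
  ultimately show ?case by (simp add: m)
qed simp

text \<open>Positive factors make the intermediate products at most the full product, so one bound
  excludes overflow throughout.\<close>

lemma bits_val_scale_all:
  assumes "\<And>a f. (a, f) \<in> set ms \<union> set ds \<Longrightarrow> 0 < a"
    and "bits_val xs * factor_prod ms u l < 2 ^ length xs"
  shows "bits_val (scale_all ms ds u l xs) = bits_val xs * factor_prod ms u l div factor_prod ds u l"
  using assms
proof (induction ms ds u l xs rule: scale_all.induct)
  case (1 a f ms ds u l xs)
  have a: "0 < a" using 1(2)[of a f] by simp
  have "0 < factor_prod ms u l" by (rule factor_prod_pos) (use 1(2) in auto)
  then have "bits_val xs * a ^ f u l \<le> bits_val xs * factor_prod ((a, f) # ms) u l" by simp
  then have e: "bits_val ((scale_bits a 1 ^^ f u l) xs) = bits_val xs * a ^ f u l"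
    using order.strict_trans1[OF _ 1(3)] a by (intro bits_val_scale_mul) auto
  have "bits_val (scale_all ms ds u l ((scale_bits a 1 ^^ f u l) xs)) =
      bits_val ((scale_bits a 1 ^^ f u l) xs) * factor_prod ms u l div factor_prod ds u l"
    by (rule 1(1)) (use 1(2,3) in \<open>auto simp: e[simplified] mult_ac\<close>)
  then show ?case by (simp add: e[simplified] mult_ac)
next
  case (2 b f ds u l xs)
  have "0 < b" using 2(2)[of b f] by simp
  then have e: "bits_val ((scale_bits 1 b ^^ f u l) xs) = bits_val xs div b ^ f u l"
    by (rule bits_val_scale_div)
  have "bits_val xs div b ^ f u l \<le> bits_val xs" by simp
  also have "\<dots> < 2 ^ length xs" using 2(3) by simp
  finally have less: "bits_val xs div b ^ f u l < 2 ^ length xs" .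
  have "bits_val (scale_all [] ds u l ((scale_bits 1 b ^^ f u l) xs)) =
      bits_val ((scale_bits 1 b ^^ f u l) xs) * factor_prod [] u l div factor_prod ds u l"
    by (rule 2(1)) (use 2(2) less in \<open>auto simp: e[simplified]\<close>)
  then show ?case by (simp add: e[simplified] div_mult2_eq)
qed simp

text \<open>A loop can only wait for a stack to become empty, so a flag on stack \<open>f\<close> is
  popped at the first \<open>True\<close> or at the end of the data. The time depends on the number
  of symbols removed, not on the height of stack \<open>r\<close>; for the error parameter this
  number is \<open>l\<close>, whereas the height is unbounded.\<close>

lemma exec_strip:
  assumes "r \<noteq> q" "r \<noteq> f" "q \<noteq> f" "s f = []"
  shows "exec (Seq (Push f True) (While f (Branch r (Pop f) (Seq (Pop r) (Push q True)) (Pop f)))) s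
    (5 * length (takeWhile Not (s r)) + 6)
    (s(r := dropWhile Not (s r), q := replicate (length (takeWhile Not (s r))) True @ s q))"
proof -
  let ?body = "Branch r (Pop f) (Seq (Pop r) (Push q True)) (Pop f)"
  have stop: "exec (While f ?body) s 4 (s(f := []))"
    if "s f = [True]" "s r = [] \<or> hd (s r)" for s
  proof -
    have 1: "exec ?body s (Suc 1) (s(f := []))"
      by (rule exec_Branch, rule exec_cong[OF exec_Pop[of f, THEN back_subst[of "\<lambda>c. exec c _ _ _"]]])
         (use that in \<open>auto split: list.split\<close>)
    have 2: "exec (While f ?body) (s(f := [])) 1 (s(f := []))" by (rule exec_While_end) simp
    have 3: "s f \<noteq> []" using that by simp
    show ?thesis by (rule exec_mono[OF exec_While[OF 3 1 2]]) simp
  qed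
  have loop: "exec (While f ?body) s (5 * length (takeWhile Not xs) + 4)
      (s(f := [], r := dropWhile Not xs, q := replicate (length (takeWhile Not xs)) True @ s q))"
    if "s f = [True]" "s r = xs" for s xs using that
  proof (induction xs arbitrary: s)
    case Nil
    show ?case by (rule exec_cong[OF stop]) (use Nil assms in \<open>auto simp: fun_eq_iff\<close>)
  next
    case (Cons x xs)
    show ?case
    proof (cases x)
      case True
      show ?thesis by (rule exec_cong[OF stop]) (use Cons.prems True assms in \<open>auto simp: fun_eq_iff\<close>)
    next
      case False
      let ?s = "s(r := xs, q := True # s q)"
      have 1: "exec ?body s (Suc (Suc (1 + 1))) ?s"
        by (rule exec_Branch, simp only: Cons.prems list.case False if_False,
            rule exec_cong[OF exec_Seq[OF exec_Pop exec_Push]])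
           (use assms Cons.prems in \<open>auto simp: fun_eq_iff\<close>)
      have 2: "exec (While f ?body) ?s (5 * length (takeWhile Not xs) + 4)
        (?s(f := [], r := dropWhile Not xs, q := replicate (length (takeWhile Not xs)) True @ ?s q))"
      proof (rule Cons.IH)
        show "?s f = [True]" "?s r = xs" using Cons.prems assms by auto
      qed
      have 3: "s f \<noteq> []" using Cons.prems by simp
      show ?thesis
        by (rule exec_cong[OF exec_While[OF 3 1 2]])
           (use False assms Cons.prems in \<open>auto simp: fun_eq_iff replicate_app_Cons_same\<close>)
    qed
  qed
  let ?s = "s(f := [True])"
  have 1: "exec (Push f True) s 1 ?s" by (rule exec_cong[OF exec_Push]) (use assms in auto)
  have 2: "exec (While f ?body) ?s (5 * length (takeWhile Not (s r)) + 4)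
      (?s(f := [], r := dropWhile Not (s r), q := replicate (length (takeWhile Not (s r))) True @ ?s q))"
    by (rule loop) (use assms in auto)
  show ?thesis
    by (rule exec_cong[OF exec_Seq[OF 1 2]]) (use assms in \<open>auto simp: fun_eq_iff\<close>)
qed

text \<open>Once the stack is exhausted zeros are supplied, so that exactly \<open>m\<close> digits
  arrive: missing digits after the binary point are zeros.\<close>

lemma exec_For_Shift_pad:
  assumes "r \<noteq> r'" "c \<noteq> r" "c \<noteq> r'" "s c = replicate m True"
  shows "exec (For c (Branch r (Push r' False) (Seq (Pop r) (Push r' False)) (Seq (Pop r) (Push r' True))))
           s (m * 7 + 1)
           (s(c := [], r := drop m (s r), r' := rev (take m (s r @ replicate m False)) @ s r'))"
proof -
  let ?b = "Branch r (Push r' False) (Seq (Pop r) (Push r' False)) (Seq (Pop r) (Push r' True))"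
  let ?w = "s r @ replicate m False"
  define F where "F = (\<lambda>i. s(r := drop (m - i) (s r), r' := rev (take (m - i) ?w) @ s r'))"
  have "exec (For c ?b) ((F m)(c := replicate m True)) (m * (4 + 3) + 1) ((F 0)(c := []))"
  proof (rule exec_For)
    fix i assume i: "i < m"
    define j where "j = m - Suc i"
    have j: "m - i = Suc j" "m - Suc i = j" "j < m" using i by (auto simp: j_def)
    let ?t = "(F (Suc i))(c := replicate i True)"
    have w: "take (Suc j) ?w = take j ?w @ [?w ! j]" by (rule take_Suc_conv_app_nth) (use j in auto)
    have eq: "?t(r := drop (Suc j) (s r), r' := (?w ! j) # ?t r') = (F i)(c := replicate i True)"
      using assms by (auto simp: F_def j w fun_eq_iff simp del: take_append)
    have "exec ?b ?t (Suc 3) (?t(r := drop (Suc j) (s r), r' := (?w ! j) # ?t r'))"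
    proof (rule exec_Branch)
      show "exec (case ?t r of [] \<Rightarrow> Push r' False | x # _ \<Rightarrow> if x then Seq (Pop r) (Push r' True)
           else Seq (Pop r) (Push r' False)) ?t 3 (?t(r := drop (Suc j) (s r), r' := (?w ! j) # ?t r'))"
      proof (cases "j < length (s r)")
        case True
        have t: "?t r = ?w ! j # drop (Suc j) (s r)"
          using assms True by (simp add: F_def j Cons_nth_drop_Suc nth_append)
        have "exec (Seq (Pop r) (Push r' (?w ! j))) ?t (Suc (1 + 1)) (?t(r := drop (Suc j) (s r), r' := (?w ! j) # ?t r'))"
          by (rule exec_cong[OF exec_Seq[OF exec_Pop exec_Push]]) (use t assms in \<open>auto simp: fun_eq_iff\<close>)
        then show ?thesis unfolding t list.case by (cases "?w ! j") (simp_all add: numeral_3_eq_3)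
      next
        case False
        have t: "?t r = []" using assms False by (simp add: F_def j)
        have wj: "?w ! j = False" using False j by (simp add: nth_append)
        show ?thesis unfolding t list.case wj
          by (rule exec_cong[OF exec_Push]) (use t False in \<open>auto simp: fun_eq_iff\<close>)
      qed
    qed
    then show "exec ?b ?t 4 ((F i)(c := replicate i True))" unfolding eq by simp
  qed
  moreover have "(F m)(c := replicate m True) = s" using assms by (auto simp: F_def)
  moreover have "(F 0)(c := []) = s(c := [], r := drop m (s r), r' := rev (take m ?w) @ s r')"
    using assms by (auto simp: F_def)
  ultimately show ?thesis by simp
qed

lemma subroutine_pushes:
  assumes f: "comp (\<lambda>u \<rho>. f u (\<rho> 0))" and r: "r < 10"
  obtains c where "subroutine c clean (\<lambda>s. s(r := replicate (f (s 0) (length (s 7))) x @ s r))"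
proof (rule subroutine_assign[OF f _ _ _ that])
  show "pbound (\<lambda>S. S * (1 + 3) + 1)" by (intro pbound_intros)
  show "clean s" if "clean s" for s using that .
  fix s S assume *: "2 \<le> S" "clean s" "size_le S s" "f (s 0) (length (s 7)) \<le> S"
  define m where "m = f (s 0) (length (s 7))"
  define F where "F = (\<lambda>i. s(r := replicate (m - i) x @ s r))"
  have 1: "exec (For 10 (Push r x)) ((F m)(10 := replicate m True)) (m * (1 + 3) + 1) ((F 0)(10 := []))"
  proof (rule exec_For)
    fix i assume i: "i < m"
    then have e: "m - i = Suc (m - Suc i)" by simp
    show "exec (Push r x) ((F (Suc i))(10 := replicate i True)) 1 ((F i)(10 := replicate i True))"
      by (rule exec_cong[OF exec_Push]) (use r in \<open>auto simp: F_def e fun_eq_iff\<close>)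
  qed
  have 2: "(F m)(10 := replicate m True) = s(10 := replicate m True)" by (auto simp: F_def)
  show "exec (For 10 (Push r x)) (s(10 := replicate (f (s 0) (length (s 7))) True)) (S * (1 + 3) + 1)
      (s(r := replicate (f (s 0) (length (s 7))) x @ s r))"
    unfolding m_def[symmetric]
    by (rule exec_cong[OF 1[unfolded 2]])
       (use *(2,4) r in \<open>auto simp: F_def clean_def fun_eq_iff m_def[symmetric]\<close>)
qed

text \<open>The counter runs down and pushing reverses, so the list ends up in ascending
  order.\<close>

lemma subroutine_emit:
  assumes f: "comp (\<lambda>u \<rho>. f u (\<rho> 0))" and a: "comp (\<lambda>u \<rho>. of_bool (a u (\<rho> 1) (\<rho> 0)))"
  obtains c where "subroutine c clean
    (\<lambda>s. s(4 := map (a (s 0) (length (s 7))) [0..<f (s 0) (length (s 7))] @ s 4))"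
proof -
  obtain ca pa where pa: "pbound pa" and ca: "computes ca pa (\<lambda>u \<rho>. of_bool (a u (\<rho> 1) (\<rho> 0)))"
    by (rule compE[OF a])
  define vs where "vs = (\<lambda>j::nat. if j = 0 then 10 else (7::nat))"
  let ?b = "Seq (ca 11 vs) (Branch 11 (Push 4 False) (Push 4 False) (Seq (Pop 11) (Push 4 True)))"
  let ?T = "\<lambda>S. Suc (pa S + 4)"
  show thesis
  proof (rule subroutine_assign[OF f _ _ _ that])
    show "pbound (\<lambda>S. S * (?T S + 3) + 1)" by (intro pbound_intros pa)
    show "clean s" if "clean s" for s using that .
    fix s S assume *: "2 \<le> S" "clean s" "size_le S s" "f (s 0) (length (s 7)) \<le> S"
    define m where "m = f (s 0) (length (s 7))"
    define A where "A = a (s 0) (length (s 7))"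
    define F where "F = (\<lambda>i. s(4 := map A [i..<m] @ s 4))"
    have 1: "exec (For 10 ?b) ((F m)(10 := replicate m True)) (m * (?T S + 3) + 1) ((F 0)(10 := []))"
    proof (rule exec_For)
      fix i assume i: "i < m"
      let ?s = "(F (Suc i))(10 := replicate i True)"
      have s: "?s 0 = s 0" "length (?s (vs 0)) = i" "length (?s (vs 1)) = length (s 7)"
        by (auto simp: F_def vs_def)
      have b1: "exec (ca 11 vs) ?s (pa S) (?s(11 := replicate (of_bool (a (?s 0) (length (?s (vs 1))) (length (?s (vs 0))))) True))"
        by (rule computesD(1)[OF ca _ _ _ _ _ _ refl refl])
           (use * i in \<open>auto simp: F_def vs_def clean_def size_le_def m_def\<close>)
      have b2: "exec (Branch 11 (Push 4 False) (Push 4 False) (Seq (Pop 11) (Push 4 True)))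
          (?s(11 := replicate (of_bool (A i)) True)) 4 ((F i)(10 := replicate i True))"
        by (rule exec_cong[OF exec_test[where P = "A i"]])
           (use * i in \<open>auto simp: F_def clean_def fun_eq_iff upt_conv_Cons\<close>)
      show "exec ?b ?s (?T S) ((F i)(10 := replicate i True))"
        by (rule exec_Seq[OF b1[unfolded s, folded A_def] b2])
    qed
    have 2: "(F m)(10 := replicate m True) = s(10 := replicate m True)" by (auto simp: F_def)
    have 3: "m * (?T S + 3) + 1 \<le> S * (?T S + 3) + 1" using *(4) by (simp add: m_def)
    show "exec (For 10 ?b) (s(10 := replicate (f (s 0) (length (s 7))) True)) (S * (?T S + 3) + 1)
      (s(4 := map (a (s 0) (length (s 7))) [0..<f (s 0) (length (s 7))] @ s 4))"
      unfolding m_def[symmetric] A_def[symmetric]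
      by (rule exec_cong[OF 1[unfolded 2] 3])
         (use *(2) in \<open>auto simp: F_def clean_def fun_eq_iff\<close>)
  qed
qed

lemma subroutine_shift:
  assumes f: "comp (\<lambda>u \<rho>. f u (\<rho> 0))" and r: "r < 10" "r' < 10" "r \<noteq> r'"
  obtains c where "subroutine c clean (\<lambda>s. s(r := drop (f (s 0) (length (s 7))) (s r),
    r' := rev (take (f (s 0) (length (s 7))) (s r)) @ s r'))"
proof (rule subroutine_assign[OF f _ _ _ that])
  show "pbound (\<lambda>S. S * 7 + 1)" by (intro pbound_intros)
  show "clean s" if "clean s" for s using that .
  fix s S assume *: "2 \<le> S" "clean s" "size_le S s" "f (s 0) (length (s 7)) \<le> S"
  show "exec (For 10 (Shift r r')) (s(10 := replicate (f (s 0) (length (s 7))) True)) (S * 7 + 1)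
      (s(r := drop (f (s 0) (length (s 7))) (s r), r' := rev (take (f (s 0) (length (s 7))) (s r)) @ s r'))"
    by (rule exec_cong[OF exec_For_Shift[where m = "f (s 0) (length (s 7))"]])
       (use * r in \<open>auto simp: clean_def fun_eq_iff\<close>)
qed

lemma subroutine_shift_pad:
  assumes f: "comp (\<lambda>u \<rho>. f u (\<rho> 0))" and r: "r < 10" "r' < 10" "r \<noteq> r'"
  obtains c where "subroutine c clean (\<lambda>s. s(r := drop (f (s 0) (length (s 7))) (s r),
    r' := rev (take (f (s 0) (length (s 7))) (s r @ replicate (f (s 0) (length (s 7))) False)) @ s r'))"
proof (rule subroutine_assign[OF f _ _ _ that])
  show "pbound (\<lambda>S. S * 7 + 1)" by (intro pbound_intros)
  show "clean s" if "clean s" for s using that .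
  fix s S assume *: "2 \<le> S" "clean s" "size_le S s" "f (s 0) (length (s 7)) \<le> S"
  let ?m = "f (s 0) (length (s 7))"
  show "exec (For 10 (Branch r (Push r' False) (Seq (Pop r) (Push r' False)) (Seq (Pop r) (Push r' True))))
      (s(10 := replicate ?m True)) (S * 7 + 1)
      (s(r := drop ?m (s r), r' := rev (take ?m (s r @ replicate ?m False)) @ s r'))"
    by (rule exec_cong[OF exec_For_Shift_pad[where m = ?m]])
       (use * r in \<open>auto simp: clean_def fun_eq_iff\<close>)
qed

section \<open>Error analysis of truncation and scaling\<close>

section \<open>Rounding\<close>

lemma frac_val_simps [simp]:
  "frac_val [] = 0" "frac_val (x # xs) = (of_bool x + frac_val xs) / 2"
  by (simp_all add: frac_val_def)

lemma frac_val_nonneg: "0 \<le> frac_val xs"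
  by (induction xs) auto

lemma frac_val_less_1: "frac_val xs < 1"
  by (induction xs) (auto simp: of_bool_def)

lemma frac_val_rev: "frac_val (rev xs) = real (bits_val xs) / 2 ^ length xs"
proof (induction xs rule: rev_induct)
  case (snoc x xs)
  then show ?case by (simp add: bits_val_append field_simps)
qed simp

lemma frac_val_leading: "frac_val (replicate l False @ xs) = frac_val xs / 2 ^ l"
  by (induction l) auto

text \<open>Keeping only \<open>K\<close> digits of a fraction of any length costs an absolute error
  below \<open>2 ^ -K\<close>.\<close>

lemma truncate_frac:
  assumes "K \<le> m"
  shows "real (bits_val (rev (take K (xs @ replicate m False)))) \<le> 2 ^ K * frac_val xs"
    and "2 ^ K * frac_val xs < real (bits_val (rev (take K (xs @ replicate m False)))) + 1"
proof -
  have "real (bits_val (rev (take K (xs @ replicate m False)))) \<le> 2 ^ K * frac_val xs \<and>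
    2 ^ K * frac_val xs < real (bits_val (rev (take K (xs @ replicate m False)))) + 1"
    using assms
  proof (induction K arbitrary: xs)
    case 0
    then show ?case by (simp add: frac_val_nonneg frac_val_less_1)
  next
    case (Suc K)
    show ?case
    proof (cases xs)
      case Nil
      have 1: "bits_val (replicate k False) = 0" for k by (induction k) auto
      have 2: "rev (take (Suc K) (xs @ replicate m False)) = replicate (Suc K) False"
        using Nil Suc.prems by (simp add: min_def del: replicate_Suc)
      show ?thesis unfolding 2 1 using Nil by simp
    next
      case (Cons x ys)
      have "length (take K (ys @ replicate m False)) = K" using Suc.prems by simp
      then show ?thesis using Suc.IH[of ys] Suc.prems
        by (simp add: Cons bits_val_append field_simps del: take_append)
    qed
  qed
  then show "real (bits_val (rev (take K (xs @ replicate m False)))) \<le> 2 ^ K * frac_val xs"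
    and "2 ^ K * frac_val xs < real (bits_val (rev (take K (xs @ replicate m False)))) + 1"
    by auto
qed

lemma bits_val_strip: "bits_val (rev (dropWhile Not xs)) = bits_val (rev xs)"
  by (induction xs) (auto simp: bits_val_append)

lemma bits_val_leading: "bits_val (xs @ replicate k False) = bits_val xs"
proof -
  have "bits_val (replicate k False) = 0" by (induction k) auto
  then show ?thesis by (simp add: bits_val_append)
qed

text \<open>Here the exclusion of leading zeros pays off: a bound on the value of an answer bounds
  the length of its integer part, so that reading \<open>L\<close> digits loses none of it.\<close>

lemma length_le_bits_val:
  assumes "xs \<noteq> [] \<Longrightarrow> hd xs" "bits_val (rev xs) < 2 ^ L"
  shows "length xs \<le> L"
proof (cases xs)
  case (Cons x ys)
  then have "2 ^ length ys \<le> bits_val (rev xs)" using assms(1) by (simp add: bits_val_append)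
  then have "(2::nat) ^ length ys < 2 ^ L" using assms(2) by linarith
  then show ?thesis using Cons by (simp add: power_strict_increasing_iff Suc_le_eq)
qed simp

lemma exp_half_less_2: "x \<le> 1 \<Longrightarrow> exp (x / 2 :: real) < 2"
proof -
  assume "x \<le> 1"
  have "exp (x / 2) \<le> exp (1 / 2)" using \<open>x \<le> 1\<close> by simp
  also have "exp (1 / 2 :: real) < 2"
  proof -
    have "exp (1 / 2 :: real) ^ 2 = exp 1" by (simp add: power2_eq_square exp_add[symmetric])
    also have "\<dots> < 2 ^ 2" using e_less_272 by simp
    finally show ?thesis by (rule power_less_imp_less_base) simp
  qed
  finally show ?thesis .
qed

text \<open>Errors are measured in units of \<open>2 ^ -D\<close>. Cutting the oracle's answer to
  \<open>v\<close> and the final integer division each lose less than one unit, the former because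
  \<open>num \<le> den\<close>; \<open>\<eta>\<close> adds less than half a unit. Since
  \<open>\<epsilon>\<close> is at least \<open>2 ^ -(l + 1)\<close>, the constant 24 makes
  \<open>f * 2 ^ D * \<epsilon>\<close> at least 12. The spare half of \<open>\<epsilon>\<close>,
  reduced by the factor 1/3 that bounds \<open>exp (- \<epsilon>)\<close> from below, is then worth
  the 2 units that may be lost.\<close>

lemma scaling_accuracy:
  fixes f g \<eta> z \<epsilon> :: real and v num den D K l :: nat
  assumes eps: "0 < \<epsilon>" "\<epsilon> < 1" "1 \<le> \<epsilon> * 2 ^ (l + 1)"
    and z: "exp (- (\<epsilon> / 2)) * g \<le> z" "z \<le> exp (\<epsilon> / 2) * g"
    and v: "real v \<le> 2 ^ K * z" "2 ^ K * z < real v + 1"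
    and eq: "g * num * 2 ^ K = (f + \<eta>) * 2 ^ D * den" and eta: "0 \<le> \<eta>" "\<eta> * 2 ^ (D + 1) < 1"
    and f: "0 \<le> f" "f = 0 \<or> 24 * 2 ^ l \<le> f * 2 ^ D"
    and num: "num \<le> den" "0 < den"
  shows "exp (- \<epsilon>) * f \<le> real (v * num div den) / 2 ^ D"
    and "real (v * num div den) / 2 ^ D \<le> exp \<epsilon> * f"
proof -
  define \<rho> where "\<rho> = real num / real den"
  have \<rho>: "0 \<le> \<rho>" "\<rho> \<le> 1" using num by (auto simp: \<rho>_def)
  have g: "g * 2 ^ K * \<rho> = (f + \<eta>) * 2 ^ D" using eq num(2) by (simp add: \<rho>_def field_simps)
  define y where "y = v * num div den"
  have y: "real y \<le> v * \<rho>" "v * \<rho> < real y + 1"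
  proof -
    have "real y * den \<le> real (v * num)" unfolding y_def of_nat_mult[symmetric]
      by (simp only: of_nat_le_iff div_times_less_eq_dividend)
    then show "real y \<le> v * \<rho>" using num(2) by (simp add: \<rho>_def field_simps)
    have "v * num < (y + 1) * den" unfolding y_def using num(2) by (simp add: dividend_less_div_times)
    then have "real (v * num) < real ((y + 1) * den)" by (simp only: of_nat_less_iff)
    then show "v * \<rho> < real y + 1" using num(2) by (simp add: \<rho>_def field_simps)
  qed
  have upper: "real y \<le> exp (\<epsilon> / 2) * ((f + \<eta>) * 2 ^ D)"
  proof -
    have "real y \<le> (2 ^ K * z) * \<rho>" using y(1) mult_right_mono[OF v(1) \<rho>(1)] by linarith
    also have "\<dots> \<le> (2 ^ K * (exp (\<epsilon> / 2) * g)) * \<rho>" using z(2) \<rho>(1) by (intro mult_right_mono mult_left_mono) auto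
    also have "\<dots> = exp (\<epsilon> / 2) * (g * 2 ^ K * \<rho>)" by simp
    finally show ?thesis unfolding g .
  qed
  have lower: "exp (- (\<epsilon> / 2)) * (f * 2 ^ D) - 2 < real y"
  proof -
    have "exp (- (\<epsilon> / 2)) * (f * 2 ^ D) \<le> exp (- (\<epsilon> / 2)) * ((f + \<eta>) * 2 ^ D)" using eta by simp
    also have "\<dots> = (2 ^ K * (exp (- (\<epsilon> / 2)) * g)) * \<rho>" unfolding g[symmetric] by simp
    also have "\<dots> \<le> (2 ^ K * z) * \<rho>" using z(1) \<rho>(1) by (intro mult_right_mono mult_left_mono) auto
    also have "\<dots> \<le> (real v + 1) * \<rho>" using v(2) \<rho>(1) by (intro mult_right_mono) auto
    also have "\<dots> < real y + 2" using y(2) \<rho>(2) by (simp add: distrib_right)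
    finally show ?thesis by simp
  qed
  have "exp (- \<epsilon>) * f \<le> real y / 2 ^ D \<and> real y / 2 ^ D \<le> exp \<epsilon> * f"
  proof (cases "f = 0")
    case True
    \<comment> \<open>For the true value 0 only \<open>\<eta>\<close> is left; the upper bound drops
      below 1, and \<open>y\<close> is a natural number.\<close>
    have "exp (\<epsilon> / 2) * (\<eta> * 2 ^ D) \<le> 2 * (\<eta> * 2 ^ D)"
      using exp_half_less_2[of \<epsilon>] eps eta by (intro mult_right_mono) auto
    also have "\<dots> < 1" using eta by simp
    finally have "y = 0" using upper True by simp
    then show ?thesis using True by simp
  next
    case False
    then have f': "24 * 2 ^ l \<le> f * 2 ^ D" "0 < f" using f by auto
    have e1: "12 \<le> (f * 2 ^ D) * \<epsilon>"
    proof -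
      have "12 \<le> (12 * \<epsilon>) * 2 ^ (l + 1)" using eps(3) by simp
      also have "\<dots> = (24 * 2 ^ l) * \<epsilon>" by simp
      also have "\<dots> \<le> (f * 2 ^ D) * \<epsilon>" using f' eps by (intro mult_right_mono) auto
      finally show ?thesis .
    qed
    have "exp (\<epsilon> / 2) * ((f + \<eta>) * 2 ^ D) \<le> exp \<epsilon> * f * 2 ^ D"
    proof -
      have "\<eta> * 2 ^ D < 1" using eta by simp
      moreover have "6 \<le> f * 2 ^ D * (\<epsilon> / 2)" using e1 by linarith
      ultimately have "\<eta> * 2 ^ D \<le> f * 2 ^ D * (\<epsilon> / 2)" by linarith
      then have "(f + \<eta>) * 2 ^ D \<le> (f * 2 ^ D) * (1 + \<epsilon> / 2)" by (simp add: algebra_simps)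
      also have "\<dots> \<le> (f * 2 ^ D) * exp (\<epsilon> / 2)" using f exp_ge_add_one_self[of "\<epsilon> / 2"]
        by (intro mult_left_mono) auto
      finally have "exp (\<epsilon> / 2) * ((f + \<eta>) * 2 ^ D) \<le> exp (\<epsilon> / 2) * ((f * 2 ^ D) * exp (\<epsilon> / 2))" by simp
      also have "\<dots> = (exp (\<epsilon> / 2) * exp (\<epsilon> / 2)) * f * 2 ^ D" by simp
      also have "exp (\<epsilon> / 2) * exp (\<epsilon> / 2) = exp \<epsilon>" by (simp add: exp_add[symmetric])
      finally show ?thesis .
    qed
    then have "real y \<le> exp \<epsilon> * f * 2 ^ D" using upper by linarith
    moreover have "exp (- \<epsilon>) * f * 2 ^ D \<le> real y"
    proof -
      have "exp \<epsilon> \<le> 3" using eps exp_le by (meson exp_le_cancel_iff less_imp_le order_trans)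
      then have e3: "1 / 3 \<le> exp (- \<epsilon>)" by (simp add: exp_minus field_simps)
      have "2 \<le> (f * 2 ^ D) * (1 / 3 * (\<epsilon> / 2))" using e1 by simp
      also have "\<dots> \<le> (f * 2 ^ D) * (exp (- \<epsilon>) * (exp (\<epsilon> / 2) - 1))"
      proof -
        have "\<epsilon> / 2 \<le> exp (\<epsilon> / 2) - 1" using exp_ge_add_one_self[of "\<epsilon> / 2"] by linarith
        then show ?thesis using f e3 eps by (intro mult_left_mono mult_mono) auto
      qed
      also have "exp (- \<epsilon>) * (exp (\<epsilon> / 2) - 1) = exp (- (\<epsilon> / 2)) - exp (- \<epsilon>)"
        by (simp add: algebra_simps exp_add[symmetric])
      finally have "exp (- \<epsilon>) * f * 2 ^ D \<le> exp (- (\<epsilon> / 2)) * (f * 2 ^ D) - 2" by (simp add: algebra_simps)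
      then show ?thesis using lower by linarith
    qed
    ultimately show ?thesis by (simp add: field_simps)
  qed
  then show "exp (- \<epsilon>) * f \<le> real (v * num div den) / 2 ^ D"
    and "real (v * num div den) / 2 ^ D \<le> exp \<epsilon> * f"
    unfolding y_def by auto
qed

section \<open>Reductions that make one query and scale its answer\<close>

section \<open>One-query reductions\<close>

abbreviation iterate :: "scheme \<Rightarrow> nat \<Rightarrow> config pmf \<Rightarrow> config pmf" where
  "iterate Or n p \<equiv> ((\<lambda>p. bind_pmf p (step Or)) ^^ n) p"

lemma iterate_Suc: "iterate Or (Suc n) (return_pmf x) = iterate Or n (step Or x)"
  by (simp add: funpow_Suc_right bind_return_pmf del: funpow.simps)

lemma iterate_bind: "iterate Or n (bind_pmf p F) = bind_pmf p (\<lambda>x. iterate Or n (F x))"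
  by (induction n) (auto simp: bind_assoc_pmf)

lemma iterate_halted: "iterate Or n (return_pmf ([], s)) = return_pmf ([], s)"
  by (induction n) (auto simp: bind_return_pmf)

lemma iterate_dstep: "(dstep ^^ t) x y \<Longrightarrow> iterate Or (t + n) (return_pmf x) = iterate Or n (return_pmf y)"
proof (induction t arbitrary: x)
  case (Suc t)
  then obtain w where w: "dstep x w" "(dstep ^^ t) w y" by (metis relpowp_Suc_D2)
  then show ?case using Suc.IH[OF w(2)] dstep_step[OF w(1), of Or]
    by (simp add: iterate_Suc del: funpow.simps)
qed simp

text \<open>Only a configuration about to run \<open>Query\<close> can violate legality, so a
  deterministic stretch in front adds nothing to check.\<close>

lemma iterate_legal:
  assumes "(dstep ^^ t) x y" "\<And>n cfg. cfg \<in> set_pmf (iterate Or n (return_pmf y)) \<Longrightarrow> legal_call Q B cfg"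
    and "cfg \<in> set_pmf (iterate Or n (return_pmf x))"
  shows "legal_call Q B cfg"
  using assms(1,3)
proof (induction t arbitrary: x n)
  case 0
  then show ?case using assms(2) by simp
next
  case (Suc t)
  then obtain w where w: "dstep x w" "(dstep ^^ t) w y" by (metis relpowp_Suc_D2)
  show ?case
  proof (cases n)
    case 0
    then show ?thesis using Suc.prems(2) dstep_legal[OF w(1)] by simp
  next
    case (Suc n')
    then show ?thesis using Suc.IH[OF w(2)] Suc.prems(2) dstep_step[OF w(1), of Or]
      by (simp add: iterate_Suc del: funpow.simps)
  qed
qed

lemma legal_call_halted: "legal_call Q B ([], s)"
  by (simp add: legal_call_def)

text \<open>The three extra steps are the two \<open>Seq\<close> and the query itself. A halted
  configuration is stationary, so every larger number of steps gives the same distribution.\<close>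

lemma one_query_run:
  assumes pre: "exec pre ((\<lambda>_. [])(0 := u, 1 := e)) T1 s"
    and post: "\<And>ip fp. exec post (s(5 := ip, 6 := fp)) T2 (s' ip fp)"
    and legal: "s 4 \<in> encode Q ` instances Q" "error_param (s 1)" "1 / frac_val (s 1) \<le> B"
  shows "T1 + T2 + 3 \<le> n \<Longrightarrow> run Or (Seq pre (Seq (Query 4 1 5 6) post)) u e n =
      map_pmf (\<lambda>z. ([], s' (fst z) (snd z))) (Or (s 4) (s 1))"
    and "cfg \<in> set_pmf (run Or (Seq pre (Seq (Query 4 1 5 6) post)) u e m) \<Longrightarrow> legal_call Q B cfg"
proof -
  let ?M = "Seq pre (Seq (Query 4 1 5 6) post)" and ?s0 = "(\<lambda>_. [])(0 := u, 1 := e)"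
  obtain t1 where t1: "t1 \<le> T1" "runs pre ?s0 t1 s" using pre unfolding exec_def by blast
  let ?y = "([Query 4 1 5 6, post], s)" and ?F = "\<lambda>z. ([post], s(5 := fst z, 6 := snd z))"
  have 1: "(dstep ^^ (Suc (t1 + 1))) ([?M], ?s0) ?y"
    by (rule relpowp_step, rule dstep.intros(4), rule relpowp_add)
       (use t1(2) in \<open>auto simp: runs_def intro: dstep.intros(4)\<close>)
  have 2: "iterate Or (Suc j) (return_pmf ?y) = bind_pmf (Or (s 4) (s 1)) (\<lambda>z. iterate Or j (return_pmf (?F z)))" for j
    unfolding iterate_Suc by (simp add: map_pmf_def iterate_bind case_prod_beta)
  have 3: "\<exists>t\<le>T2. (dstep ^^ t) (?F z) ([], s' (fst z) (snd z))" for z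
    using post[of "fst z" "snd z"] unfolding exec_def runs_def by blast
  have 4: "iterate Or j (return_pmf (?F z)) = return_pmf ([], s' (fst z) (snd z))" if "T2 \<le> j" for j z
  proof -
    obtain t where t: "t \<le> T2" "(dstep ^^ t) (?F z) ([], s' (fst z) (snd z))" using 3 by blast
    have "iterate Or (t + (j - t)) (return_pmf (?F z)) = return_pmf ([], s' (fst z) (snd z))"
      unfolding iterate_dstep[OF t(2)] by (rule iterate_halted)
    then show ?thesis using that t(1) by simp
  qed
  have run: "run Or ?M u e m = iterate Or m (return_pmf ([?M], ?s0))" for m
    by (simp add: run_def initial_def)
  show "run Or ?M u e n = map_pmf (\<lambda>z. ([], s' (fst z) (snd z))) (Or (s 4) (s 1))" if "T1 + T2 + 3 \<le> n"
  proof -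
    define j where "j = n - (t1 + 3)"
    have n: "n = Suc (t1 + 1) + Suc j" and j: "T2 \<le> j" using that t1(1) by (auto simp: j_def)
    show ?thesis unfolding run n iterate_dstep[OF 1] 2 4[OF j] by (simp add: map_pmf_def)
  qed
  show "legal_call Q B cfg" if "cfg \<in> set_pmf (run Or ?M u e m)"
    using 1 _ that[unfolded run]
  proof (rule iterate_legal)
    fix n cfg assume *: "cfg \<in> set_pmf (iterate Or n (return_pmf ?y))"
    show "legal_call Q B cfg"
    proof (cases n)
      case 0
      then show ?thesis using * legal by (auto simp: legal_call_def)
    next
      case (Suc j)
      then obtain z where z: "cfg \<in> set_pmf (iterate Or j (return_pmf (?F z)))"
        using * unfolding Suc 2 by auto
      obtain t where t: "(dstep ^^ t) (?F z) ([], s' (fst z) (snd z))" using 3 by blast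
      show ?thesis using t _ z
        by (rule iterate_legal) (auto simp: iterate_halted legal_call_halted simp del: funpow.simps)
    qed
  qed
qed

text \<open>The query is pushed from its end: matrix, separator, size. On stack 1 the
  \<open>l\<close> zeros stripped before are put back together with one more, which halves the error
  parameter without its remaining digits being read.\<close>

lemma subroutine_query:
  assumes N: "comp (\<lambda>u \<rho>. N u (\<rho> 0))" and adj: "comp (\<lambda>u \<rho>. of_bool (adj u (\<rho> 1) (\<rho> 0)))"
  obtains c where "subroutine c clean (\<lambda>s. s(1 := replicate (length (s 7) + 1) False @ s 1,
    4 := replicate (N (s 0) (length (s 7))) True @ False #
      map (adj (s 0) (length (s 7))) [0..<N (s 0) (length (s 7)) * N (s 0) (length (s 7))] @ s 4))"
proof -
  have f1: "comp (\<lambda>u \<rho>. \<rho> 0 + 1)" by (intro comp_intros)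
  obtain c1 where c1: "subroutine c1 clean (\<lambda>s. s(1 := replicate (length (s 7) + 1) False @ s 1))"
    by (rule subroutine_pushes[OF f1, of 1 False]) auto
  have f2: "comp (\<lambda>u \<rho>. N u (\<rho> 0) * N u (\<rho> 0))" by (intro comp_mult N)
  obtain c2 where c2: "subroutine c2 clean (\<lambda>s. s(4 := map (adj (s 0) (length (s 7)))
      [0..<N (s 0) (length (s 7)) * N (s 0) (length (s 7))] @ s 4))"
    by (rule subroutine_emit[OF f2 adj])
  have c3: "subroutine (Push 4 False) clean (\<lambda>s. s(4 := False # s 4))"
    by (rule subroutineI[OF pbound_const[of 1]]) (rule exec_Push)
  obtain c4 where c4: "subroutine c4 clean (\<lambda>s. s(4 := replicate (N (s 0) (length (s 7))) True @ s 4))"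
    by (rule subroutine_pushes[OF N, of 4 True]) auto
  have "subroutine (Seq c1 (Seq c2 (Seq (Push 4 False) c4))) clean
    (\<lambda>s. s(1 := replicate (length (s 7) + 1) False @ s 1,
    4 := replicate (N (s 0) (length (s 7))) True @ False #
      map (adj (s 0) (length (s 7))) [0..<N (s 0) (length (s 7)) * N (s 0) (length (s 7))] @ s 4))"
    by (rule subroutine_cong[OF subroutine_Seq[OF c1 subroutine_Seq[OF c2 subroutine_Seq[OF c3 c4]]]])
       (auto simp: clean_def fun_eq_iff)
  then show thesis by (rule that)
qed

text \<open>Only \<open>L\<close> digits before and \<open>K\<close> digits after the binary point of the oracle's answer are
  kept, least significant digit first, as they can be scaled in polynomial time.\<close>

definition scaled_digits ::
    "factor list \<Rightarrow> factor list \<Rightarrow> bool list \<Rightarrow> nat \<Rightarrow> nat \<Rightarrow> nat \<Rightarrow> numeral_rep \<Rightarrow> bool list" where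
  "scaled_digits ms ds u l L K z = scale_all ms ds u l
     (rev (take K (snd z @ replicate K False)) @ rev (take L (fst z)) @ replicate K False)"

definition scaled_numeral :: "nat \<Rightarrow> bool list \<Rightarrow> numeral_rep" where
  "scaled_numeral D w = (dropWhile Not (rev (drop D w)), rev (take D w))"

text \<open>Only the output stacks of the final store matter, so \<open>F\<close> is specified on
  these alone. Stack 9 receives \<open>K\<close> zeros, the integer digits and the fraction digits
  in this order, which puts the least significant digit on top and the zeros at the significant end
  as room for the multiplications.\<close>

lemma subroutine_answer:
  assumes L: "comp (\<lambda>u \<rho>. L u (\<rho> 0))" and K: "comp (\<lambda>u \<rho>. K u (\<rho> 0))" and D: "comp (\<lambda>u \<rho>. D u (\<rho> 0))"
    and fs: "\<And>a f. (a, f) \<in> set ms \<union> set ds \<Longrightarrow> 0 < a \<and> comp (\<lambda>u \<rho>. f u (\<rho> 0))"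
  shows "\<exists>c F. subroutine c (\<lambda>s. clean s \<and> (\<forall>r\<in>{2, 3, 8, 9}. s r = [])) F \<and>
    (\<forall>s. clean s \<longrightarrow> (\<forall>r\<in>{2, 3, 8, 9}. s r = []) \<longrightarrow>
      (F s 2, F s 3) = scaled_numeral (D (s 0) (length (s 7)))
        (scaled_digits ms ds (s 0) (length (s 7)) (L (s 0) (length (s 7))) (K (s 0) (length (s 7))) (s 5, s 6)))"
proof -
  obtain c1 where c1: "subroutine c1 clean (\<lambda>s. s(9 := replicate (K (s 0) (length (s 7))) False @ s 9))"
    by (rule subroutine_pushes[OF K, of 9 False]) auto
  obtain c2 where c2: "subroutine c2 clean (\<lambda>s. s(5 := drop (L (s 0) (length (s 7))) (s 5),
      9 := rev (take (L (s 0) (length (s 7))) (s 5)) @ s 9))"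
    by (rule subroutine_shift[OF L, of 5 9]) auto
  obtain c3 where c3: "subroutine c3 clean (\<lambda>s. s(6 := drop (K (s 0) (length (s 7))) (s 6),
      9 := rev (take (K (s 0) (length (s 7))) (s 6 @ replicate (K (s 0) (length (s 7))) False)) @ s 9))"
    by (rule subroutine_shift_pad[OF K, of 6 9]) auto
  obtain c4 where c4: "subroutine c4 (\<lambda>s. s 8 = [] \<and> clean s)
      (\<lambda>s. s(9 := scale_all ms ds (s 0) (length (s 7)) (s 9)))"
    by (rule subroutine_scale_all[OF fs])
  obtain c5 where c5: "subroutine c5 clean (\<lambda>s. s(9 := drop (D (s 0) (length (s 7))) (s 9),
      3 := rev (take (D (s 0) (length (s 7))) (s 9)) @ s 3))"
    by (rule subroutine_shift[OF D, of 9 3]) auto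
  have c6: "subroutine (Move 9 2) clean (\<lambda>s. s(9 := [], 2 := rev (s 9) @ s 2))"
  proof (rule subroutineI)
    show "pbound (\<lambda>S. 5 * S + 1)" by (intro pbound_intros)
    fix s S assume "size_le S s"
    then show "exec (Move 9 2) s (5 * S + 1) (s(9 := [], 2 := rev (s 9) @ s 2))"
      by (intro exec_cong[OF exec_Move[OF _ refl]]) (auto simp: size_le_def)
  qed
  let ?strip = "Seq (Push 10 True) (While 10 (Branch 2 (Pop 10) (Seq (Pop 2) (Push 8 True)) (Pop 10)))"
  have c7: "subroutine ?strip clean (\<lambda>s. s(2 := dropWhile Not (s 2),
      8 := replicate (length (takeWhile Not (s 2))) True @ s 8))"
  proof (rule subroutineI)
    show "pbound (\<lambda>S. 5 * S + 6)" by (intro pbound_intros)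
    fix s S assume *: "clean s" "size_le S s"
    have "length (takeWhile Not (s 2)) \<le> S"
      using *(2) length_takeWhile_le[of Not "s 2"] by (auto simp: size_le_def intro: order_trans)
    then show "exec ?strip s (5 * S + 6) (s(2 := dropWhile Not (s 2),
        8 := replicate (length (takeWhile Not (s 2))) True @ s 8))"
      by (intro exec_cong[OF exec_strip]) (use *(1) in \<open>auto simp: clean_def\<close>)
  qed
  let ?P = "\<lambda>s. s 8 = [] \<and> clean s"
  have w: "subroutine c ?P F" if "subroutine c clean F" for c F
    by (rule subroutine_cong[OF that]) auto
  have c67: "subroutine (Seq (Move 9 2) ?strip) clean
      (\<lambda>s. s(9 := [], 2 := dropWhile Not (rev (s 9) @ s 2),
         8 := replicate (length (takeWhile Not (rev (s 9) @ s 2))) True @ s 8))"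
    by (rule subroutine_cong[OF subroutine_Seq[OF c6 c7]]) (simp_all add: clean_def fun_eq_iff)
  have c57: "subroutine (Seq c5 (Seq (Move 9 2) ?strip)) clean
      (\<lambda>s. let w = rev (drop (D (s 0) (length (s 7))) (s 9)) @ s 2 in s(9 := [],
         3 := rev (take (D (s 0) (length (s 7))) (s 9)) @ s 3, 2 := dropWhile Not w,
         8 := replicate (length (takeWhile Not w)) True @ s 8))"
    by (rule subroutine_cong[OF subroutine_Seq[OF c5 c67]]) (simp_all add: clean_def fun_eq_iff Let_def)
  have c47: "subroutine (Seq c4 (Seq c5 (Seq (Move 9 2) ?strip))) ?P
      (\<lambda>s. let x = scale_all ms ds (s 0) (length (s 7)) (s 9);
         w = rev (drop (D (s 0) (length (s 7))) x) @ s 2 in s(9 := [],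
         3 := rev (take (D (s 0) (length (s 7))) x) @ s 3, 2 := dropWhile Not w,
         8 := replicate (length (takeWhile Not w)) True @ s 8))"
    by (rule subroutine_cong[OF subroutine_Seq[OF c4 c57]]) (simp_all add: clean_def fun_eq_iff Let_def)
  define G where "G = (\<lambda>s :: store. let x = scale_all ms ds (s 0) (length (s 7)) (s 9);
         w = rev (drop (D (s 0) (length (s 7))) x) @ s 2 in s(9 := [],
         3 := rev (take (D (s 0) (length (s 7))) x) @ s 3, 2 := dropWhile Not w,
         8 := replicate (length (takeWhile Not w)) True @ s 8))"
  have c23: "subroutine (Seq c2 c3) ?P (\<lambda>s. s(5 := drop (L (s 0) (length (s 7))) (s 5),
      6 := drop (K (s 0) (length (s 7))) (s 6),
      9 := rev (take (K (s 0) (length (s 7))) (s 6 @ replicate (K (s 0) (length (s 7))) False)) @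
        rev (take (L (s 0) (length (s 7))) (s 5)) @ s 9))"
    by (rule subroutine_cong[OF subroutine_Seq[OF w[OF c2] w[OF c3]]]) (simp_all add: clean_def fun_eq_iff)
  have c13: "subroutine (Seq c1 (Seq c2 c3)) ?P (\<lambda>s. s(5 := drop (L (s 0) (length (s 7))) (s 5),
      6 := drop (K (s 0) (length (s 7))) (s 6),
      9 := rev (take (K (s 0) (length (s 7))) (s 6 @ replicate (K (s 0) (length (s 7))) False)) @
        rev (take (L (s 0) (length (s 7))) (s 5)) @ replicate (K (s 0) (length (s 7))) False @ s 9))"
    by (rule subroutine_cong[OF subroutine_Seq[OF w[OF c1] c23]]) (simp_all add: clean_def fun_eq_iff)
  show ?thesis
  proof (intro exI conjI allI impI)
    show "subroutine (Seq (Seq c1 (Seq c2 c3)) (Seq c4 (Seq c5 (Seq (Move 9 2) ?strip))))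
      (\<lambda>s. clean s \<and> (\<forall>r\<in>{2, 3, 8, 9}. s r = [])) (\<lambda>s. G (s(5 := drop (L (s 0) (length (s 7))) (s 5),
      6 := drop (K (s 0) (length (s 7))) (s 6),
      9 := rev (take (K (s 0) (length (s 7))) (s 6 @ replicate (K (s 0) (length (s 7))) False)) @
        rev (take (L (s 0) (length (s 7))) (s 5)) @ replicate (K (s 0) (length (s 7))) False @ s 9)))"
      by (rule subroutine_cong[OF subroutine_Seq[OF c13 c47[folded G_def]]]) (simp_all add: clean_def)
  qed (simp add: G_def Let_def scaled_digits_def scaled_numeral_def)
qed

text \<open>The oracle's answer is at most \<open>exp (\<epsilon> / 2) * g\<close>, which is at most
  \<open>2 * 2 ^ B\<close>, so its integer part fits into \<open>L = B + 2\<close> digits. The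
  multiplier is at most \<open>2 ^ K\<close>, so \<open>K\<close> zeros of padding exclude overflow.
  An answer violating its error bounds may lose digits, but nothing is claimed for it.\<close>

lemma scaled_numeral_correct:
  fixes g f \<eta> \<epsilon> :: real
  assumes z: "valid_numeral z" "exp (- (\<epsilon> / 2)) * g \<le> numeral_val z" "numeral_val z \<le> exp (\<epsilon> / 2) * g"
    and eps: "0 < \<epsilon>" "\<epsilon> < 1" "1 \<le> \<epsilon> * 2 ^ (l + 1)"
    and g: "0 \<le> g" "g \<le> 2 ^ B" and L: "L = B + 2"
    and fs: "\<forall>a f. (a, f) \<in> set ms \<union> set ds \<longrightarrow> 0 < a"
    and num: "num = factor_prod ms u l" "den = factor_prod ds u l" "num \<le> den" "num \<le> 2 ^ K"
    and eq: "g * num * 2 ^ K = (f + \<eta>) * 2 ^ D * den" and eta: "0 \<le> \<eta>" "\<eta> * 2 ^ (D + 1) < 1"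
    and f: "0 \<le> f" "f = 0 \<or> 24 * 2 ^ l \<le> f * 2 ^ D" and DK: "D \<le> K"
  defines "w \<equiv> scaled_numeral D (scaled_digits ms ds u l L K z)"
  shows "valid_numeral w" "exp (- \<epsilon>) * f \<le> numeral_val w" "numeral_val w \<le> exp \<epsilon> * f"
proof -
  define ip where "ip = fst z"
  define fp where "fp = snd z"
  define xs where "xs = rev (take K (fp @ replicate K False)) @ rev (take L ip) @ replicate K False"
  define ys where "ys = scale_all ms ds u l xs"
  have w: "w = (dropWhile Not (rev (drop D ys)), rev (take D ys))"
    by (simp add: w_def scaled_numeral_def scaled_digits_def ys_def xs_def ip_def fp_def)
  have nv: "numeral_val z = real (bits_val (rev ip)) + frac_val fp"
  proof -
    have "horner_sum of_bool 2 xs = real (bits_val xs)" for xs by (induction xs) auto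
    then show ?thesis by (simp add: numeral_val_def ip_def fp_def)
  qed
  have ip: "length ip \<le> L"
  proof (rule length_le_bits_val)
    show "hd ip" if "ip \<noteq> []" using z(1) that by (simp add: valid_numeral_def ip_def)
    have "real (bits_val (rev ip)) \<le> numeral_val z" using frac_val_nonneg[of fp] by (simp add: nv)
    also have "\<dots> \<le> exp (\<epsilon> / 2) * g" by (rule z)
    also have "\<dots> \<le> 2 * 2 ^ B" using g exp_half_less_2[of \<epsilon>] eps by (intro mult_mono) auto
    also have "\<dots> < 2 ^ L" by (simp add: L)
    finally show "bits_val (rev ip) < 2 ^ L" by (metis of_nat_less_iff of_nat_numeral of_nat_power)
  qed
  have len: "length (take K (fp @ replicate K False)) = K" by simp
  have lx: "length xs = K + length ip + K" using ip by (simp add: xs_def)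
  have v: "bits_val xs = bits_val (rev (take K (fp @ replicate K False))) + 2 ^ K * bits_val (rev ip)"
  proof -
    have "xs = (rev (take K (fp @ replicate K False)) @ rev ip) @ replicate K False"
      unfolding xs_def using ip by simp
    then have "bits_val xs = bits_val (rev (take K (fp @ replicate K False)) @ rev ip)"
      by (simp only: bits_val_leading)
    then show ?thesis using len by (simp add: bits_val_append del: take_append)
  qed
  have v1: "real (bits_val xs) \<le> 2 ^ K * numeral_val z" "2 ^ K * numeral_val z < real (bits_val xs) + 1"
    using truncate_frac[of K K fp] unfolding v nv by (simp_all add: algebra_simps del: take_append)
  have "bits_val xs < 2 ^ (K + length ip)"
  proof -
    have "bits_val xs = bits_val (rev (take K (fp @ replicate K False)) @ rev ip)"
      unfolding v using len by (simp add: bits_val_append del: take_append)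
    also have "\<dots> < 2 ^ length (rev (take K (fp @ replicate K False)) @ rev ip)" by (rule bits_val_less)
    also have "length (rev (take K (fp @ replicate K False)) @ rev ip) = K + length ip" by simp
    finally show ?thesis .
  qed
  moreover have "0 < num" unfolding num(1) by (rule factor_prod_pos) (use fs in auto)
  ultimately have "bits_val xs * num < 2 ^ (K + length ip) * 2 ^ K"
    using num(4) by (intro mult_less_le_imp_less) auto
  then have "bits_val xs * factor_prod ms u l < 2 ^ length xs" unfolding lx by (simp add: num(1) power_add)
  then have ys: "bits_val ys = bits_val xs * num div den"
    unfolding ys_def num(1,2) using fs by (intro bits_val_scale_all) auto
  have "length ys = length xs" by (simp add: ys_def)
  then have D: "length (take D ys) = D" using DK by (simp add: lx)
  have "bits_val ys = bits_val (take D ys @ drop D ys)" by simp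
  then have ys2: "bits_val ys = bits_val (take D ys) + 2 ^ D * bits_val (drop D ys)"
    unfolding bits_val_append D .
  have nw: "numeral_val w = real (bits_val ys) / 2 ^ D"
  proof -
    have "horner_sum of_bool 2 xs = real (bits_val xs)" for xs by (induction xs) auto
    then show ?thesis unfolding numeral_val_def w fst_conv snd_conv bits_val_strip frac_val_rev ys2 D
      by (simp add: bits_val_strip field_simps)
  qed
  show "valid_numeral w" unfolding valid_numeral_def w fst_conv
    using hd_dropWhile[of Not "rev (drop D ys)"] by simp
  have den: "0 < den" unfolding num(2) by (rule factor_prod_pos) (use fs in auto)
  show "exp (- \<epsilon>) * f \<le> numeral_val w" "numeral_val w \<le> exp \<epsilon> * f"
    unfolding nw ys by (rule scaling_accuracy[OF eps z(2,3) v1 eq eta f num(3) den])+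
qed

text \<open>The answer of the oracle is multiplied by the rational \<open>ms / ds\<close> times a power of two and
  truncated to \<open>D\<close> binary places.  An error parameter with \<open>l\<close> leading zeros is at least
  \<open>1 / 2 ^ (l + 1)\<close>; half of it is passed to the oracle.  If the exact answer is nonzero, the other half
  pays for the truncation and for \<open>\<eta>\<close>.  If it is zero, then \<open>\<eta>\<close> is too small to survive the truncation.\<close>

theorem AP_reducible_by_scaling:
  fixes P Q :: "input_graph problem" and N D K :: "bool list \<Rightarrow> nat \<Rightarrow> nat"
  assumes enc: "encode P = encode_graph" "encode Q = encode_graph"
    and N: "comp (\<lambda>u \<rho>. N u (\<rho> 0))" and K: "comp (\<lambda>u \<rho>. K u (\<rho> 0))" and D: "comp (\<lambda>u \<rho>. D u (\<rho> 0))"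
    and adj: "comp (\<lambda>u \<rho>. of_bool (adj u (\<rho> 1) (\<rho> 0)))"
    and fs: "\<And>a f. (a, f) \<in> set ms \<union> set ds \<Longrightarrow> 0 < a \<and> comp (\<lambda>u \<rho>. f u (\<rho> 0))"
    and correct: "\<And>x u l. x \<in> instances P \<Longrightarrow> u = encode_graph x \<Longrightarrow>
      \<exists>E \<eta>. (N u l, E) \<in> instances Q \<and> (\<forall>i<N u l * N u l. adj u l i \<longleftrightarrow> {i div N u l, i mod N u l} \<in> E) \<and>
        0 \<le> answer Q (N u l, E) \<and> answer Q (N u l, E) \<le> 2 ^ (N u l * N u l) \<and>
        answer Q (N u l, E) * factor_prod ms u l * 2 ^ K u l =
          (answer P x + \<eta>) * 2 ^ D u l * factor_prod ds u l \<and>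
        0 \<le> \<eta> \<and> \<eta> * 2 ^ (D u l + 1) < 1 \<and>
        0 \<le> answer P x \<and> (answer P x = 0 \<or> 24 * 2 ^ l \<le> answer P x * 2 ^ D u l) \<and>
        factor_prod ms u l \<le> factor_prod ds u l \<and> factor_prod ms u l \<le> 2 ^ K u l \<and> D u l \<le> K u l"
  shows "P \<le>\<^sub>A\<^sub>P Q"
proof -
  define L where "L = (\<lambda>u l. N u l * N u l + 2)"
  have L': "comp (\<lambda>u \<rho>. L u (\<rho> 0))" unfolding L_def by (intro comp_add comp_mult comp_const N)
  obtain cq where cq: "subroutine cq clean (\<lambda>s. s(1 := replicate (length (s 7) + 1) False @ s 1,
    4 := replicate (N (s 0) (length (s 7))) True @ False #
      map (adj (s 0) (length (s 7))) [0..<N (s 0) (length (s 7)) * N (s 0) (length (s 7))] @ s 4))"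
    by (rule subroutine_query[OF N adj])
  obtain ca F where ca: "subroutine ca (\<lambda>s. clean s \<and> (\<forall>r\<in>{2, 3, 8, 9}. s r = [])) F" and F:
    "\<And>s. clean s \<Longrightarrow> \<forall>r\<in>{2, 3, 8, 9}. s r = [] \<Longrightarrow>
      (F s 2, F s 3) = scaled_numeral (D (s 0) (length (s 7)))
        (scaled_digits ms ds (s 0) (length (s 7)) (L (s 0) (length (s 7))) (K (s 0) (length (s 7))) (s 5, s 6))"
    using subroutine_answer[OF L' K D fs] by blast
  obtain pq where pq: "pbound pq" "\<And>s S. \<lbrakk>2 \<le> S; clean s; size_le S s\<rbrakk> \<Longrightarrow> exec cq s (pq S)
    (s(1 := replicate (length (s 7) + 1) False @ s 1,
    4 := replicate (N (s 0) (length (s 7))) True @ False #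
      map (adj (s 0) (length (s 7))) [0..<N (s 0) (length (s 7)) * N (s 0) (length (s 7))] @ s 4))"
    using cq unfolding subroutine_def by blast
  obtain pa where pa: "pbound pa" "\<And>s S. \<lbrakk>2 \<le> S; clean s \<and> (\<forall>r\<in>{2, 3, 8, 9}. s r = []); size_le S s\<rbrakk> \<Longrightarrow>
    exec ca s (pa S) (F s)"
    using ca unfolding subroutine_def by blast
  let ?strip = "Seq (Push 10 True) (While 10 (Branch 1 (Pop 10) (Seq (Pop 1) (Push 7 True)) (Pop 10)))"
  let ?pre = "Seq ?strip cq"
  let ?M = "Seq ?pre (Seq (Query 4 1 5 6) ca)"
  let ?T1 = "\<lambda>S. Suc ((5 * S + 6) + pq S)"
  let ?T = "\<lambda>S. ?T1 S + pa (S + ?T1 S) + 3"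
  have "pbound ?T1" by (intro pbound_intros pq(1))
  then have "pbound ?T" by (intro pbound_intros pq(1) pbound_comp[OF pa(1)])
  then obtain k where k: "\<And>S. 2 \<le> S \<Longrightarrow> ?T S \<le> S ^ k" unfolding pbound_def by blast
  define l where "l = (\<lambda>e. length (takeWhile Not e))"
  define S where "S = (\<lambda>(u :: bool list) e. length u + l e + 2)"
  \<comment> \<open>With \<open>X\<close> for the sum of \<open>length u\<close> and
    \<open>1 / \<epsilon>\<close>, the initial stack size is \<open>length u + l + 2\<close>, at
    most \<open>3 * X\<close> because \<open>l \<le> 1 / \<epsilon>\<close> and
    \<open>1 < 1 / \<epsilon>\<close>. The exponent \<open>Suc k\<close> instead of \<open>k\<close>
    leaves room for \<open>1 / frac_val (\<delta> e) = 2 / \<epsilon>\<close> even if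
    \<open>k = 0\<close>.\<close>
  define B where "B = poly_bound (3 ^ Suc k) (Suc k)"
  define \<delta> where "\<delta> = (\<lambda>e. False # e)"
  \<comment> \<open>Behind its \<open>l\<close> leading zeros \<open>e\<close> has a one, so
    \<open>\<epsilon>\<close> lies between \<open>2 ^ -(l + 1)\<close> and \<open>2 ^ -l\<close>. In
    particular \<open>l \<le> 2 ^ l \<le> 1 / \<epsilon>\<close>, so \<open>l\<close> may be stored
    in unary.\<close>
  have eps: "0 < frac_val e" "frac_val e < 1" "1 \<le> frac_val e * 2 ^ (l e + 1)" "real (l e) \<le> 1 / frac_val e"
    "replicate (l e) False @ dropWhile Not e = e" if "error_param e" for e
  proof -
    show 1: "0 < frac_val e" "frac_val e < 1" using that by (auto simp: error_param_def)
    have "takeWhile Not e = replicate (l e) False"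
      unfolding l_def by (induction e) auto
    then show split: "replicate (l e) False @ dropWhile Not e = e"
      using takeWhile_dropWhile_id[of Not e] by simp
    have fe: "frac_val e = frac_val (dropWhile Not e) / 2 ^ l e"
      by (rule frac_val_leading[of "l e" "dropWhile Not e", unfolded split])
    have "dropWhile Not e \<noteq> []"
    proof
      assume d: "dropWhile Not e = []"
      have "frac_val e = frac_val [] / 2 ^ l e" using fe unfolding d .
      then show False using 1(1) by simp
    qed
    then obtain ys where ys: "dropWhile Not e = True # ys"
      using hd_dropWhile[of Not e] by (cases "dropWhile Not e") auto
    have f: "frac_val e * 2 ^ l e = (1 + frac_val ys) / 2" using fe by (simp add: ys)
    then have "frac_val e * 2 ^ (l e + 1) = 1 + frac_val ys" by simp
    then show "1 \<le> frac_val e * 2 ^ (l e + 1)" using frac_val_nonneg[of ys] by simp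
    have "real (l e) \<le> 2 ^ l e" by (metis less_exp less_imp_le of_nat_le_iff of_nat_numeral of_nat_power)
    moreover have "frac_val e * 2 ^ l e \<le> 1" using f frac_val_less_1[of ys] by simp
    then have "2 ^ l e \<le> 1 / frac_val e" using 1 by (simp add: field_simps)
    ultimately show "real (l e) \<le> 1 / frac_val e" by linarith
  qed
  have bound: "real (?T (S u e)) \<le> B u e" "1 / frac_val (\<delta> e) \<le> B u e" if "error_param e" for u e :: "bool list"
  proof -
    note e = eps[OF that]
    let ?X = "real (length u) + 1 / frac_val e"
    have X: "1 < 1 / frac_val e" using e(1,2) by simp
    have B: "(3 * ?X) ^ Suc k = B u e"
      unfolding B_def poly_bound_def power_mult_distrib by simp
    have S: "real (S u e) \<le> 3 * ?X" using e(4) X by (simp add: S_def)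
    have "?T (S u e) \<le> S u e ^ k" by (rule k) (simp add: S_def)
    also have "\<dots> \<le> S u e ^ Suc k" by (intro power_increasing) (auto simp: S_def)
    finally have "real (?T (S u e)) \<le> real (S u e) ^ Suc k" by (metis of_nat_le_iff of_nat_power)
    also have "\<dots> \<le> (3 * ?X) ^ Suc k" using S by (intro power_mono) auto
    finally show "real (?T (S u e)) \<le> B u e" unfolding B .
    have "1 / frac_val (\<delta> e) = 2 / frac_val e" by (simp add: \<delta>_def)
    also have "\<dots> \<le> 3 * ?X" using X by simp
    also have "\<dots> = (3 * ?X) ^ 1" by simp
    also have "\<dots> \<le> (3 * ?X) ^ Suc k" using X by (intro power_increasing) auto
    finally show "1 / frac_val (\<delta> e) \<le> B u e" unfolding B .
  qed
  define s1 where "s1 = (\<lambda>u e. ((\<lambda>_. []) :: store)(0 := u, 1 := dropWhile Not e, 7 := replicate (l e) True))"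
  define s2 where "s2 = (\<lambda>u e. (s1 u e)(1 := \<delta> e, 4 := replicate (N u (l e)) True @ False #
      map (adj u (l e)) [0..<N u (l e) * N u (l e)]))"
  have pre: "exec ?pre ((\<lambda>_. [])(0 := u, 1 := e)) (?T1 (S u e)) (s2 u e) \<and> size_le (S u e + ?T1 (S u e)) (s2 u e)"
    if "error_param e" for u e :: "bool list"
  proof -
    have 1: "exec ?strip ((\<lambda>_. [])(0 := u, 1 := e)) (5 * S u e + 6) (s1 u e)"
      by (rule exec_cong[OF exec_strip]) (auto simp: s1_def S_def l_def fun_eq_iff)
    have sz: "size_le (S u e) (s1 u e)" by (auto simp: size_le_def s1_def S_def)
    have "replicate (l e + 1) False @ dropWhile Not e = \<delta> e"
      using eps(5)[OF that] by (simp add: \<delta>_def)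
    then have 2: "exec cq (s1 u e) (pq (S u e)) (s2 u e)"
      by (intro exec_cong[OF pq(2)[OF _ _ sz]]) (auto simp: s1_def s2_def S_def clean_def fun_eq_iff)
    have 3: "exec ?pre ((\<lambda>_. [])(0 := u, 1 := e)) (?T1 (S u e)) (s2 u e)" by (rule exec_Seq[OF 1 2])
    have "size_le (S u e) ((\<lambda>_. [])(0 := u, 1 := e))" by (auto simp: size_le_def S_def)
    from size_le_exec[OF 3 this] 3 show ?thesis by blast
  qed
  define out where "out = (\<lambda>u e z. F ((s2 u e)(5 := fst z, 6 := snd z)))"
  have post: "exec ca ((s2 u e)(5 := ip, 6 := fp)) (pa (S u e + ?T1 (S u e))) (F ((s2 u e)(5 := ip, 6 := fp)))"
    if "error_param e" for u e ip fp :: "bool list"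
  proof (rule pa(2))
    show "2 \<le> S u e + ?T1 (S u e)" by simp
    show "size_le (S u e + ?T1 (S u e)) ((s2 u e)(5 := ip, 6 := fp))"
      using pre[OF that, of u] by (auto simp: size_le_def)
  qed (auto simp: s2_def s1_def clean_def)
  have result: "result ([], F ((s2 u e)(5 := fst z, 6 := snd z))) =
      scaled_numeral (D u (l e)) (scaled_digits ms ds u (l e) (L u (l e)) (K u (l e)) z)" for u e :: "bool list" and z
    unfolding result_def snd_conv
    by (subst F) (auto simp: s2_def s1_def clean_def)
  have run: "B u e \<ge> 0 \<and> (\<forall>n. \<forall>cfg \<in> set_pmf (run Or ?M u e n). legal_call Q (B u e) cfg) \<and>
     run Or ?M u e (nat \<lfloor>B u e\<rfloor>) = map_pmf (\<lambda>z. ([], F ((s2 u e)(5 := fst z, 6 := snd z)))) (Or (encode Q (N u (l e), E)) (\<delta> e))"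
    if x: "x \<in> instances P" "u = encode P x" and e: "error_param e"
      and E: "(N u (l e), E) \<in> instances Q" "\<forall>i<N u (l e) * N u (l e). adj u (l e) i \<longleftrightarrow> {i div N u (l e), i mod N u (l e)} \<in> E"
      for Or x u e E
  proof -
    have s4: "s2 u e 4 = encode Q (N u (l e), E)"
      using E(2) by (auto simp: s2_def enc encode_graph_eq)
    have s1: "s2 u e 1 = \<delta> e" by (simp add: s2_def)
    have "error_param (\<delta> e)" using eps(1,2)[OF e] by (simp add: \<delta>_def error_param_def)
    then have l: "s2 u e 4 \<in> encode Q ` instances Q" "error_param (s2 u e 1)" "1 / frac_val (s2 u e 1) \<le> B u e"
      using E(1) bound(2)[OF e] unfolding s4 s1 by auto
    have n: "?T1 (S u e) + pa (S u e + ?T1 (S u e)) + 3 \<le> nat \<lfloor>B u e\<rfloor>"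
      using bound(1)[OF e, of u] by (simp only: le_nat_floor)
    show ?thesis
      using one_query_run[OF conjunct1[OF pre[OF e]] post[OF e] l] n bound(1)[OF e, of u] unfolding s4 s1
      by (auto intro: order_trans[OF of_nat_0_le_iff])
  qed
  have "AP_reduction ?M (3 ^ Suc k) (Suc k) P Q"
    unfolding AP_reduction_def Let_def B_def[symmetric]
  proof (intro conjI allI ballI impI)
    fix Or x e assume x: "x \<in> instances P" and e: "error_param e"
    obtain E where "(N (encode P x) (l e), E) \<in> instances Q"
      "\<forall>i<N (encode P x) (l e) * N (encode P x) (l e). adj (encode P x) (l e) i \<longleftrightarrow>
        {i div N (encode P x) (l e), i mod N (encode P x) (l e)} \<in> E"
      using correct[OF x, of "encode P x" "l e"] by (auto simp: enc)
    note r = run[OF x refl e this, of Or]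
    show "legal_call Q (B (encode P x) e) cfg" if "cfg \<in> set_pmf (run Or ?M (encode P x) e n)" for n cfg
      using r that by blast
    show "fst cfg = []" if "cfg \<in> set_pmf (run Or ?M (encode P x) e (nat \<lfloor>B (encode P x) e\<rfloor>))" for cfg
      using r that by auto
  next
    fix Or assume Or: "RAS Q Or"
    show "RAS P (\<lambda>u e. map_pmf result (run Or ?M u e (nat \<lfloor>B u e\<rfloor>)))"
      unfolding RAS_def
    proof (intro ballI allI impI)
      fix x e assume x: "x \<in> instances P" and e: "error_param e"
      define u where "u = encode P x"
      obtain E \<eta> where E: "(N u (l e), E) \<in> instances Q"
        "\<forall>i<N u (l e) * N u (l e). adj u (l e) i \<longleftrightarrow> {i div N u (l e), i mod N u (l e)} \<in> E"
        and c: "0 \<le> answer Q (N u (l e), E)" "answer Q (N u (l e), E) \<le> 2 ^ (N u (l e) * N u (l e))"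
        "answer Q (N u (l e), E) * factor_prod ms u (l e) * 2 ^ K u (l e) =
          (answer P x + \<eta>) * 2 ^ D u (l e) * factor_prod ds u (l e)"
        "0 \<le> \<eta>" "\<eta> * 2 ^ (D u (l e) + 1) < 1"
        "0 \<le> answer P x" "answer P x = 0 \<or> 24 * 2 ^ l e \<le> answer P x * 2 ^ D u (l e)"
        "factor_prod ms u (l e) \<le> factor_prod ds u (l e)" "factor_prod ms u (l e) \<le> 2 ^ K u (l e)"
        "D u (l e) \<le> K u (l e)"
        using correct[OF x, of u "l e"] by (auto simp: enc u_def)
      let ?x' = "(N u (l e), E)"
      have \<delta>: "error_param (\<delta> e)" "frac_val (\<delta> e) = frac_val e / 2"
        using eps(1,2)[OF e] by (auto simp: \<delta>_def error_param_def)
      let ?good' = "{z. valid_numeral z \<and> exp (- frac_val (\<delta> e)) * answer Q ?x' \<le> numeral_val z \<and>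
           numeral_val z \<le> exp (frac_val (\<delta> e)) * answer Q ?x'}"
      let ?good = "{z. valid_numeral z \<and> exp (- frac_val e) * answer P x \<le> numeral_val z \<and>
           numeral_val z \<le> exp (frac_val e) * answer P x}"
      let ?out = "\<lambda>z. scaled_numeral (D u (l e)) (scaled_digits ms ds u (l e) (L u (l e)) (K u (l e)) z)"
      have "map_pmf result (run Or ?M u e (nat \<lfloor>B u e\<rfloor>)) = map_pmf ?out (Or (encode Q ?x') (\<delta> e))"
        using run[OF x u_def e E, of Or] by (simp add: map_pmf_comp o_def result)
      \<comment> \<open>The treatment of the answer is deterministic, so it suffices that good
        answers are turned into good outputs.\<close>
      moreover have "?good' \<subseteq> ?out -` ?good"
      proof
        fix z assume z: "z \<in> ?good'"
        have "valid_numeral (?out z) \<and> exp (- frac_val e) * answer P x \<le> numeral_val (?out z) \<and>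
           numeral_val (?out z) \<le> exp (frac_val e) * answer P x"
        proof -
          have z': "valid_numeral z" "exp (- (frac_val e / 2)) * answer Q ?x' \<le> numeral_val z"
            "numeral_val z \<le> exp (frac_val e / 2) * answer Q ?x'"
            using z by (simp_all add: \<delta>(2))
          have L: "L u (l e) = N u (l e) * N u (l e) + 2" by (simp add: L_def)
          have pos: "\<forall>a f. (a, f) \<in> set ms \<union> set ds \<longrightarrow> 0 < a" using fs by blast
          show ?thesis
            using scaled_numeral_correct[OF z' eps(1-3)[OF e] c(1,2) L pos refl refl c(8,9,3-7,10)] by blast
        qed
        then show "z \<in> ?out -` ?good" by simp
      qed
      moreover have "3 / 4 \<le> measure_pmf.prob (Or (encode Q ?x') (\<delta> e)) ?good'"
        using Or E(1) \<delta>(1) unfolding RAS_def by blast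
      ultimately show "3 / 4 \<le> measure_pmf.prob (map_pmf result (run Or ?M (encode P x) e (nat \<lfloor>B (encode P x) e\<rfloor>))) ?good"
        unfolding u_def[symmetric] using measure_pmf.finite_measure_mono[of ?good' "?out -` ?good" "Or (encode Q ?x') (\<delta> e)"]
        by simp
    qed
  qed
  then show ?thesis unfolding AP_reducible_def by blast
qed

section \<open>High-temperature expansion and the sign of the partition function\<close>

section \<open>The expansion over odd subgraphs\<close>

definition odd_subgraphs :: "'a set \<Rightarrow> 'a set set \<Rightarrow> 'a set set set" where
  "odd_subgraphs V E = {A. A \<subseteq> E \<and> (\<forall>v\<in>V. odd (degree A v))}"

lemma finite_graph_finite_edges: "finite_graph V E \<Longrightarrow> finite E"
  unfolding finite_graph_def by (meson Pow_iff finite_Pow_iff finite_subset subsetI)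

lemma finite_odd_subgraphs: "finite_graph V E \<Longrightarrow> finite (odd_subgraphs V E)"
  unfolding odd_subgraphs_def by (rule finite_subset[of _ "Pow E"]) (auto simp: finite_graph_finite_edges)

lemma degree_eq_sum: "finite A \<Longrightarrow> degree A v = (\<Sum>e\<in>A. of_bool (v \<in> e))"
  unfolding degree_def by (simp add: Int_def)

fun spin_sign :: "spin \<Rightarrow> real" where
  "spin_sign Plus = 1"
| "spin_sign Minus = -1"

lemma UNIV_spin: "UNIV = {Plus, Minus}"
  using spin.exhaust by auto

text \<open>The product of the two end signs is 1 on an uncut and -1 on a cut edge, and every
  function of a two-valued quantity is affine in it.\<close>

lemma edge_weight:
  assumes "card e = 2"
  shows "(if \<exists>u\<in>e. \<exists>v\<in>e. \<sigma> u \<noteq> \<sigma> v then b else 1) =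
    (1 - b) / 2 * (\<Prod>v\<in>e. spin_sign (\<sigma> v)) + (1 + b) / 2"
proof -
  obtain u v where e: "e = {u, v}" "u \<noteq> v" using assms by (auto simp: card_2_iff)
  show ?thesis unfolding e using e(2)
    by (cases "\<sigma> u"; cases "\<sigma> v") (auto simp: field_simps)
qed

text \<open>Expanding the product of the edge weights over edge sets \<open>A\<close> gives the spin
  at \<open>v\<close> the weight \<open>-1\<close> or \<open>(-1) ^ degree A v\<close>. The sum of
  the two is -2 for odd degree and 0 for even degree, and the sum over all spin assignments
  factorises over the vertices.\<close>

theorem ising_Z_odd_expansion:
  fixes b :: real
  assumes G: "finite_graph V E"
  shows "ising_Z V E (-1) b = (-2) ^ card V *
    (\<Sum>A\<in>odd_subgraphs V E. ((1 - b) / 2) ^ card A * ((1 + b) / 2) ^ card (E - A))"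
proof -
  have fin: "finite V" "finite E" using G finite_graph_finite_edges by (auto simp: finite_graph_def)
  have e: "card e = 2" "e \<subseteq> V" if "e \<in> E" for e using G that by (auto simp: finite_graph_def)
  let ?x = "(1 - b) / 2" and ?y = "(1 + b) / 2"
  have expand: "(-1) ^ num_plus V \<sigma> * b ^ num_cut E \<sigma> =
      (\<Sum>A\<in>Pow E. ?x ^ card A * ?y ^ card (E - A) *
        (\<Prod>v\<in>V. (if \<sigma> v = Plus then -1 else 1) * spin_sign (\<sigma> v) ^ degree A v))" for \<sigma>
  proof -
    have "b ^ num_cut E \<sigma> = (\<Prod>e\<in>E. if \<exists>u\<in>e. \<exists>v\<in>e. \<sigma> u \<noteq> \<sigma> v then b else 1)"
      unfolding num_cut_def using fin by (subst prod.If_cases) (auto simp: Int_def)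
    also have "(\<Prod>e\<in>E. if \<exists>u\<in>e. \<exists>v\<in>e. \<sigma> u \<noteq> \<sigma> v then b else 1) = (\<Prod>e\<in>E. ?x * (\<Prod>v\<in>e. spin_sign (\<sigma> v)) + ?y)"
      by (intro prod.cong refl edge_weight e)
    also have "\<dots> = (\<Sum>A\<in>Pow E. (\<Prod>e\<in>A. ?x * (\<Prod>v\<in>e. spin_sign (\<sigma> v))) * (\<Prod>e\<in>E - A. ?y))"
      by (rule prod_add) (rule fin)
    also have "\<dots> = (\<Sum>A\<in>Pow E. ?x ^ card A * ?y ^ card (E - A) * (\<Prod>v\<in>V. spin_sign (\<sigma> v) ^ degree A v))"
    proof (intro sum.cong refl)
      fix A assume A: "A \<in> Pow E"
      then have fA: "finite A" using fin by (auto intro: finite_subset)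
      have "(\<Prod>e\<in>A. \<Prod>v\<in>e. spin_sign (\<sigma> v)) = (\<Prod>e\<in>A. \<Prod>v\<in>V. if v \<in> e then spin_sign (\<sigma> v) else 1)"
      proof (rule prod.cong[OF refl])
        fix x assume "x \<in> A"
        then have "x \<subseteq> V" using A e by auto
        then show "(\<Prod>v\<in>x. spin_sign (\<sigma> v)) = (\<Prod>v\<in>V. if v \<in> x then spin_sign (\<sigma> v) else 1)"
          using fin by (simp add: prod.If_cases Int_absorb1)
      qed
      also have "\<dots> = (\<Prod>v\<in>V. \<Prod>e\<in>A. if v \<in> e then spin_sign (\<sigma> v) else 1)"
        by (rule prod.swap)
      also have "\<dots> = (\<Prod>v\<in>V. spin_sign (\<sigma> v) ^ degree A v)"
        using fA by (simp add: prod.If_cases degree_def Int_def)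
      finally have p: "(\<Prod>e\<in>A. \<Prod>v\<in>e. spin_sign (\<sigma> v)) = (\<Prod>v\<in>V. spin_sign (\<sigma> v) ^ degree A v)" .
      show "(\<Prod>e\<in>A. ?x * (\<Prod>v\<in>e. spin_sign (\<sigma> v))) * (\<Prod>e\<in>E - A. ?y) =
        ?x ^ card A * ?y ^ card (E - A) * (\<Prod>v\<in>V. spin_sign (\<sigma> v) ^ degree A v)"
        unfolding prod.distrib p by simp
    qed
    finally have 1: "b ^ num_cut E \<sigma> = (\<Sum>A\<in>Pow E. ?x ^ card A * ?y ^ card (E - A) *
        (\<Prod>v\<in>V. spin_sign (\<sigma> v) ^ degree A v))" .
    have 2: "(-1) ^ num_plus V \<sigma> = (\<Prod>v\<in>V. if \<sigma> v = Plus then -1 else (1::real))"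
      unfolding num_plus_def using fin by (subst prod.If_cases) (auto simp: Int_def)
    show ?thesis unfolding 1 2 sum_distrib_left prod.distrib by (intro sum.cong refl) (simp only: mult_ac)
  qed
  have "ising_Z V E (-1) b = (\<Sum>A\<in>Pow E. ?x ^ card A * ?y ^ card (E - A) *
     (\<Sum>\<sigma>\<in>V \<rightarrow>\<^sub>E UNIV. \<Prod>v\<in>V. (if \<sigma> v = Plus then -1 else 1) * spin_sign (\<sigma> v) ^ degree A v))"
    unfolding ising_Z_def expand by (subst sum.swap) (simp add: sum_distrib_left)
  also have "\<dots> = (\<Sum>A\<in>Pow E. ?x ^ card A * ?y ^ card (E - A) *
      (if A \<in> odd_subgraphs V E then (-2) ^ card V else 0))"
  proof (intro sum.cong refl)
    fix A assume A: "A \<in> Pow E"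
    have "(\<Sum>\<sigma>\<in>V \<rightarrow>\<^sub>E UNIV. \<Prod>v\<in>V. (if \<sigma> v = Plus then -1 else 1) * spin_sign (\<sigma> v) ^ degree A v) =
      (\<Prod>v\<in>V. \<Sum>s\<in>UNIV. (if s = Plus then -1 else 1) * spin_sign s ^ degree A v)"
      using fin by (subst prod_sum_PiE) (auto simp: UNIV_spin)
    also have "\<dots> = (\<Prod>v\<in>V. if odd (degree A v) then -2 else 0)"
      by (intro prod.cong refl) (auto simp: UNIV_spin)
    also have "\<dots> = (if A \<in> odd_subgraphs V E then (-2) ^ card V else 0)"
      using A fin by (auto simp: odd_subgraphs_def)
    finally show "?x ^ card A * ?y ^ card (E - A) *
        (\<Sum>\<sigma>\<in>V \<rightarrow>\<^sub>E UNIV. \<Prod>v\<in>V. (if \<sigma> v = Plus then -1 else 1) * spin_sign (\<sigma> v) ^ degree A v) =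
      ?x ^ card A * ?y ^ card (E - A) * (if A \<in> odd_subgraphs V E then (-2) ^ card V else 0)" by simp
  qed
  also have "\<dots> = (\<Sum>A\<in>odd_subgraphs V E. ?x ^ card A * ?y ^ card (E - A) * (-2) ^ card V)"
    using fin by (intro sum.mono_neutral_cong_right) (auto simp: odd_subgraphs_def)
  finally show ?thesis by (simp add: sum_distrib_left mult_ac)
qed

lemma sum_degree:
  assumes "finite_graph V E" "A \<subseteq> E"
  shows "(\<Sum>v\<in>V. degree A v) = 2 * card A"
proof -
  have fA: "finite A" using assms finite_graph_finite_edges finite_subset by blast
  have "(\<Sum>v\<in>V. degree A v) = (\<Sum>e\<in>A. \<Sum>v\<in>V. of_bool (v \<in> e))"
    unfolding degree_eq_sum[OF fA] by (rule sum.swap)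
  also have "\<dots> = (\<Sum>e\<in>A. 2)"
  proof (intro sum.cong refl)
    fix e assume "e \<in> A"
    then have "e \<subseteq> V" "card e = 2" "finite V" using assms by (auto simp: finite_graph_def)
    then show "(\<Sum>v\<in>V. of_bool (v \<in> e)) = (2::nat)" by (simp add: Int_absorb1)
  qed
  finally show ?thesis by simp
qed

lemma even_sum_odd: "finite V \<Longrightarrow> \<forall>v\<in>V. odd (f v) \<Longrightarrow> even (sum f V :: nat) \<longleftrightarrow> even (card V)"
  by (induction V rule: finite_induct) auto

text \<open>By the handshake lemma the degrees sum to an even number, which an odd number of odd
  degrees cannot do.\<close>

lemma odd_subgraphs_odd_card:
  assumes "finite_graph V E" "odd (card V)"
  shows "odd_subgraphs V E = {}"
proof -
  have "False" if "A \<in> odd_subgraphs V E" for A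
  proof -
    have A: "A \<subseteq> E" "\<forall>v\<in>V. odd (degree A v)" using that by (auto simp: odd_subgraphs_def)
    have "finite V" using assms by (simp add: finite_graph_def)
    from even_sum_odd[OF this A(2)] sum_degree[OF assms(1) A(1)] assms(2) show False by simp
  qed
  then show ?thesis by blast
qed

lemma odd_degree_sym_diff:
  assumes "finite A" "finite B"
  shows "odd (degree (sym_diff A B) v) \<longleftrightarrow> odd (degree A v) \<noteq> odd (degree B v)"
proof -
  let ?A = "{e\<in>A. v \<in> e}" and ?B = "{e\<in>B. v \<in> e}"
  have "{e \<in> sym_diff A B. v \<in> e} = (?A - ?B) \<union> (?B - ?A)" by auto
  then have "degree (sym_diff A B) v = card (?A - ?B) + card (?B - ?A)"
    unfolding degree_def using assms by (simp add: card_Un_disjoint disjoint_iff)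
  moreover have "card ?A = card (?A \<inter> ?B) + card (?A - ?B)" "card ?B = card (?B \<inter> ?A) + card (?B - ?A)"
    using assms by (intro card_Int_Diff; simp)+
  moreover have "?A \<inter> ?B = ?B \<inter> ?A" by (rule Int_commute)
  ultimately show ?thesis unfolding degree_def by presburger
qed

text \<open>In a connected graph every even vertex set is the set of odd vertices of some edge set:
  join its elements in pairs by walks and add up modulo 2.\<close>

lemma walk_parity:
  assumes "finite_graph V E" "(u, v) \<in> {(x, y). {x, y} \<in> E}\<^sup>*"
  shows "\<exists>A\<subseteq>E. \<forall>w. odd (degree A w) \<longleftrightarrow> (w = u) \<noteq> (w = v)"
  using assms(2)
proof (induction rule: rtrancl_induct)
  case base
  show ?case by (rule exI[of _ "{}"]) (simp add: degree_def)
next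
  case (step y z)
  then obtain A where A: "A \<subseteq> E" "\<And>w. odd (degree A w) \<longleftrightarrow> (w = u) \<noteq> (w = y)" by blast
  have yz: "{y, z} \<in> E" using step by simp
  then have "y \<noteq> z" using assms(1) by (auto simp: finite_graph_def)
  have "finite A" using A assms(1) finite_graph_finite_edges finite_subset by blast
  have "odd (degree {{y, z}} w) \<longleftrightarrow> (w = y) \<noteq> (w = z)" for w
  proof -
    have "{e \<in> {{y, z}}. w \<in> e} = (if w = y \<or> w = z then {{y, z}} else {})" by auto
    then show ?thesis using \<open>y \<noteq> z\<close> by (auto simp: degree_def)
  qed
  then have "odd (degree (sym_diff A {{y, z}}) w) \<longleftrightarrow> (w = u) \<noteq> (w = z)" for w
    using odd_degree_sym_diff[OF \<open>finite A\<close>, of "{{y, z}}" w] A(2)[of w] by auto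
  then show ?case using A(1) yz by (intro exI[of _ "sym_diff A {{y, z}}"]) auto
qed

lemma even_set_parity:
  assumes G: "connected_graph V E" and "T \<subseteq> V" "even (card T)"
  shows "\<exists>A\<subseteq>E. \<forall>w\<in>V. odd (degree A w) \<longleftrightarrow> w \<in> T"
  using assms(2,3)
proof (induction "card T" arbitrary: T rule: less_induct)
  case less
  have fin: "finite_graph V E" using G by (simp add: connected_graph_def)
  then have "finite T" using less.prems finite_subset by (auto simp: finite_graph_def)
  show ?case
  proof (cases "T = {}")
    case True
    then show ?thesis by (intro exI[of _ "{}"]) (simp add: degree_def)
  next
    case False
    then obtain u where u: "u \<in> T" by blast
    have "T \<noteq> {u}" using less.prems by auto
    then obtain v where v: "v \<in> T" "v \<noteq> u" using u by blast
    have c: "card (T - {u, v}) = card T - 2" "2 \<le> card T"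
      using u v \<open>finite T\<close> card_mono[of T "{u, v}"] by (simp_all add: card_Diff_subset)
    then have "card (T - {u, v}) < card T" "even (card (T - {u, v}))" using less.prems by auto
    moreover have "T - {u, v} \<subseteq> V" using less.prems(1) by blast
    ultimately have "\<exists>A\<subseteq>E. \<forall>w\<in>V. odd (degree A w) \<longleftrightarrow> w \<in> T - {u, v}"
      by (intro less.hyps)
    then obtain A where A: "A \<subseteq> E" "\<forall>w\<in>V. odd (degree A w) \<longleftrightarrow> w \<in> T - {u, v}" by blast
    have "u \<in> V" "v \<in> V" using u v less.prems(1) by auto
    then have "(u, v) \<in> {(x, y). {x, y} \<in> E}\<^sup>*"
      using G by (simp add: connected_graph_def)
    from walk_parity[OF fin this] obtain B
      where B: "B \<subseteq> E" "\<And>w. odd (degree B w) \<longleftrightarrow> (w = u) \<noteq> (w = v)" by auto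
    have "finite A" "finite B"
      using finite_subset[OF A(1)] finite_subset[OF B(1)] finite_graph_finite_edges[OF fin] by auto
    then have "\<forall>w\<in>V. odd (degree (sym_diff A B) w) \<longleftrightarrow> w \<in> T"
      using A(2) B(2) u v by (auto simp: odd_degree_sym_diff)
    then show ?thesis using A B by (intro exI[of _ "sym_diff A B"]) auto
  qed
qed

theorem ising_Z_connected:
  fixes b :: real
  assumes b: "0 < b" "b < 1" and G: "connected_graph V E"
  shows "even (card V) \<Longrightarrow> ising_Z V E (-1) b > 0" "odd (card V) \<Longrightarrow> ising_Z V E (-1) b = 0"
proof -
  have fin: "finite_graph V E" using G by (simp add: connected_graph_def)
  show "ising_Z V E (-1) b = 0" if "odd (card V)"
    unfolding ising_Z_odd_expansion[OF fin] odd_subgraphs_odd_card[OF fin that] by simp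
  show "ising_Z V E (-1) b > 0" if ev: "even (card V)"
  proof -
    \<comment> \<open>The even vertex set to be joined up is \<open>V\<close> itself.\<close>
    obtain A where "A \<in> odd_subgraphs V E"
      using even_set_parity[OF G order_refl ev] by (auto simp: odd_subgraphs_def)
    then have "0 < (\<Sum>A\<in>odd_subgraphs V E. ((1 - b) / 2) ^ card A * ((1 + b) / 2) ^ card (E - A))"
      using b by (intro sum_pos finite_odd_subgraphs fin) auto
    then show ?thesis unfolding ising_Z_odd_expansion[OF fin] using ev by simp
  qed
qed

lemma abs_ising_Z:
  fixes b :: real
  assumes b: "0 < b" "b < 1" and G: "finite_graph V E"
  shows "\<bar>ising_Z V E (-1) b\<bar> = 2 ^ card V * ((1 + b) / 2) ^ card E *
    (\<Sum>A\<in>odd_subgraphs V E. ((1 - b) / (1 + b)) ^ card A)"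
proof -
  have "((1 - b) / 2) ^ card A * ((1 + b) / 2) ^ card (E - A) =
      ((1 + b) / 2) ^ card E * ((1 - b) / (1 + b)) ^ card A" if "A \<in> odd_subgraphs V E" for A
  proof -
    have A: "A \<subseteq> E" "finite E" using that G finite_graph_finite_edges by (auto simp: odd_subgraphs_def)
    then have "card E = card A + card (E - A)"
      by (simp add: card_Diff_subset card_mono finite_subset)
    moreover have "(1 - b) / 2 = (1 + b) / 2 * ((1 - b) / (1 + b))" using b by (simp add: field_simps)
    ultimately show ?thesis by (simp only: power_add power_mult_distrib) simp
  qed
  then have "ising_Z V E (-1) b = (-2) ^ card V * (((1 + b) / 2) ^ card E *
      (\<Sum>A\<in>odd_subgraphs V E. ((1 - b) / (1 + b)) ^ card A))"
    unfolding ising_Z_odd_expansion[OF G] sum_distrib_left by simp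
  moreover have "0 \<le> (\<Sum>A\<in>odd_subgraphs V E. ((1 - b) / (1 + b)) ^ card A)"
    using b by (intro sum_nonneg) auto
  ultimately show ?thesis using b by (simp add: abs_mult power_abs)
qed

section \<open>Perfect-matching counts under deletion of vertices\<close>

section \<open>Counting perfect matchings\<close>

text \<open>\<open>perfect_matchings\<close> does not confine the edges to \<open>V\<close>.
  Restricting them here turns the deletion of vertices into shrinking \<open>V\<close> with
  \<open>E\<close> unchanged.\<close>

definition num_pm :: "'a set \<Rightarrow> 'a set set \<Rightarrow> nat" where
  "num_pm V E = card (perfect_matchings V {e\<in>E. e \<subseteq> V})"

text \<open>Graph edges without reference to a vertex set, since the latter changes with every
  deletion.\<close>

definition edges :: "'a set set \<Rightarrow> bool" where
  "edges E \<longleftrightarrow> finite E \<and> (\<forall>e\<in>E. card e = 2)"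

lemma num_pm_graph: "finite_graph V E \<Longrightarrow> num_pm V E = card (perfect_matchings V E)"
proof -
  assume "finite_graph V E"
  then have 1: "{e\<in>E. e \<subseteq> V} = E" unfolding finite_graph_def by blast
  show ?thesis unfolding num_pm_def 1 ..
qed

lemma finite_perfect_matchings: "finite E \<Longrightarrow> finite (perfect_matchings V E)"
  unfolding perfect_matchings_def by (rule finite_subset[of _ "Pow E"]) auto

lemma num_pm_cong: "{e\<in>E. e \<subseteq> V} = {e\<in>E'. e \<subseteq> V} \<Longrightarrow> num_pm V E = num_pm V E'"
  by (simp add: num_pm_def)

lemma perfect_matchings_degree:
  "M \<in> perfect_matchings V E \<Longrightarrow> v \<in> V \<Longrightarrow> degree M v = 1"
proof -
  assume "M \<in> perfect_matchings V E" "v \<in> V"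
  then obtain e where "e \<in> M" "v \<in> e" "\<And>f. f \<in> M \<Longrightarrow> v \<in> f \<Longrightarrow> f = e"
    unfolding perfect_matchings_def by blast
  then have "{e\<in>M. v \<in> e} = {e}" by blast
  then show ?thesis by (simp add: degree_def)
qed

lemma perfect_matching_card:
  assumes "finite V" "edges E" "M \<in> perfect_matchings V {e\<in>E. e \<subseteq> V}"
  shows "card V = 2 * card M"
proof -
  have g: "finite_graph V {e\<in>E. e \<subseteq> V}" using assms by (auto simp: finite_graph_def edges_def)
  have "M \<subseteq> {e\<in>E. e \<subseteq> V}" using assms(3) by (simp add: perfect_matchings_def)
  from sum_degree[OF g this] perfect_matchings_degree[OF assms(3)] show ?thesis by simp
qed

lemma num_pm_odd: "finite V \<Longrightarrow> edges E \<Longrightarrow> odd (card V) \<Longrightarrow> num_pm V E = 0"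
proof -
  assume *: "finite V" "edges E" "odd (card V)"
  have 1: "perfect_matchings V {e\<in>E. e \<subseteq> V} = {}"
  proof (rule equals0I)
    fix M assume "M \<in> perfect_matchings V {e\<in>E. e \<subseteq> V}"
    from perfect_matching_card[OF *(1,2) this] *(3) show False by simp
  qed
  show ?thesis unfolding num_pm_def 1 by simp
qed

lemma num_pm_empty:
  assumes "edges E"
  shows "num_pm {} E = 1"
proof -
  have "{} \<notin> E" using assms unfolding edges_def by force
  then have 1: "{e\<in>E. e \<subseteq> {}} = {}" by auto
  have 2: "perfect_matchings {} {} = {{}}" by (auto simp: perfect_matchings_def)
  show ?thesis unfolding num_pm_def 1 2 by simp
qed

lemma num_pm_pair:
  assumes "edges E" "a \<noteq> b"
  shows "num_pm {a, b} E = of_bool ({a, b} \<in> E)"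
proof -
  have e: "e = {a, b}" if "e \<in> E" "e \<subseteq> {a, b}" for e
  proof (rule card_subset_eq)
    show "card e = card {a, b}" using that assms by (simp add: edges_def)
  qed (use that in auto)
  show ?thesis
  proof (cases "{a, b} \<in> E")
    case True
    then have 1: "{e\<in>E. e \<subseteq> {a, b}} = {{a, b}}" using e by blast
    have 2: "perfect_matchings {a, b} {{a, b}} = {{{a, b}}}"
      unfolding perfect_matchings_def by blast
    have "num_pm {a, b} E = 1" unfolding num_pm_def 1 2 by simp
    then show ?thesis using True by simp
  next
    case False
    then have 1: "{e\<in>E. e \<subseteq> {a, b}} = {}" using e by blast
    have 2: "perfect_matchings {a, b} {} = {}" unfolding perfect_matchings_def by blast
    have "num_pm {a, b} E = 0" unfolding num_pm_def 1 2 by simp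
    then show ?thesis using False by simp
  qed
qed

definition matching :: "'a set set \<Rightarrow> bool" where
  "matching S \<longleftrightarrow> (\<forall>e\<in>S. \<forall>f\<in>S. e \<noteq> f \<longrightarrow> e \<inter> f = {})"

text \<open>Perfect matchings are classified by the set \<open>S\<close> of their edges in
  \<open>C\<close>. What remains is a perfect matching, by edges of \<open>E\<close>, of the
  vertices that \<open>S\<close> leaves uncovered.\<close>

lemma num_pm_split:
  assumes "finite C" "finite E" "E \<inter> C = {}" "\<And>e. e \<in> C \<Longrightarrow> e \<subseteq> V"
  shows "num_pm V (E \<union> C) = (\<Sum>S | S \<subseteq> C \<and> matching S. num_pm (V - \<Union>S) E)"
proof -
  let ?I = "{S. S \<subseteq> C \<and> matching S}"
  let ?F = "\<lambda>S. {e\<in>E. e \<subseteq> V - \<Union>S}"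
  let ?P = "\<lambda>S. perfect_matchings (V - \<Union>S) (?F S)"
  have "bij_betw (\<lambda>(S, M). S \<union> M) (SIGMA S:?I. ?P S) (perfect_matchings V {e\<in>E \<union> C. e \<subseteq> V})"
  proof (rule bij_betwI[where g = "\<lambda>M. (M \<inter> C, M - C)"])
    show "(\<lambda>(S, M). S \<union> M) \<in> (SIGMA S:?I. ?P S) \<rightarrow> perfect_matchings V {e\<in>E \<union> C. e \<subseteq> V}"
    proof
      fix x assume "x \<in> (SIGMA S:?I. ?P S)"
      then obtain S M where x: "x = (S, M)" and S: "S \<subseteq> C" "matching S" and M: "M \<in> ?P S" by auto
      have Msub: "M \<subseteq> ?F S" and Mex: "\<And>v. v \<in> V - \<Union>S \<Longrightarrow> \<exists>!e. e \<in> M \<and> v \<in> e"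
        using M unfolding perfect_matchings_def by simp_all
      have "\<exists>!e. e \<in> S \<union> M \<and> v \<in> e" if v: "v \<in> V" for v
      proof (cases "v \<in> \<Union>S")
        case True
        then obtain e where e: "e \<in> S" "v \<in> e" by auto
        show ?thesis
        proof (rule ex1I[of _ e])
          fix f assume f: "f \<in> S \<union> M \<and> v \<in> f"
          then have "f \<notin> M" using Msub True by auto
          then have "f \<in> S" "f \<inter> e \<noteq> {}" using f e by auto
          then show "f = e" using e(1) S(2) unfolding matching_def by metis
        qed (use e in simp)
      next
        case False
        have "e \<in> S \<union> M \<and> v \<in> e \<longleftrightarrow> e \<in> M \<and> v \<in> e" for e using False by auto
        then show ?thesis using Mex[of v] v False by simp
      qed
      moreover have "S \<union> M \<subseteq> {e\<in>E \<union> C. e \<subseteq> V}" using S(1) Msub assms(4) by auto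
      ultimately show "(case x of (S, M) \<Rightarrow> S \<union> M) \<in> perfect_matchings V {e\<in>E \<union> C. e \<subseteq> V}"
        unfolding perfect_matchings_def x by simp
    qed
    show "(\<lambda>M. (M \<inter> C, M - C)) \<in> perfect_matchings V {e\<in>E \<union> C. e \<subseteq> V} \<rightarrow> (SIGMA S:?I. ?P S)"
    proof
      fix M assume M: "M \<in> perfect_matchings V {e\<in>E \<union> C. e \<subseteq> V}"
      then have sub: "M \<subseteq> {e\<in>E \<union> C. e \<subseteq> V}"
        and ex: "\<And>v. v \<in> V \<Longrightarrow> \<exists>!e. e \<in> M \<and> v \<in> e" by (auto simp: perfect_matchings_def)
      have uniq: "e = f" if "e \<in> M" "f \<in> M" "v \<in> e" "v \<in> f" for e f v
      proof -
        have "v \<in> V" using that(1,3) sub by blast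
        then show ?thesis using ex[of v] that by (auto elim!: ex1E)
      qed
      have 1: "matching (M \<inter> C)" unfolding matching_def
      proof (intro ballI impI equals0I)
        fix e f v assume "e \<in> M \<inter> C" "f \<in> M \<inter> C" "e \<noteq> f" "v \<in> e \<inter> f"
        then show False using uniq[of e f v] by simp
      qed
      have 2: "e \<subseteq> V - \<Union>(M \<inter> C)" if e: "e \<in> M - C" for e
      proof
        fix v assume v: "v \<in> e"
        have "v \<notin> g" if "g \<in> M \<inter> C" for g using uniq[of e g v] e v that by auto
        then show "v \<in> V - \<Union>(M \<inter> C)" using e v sub by blast
      qed
      have 3: "\<exists>!e. e \<in> M - C \<and> v \<in> e" if v: "v \<in> V - \<Union>(M \<inter> C)" for v
      proof -
        obtain e where e: "e \<in> M" "v \<in> e" using ex[of v] v by blast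
        then have "e \<notin> C" using v by blast
        then show ?thesis using e uniq by (intro ex1I[of _ e]) auto
      qed
      have "M - C \<subseteq> ?F (M \<inter> C)" using sub 2 by blast
      then show "(M \<inter> C, M - C) \<in> (SIGMA S:?I. ?P S)"
        using 1 3 unfolding perfect_matchings_def by simp
    qed
    show "(\<lambda>M. (M \<inter> C, M - C)) (case x of (S, M) \<Rightarrow> S \<union> M) = x" if px: "x \<in> (SIGMA S:?I. ?P S)" for x
    proof -
      obtain S M where x: "x = (S, M)" and S: "S \<subseteq> C" and M: "M \<in> ?P S" using px by auto
      have "M \<subseteq> E" using M unfolding perfect_matchings_def by auto
      then have "(S \<union> M) \<inter> C = S" "(S \<union> M) - C = M" using S assms(3) by auto
      then show ?thesis by (simp add: x)
    qed
    show "(case (M \<inter> C, M - C) of (S, M) \<Rightarrow> S \<union> M) = M" for M by auto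
  qed
  then have "num_pm V (E \<union> C) = card (SIGMA S:?I. ?P S)"
    unfolding num_pm_def by (simp add: bij_betw_same_card)
  also have "\<dots> = (\<Sum>S\<in>?I. card (?P S))"
    using assms(1,2) by (intro card_SigmaI) (auto intro: finite_perfect_matchings)
  finally show ?thesis by (simp add: num_pm_def)
qed

text \<open>Edges of one part may end in deleted vertices; so they are required to avoid the other
  part instead of lying inside their own.\<close>

lemma num_pm_union:
  assumes "finite E1" "finite E2" "V1 \<inter> V2 = {}" "\<And>e. e \<in> E1 \<union> E2 \<Longrightarrow> e \<noteq> {}"
    "\<And>e. e \<in> E1 \<Longrightarrow> e \<inter> V2 = {}" "\<And>e. e \<in> E2 \<Longrightarrow> e \<inter> V1 = {}"
  shows "num_pm (V1 \<union> V2) (E1 \<union> E2) = num_pm V1 E1 * num_pm V2 E2"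
proof -
  let ?P1 = "perfect_matchings V1 {e\<in>E1. e \<subseteq> V1}" and ?P2 = "perfect_matchings V2 {e\<in>E2. e \<subseteq> V2}"
  let ?E = "{e\<in>E1 \<union> E2. e \<subseteq> V1 \<union> V2}"
  have dis: "{e\<in>E1. e \<subseteq> V1} \<inter> {e\<in>E2. e \<subseteq> V2} = {}"
  proof (rule equals0I)
    fix e assume e: "e \<in> {e\<in>E1. e \<subseteq> V1} \<inter> {e\<in>E2. e \<subseteq> V2}"
    then have "e \<subseteq> V1 \<inter> V2" by auto
    then show False using assms(3) assms(4)[of e] e by simp
  qed
  have "e \<subseteq> V1 \<union> V2 \<longleftrightarrow> e \<subseteq> V1" if "e \<in> E1" for e using assms(5)[OF that] by auto
  moreover have "e \<subseteq> V1 \<union> V2 \<longleftrightarrow> e \<subseteq> V2" if "e \<in> E2" for e using assms(6)[OF that] by auto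
  ultimately have E: "?E = {e\<in>E1. e \<subseteq> V1} \<union> {e\<in>E2. e \<subseteq> V2}" by auto
  let ?F1 = "{e\<in>E1. e \<subseteq> V1}" and ?F2 = "{e\<in>E2. e \<subseteq> V2}"
  have pm: "M \<union> N \<in> perfect_matchings (V1 \<union> V2) ?E \<longleftrightarrow> M \<in> ?P1 \<and> N \<in> ?P2"
    if M: "M \<subseteq> ?F1" and N: "N \<subseteq> ?F2" for M N
  proof -
    have 1: "e \<in> M \<union> N \<and> v \<in> e \<longleftrightarrow> e \<in> M \<and> v \<in> e" if v: "v \<in> V1" for e v
      using v N assms(3) by auto
    have 2: "e \<in> M \<union> N \<and> v \<in> e \<longleftrightarrow> e \<in> N \<and> v \<in> e" if v: "v \<in> V2" for e v
      using v M assms(3) by auto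
    have "M \<union> N \<subseteq> ?E" using M N by auto
    moreover have "(\<forall>v\<in>V1. \<exists>!e. e \<in> M \<union> N \<and> v \<in> e) \<longleftrightarrow> (\<forall>v\<in>V1. \<exists>!e. e \<in> M \<and> v \<in> e)"
      by (rule ball_cong[OF refl]) (simp only: 1)
    moreover have "(\<forall>v\<in>V2. \<exists>!e. e \<in> M \<union> N \<and> v \<in> e) \<longleftrightarrow> (\<forall>v\<in>V2. \<exists>!e. e \<in> N \<and> v \<in> e)"
      by (rule ball_cong[OF refl]) (simp only: 2)
    ultimately show ?thesis unfolding perfect_matchings_def mem_Collect_eq ball_Un using M N by simp
  qed
  have "bij_betw (\<lambda>(M, N). M \<union> N) (?P1 \<times> ?P2) (perfect_matchings (V1 \<union> V2) ?E)"
  proof (rule bij_betwI[where g = "\<lambda>M. (M \<inter> ?F1, M \<inter> ?F2)"])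
    show "(\<lambda>(M, N). M \<union> N) \<in> ?P1 \<times> ?P2 \<rightarrow> perfect_matchings (V1 \<union> V2) ?E"
    proof
      fix x assume "x \<in> ?P1 \<times> ?P2"
      then obtain M N where x: "x = (M, N)" "M \<in> ?P1" "N \<in> ?P2" by auto
      then have "M \<subseteq> ?F1" "N \<subseteq> ?F2" unfolding perfect_matchings_def by simp_all
      from pm[OF this] x show "(case x of (M, N) \<Rightarrow> M \<union> N) \<in> perfect_matchings (V1 \<union> V2) ?E" by simp
    qed
    show "(\<lambda>M. (M \<inter> ?F1, M \<inter> ?F2)) \<in> perfect_matchings (V1 \<union> V2) ?E \<rightarrow> ?P1 \<times> ?P2"
    proof
      fix M assume M: "M \<in> perfect_matchings (V1 \<union> V2) ?E"
      then have "M \<subseteq> ?E" unfolding perfect_matchings_def by simp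
      then have "(M \<inter> ?F1) \<union> (M \<inter> ?F2) = M" unfolding E by auto
      with M pm[of "M \<inter> ?F1" "M \<inter> ?F2"] show "(M \<inter> ?F1, M \<inter> ?F2) \<in> ?P1 \<times> ?P2" by simp
    qed
    show "(\<lambda>M. (M \<inter> ?F1, M \<inter> ?F2)) (case x of (M, N) \<Rightarrow> M \<union> N) = x" if px: "x \<in> ?P1 \<times> ?P2" for x
    proof -
      obtain M N where x: "x = (M, N)" "M \<in> ?P1" "N \<in> ?P2" using px by auto
      then have "M \<subseteq> ?F1" "N \<subseteq> ?F2" unfolding perfect_matchings_def by simp_all
      then have "(M \<union> N) \<inter> ?F1 = M" "(M \<union> N) \<inter> ?F2 = N" using dis by auto
      then show ?thesis by (simp add: x(1))
    qed
    show "(case (M \<inter> ?F1, M \<inter> ?F2) of (M, N) \<Rightarrow> M \<union> N) = M"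
      if pM: "M \<in> perfect_matchings (V1 \<union> V2) ?E" for M
    proof -
      have "M \<subseteq> ?F1 \<union> ?F2" using pM unfolding perfect_matchings_def E by simp
      then show ?thesis by auto
    qed
  qed
  then show ?thesis unfolding num_pm_def by (simp add: bij_betw_same_card[symmetric] card_cartesian_product)
qed

lemma num_pm_Union:
  assumes "finite I" "\<And>i. i \<in> I \<Longrightarrow> finite (E i)" "\<And>i e. i \<in> I \<Longrightarrow> e \<in> E i \<Longrightarrow> e \<noteq> {}"
    "\<And>i j. i \<in> I \<Longrightarrow> j \<in> I \<Longrightarrow> i \<noteq> j \<Longrightarrow> V i \<inter> V j = {}"
    "\<And>i j e. i \<in> I \<Longrightarrow> j \<in> I \<Longrightarrow> i \<noteq> j \<Longrightarrow> e \<in> E i \<Longrightarrow> e \<inter> V j = {}"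
  shows "num_pm (\<Union>i\<in>I. V i) (\<Union>i\<in>I. E i) = (\<Prod>i\<in>I. num_pm (V i) (E i))"
  using assms
proof (induction I rule: finite_induct)
  case empty
  show ?case using num_pm_empty[of "{}"] by (simp add: edges_def)
next
  case (insert i I)
  have "num_pm (V i \<union> (\<Union>i\<in>I. V i)) (E i \<union> (\<Union>i\<in>I. E i)) = num_pm (V i) (E i) * num_pm (\<Union>i\<in>I. V i) (\<Union>i\<in>I. E i)"
  proof (rule num_pm_union)
    show "V i \<inter> (\<Union>i\<in>I. V i) = {}" using insert.hyps(2) insert.prems(3)[of i] by blast
    show "e \<inter> (\<Union>i\<in>I. V i) = {}" if "e \<in> E i" for e
      using insert.hyps(2) insert.prems(4)[of i _ e] that by blast
    show "e \<inter> V i = {}" if "e \<in> (\<Union>i\<in>I. E i)" for e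
      using insert.hyps(2) insert.prems(4)[of _ i e] that by blast
    show "finite (E i)" by (rule insert.prems(1)) simp
    show "finite (\<Union>i\<in>I. E i)" using insert.hyps(1) insert.prems(1) by (intro finite_UN_I) simp_all
    show "e \<noteq> {}" if "e \<in> E i \<union> (\<Union>i\<in>I. E i)" for e
      using that insert.prems(2)[of _ e] by blast
  qed
  moreover have "num_pm (\<Union>i\<in>I. V i) (\<Union>i\<in>I. E i) = (\<Prod>i\<in>I. num_pm (V i) (E i))"
  proof (rule insert.IH)
    show "finite (E j)" if "j \<in> I" for j using insert.prems(1)[of j] that by simp
    show "e \<noteq> {}" if "j \<in> I" "e \<in> E j" for j e using insert.prems(2)[of j e] that by simp
    show "V j \<inter> V k = {}" if "j \<in> I" "k \<in> I" "j \<noteq> k" for j k using insert.prems(3)[of j k] that by simp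
    show "e \<inter> V k = {}" if "j \<in> I" "k \<in> I" "j \<noteq> k" "e \<in> E j" for j k e
      using insert.prems(4)[of j k e] that by simp
  qed
  ultimately show ?case by (simp only: UN_insert prod.insert[OF insert.hyps])
qed

lemma num_pm_image:
  assumes "inj_on f W" "V \<subseteq> W" "\<And>e. e \<in> E \<Longrightarrow> e \<subseteq> W"
  shows "num_pm (f ` V) ((`) f ` E) = num_pm V E"
proof -
  have F: "{e \<in> (`) f ` E. e \<subseteq> f ` V} = (`) f ` {e\<in>E. e \<subseteq> V}"
  proof -
    have "f ` e \<subseteq> f ` V \<longleftrightarrow> e \<subseteq> V" if "e \<in> E" for e
      using assms(3)[OF that] by (rule inj_on_image_subset_iff[OF assms(1) _ assms(2)])
    then show ?thesis by blast
  qed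
  have "bij_betw ((`) ((`) f)) (perfect_matchings V {e\<in>E. e \<subseteq> V}) (perfect_matchings (f ` V) {e \<in> (`) f ` E. e \<subseteq> f ` V})"
    unfolding F
  proof (rule bij_betw_imageI)
    have i: "inj_on ((`) f) {e\<in>E. e \<subseteq> V}"
    proof (rule inj_onI)
      fix e e' assume "e \<in> {e\<in>E. e \<subseteq> V}" "e' \<in> {e\<in>E. e \<subseteq> V}" "f ` e = f ` e'"
      moreover have "e \<subseteq> W" "e' \<subseteq> W" using calculation assms(3) by simp_all
      ultimately show "e = e'" using inj_on_image_eq_iff[OF assms(1), of e e'] by simp
    qed
    show "inj_on ((`) ((`) f)) (perfect_matchings V {e\<in>E. e \<subseteq> V})"
      using inj_on_image_Pow[OF i] by (rule inj_on_subset) (auto simp: perfect_matchings_def)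
    have key: "(\<forall>v\<in>f ` V. \<exists>!e. e \<in> (`) f ` M \<and> v \<in> e) \<longleftrightarrow> (\<forall>v\<in>V. \<exists>!e. e \<in> M \<and> v \<in> e)"
      if M: "M \<subseteq> {e\<in>E. e \<subseteq> V}" for M
    proof -
      have "(\<exists>!e. e \<in> (`) f ` M \<and> f v \<in> e) \<longleftrightarrow> (\<exists>!e. e \<in> M \<and> v \<in> e)" if v: "v \<in> V" for v
      proof -
        have sub: "e \<subseteq> W" if "e \<in> M" for e using subsetD[OF M that] assms(2) by auto
        have mem: "f v \<in> f ` e \<longleftrightarrow> v \<in> e" if "e \<in> M" for e
          using inj_on_image_mem_iff[OF assms(1) _ sub[OF that], of v] subsetD[OF assms(2) v] by simp
        have eq: "e = e'" if "e \<in> M" "e' \<in> M" "f ` e = f ` e'" for e e'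
          using inj_on_image_eq_iff[OF assms(1) sub[OF that(1)] sub[OF that(2)]] that(3) by simp
        show ?thesis
        proof
          assume "\<exists>!e. e \<in> (`) f ` M \<and> f v \<in> e"
          then obtain e where e: "e \<in> M" "f v \<in> f ` e"
            and u: "\<And>e'. e' \<in> (`) f ` M \<Longrightarrow> f v \<in> e' \<Longrightarrow> e' = f ` e" by (auto elim!: ex1E)
          show "\<exists>!e. e \<in> M \<and> v \<in> e"
          proof (rule ex1I[of _ e])
            show "e \<in> M \<and> v \<in> e" using e mem by simp
            fix e' assume "e' \<in> M \<and> v \<in> e'"
            then show "e' = e" using u[of "f ` e'"] e(1) by (intro eq) auto
          qed
        next
          assume "\<exists>!e. e \<in> M \<and> v \<in> e"
          then obtain e where e: "e \<in> M" "v \<in> e" and u: "\<And>e'. e' \<in> M \<Longrightarrow> v \<in> e' \<Longrightarrow> e' = e" by blast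
          show "\<exists>!e. e \<in> (`) f ` M \<and> f v \<in> e"
          proof (rule ex1I[of _ "f ` e"])
            show "f ` e \<in> (`) f ` M \<and> f v \<in> f ` e" using e by simp
            fix e' assume "e' \<in> (`) f ` M \<and> f v \<in> e'"
            then obtain d where d: "d \<in> M" "e' = f ` d" "f v \<in> f ` d" by blast
            then show "e' = f ` e" using u[of d] mem[of d] by simp
          qed
        qed
      qed
      then show ?thesis by simp
    qed
    show "(`) ((`) f) ` perfect_matchings V {e\<in>E. e \<subseteq> V} = perfect_matchings (f ` V) ((`) f ` {e\<in>E. e \<subseteq> V})"
    proof (intro equalityI subsetI)
      fix N assume "N \<in> (`) ((`) f) ` perfect_matchings V {e\<in>E. e \<subseteq> V}"
      then obtain M where M: "M \<subseteq> {e\<in>E. e \<subseteq> V}" "\<forall>v\<in>V. \<exists>!e. e \<in> M \<and> v \<in> e" and N: "N = (`) f ` M"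
        unfolding perfect_matchings_def by blast
      have "N \<subseteq> (`) f ` {e\<in>E. e \<subseteq> V}" unfolding N using M(1) by (rule image_mono)
      moreover have "\<forall>v\<in>f ` V. \<exists>!e. e \<in> N \<and> v \<in> e" unfolding N key[OF M(1)] by (rule M(2))
      ultimately show "N \<in> perfect_matchings (f ` V) ((`) f ` {e\<in>E. e \<subseteq> V})"
        unfolding perfect_matchings_def by simp
    next
      fix N assume "N \<in> perfect_matchings (f ` V) ((`) f ` {e\<in>E. e \<subseteq> V})"
      then have N: "N \<subseteq> (`) f ` {e\<in>E. e \<subseteq> V}" "\<forall>v\<in>f ` V. \<exists>!e. e \<in> N \<and> v \<in> e"
        unfolding perfect_matchings_def by simp_all
      from N(1) obtain M where M: "M \<subseteq> {e\<in>E. e \<subseteq> V}" "N = (`) f ` M"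
        unfolding subset_image_iff by blast
      have "\<forall>v\<in>V. \<exists>!e. e \<in> M \<and> v \<in> e" using N(2) unfolding M(2) key[OF M(1)] .
      then have "M \<in> perfect_matchings V {e\<in>E. e \<subseteq> V}" using M(1) unfolding perfect_matchings_def by simp
      then show "N \<in> (`) ((`) f) ` perfect_matchings V {e\<in>E. e \<subseteq> V}" unfolding M(2) by (rule imageI)
    qed
  qed
  then show ?thesis unfolding num_pm_def by (simp add: bij_betw_same_card)
qed

lemma edges_Un: "edges (A \<union> B) \<longleftrightarrow> edges A \<and> edges B"
  unfolding edges_def by auto

lemma num_pm_singleton: "edges E \<Longrightarrow> num_pm {x} E = 0"
  by (rule num_pm_odd) auto

text \<open>Either the middle edge covers \<open>x\<close> and \<open>y\<close>, or both outer edges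
  are used and consume \<open>f\<close> and \<open>g\<close>; a single outer edge would leave one
  inner vertex uncovered. The condition allows for ends that have been deleted already.\<close>

lemma num_pm_path:
  assumes V: "finite V" "x \<notin> V" "y \<notin> V" and E: "edges E" "\<And>e. e \<in> E \<Longrightarrow> x \<notin> e \<and> y \<notin> e"
    and fg: "f \<noteq> g" "f \<noteq> x" "f \<noteq> y" "g \<noteq> x" "g \<noteq> y" "x \<noteq> y"
  shows "num_pm (V \<union> {x, y}) (E \<union> {{f, x}, {x, y}, {y, g}}) =
    num_pm V E + (if f \<in> V \<and> g \<in> V then num_pm (V - {f, g}) E else 0)"
proof -
  let ?V = "V \<union> {x, y}" and ?E = "E \<union> {{x, y}}"
  let ?C = "{e \<in> {{f, x}, {y, g}}. e \<subseteq> ?V}"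
  have exy: "edges {{x, y}}" using fg by (auto simp: edges_def)
  have E': "edges ?E" using E(1) exy by (simp only: edges_Un)
  have "num_pm ?V (E \<union> {{f, x}, {x, y}, {y, g}}) = num_pm ?V (?E \<union> ?C)"
    by (rule num_pm_cong) auto
  also have "\<dots> = (\<Sum>S | S \<subseteq> ?C \<and> matching S. num_pm (?V - \<Union>S) ?E)"
  proof (rule num_pm_split)
    show "finite ?E" using E' by (simp add: edges_def)
    show "?E \<inter> ?C = {}" using E(2) fg by (auto simp: doubleton_eq_iff)
  qed auto
  also have "{S. S \<subseteq> ?C \<and> matching S} = Pow ?C"
    using fg by (auto simp: matching_def)
  finally have 1: "num_pm ?V (E \<union> {{f, x}, {x, y}, {y, g}}) = (\<Sum>S\<in>Pow ?C. num_pm (?V - \<Union>S) ?E)" .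
  have part: "num_pm (A \<union> B) ?E = num_pm A E * num_pm B {{x, y}}" if "A \<subseteq> V" "B \<subseteq> {x, y}" for A B
  proof (rule num_pm_union)
    show "e \<noteq> {}" if "e \<in> E \<union> {{x, y}}" for e using E' that by (auto simp: edges_def)
    show "e \<inter> B = {}" if "e \<in> E" for e using E(2)[OF that] \<open>B \<subseteq> {x, y}\<close> by auto
  qed (use E' that V in \<open>auto simp: edges_def\<close>)
  have t0: "num_pm ?V ?E = num_pm V E"
    using part[of V "{x, y}"] num_pm_pair[OF exy fg(6)] by simp
  have t1: "num_pm (?V - {f, x}) ?E = 0"
  proof -
    have "?V - {f, x} = (V - {f}) \<union> {y}" using fg V by auto
    then show ?thesis using part[of "V - {f}" "{y}"] num_pm_singleton[OF exy, of y] by auto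
  qed
  have t2: "num_pm (?V - {y, g}) ?E = 0"
  proof -
    have "?V - {y, g} = (V - {g}) \<union> {x}" using fg V by auto
    then show ?thesis using part[of "V - {g}" "{x}"] num_pm_singleton[OF exy, of x] by auto
  qed
  have t3: "num_pm (?V - ({f, x} \<union> {y, g})) ?E = num_pm (V - {f, g}) E"
  proof -
    have "?V - ({f, x} \<union> {y, g}) = (V - {f, g}) \<union> {}" using fg V by auto
    then show ?thesis using part[of "V - {f, g}" "{}"] num_pm_empty[OF exy] by auto
  qed
  have ne: "{f, x} \<noteq> {y, g}" using fg by (auto simp: doubleton_eq_iff)
  consider (both) "f \<in> V" "g \<in> V" | (f) "f \<in> V" "g \<notin> V" | (g) "f \<notin> V" "g \<in> V" | (none) "f \<notin> V" "g \<notin> V"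
    by blast
  then show ?thesis
  proof cases
    case both
    then have "?C = {{f, x}, {y, g}}" by auto
    moreover have "Pow {{f, x}, {y, g}} = {{}, {{f, x}}, {{y, g}}, {{f, x}, {y, g}}}" by (auto simp: Pow_insert)
    moreover have "(\<Sum>S\<in>{{}, {{f, x}}, {{y, g}}, {{f, x}, {y, g}}}. num_pm (?V - \<Union>S) ?E) =
        num_pm ?V ?E + (num_pm (?V - {f, x}) ?E + (num_pm (?V - {y, g}) ?E + num_pm (?V - ({f, x} \<union> {y, g})) ?E))"
      using ne by simp
    ultimately show ?thesis using 1 both unfolding t0 t1 t2 t3 by simp
  next
    case f
    then have C: "?C = {{f, x}}" using fg by auto
    have P: "Pow {{f, x}} = {{}, {{f, x}}}" by (auto simp: Pow_insert)
    have "(\<Sum>S\<in>{{}, {{f, x}}}. num_pm (?V - \<Union>S) ?E) = num_pm ?V ?E + num_pm (?V - {f, x}) ?E" by simp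
    then show ?thesis using 1 f unfolding C P t0 t1 by simp
  next
    case g
    then have C: "?C = {{y, g}}" using fg by auto
    have P: "Pow {{y, g}} = {{}, {{y, g}}}" by (auto simp: Pow_insert)
    have "(\<Sum>S\<in>{{}, {{y, g}}}. num_pm (?V - \<Union>S) ?E) = num_pm ?V ?E + num_pm (?V - {y, g}) ?E" by simp
    then show ?thesis using 1 g unfolding C P t0 t2 by simp
  next
    case none
    then have C: "?C = {}" using fg by auto
    show ?thesis using 1 none unfolding C Pow_empty by (simp add: t0[simplified])
  qed
qed

subsection \<open>A weighted edge\<close>

text \<open>A path of three edges through two new vertices adds to the number of perfect matchings the
  number of those of the old graph without the two ends of the path.  The ends are chosen such
  that each of the first \<open>m - 1\<close> paths adds 1, and such that the number of perfect matchings
  avoiding 0 and 1 grows from 1 to \<open>p\<close> with the paths 2 to \<open>p\<close> and is constant from then on.  This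
  gadget acts like an edge that may be chosen with relative weight \<open>p / m\<close>.\<close>

definition path_ends :: "nat \<Rightarrow> nat \<Rightarrow> nat \<times> nat" where
  "path_ends p k = (if k = 1 then (0, 1) else if k \<le> p then (2, 3) else (0, 2))"

definition path_edges :: "nat \<Rightarrow> nat \<Rightarrow> nat set set" where
  "path_edges p k = {{fst (path_ends p k), 2 * k}, {2 * k, 2 * k + 1}, {2 * k + 1, snd (path_ends p k)}}"

definition weight_edges :: "nat \<Rightarrow> nat \<Rightarrow> nat set set" where
  "weight_edges p m = {{0, 1}} \<union> (\<Union>k\<in>{1..<m}. path_edges p k)"

lemma path_ends_less: "1 \<le> k \<Longrightarrow> fst (path_ends p k) < 2 * k \<and> snd (path_ends p k) < 2 * k \<and>
    fst (path_ends p k) \<noteq> snd (path_ends p k)"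
  by (auto simp: path_ends_def)

lemma weight_edges_edges: "edges (weight_edges p m)"
proof -
  have "card e = 2" if "e \<in> path_edges p k" "1 \<le> k" for e k
    using path_ends_less[OF that(2), of p] that(1) by (auto simp: path_edges_def)
  then show ?thesis by (auto simp: edges_def weight_edges_def path_edges_def)
qed

lemma weight_edges_bound: "1 \<le> m \<Longrightarrow> e \<in> weight_edges p m \<Longrightarrow> e \<subseteq> {..<2 * m}"
proof -
  assume m: "1 \<le> m" and e: "e \<in> weight_edges p m"
  show ?thesis
  proof (cases "e = {0, 1}")
    case False
    then have "e \<in> (\<Union>k\<in>{1..<m}. path_edges p k)" using e unfolding weight_edges_def by blast
    then obtain k where k: "k \<in> {1..<m}" "e \<in> path_edges p k" by blast
    then show ?thesis using path_ends_less[of k p] by (auto simp: path_edges_def)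
  qed (use m in auto)
qed

lemma weight_edges_Suc:
  assumes "1 \<le> m"
  shows "weight_edges p (Suc m) = weight_edges p m \<union> path_edges p m"
proof -
  have "{1..<Suc m} = insert m {1..<m}" using assms by auto
  then show ?thesis by (auto simp: weight_edges_def)
qed

lemma num_pm_weight_Suc:
  assumes U: "U \<subseteq> {..<2 * m}" and m: "1 \<le> m"
  shows "num_pm ({..<2 * Suc m} - U) (weight_edges p (Suc m)) = num_pm ({..<2 * m} - U) (weight_edges p m) +
    (if fst (path_ends p m) \<notin> U \<and> snd (path_ends p m) \<notin> U
     then num_pm ({..<2 * m} - (U \<union> {fst (path_ends p m), snd (path_ends p m)})) (weight_edges p m) else 0)"
proof -
  let ?f = "fst (path_ends p m)" and ?g = "snd (path_ends p m)" and ?V = "{..<2 * m} - U"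
  note fg = path_ends_less[OF m, of p]
  have "{..<2 * Suc m} - U = ?V \<union> {2 * m, 2 * m + 1}" using U by auto
  moreover have "num_pm (?V \<union> {2 * m, 2 * m + 1}) (weight_edges p m \<union> {{?f, 2 * m}, {2 * m, 2 * m + 1}, {2 * m + 1, ?g}}) =
    num_pm ?V (weight_edges p m) + (if ?f \<in> ?V \<and> ?g \<in> ?V then num_pm (?V - {?f, ?g}) (weight_edges p m) else 0)"
  proof (rule num_pm_path)
    show "2 * m \<notin> e \<and> 2 * m + 1 \<notin> e" if "e \<in> weight_edges p m" for e
      using weight_edges_bound[OF m that] by auto
  qed (use fg weight_edges_edges in auto)
  moreover have "?V - {?f, ?g} = {..<2 * m} - (U \<union> {?f, ?g})" by auto
  ultimately show ?thesis using fg by (simp add: weight_edges_Suc[OF m] path_edges_def)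
qed

text \<open>Every path after the first has 2 as an end. Once 2 is deleted these paths can only use
  their middle edges, so they do not change the count.\<close>

lemma num_pm_weight_blocked:
  assumes "2 \<in> U" "U \<subseteq> {..<4}" "2 \<le> m"
  shows "num_pm ({..<2 * m} - U) (weight_edges p m) = num_pm ({..<4} - U) (weight_edges p 2)"
  using assms(3)
proof (induction m rule: dec_induct)
  case (step m)
  have "U \<subseteq> {..<2 * m}" using assms(2) step(1) by auto
  moreover have "fst (path_ends p m) = 2 \<or> snd (path_ends p m) = 2" using step(1) by (simp add: path_ends_def)
  ultimately show ?case using num_pm_weight_Suc[of U m p] step assms(1) by auto
qed simp

text \<open>Path \<open>k\<close> adds the number of matchings that avoid its ends, and for ends
  containing 2 this number is 1 by blocking. If 0 and 1 are deleted, the paths ending in 0 are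
  disabled and only those from 2 to 3 still add.\<close>

lemma num_pm_weight:
  assumes p: "1 \<le> p" and m: "2 \<le> m"
  shows "num_pm {..<2 * m} (weight_edges p m) = m"
    and "num_pm ({..<2 * m} - {0, 1}) (weight_edges p m) = (if m \<le> p then m - 1 else p)"
proof -
  let ?W = "weight_edges p"
  have e2: "?W 2 = {{0, 1}, {0, 2}, {2, 3}, {3, 1}}"
  proof -
    have "{1..<2} = {1::nat}" by auto
    then show ?thesis by (auto simp: weight_edges_def path_edges_def path_ends_def numeral_3_eq_3)
  qed
  have e1: "?W 1 = {{0, 1}}" by (simp add: weight_edges_def)
  have "edges (?W m)" for m by (rule weight_edges_edges)
  note pair = num_pm_pair[OF this]
  have s4: "{..<4} = {0, 1, 2, 3::nat}" by auto
  have s2: "{..<2} = {0, 1::nat}" by auto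
  have b01: "num_pm {0, 1} (?W 2) = 1" "num_pm {1, 3} (?W 2) = 1" "num_pm {2, 3} (?W 2) = 1" "num_pm {} (?W m) = 1" for m
    using pair[of 0 1 2] pair[of 1 3 2] pair[of 2 3 2] num_pm_empty[OF weight_edges_edges]
    by (auto simp: e2 insert_commute)
  have i: "{0, Suc 0} \<in> ?W (Suc 0)" by (simp add: weight_edges_def)
  have base: "num_pm {..<4} (?W 2) = 2"
    using num_pm_weight_Suc[of "{}" 1 p] pair[of 0 1 1] b01(4)[of 1]
    by (simp add: path_ends_def s2 e1 eval_nat_numeral lessThan_Suc insert_commute i)
  have base': "num_pm ({..<4} - {0, 1}) (?W 2) = 1"
  proof -
    have "{..<4} - {0, 1} = {2, 3::nat}" by auto
    then show ?thesis using b01(3) by simp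
  qed
  have x1: "num_pm ({..<2 * m} - {2, 3}) (?W m) = 1" if "2 \<le> m" for m
  proof -
    have "{..<4} - {2, 3} = {0, 1::nat}" by auto
    then show ?thesis using num_pm_weight_blocked[of "{2, 3}" m p] that b01(1) by auto
  qed
  have x2: "num_pm ({..<2 * m} - {0, 2}) (?W m) = 1" if "2 \<le> m" for m
  proof -
    have "{..<4} - {0, 2} = {1, 3::nat}" by auto
    then show ?thesis using num_pm_weight_blocked[of "{0, 2}" m p] that b01(2) by auto
  qed
  have x3: "num_pm ({..<2 * m} - {0, 1, 2, 3}) (?W m) = 1" if "2 \<le> m" for m
  proof -
    have e: "{..<4} - {0, 1, 2, 3::nat} = {}" by auto
    have "num_pm ({..<2 * m} - {0, 1, 2, 3}) (?W m) = num_pm ({..<4} - {0, 1, 2, 3}) (?W 2)"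
      by (rule num_pm_weight_blocked) (use that in auto)
    then show ?thesis unfolding e b01(4) .
  qed
  show "num_pm {..<2 * m} (?W m) = m"
    using m
  proof (induction m rule: dec_induct)
    case base
    show ?case using \<open>num_pm {..<4} (?W 2) = 2\<close> by simp
  next
    case (step m)
    then show ?case using num_pm_weight_Suc[of "{}" m p] x1[of m] x2[of m] by (auto simp: path_ends_def)
  qed
  show "num_pm ({..<2 * m} - {0, 1}) (?W m) = (if m \<le> p then m - 1 else p)"
    using m
  proof (induction m rule: dec_induct)
    case base
    show ?case using base' p by auto
  next
    case (step m)
    have "{0, 1} \<subseteq> {..<2 * m}" using step(1) by auto
    from num_pm_weight_Suc[OF this, of p] step x3[of m] show ?case
      by (auto simp: path_ends_def insert_commute)
  qed
qed

text \<open>This forces both ends of an edge to agree on whether it is selected.\<close>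

lemma num_pm_weight_odd:
  assumes "1 \<le> m"
  shows "num_pm ({..<2 * m} - {0}) (weight_edges p m) = 0" "num_pm ({..<2 * m} - {1}) (weight_edges p m) = 0"
  using assms by (auto intro!: num_pm_odd weight_edges_edges simp: card_Diff_singleton_if)

subsection \<open>A parity gadget\<close>

lemma num_pm_triangle:
  assumes "a \<noteq> b" "b \<noteq> c" "a \<noteq> c"
  shows "num_pm ({a, b, c} - U) {{a, b}, {b, c}, {a, c}} = of_bool (even (card ({a, b, c} - U)))"
proof -
  let ?E = "{{a, b}, {b, c}, {a, c}}"
  have E: "edges ?E" using assms by (auto simp: edges_def)
  note s = num_pm_singleton[OF E] num_pm_empty[OF E] num_pm_pair[OF E] num_pm_odd[OF _ E]
  consider "{a, b, c} - U = {a, b, c}" | "{a, b, c} - U = {a, b}" | "{a, b, c} - U = {a, c}" | "{a, b, c} - U = {b, c}" |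
    "{a, b, c} - U = {a}" | "{a, b, c} - U = {b}" | "{a, b, c} - U = {c}" | "{a, b, c} - U = {}"
    by (cases "a \<in> U"; cases "b \<in> U"; cases "c \<in> U") auto
  then show ?thesis by cases (use assms s(4)[of "{a, b, c}"] in \<open>simp_all add: s(1-3)\<close>)
qed

text \<open>However the middle vertices \<open>3 * w + 1\<close> of a chain of triangles are deleted, the rest has exactly one
  perfect matching if its order is even (the parity of the surviving vertices so far determines
  which linking edges are used) and none otherwise.\<close>

definition chain_edges :: "nat \<Rightarrow> nat set set" where
  "chain_edges m = (\<Union>w\<in>{..<m}. {{3 * w, 3 * w + 1}, {3 * w + 1, 3 * w + 2}, {3 * w, 3 * w + 2}}) \<union>
     (\<Union>w\<in>{1..<m}. {{3 * w - 1, 3 * w}})"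

lemma chain_edges_Suc:
  assumes "1 \<le> m"
  shows "chain_edges (Suc m) =
    chain_edges m \<union> {{3 * m, 3 * m + 1}, {3 * m + 1, 3 * m + 2}, {3 * m, 3 * m + 2}} \<union> {{3 * m - 1, 3 * m}}"
proof -
  have "{1..<Suc m} = insert m {1..<m}" using assms by auto
  then show ?thesis unfolding chain_edges_def by (simp only: lessThan_Suc UN_insert) blast
qed

lemma chain_edges_edges: "edges (chain_edges m)"
  by (auto simp: edges_def chain_edges_def)

lemma chain_edges_bound: "e \<in> chain_edges m \<Longrightarrow> e \<subseteq> {..<3 * m}"
  by (auto simp: chain_edges_def)

text \<open>The last vertex \<open>3 * m - 1\<close> may be deleted too, because the induction also
  needs the chain whose last vertex is consumed by the link to the next triangle.\<close>

lemma num_pm_chain: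
  assumes "1 \<le> m" "U \<subseteq> range (\<lambda>w. 3 * w + 1) \<union> {3 * m - 1}"
  shows "num_pm ({..<3 * m} - U) (chain_edges m) = of_bool (even (card ({..<3 * m} - U)))"
  using assms
proof (induction m arbitrary: U rule: dec_induct)
  case base
  have "{..<3 * 1} = {0, 1, 2::nat}" by auto
  moreover have "chain_edges 1 = {{0, 1}, {1, 2}, {0, 2}}" by (simp add: chain_edges_def eval_nat_numeral lessThan_Suc)
  ultimately show ?case using num_pm_triangle[of "0::nat" 1 2 U] by simp
next
  case (step m)
  let ?T = "{3 * m, 3 * m + 1, 3 * m + 2}" and ?L = "{..<3 * m}"
  let ?ET = "{{3 * m, 3 * m + 1}, {3 * m + 1, 3 * m + 2}, {3 * m, 3 * m + 2}}"
  let ?c = "{3 * m - 1, 3 * m}" and ?E = "chain_edges m \<union> ?ET"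
  have notU: "3 * m - 1 \<notin> U" "3 * m \<notin> U"
  proof -
    have *: "u mod 3 = 1 \<or> u = 3 * Suc m - 1" if "u \<in> U" for u using step.prems that by auto
    obtain k where k: "3 * m - 1 = 2 + 3 * k" using \<open>1 \<le> m\<close> by (cases m) auto
    have "(3 * m - 1) mod 3 \<noteq> 1" unfolding k mod_mult_self2 by simp
    moreover have "3 * m - 1 \<noteq> 3 * Suc m - 1" by simp
    ultimately have "3 * m - 1 \<notin> U" using *[of "3 * m - 1"] by blast
    then show "3 * m - 1 \<notin> U" .
    have "(3 * m) mod 3 \<noteq> 1" "3 * m \<noteq> 3 * Suc m - 1" by simp_all
    then show "3 * m \<notin> U" using *[of "3 * m"] by blast
  qed
  have V: "{..<3 * Suc m} - U = (?L - U) \<union> (?T - U)" by auto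
  have part: "num_pm ((?L - A) \<union> (?T - B)) ?E = num_pm (?L - A) (chain_edges m) * num_pm (?T - B) ?ET" for A B
  proof (rule num_pm_union)
    show "finite (chain_edges m)" using chain_edges_edges by (simp add: edges_def)
    show "e \<inter> (?T - B) = {}" if "e \<in> chain_edges m" for e using chain_edges_bound[OF that] by auto
    show "e \<noteq> {}" if "e \<in> ?E" for e using that chain_edges_edges[of m] by (auto simp: edges_def)
  qed auto
  \<comment> \<open>Distinguish whether the link between the old chain and the new triangle is
    used.\<close>
  have "num_pm ({..<3 * Suc m} - U) (?E \<union> {?c}) =
      (\<Sum>S | S \<subseteq> {?c} \<and> matching S. num_pm (({..<3 * Suc m} - U) - \<Union>S) ?E)"
  proof (rule num_pm_split)
    show "finite ?E" using chain_edges_edges by (simp add: edges_def)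
    have "?c \<notin> chain_edges m" using chain_edges_bound[of ?c m] by auto
    moreover have "?c \<notin> ?ET" using step.hyps by (auto simp: doubleton_eq_iff)
    ultimately show "?E \<inter> {?c} = {}" by blast
    show "e \<subseteq> {..<3 * Suc m} - U" if "e \<in> {?c}" for e using that notU by auto
  qed simp
  also have "{S. S \<subseteq> {?c} \<and> matching S} = {{}, {?c}}" by (auto simp: matching_def)
  also have "(\<Sum>S\<in>{{}, {?c}}. num_pm (({..<3 * Suc m} - U) - \<Union>S) ?E) =
      num_pm ({..<3 * Suc m} - U) ?E + num_pm (({..<3 * Suc m} - U) - ?c) ?E" by simp
  also have "({..<3 * Suc m} - U) - ?c = (?L - (U \<union> {3 * m - 1})) \<union> (?T - (U \<union> {3 * m}))"
    using step.hyps by auto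
  also have "num_pm ({..<3 * Suc m} - U) ?E = num_pm (?L - U) (chain_edges m) * num_pm (?T - U) ?ET"
    unfolding V by (rule part)
  also have "num_pm ((?L - (U \<union> {3 * m - 1})) \<union> (?T - (U \<union> {3 * m}))) ?E =
      num_pm (?L - (U \<union> {3 * m - 1})) (chain_edges m) * num_pm (?T - (U \<union> {3 * m})) ?ET"
    by (rule part)
  also have "num_pm (?L - U) (chain_edges m) = of_bool (even (card (?L - U)))"
  proof -
    have "?L - U = ?L - (U \<inter> ?L)" by auto
    moreover have "U \<inter> ?L \<subseteq> range (\<lambda>w. 3 * w + 1) \<union> {3 * m - 1}" using step.prems by auto
    ultimately show ?thesis using step.IH[of "U \<inter> ?L"] by simp
  qed
  also have "num_pm (?L - (U \<union> {3 * m - 1})) (chain_edges m) = of_bool (even (card (?L - (U \<union> {3 * m - 1}))))"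
  proof -
    have "?L - (U \<union> {3 * m - 1}) = ?L - ((U \<inter> ?L) \<union> {3 * m - 1})" by auto
    moreover have "(U \<inter> ?L) \<union> {3 * m - 1} \<subseteq> range (\<lambda>w. 3 * w + 1) \<union> {3 * m - 1}" using step.prems by auto
    ultimately show ?thesis using step.IH[of "(U \<inter> ?L) \<union> {3 * m - 1}"] by simp
  qed
  also have "num_pm (?T - U) ?ET = of_bool (even (card (?T - U)))"
    by (rule num_pm_triangle) auto
  also have "num_pm (?T - (U \<union> {3 * m})) ?ET = of_bool (even (card (?T - (U \<union> {3 * m}))))"
    by (rule num_pm_triangle) auto
  finally have 1: "num_pm ({..<3 * Suc m} - U) (?E \<union> {?c}) =
      of_bool (even (card (?L - U))) * of_bool (even (card (?T - U))) +
      of_bool (even (card (?L - (U \<union> {3 * m - 1})))) * of_bool (even (card (?T - (U \<union> {3 * m}))))" .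
  \<comment> \<open>Using the link flips the parity on both sides. If the two parities agree,
    exactly one of the two terms is 1; otherwise both vanish.\<close>
  have "?L - U = insert (3 * m - 1) (?L - (U \<union> {3 * m - 1}))" using notU step.hyps by auto
  then have a: "card (?L - U) = Suc (card (?L - (U \<union> {3 * m - 1})))"
    by (metis (no_types, lifting) DiffE UnCI card_insert_disjoint finite_Diff finite_lessThan insertI1)
  have "?T - U = insert (3 * m) (?T - (U \<union> {3 * m}))" using notU by auto
  then have b: "card (?T - U) = Suc (card (?T - (U \<union> {3 * m})))"
    by (metis (no_types, lifting) DiffE UnCI card_insert_disjoint finite_Diff finite.emptyI finite_insert insertI1)
  have c: "card ({..<3 * Suc m} - U) = card (?L - U) + card (?T - U)"
    unfolding V by (rule card_Un_disjoint) auto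
  show ?case unfolding chain_edges_Suc[OF step.hyps(1)] 1 c a b by simp
qed

section \<open>Odd subgraphs, weighted by \<open>p / q\<close>, as perfect matchings\<close>

section \<open>From odd subgraphs to perfect matchings\<close>

lemma degree_eq_card_neighbours:
  assumes "finite_graph V E" "A \<subseteq> E"
  shows "degree A v = card {w. {v, w} \<in> A}"
proof -
  have "bij_betw (\<lambda>w. {v, w}) {w. {v, w} \<in> A} {e\<in>A. v \<in> e}"
  proof (rule bij_betw_imageI)
    show "inj_on (\<lambda>w. {v, w}) {w. {v, w} \<in> A}" by (auto simp: inj_on_def doubleton_eq_iff)
    show "(\<lambda>w. {v, w}) ` {w. {v, w} \<in> A} = {e\<in>A. v \<in> e}"
    proof
      show "{e\<in>A. v \<in> e} \<subseteq> (\<lambda>w. {v, w}) ` {w. {v, w} \<in> A}"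
      proof
        fix e assume e: "e \<in> {e\<in>A. v \<in> e}"
        then have "card e = 2" using assms by (auto simp: finite_graph_def)
        then obtain a b where "e = {a, b}" by (auto simp: card_2_iff)
        with e show "e \<in> (\<lambda>w. {v, w}) ` {w. {v, w} \<in> A}" by (auto simp: insert_commute)
      qed
    qed auto
  qed
  then show ?thesis unfolding degree_def by (simp add: bij_betw_same_card)
qed

text \<open>Vertex \<open>v\<close> becomes a chain of triangles \<open>(v, w, 0..2)\<close>, whose middle vertex \<open>(v, w, 1)\<close> is
  consumed if the edge from \<open>v\<close> to \<open>w\<close> is selected; the vertices \<open>(v, w, j)\<close> with \<open>3 \<le> j\<close> form the weight
  gadget of that edge if \<open>v < w\<close>.  The chain has odd length \<open>2 * n + 1\<close> to make the selected degree odd.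
  The remaining weight gadgets are idle and contribute a constant factor.\<close>

definition chain_vertex :: "nat \<Rightarrow> nat \<Rightarrow> nat \<times> nat \<times> nat" where
  "chain_vertex v j = (v, j div 3, j mod 3)"

definition weight_vertex :: "nat \<times> nat \<Rightarrow> nat \<Rightarrow> nat \<times> nat \<times> nat" where
  "weight_vertex x j = (fst x, snd x, 3 + j)"

definition matching_vertices :: "nat \<Rightarrow> nat \<Rightarrow> (nat \<times> nat \<times> nat) set" where
  "matching_vertices n q = {..<n} \<times> {..<2 * n + 1} \<times> {..<3 + 2 * q}"

definition gadget_edges :: "nat \<Rightarrow> nat \<Rightarrow> nat \<Rightarrow> (nat \<times> nat \<times> nat) set set" where
  "gadget_edges n p q = (\<Union>v\<in>{..<n}. (`) (chain_vertex v) ` chain_edges (2 * n + 1)) \<union>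
     (\<Union>x\<in>{..<n} \<times> {..<2 * n + 1}. (`) (weight_vertex x) ` weight_edges p q)"

text \<open>Third coordinates 3 and 4 are the ends 0 and 1 of the weight gadget at
  \<open>(Min e, Max e)\<close>. The two connectors tie these to the middle vertices reserved for
  \<open>e\<close> in the chains of its two end vertices.\<close>

definition lower_connector :: "nat set \<Rightarrow> (nat \<times> nat \<times> nat) set" where
  "lower_connector e = {(Min e, Max e, 3), (Min e, Max e, 1)}"

definition upper_connector :: "nat set \<Rightarrow> (nat \<times> nat \<times> nat) set" where
  "upper_connector e = {(Min e, Max e, 4), (Max e, Min e, 1)}"

definition matching_edges :: "nat \<Rightarrow> nat set set \<Rightarrow> nat \<Rightarrow> nat \<Rightarrow> (nat \<times> nat \<times> nat) set set" where
  "matching_edges n E p q = gadget_edges n p q \<union> (lower_connector ` E \<union> upper_connector ` E)"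

lemma edges_image:
  assumes "inj f" "edges E"
  shows "edges ((`) f ` E)"
  using assms by (auto simp: edges_def card_image inj_on_subset[OF assms(1)])

lemma inj_chain_vertex: "inj (chain_vertex v)"
proof (rule injI)
  fix a b assume "chain_vertex v a = chain_vertex v b"
  then have *: "a div 3 = b div 3" "a mod 3 = b mod 3" unfolding chain_vertex_def by blast+
  have "a = 3 * (a div 3) + a mod 3" by (rule mult_div_mod_eq[symmetric])
  also have "\<dots> = b" unfolding * by (rule mult_div_mod_eq)
  finally show "a = b" .
qed

lemma inj_weight_vertex: "inj (weight_vertex x)"
  unfolding weight_vertex_def by (rule injI) simp

lemma finite_graph_pair:
  assumes "finite_graph {..<n} E" "e \<in> E"
  shows "e = {Min e, Max e}" "Min e < Max e" "Max e < n"
proof -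
  have "card e = 2" "e \<subseteq> {..<n}" using assms by (auto simp: finite_graph_def)
  then obtain a b where "e = {a, b}" "a \<noteq> b" by (auto simp: card_2_iff)
  with \<open>e \<subseteq> {..<n}\<close> show "e = {Min e, Max e}" "Min e < Max e" "Max e < n"
    by (auto simp: min_def max_def)
qed

lemma gadget_edges_edges: "edges (gadget_edges n p q)"
proof -
  have "edges ((`) (chain_vertex v) ` chain_edges m)" for v m
    by (rule edges_image[OF inj_chain_vertex chain_edges_edges])
  moreover have "edges ((`) (weight_vertex x) ` weight_edges p q)" for x
    by (rule edges_image[OF inj_weight_vertex weight_edges_edges])
  ultimately show ?thesis unfolding gadget_edges_def edges_def by blast
qed

text \<open>Without the connectors the graph falls apart into chains, with third coordinate below 3,
  and weight gadgets, with third coordinate from 3 on; their counts multiply.\<close>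

lemma num_pm_gadgets:
  assumes U: "\<And>v. U v \<subseteq> {..<3 * (2 * n + 1)}" and X: "\<And>x. X x \<subseteq> {..<2 * q}" and q: "1 \<le> q"
  shows "num_pm ((\<Union>v\<in>{..<n}. chain_vertex v ` ({..<3 * (2 * n + 1)} - U v)) \<union>
      (\<Union>x\<in>{..<n} \<times> {..<2 * n + 1}. weight_vertex x ` ({..<2 * q} - X x))) (gadget_edges n p q) =
    (\<Prod>v<n. num_pm ({..<3 * (2 * n + 1)} - U v) (chain_edges (2 * n + 1))) *
    (\<Prod>x\<in>{..<n} \<times> {..<2 * n + 1}. num_pm ({..<2 * q} - X x) (weight_edges p q))"
proof -
  let ?m = "2 * n + 1" and ?J = "{..<n} \<times> {..<2 * n + 1}"
  let ?VC = "\<lambda>v. chain_vertex v ` ({..<3 * ?m} - U v)" and ?EC = "\<lambda>v. (`) (chain_vertex v) ` chain_edges ?m"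
  let ?VW = "\<lambda>x. weight_vertex x ` ({..<2 * q} - X x)" and ?EW = "\<lambda>x. (`) (weight_vertex x) ` weight_edges p q"
  have EC: "edges (?EC v)" for v by (rule edges_image[OF inj_chain_vertex chain_edges_edges])
  have EW: "edges (?EW x)" for x by (rule edges_image[OF inj_weight_vertex weight_edges_edges])
  have subC: "e \<subseteq> range (chain_vertex v)" if "e \<in> ?EC v" for e v using that by auto
  have subW: "e \<subseteq> range (weight_vertex x)" if "e \<in> ?EW x" for e x using that by auto
  have dCC: "range (chain_vertex v) \<inter> range (chain_vertex v') = {}" if "v \<noteq> v'" for v v'
    using that by (auto simp: chain_vertex_def)
  have dWW: "range (weight_vertex x) \<inter> range (weight_vertex x') = {}" if "x \<noteq> x'" for x x'
    using that by (cases x; cases x') (auto simp: weight_vertex_def)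
  have dCW: "range (chain_vertex v) \<inter> range (weight_vertex x) = {}" for v x
  proof (rule equals0I)
    fix y assume "y \<in> range (chain_vertex v) \<inter> range (weight_vertex x)"
    then obtain j k where "chain_vertex v j = weight_vertex x k" by auto
    then have "j mod 3 = 3 + k" by (simp add: chain_vertex_def weight_vertex_def)
    moreover have "j mod 3 < 3" by simp
    ultimately show False by linarith
  qed
  have ne: "e \<noteq> {}" if "edges F" "e \<in> F" for e :: "(nat \<times> nat \<times> nat) set" and F
    using that by (auto simp: edges_def)
  have "num_pm ((\<Union>v\<in>{..<n}. ?VC v) \<union> (\<Union>x\<in>?J. ?VW x)) ((\<Union>v\<in>{..<n}. ?EC v) \<union> (\<Union>x\<in>?J. ?EW x)) =
      num_pm (\<Union>v\<in>{..<n}. ?VC v) (\<Union>v\<in>{..<n}. ?EC v) * num_pm (\<Union>x\<in>?J. ?VW x) (\<Union>x\<in>?J. ?EW x)"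
  proof (rule num_pm_union)
    show "finite (\<Union>v\<in>{..<n}. ?EC v)" using EC by (auto simp: edges_def)
    show "finite (\<Union>x\<in>?J. ?EW x)" using EW by (auto simp: edges_def)
    show "(\<Union>v\<in>{..<n}. ?VC v) \<inter> (\<Union>x\<in>?J. ?VW x) = {}" using dCW by blast
    show "e \<noteq> {}" if "e \<in> (\<Union>v\<in>{..<n}. ?EC v) \<union> (\<Union>x\<in>?J. ?EW x)" for e
      using that ne[OF EC] ne[OF EW] by blast
    show "e \<inter> (\<Union>x\<in>?J. ?VW x) = {}" if eC: "e \<in> (\<Union>v\<in>{..<n}. ?EC v)" for e
    proof -
      from eC obtain v where "e \<in> ?EC v" by blast
      then have "e \<subseteq> range (chain_vertex v)" by (rule subC)
      then show ?thesis using dCW by blast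
    qed
    show "e \<inter> (\<Union>v\<in>{..<n}. ?VC v) = {}" if eW: "e \<in> (\<Union>x\<in>?J. ?EW x)" for e
    proof -
      from eW obtain x where "e \<in> ?EW x" by blast
      then have "e \<subseteq> range (weight_vertex x)" by (rule subW)
      then show ?thesis using dCW by blast
    qed
  qed
  also have "num_pm (\<Union>v\<in>{..<n}. ?VC v) (\<Union>v\<in>{..<n}. ?EC v) = (\<Prod>v<n. num_pm (?VC v) (?EC v))"
  proof (rule num_pm_Union)
    show "e \<inter> ?VC v' = {}" if "v \<noteq> v'" "e \<in> ?EC v" for v v' e
      using subC[OF that(2)] dCC[OF that(1)] by blast
    show "?VC v \<inter> ?VC v' = {}" if "v \<noteq> v'" for v v' using dCC[OF that] by blast
  qed (use EC ne[OF EC] in \<open>auto simp: edges_def\<close>)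
  also have "num_pm (\<Union>x\<in>?J. ?VW x) (\<Union>x\<in>?J. ?EW x) = (\<Prod>x\<in>?J. num_pm (?VW x) (?EW x))"
  proof (rule num_pm_Union)
    show "e \<inter> ?VW x' = {}" if "x \<noteq> x'" "e \<in> ?EW x" for x x' e
      using subW[OF that(2)] dWW[OF that(1)] by blast
    show "?VW x \<inter> ?VW x' = {}" if "x \<noteq> x'" for x x' using dWW[OF that] by blast
  qed (use EW ne[OF EW] in \<open>auto simp: edges_def\<close>)
  also have "(\<Prod>v<n. num_pm (?VC v) (?EC v)) = (\<Prod>v<n. num_pm ({..<3 * ?m} - U v) (chain_edges ?m))"
    by (intro prod.cong refl num_pm_image[OF inj_chain_vertex]) auto
  also have "(\<Prod>x\<in>?J. num_pm (?VW x) (?EW x)) = (\<Prod>x\<in>?J. num_pm ({..<2 * q} - X x) (weight_edges p q))"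
    by (intro prod.cong refl num_pm_image[OF inj_weight_vertex]) auto
  finally show ?thesis unfolding gadget_edges_def .
qed

text \<open>Sum over the set \<open>A\<close> of lower and the set \<open>B\<close> of upper
  connectors used. The weight gadgets annihilate all terms with \<open>A \<noteq> B\<close> and give
  \<open>p\<close> for each edge in \<open>A\<close> and \<open>q\<close> for each other pair; the
  chains annihilate the terms in which some degree is even.\<close>

theorem num_pm_matching_graph:
  assumes G: "finite_graph {..<n} E" and pq: "1 \<le> p" "p < q"
  shows "num_pm (matching_vertices n q) (matching_edges n E p q) =
    (\<Sum>A\<in>odd_subgraphs {..<n} E. p ^ card A * q ^ (n * (2 * n + 1) - card A))"
proof -
  let ?m = "2 * n + 1" and ?J = "{..<n} \<times> {..<2 * n + 1}" and ?V = "matching_vertices n q"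
  let ?C = "lower_connector ` E \<union> upper_connector ` E" and ?E0 = "gadget_edges n p q"
  note pair = finite_graph_pair[OF G]
  have finE: "finite E" by (rule finite_graph_finite_edges[OF G])
  have eqI: "e = f" if "e \<in> E" "f \<in> E" "Min e = Min f" "Max e = Max f" for e f
    using pair(1)[OF that(1)] pair(1)[OF that(2)] that(3,4) by simp
  have dl: "lower_connector e \<inter> lower_connector f = {}" if "e \<in> E" "f \<in> E" "e \<noteq> f" for e f
    using eqI[OF that(1,2)] that(3) by (auto simp: lower_connector_def)
  have du: "upper_connector e \<inter> upper_connector f = {}" if "e \<in> E" "f \<in> E" "e \<noteq> f" for e f
    using eqI[OF that(1,2)] that(3) by (auto simp: upper_connector_def)
  have dlu: "lower_connector e \<inter> upper_connector f = {}" if "e \<in> E" "f \<in> E" for e f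
    using pair(2)[OF that(1)] pair(2)[OF that(2)] by (auto simp: lower_connector_def upper_connector_def)
  have nel: "lower_connector e \<noteq> {}" "upper_connector e \<noteq> {}" for e
    by (auto simp: lower_connector_def upper_connector_def)
  have li: "e = f" if "e \<in> E" "f \<in> E" "lower_connector e = lower_connector f" for e f
    using dl[OF that(1,2)] that(3) nel by auto
  have ui: "e = f" if "e \<in> E" "f \<in> E" "upper_connector e = upper_connector f" for e f
    using du[OF that(1,2)] that(3) nel by auto
  have lu: "lower_connector e \<noteq> upper_connector f" if "e \<in> E" "f \<in> E" for e f
    using dlu[OF that] nel by auto
  have "num_pm ?V (?E0 \<union> ?C) = (\<Sum>S | S \<subseteq> ?C \<and> matching S. num_pm (?V - \<Union>S) ?E0)"
  proof (rule num_pm_split)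
    show "finite ?C" using finE by simp
    show "finite ?E0" using gadget_edges_edges by (simp add: edges_def)
    show "e \<subseteq> ?V" if eC: "e \<in> ?C" for e
    proof -
      obtain f where f: "f \<in> E" "e = lower_connector f \<or> e = upper_connector f" using eC by auto
      then show ?thesis using pair(2,3)[OF f(1)] pq
        by (auto simp: matching_vertices_def lower_connector_def upper_connector_def)
    qed
    show "?E0 \<inter> ?C = {}"
    proof (rule equals0I)
      fix e assume e: "e \<in> ?E0 \<inter> ?C"
      then obtain f where f: "e = lower_connector f \<or> e = upper_connector f" by auto
      have "(\<forall>x\<in>e. snd (snd x) < 3) \<or> (\<forall>x\<in>e. 3 \<le> snd (snd x))"
        using e by (auto simp: gadget_edges_def chain_vertex_def weight_vertex_def)
      then show False using f by (auto simp: lower_connector_def upper_connector_def)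
    qed
  qed
  also have "{S. S \<subseteq> ?C \<and> matching S} = Pow ?C"
  proof -
    \<comment> \<open>The connectors are pairwise disjoint, so they may be chosen independently of
      each other.\<close>
    have "matching ?C" unfolding matching_def
    proof (intro ballI impI)
      fix e f assume e: "e \<in> ?C" and f: "f \<in> ?C" and ne: "e \<noteq> f"
      from e show "e \<inter> f = {}"
      proof (elim UnE imageE)
        fix a assume a: "e = lower_connector a" "a \<in> E"
        from f show ?thesis
        proof (elim UnE imageE)
          fix b assume b: "f = lower_connector b" "b \<in> E"
          then have "a \<noteq> b" using a ne by auto
          then show ?thesis using dl[OF a(2) b(2)] a b by simp
        next
          fix b assume b: "f = upper_connector b" "b \<in> E"
          then show ?thesis using dlu[OF a(2) b(2)] a by simp
        qed
      next
        fix a assume a: "e = upper_connector a" "a \<in> E"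
        from f show ?thesis
        proof (elim UnE imageE)
          fix b assume b: "f = lower_connector b" "b \<in> E"
          then show ?thesis using dlu[OF b(2) a(2)] a by (simp add: Int_commute)
        next
          fix b assume b: "f = upper_connector b" "b \<in> E"
          then have "a \<noteq> b" using a ne by auto
          then show ?thesis using du[OF a(2) b(2)] a b by simp
        qed
      qed
    qed
    then have "matching S" if "S \<subseteq> ?C" for S using that unfolding matching_def by (meson subsetD)
    then show ?thesis by auto
  qed
  also have "(\<Sum>S\<in>Pow ?C. num_pm (?V - \<Union>S) ?E0) =
      (\<Sum>(A, B)\<in>Pow E \<times> Pow E. num_pm (?V - \<Union>(lower_connector ` A \<union> upper_connector ` B)) ?E0)"
  proof (rule sum.reindex_bij_witness[where i = "\<lambda>(A, B). lower_connector ` A \<union> upper_connector ` B"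
        and j = "\<lambda>S. ({e\<in>E. lower_connector e \<in> S}, {e\<in>E. upper_connector e \<in> S})"])
    fix S assume S: "S \<in> Pow ?C"
    have S': "lower_connector ` {e\<in>E. lower_connector e \<in> S} \<union> upper_connector ` {e\<in>E. upper_connector e \<in> S} = S"
      using S by auto
    show "(case ({e\<in>E. lower_connector e \<in> S}, {e\<in>E. upper_connector e \<in> S}) of
        (A, B) \<Rightarrow> lower_connector ` A \<union> upper_connector ` B) = S" by (simp only: prod.case S')
    show "(case ({e\<in>E. lower_connector e \<in> S}, {e\<in>E. upper_connector e \<in> S}) of
        (A, B) \<Rightarrow> num_pm (?V - \<Union>(lower_connector ` A \<union> upper_connector ` B)) ?E0) = num_pm (?V - \<Union>S) ?E0"
      by (simp only: prod.case S')
    show "({e\<in>E. lower_connector e \<in> S}, {e\<in>E. upper_connector e \<in> S}) \<in> Pow E \<times> Pow E" by auto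
  next
    fix AB assume AB: "AB \<in> Pow E \<times> Pow E"
    then obtain A B where x: "AB = (A, B)" "A \<subseteq> E" "B \<subseteq> E" by auto
    have "{e\<in>E. lower_connector e \<in> lower_connector ` A \<union> upper_connector ` B} = A"
    proof (intro equalityI subsetI)
      fix e assume e: "e \<in> {e\<in>E. lower_connector e \<in> lower_connector ` A \<union> upper_connector ` B}"
      then have eE: "e \<in> E" by simp
      have "lower_connector e \<notin> upper_connector ` B" using lu[OF eE] x(3) by auto
      then have "lower_connector e \<in> lower_connector ` A" using e by auto
      then obtain f where f: "f \<in> A" "lower_connector e = lower_connector f" by auto
      then show "e \<in> A" using li[OF eE _ f(2)] x(2) by auto
    qed (use x in auto)
    moreover have "{e\<in>E. upper_connector e \<in> lower_connector ` A \<union> upper_connector ` B} = B"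
    proof (intro equalityI subsetI)
      fix e assume e: "e \<in> {e\<in>E. upper_connector e \<in> lower_connector ` A \<union> upper_connector ` B}"
      then have eE: "e \<in> E" by simp
      have "upper_connector e \<notin> lower_connector ` A" using lu[OF _ eE] x(2) by force
      then have "upper_connector e \<in> upper_connector ` B" using e by auto
      then obtain f where f: "f \<in> B" "upper_connector e = upper_connector f" by auto
      then show "e \<in> B" using ui[OF eE _ f(2)] x(3) by auto
    qed (use x in auto)
    ultimately show "({e\<in>E. lower_connector e \<in> (case AB of (A, B) \<Rightarrow> lower_connector ` A \<union> upper_connector ` B)},
        {e\<in>E. upper_connector e \<in> (case AB of (A, B) \<Rightarrow> lower_connector ` A \<union> upper_connector ` B)}) = AB"
      by (simp add: x(1))
    show "(case AB of (A, B) \<Rightarrow> lower_connector ` A \<union> upper_connector ` B) \<in> Pow ?C" using x by auto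
  qed
  also have "\<dots> = (\<Sum>(A, B)\<in>Pow E \<times> Pow E. if A = B \<and> A \<in> odd_subgraphs {..<n} E
      then p ^ card A * q ^ (n * ?m - card A) else 0)"
  proof (rule sum.cong[OF refl])
    fix AB assume "AB \<in> Pow E \<times> Pow E"
    then obtain A B where AB: "AB = (A, B)" and A: "A \<subseteq> E" and B: "B \<subseteq> E" by auto
    \<comment> \<open>\<open>PA\<close> and \<open>PB\<close> are the two choices as ordered pairs.
      They consume the middle vertices \<open>U v\<close> of the chain of \<open>v\<close> and the
      ends \<open>X x\<close> of the weight gadget at \<open>x\<close>.\<close>
    define PA where "PA = (\<lambda>e. (Min e, Max e)) ` A"
    define PB where "PB = (\<lambda>e. (Min e, Max e)) ` B"
    define U where "U = (\<lambda>v. (\<lambda>w. 3 * w + 1) ` {w. (v, w) \<in> PA \<or> (w, v) \<in> PB})"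
    define X where "X = (\<lambda>x. {j::nat. (j = 0 \<and> x \<in> PA) \<or> (j = 1 \<and> x \<in> PB)})"
    have PA: "v < w \<and> w < n" if "(v, w) \<in> PA" for v w using that pair(2,3) A by (auto simp: PA_def)
    have PB: "v < w \<and> w < n" if "(v, w) \<in> PB" for v w using that pair(2,3) B by (auto simp: PB_def)
    have used: "\<Union>(lower_connector ` A \<union> upper_connector ` B) =
        {(v, w, j). (v, w) \<in> PA \<and> (j = 3 \<or> j = 1) \<or> (v, w) \<in> PB \<and> j = 4 \<or> (w, v) \<in> PB \<and> j = 1}"
      by (auto simp: lower_connector_def upper_connector_def PA_def PB_def)
    have V: "?V - \<Union>(lower_connector ` A \<union> upper_connector ` B) =
      (\<Union>v\<in>{..<n}. chain_vertex v ` ({..<3 * ?m} - U v)) \<union> (\<Union>x\<in>?J. weight_vertex x ` ({..<2 * q} - X x))"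
      (is "?L = ?C1 \<union> ?C2")
    proof (intro equalityI subsetI)
      fix y assume y: "y \<in> ?L"
      obtain v w j where y': "y = (v, w, j)" by (cases y)
      have b: "v < n" "w < ?m" "j < 3 + 2 * q" using y by (auto simp: y' matching_vertices_def)
      show "y \<in> ?C1 \<union> ?C2"
      proof (cases "j < 3")
        case True
        have "3 * w + j \<notin> U v"
        proof
          assume "3 * w + j \<in> U v"
          then obtain w' where w': "3 * w + j = 3 * w' + 1" "(v, w') \<in> PA \<or> (w', v) \<in> PB" by (auto simp: U_def)
          have "w = w'" using w'(1) True by presburger
          moreover have "j = 1" using w'(1) True by presburger
          ultimately show False using y w'(2) unfolding used by (auto simp: y')
        qed
        moreover have "3 * w + j < 3 * ?m" using b(2) True by presburger
        moreover have "y = chain_vertex v (3 * w + j)" using True by (simp add: y' chain_vertex_def)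
        ultimately have "y \<in> chain_vertex v ` ({..<3 * ?m} - U v)" by blast
        then show ?thesis using b(1) by blast
      next
        case False
        have "j - 3 \<notin> X (v, w)" using y False unfolding used by (auto simp: y' X_def)
        moreover have "y = weight_vertex (v, w) (j - 3)" "j - 3 < 2 * q" using False b(3)
          by (auto simp: y' weight_vertex_def)
        ultimately have "y \<in> weight_vertex (v, w) ` ({..<2 * q} - X (v, w))" by blast
        then show ?thesis using b(1,2) by blast
      qed
    next
      fix y assume "y \<in> ?C1 \<union> ?C2"
      then consider (c) v j where "v < n" "j < 3 * ?m" "j \<notin> U v" "y = chain_vertex v j"
        | (w) v w j where "v < n" "w < ?m" "j < 2 * q" "j \<notin> X (v, w)" "y = weight_vertex (v, w) j" by auto
      then show "y \<in> ?L"
      proof cases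
        case c
        have "\<not> ((v, j div 3) \<in> PA \<or> (j div 3, v) \<in> PB)" if "j mod 3 = 1"
        proof
          assume "(v, j div 3) \<in> PA \<or> (j div 3, v) \<in> PB"
          moreover have "j = 3 * (j div 3) + 1" using that by presburger
          ultimately have "j \<in> U v" unfolding U_def by blast
          then show False using c(3) by simp
        qed
        moreover have "j mod 3 < 3" by simp
        moreover have "j div 3 < ?m" using c(2) by (simp add: less_mult_imp_div_less mult.commute)
        ultimately show ?thesis using c(1) unfolding used c(4)
          by (auto simp: chain_vertex_def matching_vertices_def)
      next
        case w
        then show ?thesis unfolding used w(5) by (auto simp: weight_vertex_def matching_vertices_def X_def)
      qed
    qed
    have Usub: "U v \<subseteq> {..<3 * ?m}" for v
    proof
      fix u assume "u \<in> U v"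
      then obtain w where w: "u = 3 * w + 1" "(v, w) \<in> PA \<or> (w, v) \<in> PB" by (auto simp: U_def)
      then have "w < n" using PA[of v w] PB[of w v] by auto
      then show "u \<in> {..<3 * ?m}" using w(1) by simp
    qed
    have Xsub: "X x \<subseteq> {..<2 * q}" for x using pq by (auto simp: X_def)
    have val: "num_pm ?L ?E0 = (\<Prod>v<n. num_pm ({..<3 * ?m} - U v) (chain_edges ?m)) *
        (\<Prod>x\<in>?J. num_pm ({..<2 * q} - X x) (weight_edges p q))"
      unfolding V by (rule num_pm_gadgets[OF Usub Xsub]) (use pq in auto)
    have w: "num_pm ({..<2 * q} - X x) (weight_edges p q) =
        (if x \<in> PA then if x \<in> PB then p else 0 else if x \<in> PB then 0 else q)" for x
    proof -
      have "X x = (if x \<in> PA then if x \<in> PB then {0, 1} else {0} else if x \<in> PB then {1} else {})"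
        by (auto simp: X_def)
      then show ?thesis using num_pm_weight[of p q] num_pm_weight_odd[of q p] pq by auto
    qed
    have "num_pm ?L ?E0 = (if A = B \<and> A \<in> odd_subgraphs {..<n} E then p ^ card A * q ^ (n * ?m - card A) else 0)"
    proof (cases "A = B")
      case False
      \<comment> \<open>An edge chosen at one end only leaves its weight gadget with an odd number
        of vertices.\<close>
      then obtain e where e: "e \<in> E" "e \<in> A \<longleftrightarrow> e \<notin> B" using A B by blast
      let ?x = "(Min e, Max e)"
      have "?x \<in> PA \<longleftrightarrow> e \<in> A" "?x \<in> PB \<longleftrightarrow> e \<in> B" using eqI e(1) A B by (auto simp: PA_def PB_def)
      then have "num_pm ({..<2 * q} - X ?x) (weight_edges p q) = 0" using e(2) unfolding w by auto
      moreover have "?x \<in> ?J" using pair(2,3)[OF e(1)] by auto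
      ultimately have "(\<Prod>x\<in>?J. num_pm ({..<2 * q} - X x) (weight_edges p q)) = 0"
        by (intro prod_zero) auto
      then show ?thesis using False unfolding val by simp
    next
      case True
      have "PB = PA" by (simp add: PA_def PB_def True)
      have sub: "PA \<subseteq> ?J" using PA by fastforce
      have cPA: "card PA = card A" unfolding PA_def by (rule card_image) (use eqI A in \<open>auto simp: inj_on_def\<close>)
      have "(\<Prod>x\<in>?J. num_pm ({..<2 * q} - X x) (weight_edges p q)) = (\<Prod>x\<in>?J. if x \<in> PA then p else q)"
        unfolding w \<open>PB = PA\<close> by (intro prod.cong refl) auto
      also have "\<dots> = p ^ card A * q ^ (n * ?m - card A)"
      proof -
        have "finite PA" using finite_subset[OF sub] by simp
        then have "card (?J \<inter> - PA) = n * ?m - card A"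
          using card_Diff_subset[OF _ sub] cPA by (simp add: Diff_eq)
        moreover have "?J \<inter> PA = PA" using sub by auto
        ultimately show ?thesis by (simp add: prod.If_cases cPA)
      qed
      finally have 1: "(\<Prod>x\<in>?J. num_pm ({..<2 * q} - X x) (weight_edges p q)) = p ^ card A * q ^ (n * ?m - card A)" .
      have c: "num_pm ({..<3 * ?m} - U v) (chain_edges ?m) = of_bool (odd (degree A v))" for v
      proof -
        have nb: "{w. (v, w) \<in> PA \<or> (w, v) \<in> PB} = {w. {v, w} \<in> A}"
        proof (intro equalityI subsetI)
          fix w assume "w \<in> {w. (v, w) \<in> PA \<or> (w, v) \<in> PB}"
          then obtain e where e: "e \<in> A" "(v, w) = (Min e, Max e) \<or> (w, v) = (Min e, Max e)"
            by (auto simp: PA_def PB_def True)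
          then have "e = {v, w}" using pair(1)[of e] A by auto
          then show "w \<in> {w. {v, w} \<in> A}" using e by auto
        next
          fix w assume w: "w \<in> {w. {v, w} \<in> A}"
          then have "v \<noteq> w" using pair(2)[of "{v, w}"] A by auto
          then have "(v, w) = (Min {v, w}, Max {v, w}) \<or> (w, v) = (Min {v, w}, Max {v, w})" by (auto simp: min_def max_def)
          then show "w \<in> {w. (v, w) \<in> PA \<or> (w, v) \<in> PB}" using w unfolding PA_def PB_def True by blast
        qed
        have "card (U v) = degree A v"
          unfolding U_def nb degree_eq_card_neighbours[OF G A] by (rule card_image) (auto simp: inj_on_def)
        moreover have "card (U v) \<le> 3 * ?m" using card_mono[OF _ Usub[of v]] by simp
        moreover have "card ({..<3 * ?m} - U v) = 3 * ?m - card (U v)"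
          using Usub[of v] finite_subset[OF Usub[of v]] by (simp add: card_Diff_subset)
        \<comment> \<open>The whole chain has the odd number \<open>3 * ?m\<close> of
          vertices.\<close>
        ultimately have "even (card ({..<3 * ?m} - U v)) \<longleftrightarrow> odd (degree A v)" by presburger
        moreover have "U v \<subseteq> range (\<lambda>w. 3 * w + 1) \<union> {3 * ?m - 1}" by (auto simp: U_def)
        ultimately show ?thesis using num_pm_chain[of ?m "U v"] by simp
      qed
      have "(\<Prod>v<n. num_pm ({..<3 * ?m} - U v) (chain_edges ?m)) = of_bool (A \<in> odd_subgraphs {..<n} E)"
        unfolding c using A by (auto simp: odd_subgraphs_def)
      then show ?thesis unfolding val 1 using True by simp
    qed
    then show "(case AB of (A, B) \<Rightarrow> num_pm (?V - \<Union>(lower_connector ` A \<union> upper_connector ` B)) ?E0) =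
      (case AB of (A, B) \<Rightarrow> if A = B \<and> A \<in> odd_subgraphs {..<n} E
        then p ^ card A * q ^ (n * ?m - card A) else 0)"
      unfolding AB prod.case .
  qed
  also have "\<dots> = (\<Sum>A\<in>Pow E. if A \<in> odd_subgraphs {..<n} E then p ^ card A * q ^ (n * ?m - card A) else 0)"
    unfolding sum.cartesian_product[symmetric]
  proof (rule sum.cong[OF refl])
    fix A assume A: "A \<in> Pow E"
    have "finite (Pow E)" using finE by simp
    then show "(\<Sum>B\<in>Pow E. if A = B \<and> A \<in> odd_subgraphs {..<n} E then p ^ card A * q ^ (n * ?m - card A) else 0) =
        (if A \<in> odd_subgraphs {..<n} E then p ^ card A * q ^ (n * ?m - card A) else 0)"
      using A by (cases "A \<in> odd_subgraphs {..<n} E") (simp_all add: sum.delta' del: Pow_iff)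
  qed
  also have "\<dots> = (\<Sum>A\<in>odd_subgraphs {..<n} E. p ^ card A * q ^ (n * ?m - card A))"
    using finE by (intro sum.mono_neutral_cong_right) (auto simp: odd_subgraphs_def)
  finally show ?thesis unfolding matching_edges_def .
qed

section \<open>Perfect matchings through odd subgraphs of a stretched graph of degree 3\<close>

section \<open>From perfect matchings to the Ising model\<close>

type_synonym ising_vertex = "nat \<times> nat \<times> nat \<times> nat"

text \<open>Vertex \<open>v\<close> becomes a path through \<open>(v, w, 0, 0)\<close> and \<open>(v, w, 0, 1)\<close> for \<open>w < n\<close>, ending at \<open>(v, n, 0, 0)\<close>.
  From \<open>(v, w, 0, 0)\<close> a stub of length \<open>k\<close> leads to the edge that joins \<open>v\<close> and \<open>w\<close>; the inner vertices of the
  stub carry leaves.  In a subgraph with all degrees odd every leaf is joined to the stub, so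
  that a stub is selected entirely or not at all, while the degree-two vertices of the path
  transmit the parity of the number of stubs selected so far.\<close>

definition leaf_edge :: "nat \<times> nat \<times> nat \<Rightarrow> ising_vertex set" where
  "leaf_edge = (\<lambda>(v, w, i). {(v, w, i, 0), (v, w, i, 1)})"

text \<open>For \<open>i = 0\<close> the vertex \<open>(v, w, 0, 1)\<close> is no leaf but the
  second path vertex for \<open>w\<close>. Together with the edges
  \<open>leaf_edge (v, w, 0)\<close> these edges make up the path that replaces
  \<open>v\<close>.\<close>

definition back_edge :: "nat \<times> nat \<Rightarrow> ising_vertex set" where
  "back_edge = (\<lambda>(v, w). {(v, w, 0, 1), (v, Suc w, 0, 0)})"

definition stub_edge :: "nat \<times> nat \<times> nat \<Rightarrow> ising_vertex set" where
  "stub_edge = (\<lambda>(v, w, i). {(v, w, i, 0), (v, w, Suc i, 0)})"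

definition tip_edge :: "nat \<Rightarrow> nat set \<Rightarrow> ising_vertex set" where
  "tip_edge k e = {(Min e, Max e, k, 0), (Max e, Min e, k, 0)}"

text \<open>One form for the whole graph and for its odd subgraphs, so that membership and
  cardinality are settled once for both.\<close>

definition select_edges :: "nat \<Rightarrow> (nat \<times> nat \<times> nat) set \<Rightarrow> (nat \<times> nat) set \<Rightarrow>
    (nat \<times> nat \<times> nat) set \<Rightarrow> nat set set \<Rightarrow> ising_vertex set set" where
  "select_edges k P Q R A = leaf_edge ` P \<union> back_edge ` Q \<union> stub_edge ` R \<union> tip_edge k ` A"

definition ising_vertices :: "nat \<Rightarrow> nat \<Rightarrow> ising_vertex set" where
  "ising_vertices n k = {..<n} \<times> {..<n} \<times> {..k} \<times> {..<2} \<union> {..<n} \<times> {n} \<times> {0} \<times> {0}"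

definition ising_edges :: "nat \<Rightarrow> nat \<Rightarrow> nat set set \<Rightarrow> ising_vertex set set" where
  "ising_edges n k E = select_edges k ({..<n} \<times> {..<n} \<times> {..k}) ({..<n} \<times> {..<n}) ({..<n} \<times> {..<n} \<times> {..<k}) E"

lemma mem_back_edge: "(v, w, i, 0) \<in> back_edge y \<longleftrightarrow> i = 0 \<and> 0 < w \<and> y = (v, w - 1)"
  by (cases y) (auto simp: back_edge_def)

lemma mem_stub_edge: "(v, w, i, 0) \<in> stub_edge y \<longleftrightarrow> y = (v, w, i) \<or> 0 < i \<and> y = (v, w, i - 1)"
  by (cases y) (auto simp: stub_edge_def)

lemma leaf_edge_inj: "leaf_edge x = leaf_edge y \<longleftrightarrow> x = y"
  by (cases x; cases y) (auto simp: leaf_edge_def doubleton_eq_iff)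

lemma back_edge_inj: "back_edge x = back_edge y \<longleftrightarrow> x = y"
  by (cases x; cases y) (auto simp: back_edge_def doubleton_eq_iff)

lemma stub_edge_inj: "stub_edge x = stub_edge y \<longleftrightarrow> x = y"
  by (cases x; cases y) (auto simp: stub_edge_def doubleton_eq_iff)

lemma edge_kinds_distinct:
  "leaf_edge x \<noteq> back_edge y" "leaf_edge x \<noteq> stub_edge z" "leaf_edge x \<noteq> tip_edge k e"
  "back_edge y \<noteq> stub_edge z" "back_edge y \<noteq> tip_edge k e" "stub_edge z \<noteq> tip_edge k e"
  by (cases x; cases y; cases z;
      auto simp: leaf_edge_def back_edge_def stub_edge_def tip_edge_def doubleton_eq_iff)+

lemma odd_card_three:
  assumes "x \<noteq> y" "x \<noteq> z" "y \<noteq> z"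
  shows "odd (card ((if P then {x} else {}) \<union> (if Q then {y} else {}) \<union> (if R then {z} else {}))) \<longleftrightarrow> (P \<noteq> (Q \<noteq> R))"
  using assms by (cases P; cases Q; cases R) auto

context
  fixes n k :: nat and E :: "nat set set"
  assumes G: "finite_graph {..<n} E"
begin

lemma edge_pair:
  assumes "e \<in> E"
  shows "e = {Min e, Max e}" "Min e < Max e" "Max e < n"
proof -
  have "card e = 2" "e \<subseteq> {..<n}" using assms G by (auto simp: finite_graph_def)
  then obtain a b where "e = {a, b}" "a \<noteq> b" by (auto simp: card_2_iff)
  with \<open>e \<subseteq> {..<n}\<close> show "e = {Min e, Max e}" "Min e < Max e" "Max e < n"
    by (auto simp: min_def max_def)
qed

lemma tip_edge_inj: "e \<in> E \<Longrightarrow> f \<in> E \<Longrightarrow> tip_edge k e = tip_edge k f \<longleftrightarrow> e = f"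
  using edge_pair[of e] edge_pair[of f] by (auto simp: tip_edge_def doubleton_eq_iff)

lemma mem_tip_edge: "e \<in> E \<Longrightarrow> (v, w, i, c) \<in> tip_edge k e \<longleftrightarrow> i = k \<and> c = 0 \<and> e = {v, w}"
proof -
  assume e: "e \<in> E"
  have "e = {v, w} \<longleftrightarrow> (v = Min e \<and> w = Max e) \<or> (v = Max e \<and> w = Min e)"
    by (subst edge_pair(1)[OF e]) (auto simp: doubleton_eq_iff)
  then show ?thesis by (auto simp: tip_edge_def)
qed

lemma select_edges_mem:
  assumes "A \<subseteq> E"
  shows "leaf_edge x \<in> select_edges k P Q R A \<longleftrightarrow> x \<in> P"
    "back_edge y \<in> select_edges k P Q R A \<longleftrightarrow> y \<in> Q"
    "stub_edge x \<in> select_edges k P Q R A \<longleftrightarrow> x \<in> R"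
    "e \<in> E \<Longrightarrow> tip_edge k e \<in> select_edges k P Q R A \<longleftrightarrow> e \<in> A"
  using assms tip_edge_inj
  by (auto simp: select_edges_def image_iff leaf_edge_inj back_edge_inj stub_edge_inj edge_kinds_distinct
      edge_kinds_distinct[symmetric])

lemma card_select_edges:
  assumes "finite P" "finite Q" "finite R" "A \<subseteq> E"
  shows "card (select_edges k P Q R A) = card P + card Q + card R + card A"
proof -
  have "finite A" using assms(4) finite_graph_finite_edges[OF G] finite_subset by auto
  have "card (leaf_edge ` P) = card P" "card (back_edge ` Q) = card Q" "card (stub_edge ` R) = card R"
    by (auto intro!: card_image inj_onI simp: leaf_edge_inj back_edge_inj stub_edge_inj)
  moreover have "card (tip_edge k ` A) = card A"
    using tip_edge_inj assms(4) by (intro card_image inj_onI) auto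
  moreover have "leaf_edge ` P \<inter> back_edge ` Q = {}" "(leaf_edge ` P \<union> back_edge ` Q) \<inter> stub_edge ` R = {}"
    "(leaf_edge ` P \<union> back_edge ` Q \<union> stub_edge ` R) \<inter> tip_edge k ` A = {}"
    using edge_kinds_distinct edge_kinds_distinct[symmetric] by auto
  ultimately show ?thesis unfolding select_edges_def
    using assms(1-3) \<open>finite A\<close> by (simp add: card_Un_disjoint)
qed

lemma finite_graph_ising: "finite_graph (ising_vertices n k) (ising_edges n k E)"
proof -
  have "e \<subseteq> ising_vertices n k \<and> card e = 2" if eE: "e \<in> ising_edges n k E" for e
  proof -
    consider (l) v w i where "v < n" "w < n" "i \<le> k" "e = leaf_edge (v, w, i)"
      | (b) v w where "v < n" "w < n" "e = back_edge (v, w)"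
      | (s) v w i where "v < n" "w < n" "i < k" "e = stub_edge (v, w, i)"
      | (t) f where "f \<in> E" "e = tip_edge k f"
      using eE unfolding ising_edges_def select_edges_def by blast
    then show ?thesis
    proof cases
      case b
      then show ?thesis by (cases "Suc w = n") (auto simp: back_edge_def ising_vertices_def)
    next
      case t
      then show ?thesis using edge_pair(2,3)[OF t(1)] by (auto simp: tip_edge_def ising_vertices_def)
    qed (auto simp: leaf_edge_def stub_edge_def ising_vertices_def)
  qed
  then show ?thesis by (auto simp: finite_graph_def ising_vertices_def)
qed

lemma card_ising_edges: "card (ising_edges n k E) = n * n * (2 * k + 2) + card E"
  unfolding ising_edges_def
  by (subst card_select_edges) (auto simp: card_cartesian_product algebra_simps)

definition next_edge :: "nat \<Rightarrow> nat \<Rightarrow> nat \<Rightarrow> ising_vertex set" where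
  "next_edge v w i = (if i < k then stub_edge (v, w, i) else tip_edge k {v, w})"

definition prev_edge :: "nat \<Rightarrow> nat \<Rightarrow> nat \<Rightarrow> ising_vertex set" where
  "prev_edge v w i = (if 0 < i then stub_edge (v, w, i - 1) else back_edge (v, w - 1))"

lemma incident_main:
  assumes "v < n" "w < n" "i \<le> k"
  shows "{e \<in> ising_edges n k E. (v, w, i, 0) \<in> e} =
    (if True then {leaf_edge (v, w, i)} else {}) \<union>
    (if 0 < i \<or> 0 < w then {prev_edge v w i} else {}) \<union>
    (if i < k \<or> {v, w} \<in> E then {next_edge v w i} else {})"
proof -
  have 1: "{e \<in> leaf_edge ` ({..<n} \<times> {..<n} \<times> {..k}). (v, w, i, 0) \<in> e} = {leaf_edge (v, w, i)}"
    using assms by (auto simp: leaf_edge_def)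
  have 2: "{e \<in> back_edge ` ({..<n} \<times> {..<n}). (v, w, i, 0) \<in> e} =
      (if i = 0 \<and> 0 < w then {back_edge (v, w - 1)} else {})"
    using assms by (auto simp: mem_back_edge intro!: imageI)
  have 3: "{e \<in> stub_edge ` ({..<n} \<times> {..<n} \<times> {..<k}). (v, w, i, 0) \<in> e} =
      (if i < k then {stub_edge (v, w, i)} else {}) \<union> (if 0 < i then {stub_edge (v, w, i - 1)} else {})"
    using assms by (auto simp: mem_stub_edge intro!: imageI)
  have 4: "{e \<in> tip_edge k ` E. (v, w, i, 0) \<in> e} = (if i = k \<and> {v, w} \<in> E then {tip_edge k {v, w}} else {})"
    using mem_tip_edge[of _ v w i 0] by auto
  have "{e \<in> ising_edges n k E. (v, w, i, 0) \<in> e} =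
     {e \<in> leaf_edge ` ({..<n} \<times> {..<n} \<times> {..k}). (v, w, i, 0) \<in> e} \<union>
     {e \<in> back_edge ` ({..<n} \<times> {..<n}). (v, w, i, 0) \<in> e} \<union>
     {e \<in> stub_edge ` ({..<n} \<times> {..<n} \<times> {..<k}). (v, w, i, 0) \<in> e} \<union>
     {e \<in> tip_edge k ` E. (v, w, i, 0) \<in> e}"
    unfolding ising_edges_def select_edges_def by blast
  then show ?thesis unfolding 1 2 3 4 next_edge_def prev_edge_def using assms(3) by auto
qed

lemma incident_leaf:
  assumes "v < n" "w < n" "i \<le> k"
  shows "{e \<in> ising_edges n k E. (v, w, i, 1) \<in> e} =
    {leaf_edge (v, w, i)} \<union> (if i = 0 then {back_edge (v, w)} else {})"
proof -
  have 1: "{e \<in> leaf_edge ` ({..<n} \<times> {..<n} \<times> {..k}). (v, w, i, 1) \<in> e} = {leaf_edge (v, w, i)}"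
    using assms by (auto simp: leaf_edge_def)
  have 2: "{e \<in> back_edge ` ({..<n} \<times> {..<n}). (v, w, i, 1) \<in> e} = (if i = 0 then {back_edge (v, w)} else {})"
    using assms by (auto simp: back_edge_def)
  have 3: "{e \<in> stub_edge ` ({..<n} \<times> {..<n} \<times> {..<k}). (v, w, i, 1) \<in> e} = {}"
    by (auto simp: stub_edge_def)
  have 4: "{e \<in> tip_edge k ` E. (v, w, i, 1) \<in> e} = {}"
    by (auto simp: tip_edge_def)
  have "{e \<in> ising_edges n k E. (v, w, i, 1) \<in> e} =
     {e \<in> leaf_edge ` ({..<n} \<times> {..<n} \<times> {..k}). (v, w, i, 1) \<in> e} \<union>
     {e \<in> back_edge ` ({..<n} \<times> {..<n}). (v, w, i, 1) \<in> e} \<union>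
     {e \<in> stub_edge ` ({..<n} \<times> {..<n} \<times> {..<k}). (v, w, i, 1) \<in> e} \<union>
     {e \<in> tip_edge k ` E. (v, w, i, 1) \<in> e}"
    unfolding ising_edges_def select_edges_def by blast
  then show ?thesis unfolding 1 2 3 4 by simp
qed

lemma incident_end:
  assumes "v < n"
  shows "{e \<in> ising_edges n k E. (v, n, 0, 0) \<in> e} = {back_edge (v, n - 1)}"
proof -
  have 1: "{e \<in> leaf_edge ` ({..<n} \<times> {..<n} \<times> {..k}). (v, n, 0, 0) \<in> e} = {}"
    by (auto simp: leaf_edge_def)
  have 2: "{e \<in> back_edge ` ({..<n} \<times> {..<n}). (v, n, 0, 0) \<in> e} = {back_edge (v, n - 1)}"
    using assms by (auto simp: mem_back_edge intro!: imageI)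
  have 3: "{e \<in> stub_edge ` ({..<n} \<times> {..<n} \<times> {..<k}). (v, n, 0, 0) \<in> e} = {}"
    by (auto simp: stub_edge_def)
  have 4: "{e \<in> tip_edge k ` E. (v, n, 0, 0) \<in> e} = {}"
    using edge_pair(2,3) by (fastforce simp: tip_edge_def)
  have "{e \<in> ising_edges n k E. (v, n, 0, 0) \<in> e} =
     {e \<in> leaf_edge ` ({..<n} \<times> {..<n} \<times> {..k}). (v, n, 0, 0) \<in> e} \<union>
     {e \<in> back_edge ` ({..<n} \<times> {..<n}). (v, n, 0, 0) \<in> e} \<union>
     {e \<in> stub_edge ` ({..<n} \<times> {..<n} \<times> {..<k}). (v, n, 0, 0) \<in> e} \<union>
     {e \<in> tip_edge k ` E. (v, n, 0, 0) \<in> e}"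
    unfolding ising_edges_def select_edges_def by blast
  then show ?thesis unfolding 1 2 3 4 by simp
qed

lemma ising_vertex_cases:
  assumes "x \<in> ising_vertices n k"
  obtains v w i where "v < n" "w < n" "i \<le> k" "x = (v, w, i, 0)"
  | v w i where "v < n" "w < n" "i \<le> k" "x = (v, w, i, 1)"
  | v where "v < n" "x = (v, n, 0, 0)"
  using assms by (auto simp: ising_vertices_def less_2_cases_iff)

lemma degree_ising:
  assumes "x \<in> ising_vertices n k"
  shows "degree (ising_edges n k E) x \<le> 3"
  using assms
proof (cases x rule: ising_vertex_cases)
  case (1 v w i)
  have "card (X \<union> Y \<union> Z) \<le> 3" if "card X \<le> 1" "card Y \<le> 1" "card Z \<le> 1" for X Y Z :: "ising_vertex set set"
    using card_Un_le[of "X \<union> Y" Z] card_Un_le[of X Y] that by linarith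
  note * = this
  show ?thesis unfolding degree_def 1(4) incident_main[OF 1(1-3)] by (rule *) simp_all
next
  case (2 v w i)
  have "card (X \<union> Y) \<le> 3" if "card X \<le> 1" "card Y \<le> 1" for X Y :: "ising_vertex set set"
    using card_Un_le[of X Y] that by linarith
  note * = this
  show ?thesis unfolding degree_def 2(4) incident_leaf[OF 2(1-3)] by (rule *) simp_all
next
  case (3 v)
  then show ?thesis unfolding degree_def 3(2) incident_end[OF 3(1)] by simp
qed

text \<open>The conditions belong, in this order, to the ends of the paths, to the second path
  vertices, to the true leaves and to the remaining vertices. A vertex of degree 1 forces its edge,
  one of degree 2 takes exactly one of its edges, and of up to three edges an odd number is
  selected.\<close>

lemma odd_ising_iff:
  assumes A: "A \<subseteq> ising_edges n k E"
  shows "A \<in> odd_subgraphs (ising_vertices n k) (ising_edges n k E) \<longleftrightarrow>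
    (\<forall>v<n. back_edge (v, n - 1) \<in> A \<and> (\<forall>w<n.
      (leaf_edge (v, w, 0) \<in> A \<longleftrightarrow> back_edge (v, w) \<notin> A) \<and>
      (\<forall>i. 0 < i \<longrightarrow> i \<le> k \<longrightarrow> leaf_edge (v, w, i) \<in> A) \<and>
      (\<forall>i\<le>k. leaf_edge (v, w, i) \<in> A \<longleftrightarrow>
        (((0 < i \<or> 0 < w) \<and> prev_edge v w i \<in> A) \<longleftrightarrow> ((i < k \<or> {v, w} \<in> E) \<and> next_edge v w i \<in> A)))))"
proof -
  have inc: "{e\<in>A. x \<in> e} = {e \<in> ising_edges n k E. x \<in> e} \<inter> A" for x using A by auto
  have main: "odd (degree A (v, w, i, 0)) \<longleftrightarrow> (leaf_edge (v, w, i) \<in> A \<longleftrightarrow>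
      (((0 < i \<or> 0 < w) \<and> prev_edge v w i \<in> A) \<longleftrightarrow> ((i < k \<or> {v, w} \<in> E) \<and> next_edge v w i \<in> A)))"
    if "v < n" "w < n" "i \<le> k" for v w i
  proof -
    have d: "leaf_edge (v, w, i) \<noteq> prev_edge v w i" "leaf_edge (v, w, i) \<noteq> next_edge v w i"
      by (auto simp: prev_edge_def next_edge_def edge_kinds_distinct)
    have d2: "prev_edge v w i \<noteq> next_edge v w i"
      by (auto simp: prev_edge_def next_edge_def edge_kinds_distinct stub_edge_inj)
    have "{e\<in>A. (v, w, i, 0) \<in> e} = (if leaf_edge (v, w, i) \<in> A then {leaf_edge (v, w, i)} else {}) \<union>
        (if (0 < i \<or> 0 < w) \<and> prev_edge v w i \<in> A then {prev_edge v w i} else {}) \<union>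
        (if (i < k \<or> {v, w} \<in> E) \<and> next_edge v w i \<in> A then {next_edge v w i} else {})"
      unfolding inc incident_main[OF that] by (simp split: if_splits) blast
    then have "odd (degree A (v, w, i, 0)) \<longleftrightarrow> ((leaf_edge (v, w, i) \<in> A) \<noteq>
      (((0 < i \<or> 0 < w) \<and> prev_edge v w i \<in> A) \<noteq> ((i < k \<or> {v, w} \<in> E) \<and> next_edge v w i \<in> A)))"
      unfolding degree_def by (simp only: odd_card_three[OF d d2])
    then show ?thesis by blast
  qed
  have leaf: "odd (degree A (v, w, i, 1)) \<longleftrightarrow>
      (if i = 0 then (leaf_edge (v, w, 0) \<in> A) = (back_edge (v, w) \<notin> A) else leaf_edge (v, w, i) \<in> A)"
    if "v < n" "w < n" "i \<le> k" for v w i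
    unfolding degree_def inc incident_leaf[OF that]
    by (auto simp: edge_kinds_distinct Int_insert_left)
  have last: "odd (degree A (v, n, 0, 0)) \<longleftrightarrow> back_edge (v, n - 1) \<in> A" if "v < n" for v
    unfolding degree_def inc incident_end[OF that]
    by (cases "back_edge (v, n - 1) \<in> A") (simp_all add: Int_insert_left)
  show ?thesis
  proof
    assume *: "A \<in> odd_subgraphs (ising_vertices n k) (ising_edges n k E)"
    have V: "(v, w, i, 0) \<in> ising_vertices n k" "(v, w, i, 1) \<in> ising_vertices n k" "(v, n, 0, 0) \<in> ising_vertices n k"
      if "v < n" "w < n" "i \<le> k" for v w i using that by (auto simp: ising_vertices_def)
    have o: "odd (degree A x)" if "x \<in> ising_vertices n k" for x using * that by (auto simp: odd_subgraphs_def)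
    show "\<forall>v<n. back_edge (v, n - 1) \<in> A \<and> (\<forall>w<n.
      (leaf_edge (v, w, 0) \<in> A \<longleftrightarrow> back_edge (v, w) \<notin> A) \<and>
      (\<forall>i. 0 < i \<longrightarrow> i \<le> k \<longrightarrow> leaf_edge (v, w, i) \<in> A) \<and>
      (\<forall>i\<le>k. leaf_edge (v, w, i) \<in> A \<longleftrightarrow>
        (((0 < i \<or> 0 < w) \<and> prev_edge v w i \<in> A) \<longleftrightarrow> ((i < k \<or> {v, w} \<in> E) \<and> next_edge v w i \<in> A))))"
    proof (intro allI impI conjI, goal_cases)
      case (1 v)
      show ?case using o[OF V(3)[of v v 0]] last[OF 1] 1 by simp
    next
      case (2 v w)
      show ?case using o[OF V(2)[OF 2, of 0]] leaf[OF 2, of 0] by simp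
    next
      case (3 v w i)
      show ?case using o[OF V(2)[OF 3(1,2,4)]] leaf[OF 3(1,2,4)] 3(3) by simp
    next
      case (4 v w i)
      show ?case using o[OF V(1)[OF 4]] unfolding main[OF 4] .
    qed
  next
    assume *: "\<forall>v<n. back_edge (v, n - 1) \<in> A \<and> (\<forall>w<n.
      (leaf_edge (v, w, 0) \<in> A \<longleftrightarrow> back_edge (v, w) \<notin> A) \<and>
      (\<forall>i. 0 < i \<longrightarrow> i \<le> k \<longrightarrow> leaf_edge (v, w, i) \<in> A) \<and>
      (\<forall>i\<le>k. leaf_edge (v, w, i) \<in> A \<longleftrightarrow>
        (((0 < i \<or> 0 < w) \<and> prev_edge v w i \<in> A) \<longleftrightarrow> ((i < k \<or> {v, w} \<in> E) \<and> next_edge v w i \<in> A))))"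
    have "odd (degree A x)" if "x \<in> ising_vertices n k" for x
      using that
    proof (cases x rule: ising_vertex_cases)
      case (1 v w i)
      then show ?thesis using * by (simp only: 1(4) main[OF 1(1-3)])
    next
      case (2 v w i)
      then show ?thesis using * by (simp only: 2(4) leaf[OF 2(1-3)]) auto
    next
      case (3 v)
      then show ?thesis using * last[OF 3(1)] by simp
    qed
    then show "A \<in> odd_subgraphs (ising_vertices n k) (ising_edges n k E)"
      using A by (auto simp: odd_subgraphs_def)
  qed
qed

text \<open>Its parity is the information carried by \<open>back_edge (v, w)\<close>. At
  \<open>w = n - 1\<close> it is the full degree, and the edge at the end of the path is forced,
  which makes that degree odd.\<close>

definition prefix_degree :: "nat set set \<Rightarrow> nat \<Rightarrow> nat \<Rightarrow> nat" where
  "prefix_degree A v w = card {w'. w' \<le> w \<and> {v, w'} \<in> A}"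

lemma prefix_degree_0: "prefix_degree A v 0 = of_bool ({v, 0} \<in> A)"
proof -
  have "{w'. w' \<le> 0 \<and> {v, w'} \<in> A} = (if {v, 0} \<in> A then {0} else {})" by auto
  then show ?thesis by (simp add: prefix_degree_def)
qed

lemma prefix_degree_Suc: "prefix_degree A v (Suc w) = prefix_degree A v w + of_bool ({v, Suc w} \<in> A)"
proof -
  have "{w'. w' \<le> Suc w \<and> {v, w'} \<in> A} =
      (if {v, Suc w} \<in> A then insert (Suc w) {w'. w' \<le> w \<and> {v, w'} \<in> A} else {w'. w' \<le> w \<and> {v, w'} \<in> A})"
    by (auto simp: le_Suc_eq)
  then show ?thesis by (simp add: prefix_degree_def)
qed

lemma neighbour_less:
  assumes "A \<subseteq> E" "{v, w} \<in> A"
  shows "v < n" "w < n"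
proof -
  have "\<forall>e\<in>E. e \<subseteq> {..<n}" using G by (simp add: finite_graph_def)
  then have "{v, w} \<subseteq> {..<n}" using subsetD[OF assms] by (rule bspec)
  then show "v < n" "w < n" by auto
qed

lemma prefix_degree_last:
  assumes "A \<subseteq> E" "v < n"
  shows "prefix_degree A v (n - 1) = degree A v"
proof -
  have "w \<le> n - 1" if "{v, w} \<in> A" for w using neighbour_less[OF assms(1) that] by simp
  then have "{w'. w' \<le> n - 1 \<and> {v, w'} \<in> A} = {w'. {v, w'} \<in> A}" by auto
  then show ?thesis by (simp add: prefix_degree_def degree_eq_card_neighbours[OF G assms(1)])
qed

definition lift_subgraph :: "nat set set \<Rightarrow> ising_vertex set set" where
  "lift_subgraph A = select_edges k
     {(v, w, i). v < n \<and> w < n \<and> i \<le> k \<and> (0 < i \<or> even (prefix_degree A v w))}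
     {(v, w). v < n \<and> w < n \<and> odd (prefix_degree A v w)}
     {(v, w, i). v < n \<and> w < n \<and> i < k \<and> {v, w} \<in> A} A"

lemma lift_subgraph_subset: "A \<subseteq> E \<Longrightarrow> lift_subgraph A \<subseteq> ising_edges n k E"
  unfolding lift_subgraph_def ising_edges_def select_edges_def
  by (intro Un_mono image_mono) auto

lemma lift_subgraph_mem:
  assumes "A \<subseteq> E"
  shows "leaf_edge (v, w, i) \<in> lift_subgraph A \<longleftrightarrow> v < n \<and> w < n \<and> i \<le> k \<and> (0 < i \<or> even (prefix_degree A v w))"
    "back_edge (v, w) \<in> lift_subgraph A \<longleftrightarrow> v < n \<and> w < n \<and> odd (prefix_degree A v w)"
    "stub_edge (v, w, i) \<in> lift_subgraph A \<longleftrightarrow> v < n \<and> w < n \<and> i < k \<and> {v, w} \<in> A"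
    "e \<in> E \<Longrightarrow> tip_edge k e \<in> lift_subgraph A \<longleftrightarrow> e \<in> A"
  unfolding lift_subgraph_def select_edges_mem[OF assms] by auto

text \<open>For every \<open>(v, w)\<close> exactly one of \<open>leaf_edge (v, w, 0)\<close> and
  \<open>back_edge (v, w)\<close> is selected, along with \<open>k\<close> leaves; this part does
  not depend on \<open>A\<close>. Each edge of \<open>A\<close> adds two stubs of length
  \<open>k\<close> and one tip edge.\<close>

lemma card_lift_subgraph:
  assumes "A \<subseteq> E"
  shows "card (lift_subgraph A) = n * n * (k + 1) + (2 * k + 1) * card A"
proof -
  let ?J = "{..<n} \<times> {..<n}"
  let ?even = "{(v, w). v < n \<and> w < n \<and> even (prefix_degree A v w)}"
    and ?odd = "{(v, w). v < n \<and> w < n \<and> odd (prefix_degree A v w)}"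
    and ?nb = "{(v, w). v < n \<and> w < n \<and> {v, w} \<in> A}"
  let ?P = "{(v, w, i). v < n \<and> w < n \<and> i \<le> k \<and> (0 < i \<or> even (prefix_degree A v w))}"
  let ?R = "{(v, w, i). v < n \<and> w < n \<and> i < k \<and> {v, w} \<in> A}"
  have fJ: "finite ?even" "finite ?odd" "finite ?nb" by (rule finite_subset[of _ ?J]; auto)+
  have fin: "finite ?P" "finite ?R" by (rule finite_subset[of _ "{..<n} \<times> {..<n} \<times> {..k}"]; auto)+
  have "card ?even + card ?odd = card (?even \<union> ?odd)"
    using fJ by (intro card_Un_disjoint[symmetric]) auto
  also have "?even \<union> ?odd = ?J" by auto
  finally have eo: "card ?even + card ?odd = n * n" by simp
  have Peq: "?P = (\<lambda>(v, w). (v, w, 0)) ` ?even \<union> {..<n} \<times> {..<n} \<times> {1..k}"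
  proof (intro equalityI subsetI)
    fix x assume x: "x \<in> ?P"
    obtain v w i where x': "x = (v, w, i)" by (cases x)
    show "x \<in> (\<lambda>(v, w). (v, w, 0)) ` ?even \<union> {..<n} \<times> {..<n} \<times> {1..k}"
    proof (cases "i = 0")
      case True
      then have "(v, w) \<in> ?even" using x by (simp add: x')
      then have "(\<lambda>(v, w). (v, w, 0)) (v, w) \<in> (\<lambda>(v, w). (v, w, 0)) ` ?even" by (rule imageI)
      then show ?thesis by (simp add: x' True)
    qed (use x in \<open>simp add: x'\<close>)
  qed auto
  have "card ?P = card ((\<lambda>(v, w). (v, w, 0::nat)) ` ?even) + card ({..<n} \<times> {..<n} \<times> {1..k})"
    unfolding Peq using fJ by (intro card_Un_disjoint) auto
  moreover have "card ((\<lambda>(v, w). (v, w, 0::nat)) ` ?even) = card ?even"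
    by (rule card_image) (auto simp: inj_on_def)
  ultimately have P: "card ?P = card ?even + n * n * k" by (simp add: card_cartesian_product)
  have Req: "?R = (\<lambda>((v, w), i). (v, w, i)) ` (?nb \<times> {..<k})" by (auto simp: image_iff)
  have "card ?R = card (?nb \<times> {..<k})" unfolding Req by (rule card_image) (auto simp: inj_on_def)
  then have R: "card ?R = card ?nb * k" by (simp add: card_cartesian_product)
  have "?nb = (SIGMA v:{..<n}. {w. {v, w} \<in> A})"
    using neighbour_less[OF assms] by auto
  moreover have "finite {w. {v, w} \<in> A}" for v
    by (rule finite_subset[of _ "{..<n}"]) (use neighbour_less[OF assms] in auto)
  ultimately have "card ?nb = (\<Sum>v<n. degree A v)"
    by (simp add: degree_eq_card_neighbours[OF G assms])
  then have nb: "card ?nb = 2 * card A" using sum_degree[OF G assms] by simp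
  show ?thesis
    unfolding lift_subgraph_def card_select_edges[OF fin(1) fJ(2) fin(2) assms] P R nb
    using eo by (simp add: algebra_simps)
qed

lemma lift_subgraph_odd:
  assumes "A \<in> odd_subgraphs {..<n} E"
  shows "lift_subgraph A \<in> odd_subgraphs (ising_vertices n k) (ising_edges n k E)"
proof -
  have A: "A \<subseteq> E" "\<And>v. v < n \<Longrightarrow> odd (degree A v)" using assms by (auto simp: odd_subgraphs_def)
  note mem = lift_subgraph_mem[OF A(1)]
  have nxt: "(i < k \<or> {v, w} \<in> E) \<and> next_edge v w i \<in> lift_subgraph A \<longleftrightarrow> {v, w} \<in> A"
    if "v < n" "w < n" "i \<le> k" for v w i
    using that A(1) mem(3)[of v w i] mem(4)[of "{v, w}"] by (auto simp: next_edge_def)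
  show ?thesis
    unfolding odd_ising_iff[OF lift_subgraph_subset[OF A(1)]]
  proof (intro allI impI conjI, goal_cases)
    case (1 v)
    then show ?case using A(2)[OF 1] prefix_degree_last[OF A(1) 1] by (simp add: mem)
  next
    case (2 v w)
    then show ?case by (simp add: mem)
  next
    case (3 v w i)
    then show ?case by (simp add: mem)
  next
    case (4 v w i)
    show ?case
    proof (cases "i = 0")
      case True
      have "(0 < w \<and> back_edge (v, w - 1) \<in> lift_subgraph A) \<longleftrightarrow>
          (even (prefix_degree A v w) \<longleftrightarrow> {v, w} \<in> A)"
        using 4 by (cases w) (auto simp: mem prefix_degree_0 prefix_degree_Suc)
      then show ?thesis unfolding nxt[OF 4] using True 4 by (auto simp: mem prev_edge_def)
    next
      case False
      then show ?thesis unfolding nxt[OF 4] using 4 by (auto simp: mem prev_edge_def)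
    qed
  qed
qed

definition project_subgraph :: "ising_vertex set set \<Rightarrow> nat set set" where
  "project_subgraph B = {e\<in>E. tip_edge k e \<in> B}"

lemma project_lift: "A \<subseteq> E \<Longrightarrow> project_subgraph (lift_subgraph A) = A"
  unfolding project_subgraph_def using lift_subgraph_mem(4) by auto

text \<open>An odd subgraph is determined by its tip edges: these fix the stubs, the stubs fix the
  back edges, and all other edges are forced by vertices of degree 1 or 2.\<close>

lemma lift_project:
  assumes "B \<in> odd_subgraphs (ising_vertices n k) (ising_edges n k E)"
  shows "project_subgraph B \<in> odd_subgraphs {..<n} E" "lift_subgraph (project_subgraph B) = B"
proof -
  let ?A = "project_subgraph B"
  have B: "B \<subseteq> ising_edges n k E" using assms by (simp add: odd_subgraphs_def)
  have A: "?A \<subseteq> E" by (auto simp: project_subgraph_def)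
  note * = assms[unfolded odd_ising_iff[OF B]]
  \<comment> \<open>From the tip inwards: the leaf at an inner stub vertex is selected, so the two
    stub edges there are selected both or not at all.\<close>
  have nxt: "(i < k \<or> {v, w} \<in> E) \<and> next_edge v w i \<in> B \<longleftrightarrow> {v, w} \<in> ?A"
    if "v < n" "w < n" "i \<le> k" for v w i
    using that(3)
  proof (induction i rule: inc_induct)
    case base
    then show ?case by (auto simp: next_edge_def project_subgraph_def)
  next
    case (step i)
    have "leaf_edge (v, w, Suc i) \<in> B" using * that(1,2) step(2) by auto
    moreover have "leaf_edge (v, w, Suc i) \<in> B \<longleftrightarrow>
        (((0 < Suc i \<or> 0 < w) \<and> prev_edge v w (Suc i) \<in> B) \<longleftrightarrow> ((Suc i < k \<or> {v, w} \<in> E) \<and> next_edge v w (Suc i) \<in> B))"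
      using * that(1,2) step(2) by (metis Suc_leI)
    ultimately have "prev_edge v w (Suc i) \<in> B \<longleftrightarrow> {v, w} \<in> ?A" using step.IH by blast
    then show ?case using step(2) by (simp add: next_edge_def prev_edge_def)
  qed
  \<comment> \<open>Along the path: selection changes from one back edge to the next exactly if the
    stub between them is selected.\<close>
  have backB: "back_edge (v, w) \<in> B \<longleftrightarrow> odd (prefix_degree ?A v w)" if v: "v < n" and w: "w < n" for v w
    using w
  proof (induction w)
    case 0
    have "leaf_edge (v, 0, 0) \<in> B \<longleftrightarrow> back_edge (v, 0) \<notin> B" using * v 0 by blast
    moreover have "leaf_edge (v, 0, 0) \<in> B \<longleftrightarrow>
        (((0 < (0::nat) \<or> 0 < (0::nat)) \<and> prev_edge v 0 0 \<in> B) \<longleftrightarrow> ((0 < k \<or> {v, 0} \<in> E) \<and> next_edge v 0 0 \<in> B))"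
      using * v 0 by blast
    ultimately show ?case using nxt[OF v 0, of 0] by (simp add: prefix_degree_0)
  next
    case (Suc w)
    have "leaf_edge (v, Suc w, 0) \<in> B \<longleftrightarrow> back_edge (v, Suc w) \<notin> B" using * v Suc.prems by blast
    moreover have "leaf_edge (v, Suc w, 0) \<in> B \<longleftrightarrow>
        (((0 < (0::nat) \<or> 0 < Suc w) \<and> prev_edge v (Suc w) 0 \<in> B) \<longleftrightarrow>
          ((0 < k \<or> {v, Suc w} \<in> E) \<and> next_edge v (Suc w) 0 \<in> B))"
      using * v Suc.prems by blast
    moreover have "back_edge (v, w) \<in> B \<longleftrightarrow> odd (prefix_degree ?A v w)" using Suc by simp
    ultimately show ?case using nxt[OF v Suc.prems, of 0] by (auto simp: prefix_degree_Suc prev_edge_def)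
  qed
  have "odd (degree ?A v)" if "v < n" for v
    using backB[OF that, of "n - 1"] * that unfolding prefix_degree_last[OF A that] by auto
  then show "?A \<in> odd_subgraphs {..<n} E" using A by (auto simp: odd_subgraphs_def)
  have leaf0: "leaf_edge (v, w, 0) \<in> B \<longleftrightarrow> back_edge (v, w) \<notin> B" if "v < n" "w < n" for v w
    using * that by blast
  have leafS: "leaf_edge (v, w, i) \<in> B" if "v < n" "w < n" "i \<le> k" "0 < i" for v w i
    using * that by blast
  have "e \<in> lift_subgraph ?A \<longleftrightarrow> e \<in> B" if eE: "e \<in> ising_edges n k E" for e
  proof -
    consider (l) v w i where "v < n" "w < n" "i \<le> k" "e = leaf_edge (v, w, i)"
      | (b) v w where "v < n" "w < n" "e = back_edge (v, w)"
      | (s) v w i where "v < n" "w < n" "i < k" "e = stub_edge (v, w, i)"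
      | (t) f where "f \<in> E" "e = tip_edge k f"
      using eE unfolding ising_edges_def select_edges_def by blast
    then show ?thesis
    proof cases
      case l
      show ?thesis
      proof (cases "i = 0")
        case True
        then show ?thesis using l leaf0[OF l(1,2)] backB[OF l(1,2)] by (simp add: lift_subgraph_mem[OF A])
      next
        case False
        then show ?thesis using l leafS[OF l(1-3)] by (simp add: lift_subgraph_mem[OF A])
      qed
    next
      case b
      then show ?thesis using backB[OF b(1,2)] by (simp add: lift_subgraph_mem[OF A])
    next
      case s
      then show ?thesis using nxt[OF s(1,2), of i] by (simp add: lift_subgraph_mem[OF A] next_edge_def)
    next
      case t
      have "f \<in> ?A \<longleftrightarrow> tip_edge k f \<in> B" using t(1) by (simp add: project_subgraph_def)
      then show ?thesis unfolding t(2) lift_subgraph_mem(4)[OF A t(1)] .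
    qed
  qed
  then show "lift_subgraph ?A = B" using B lift_subgraph_subset[OF A] by blast
qed

theorem sum_odd_ising:
  fixes t :: real
  shows "(\<Sum>B\<in>odd_subgraphs (ising_vertices n k) (ising_edges n k E). t ^ card B) =
    t ^ (n * n * (k + 1)) * (\<Sum>A\<in>odd_subgraphs {..<n} E. (t ^ (2 * k + 1)) ^ card A)"
proof -
  have "(\<Sum>B\<in>odd_subgraphs (ising_vertices n k) (ising_edges n k E). t ^ card B) =
      (\<Sum>A\<in>odd_subgraphs {..<n} E. t ^ card (lift_subgraph A))"
  proof (rule sum.reindex_bij_witness[where i = lift_subgraph and j = project_subgraph])
    show "project_subgraph (lift_subgraph A) = A" if "A \<in> odd_subgraphs {..<n} E" for A
      using that by (intro project_lift) (simp add: odd_subgraphs_def)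
  qed (simp_all add: lift_project lift_subgraph_odd)
  also have "\<dots> = (\<Sum>A\<in>odd_subgraphs {..<n} E. t ^ (n * n * (k + 1)) * (t ^ (2 * k + 1)) ^ card A)"
  proof (rule sum.cong[OF refl])
    fix A assume "A \<in> odd_subgraphs {..<n} E"
    then have "A \<subseteq> E" by (simp add: odd_subgraphs_def)
    show "t ^ card (lift_subgraph A) = t ^ (n * n * (k + 1)) * (t ^ (2 * k + 1)) ^ card A"
      unfolding card_lift_subgraph[OF \<open>A \<subseteq> E\<close>] by (simp only: power_add[of t "n * n * (k + 1)"] power_mult)
  qed
  finally show ?thesis by (simp add: sum_distrib_left)
qed

end

section \<open>Vertices as numbers and adjacency as arithmetic\<close>

section \<open>Numbering the vertices\<close>

lemma degree_image:
  assumes "inj_on f V" "finite_graph V E" "A \<subseteq> E" "v \<in> V"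
  shows "degree ((`) f ` A) (f v) = degree A v"
proof -
  have sub: "e \<subseteq> V" if "e \<in> A" for e using that assms(2,3) by (auto simp: finite_graph_def)
  have "{e \<in> (`) f ` A. f v \<in> e} = (`) f ` {e\<in>A. v \<in> e}"
    using inj_on_image_mem_iff[OF assms(1,4)] sub by auto
  moreover have "inj_on ((`) f) {e\<in>A. v \<in> e}"
    using sub by (intro inj_on_subset[OF inj_on_image_Pow[OF assms(1)]]) auto
  ultimately show ?thesis by (simp add: degree_def card_image)
qed

lemma finite_graph_image:
  assumes "inj_on f V" "finite_graph V E"
  shows "finite_graph (f ` V) ((`) f ` E)"
  using assms by (auto simp: finite_graph_def card_image inj_on_subset)

lemma card_edges_image:
  assumes "inj_on f V" "finite_graph V E" "A \<subseteq> E"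
  shows "card ((`) f ` A) = card A"
proof (rule card_image)
  show "inj_on ((`) f) A"
    using assms(2,3) by (intro inj_on_subset[OF inj_on_image_Pow[OF assms(1)]]) (auto simp: finite_graph_def)
qed

lemma sum_odd_subgraphs_image:
  fixes t :: real
  assumes f: "inj_on f V" and G: "finite_graph V E"
  shows "(\<Sum>A\<in>odd_subgraphs (f ` V) ((`) f ` E). t ^ card A) = (\<Sum>A\<in>odd_subgraphs V E. t ^ card A)"
proof -
  have i: "inj_on ((`) f) E"
    using G by (intro inj_on_subset[OF inj_on_image_Pow[OF f]]) (auto simp: finite_graph_def)
  have "odd_subgraphs (f ` V) ((`) f ` E) = (`) ((`) f) ` odd_subgraphs V E"
  proof (intro equalityI subsetI)
    fix B assume B: "B \<in> odd_subgraphs (f ` V) ((`) f ` E)"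
    then obtain A where A: "A \<subseteq> E" "B = (`) f ` A" by (auto simp: odd_subgraphs_def subset_image_iff)
    have "odd (degree A v)" if "v \<in> V" for v
      using B degree_image[OF f G A(1) that] that by (auto simp: odd_subgraphs_def A(2))
    then show "B \<in> (`) ((`) f) ` odd_subgraphs V E" using A by (auto simp: odd_subgraphs_def)
  next
    fix B assume "B \<in> (`) ((`) f) ` odd_subgraphs V E"
    then obtain A where A: "A \<subseteq> E" "B = (`) f ` A" "\<forall>v\<in>V. odd (degree A v)" by (auto simp: odd_subgraphs_def)
    then show "B \<in> odd_subgraphs (f ` V) ((`) f ` E)"
      using degree_image[OF f G A(1)] by (auto simp: odd_subgraphs_def)
  qed
  moreover have "inj_on ((`) ((`) f)) (odd_subgraphs V E)"
    by (rule inj_on_subset[OF inj_on_image_Pow[OF i]]) (auto simp: odd_subgraphs_def)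
  ultimately have "(\<Sum>A\<in>odd_subgraphs (f ` V) ((`) f ` E). t ^ card A) =
      (\<Sum>A\<in>odd_subgraphs V E. t ^ card ((`) f ` A))"
    by (simp add: sum.reindex)
  also have "\<dots> = (\<Sum>A\<in>odd_subgraphs V E. t ^ card A)"
    by (intro sum.cong refl) (simp add: card_edges_image[OF f G] odd_subgraphs_def)
  finally show ?thesis .
qed

lemma image_pair_mem:
  assumes "inj_on f V" "x \<in> V" "y \<in> V" "\<And>e. e \<in> E \<Longrightarrow> e \<subseteq> V"
  shows "{f x, f y} \<in> (`) f ` E \<longleftrightarrow> {x, y} \<in> E"
proof -
  have "{f x, f y} = f ` e \<longleftrightarrow> {x, y} = e" if "e \<in> E" for e
    using inj_on_image_eq_iff[OF assms(1), of "{x, y}" e] assms(2,3) assms(4)[OF that] by auto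
  then show ?thesis by blast
qed

lemma card_edges_le:
  assumes "finite_graph {..<n} E"
  shows "card E \<le> n * n"
proof -
  have "inj_on (\<lambda>e. (Min e, Max e)) E"
    by (rule inj_onI) (metis Pair_inject finite_graph_pair(1)[OF assms])
  moreover have "(\<lambda>e. (Min e, Max e)) ` E \<subseteq> {..<n} \<times> {..<n}"
    using finite_graph_pair(2,3)[OF assms] by fastforce
  ultimately have "card E \<le> card ({..<n} \<times> {..<n})"
    by (intro card_inj_on_le) auto
  then show ?thesis by simp
qed

lemma mixed_radix:
  fixes a j R :: nat
  assumes "j < R"
  shows "(a * R + j) div R = a" "(a * R + j) mod R = j"
  using assms by auto

lemma mixed_radix_less:
  fixes a j R :: nat
  assumes "j < R" "a < n"
  shows "a * R + j < n * R"
proof -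
  have "a * R + j < Suc a * R" using assms by simp
  also have "\<dots> \<le> n * R" using assms by (intro mult_right_mono) auto
  finally show ?thesis .
qed

subsection \<open>The graph with perfect matchings\<close>

definition matching_code :: "nat \<Rightarrow> nat \<Rightarrow> nat \<times> nat \<times> nat \<Rightarrow> nat" where
  "matching_code n q = (\<lambda>(v, w, j). (v * (2 * n + 1) + w) * (3 + 2 * q) + j)"

definition matching_decode :: "nat \<Rightarrow> nat \<Rightarrow> nat \<Rightarrow> nat \<times> nat \<times> nat" where
  "matching_decode n q x =
     (x div (3 + 2 * q) div (2 * n + 1), x div (3 + 2 * q) mod (2 * n + 1), x mod (3 + 2 * q))"

lemma matching_decode_code: "y \<in> matching_vertices n q \<Longrightarrow> matching_decode n q (matching_code n q y) = y"
proof -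
  assume y: "y \<in> matching_vertices n q"
  obtain v w j where y': "y = (v, w, j)" by (cases y)
  have b: "j < 3 + 2 * q" "w < 2 * n + 1" using y by (auto simp: y' matching_vertices_def)
  show ?thesis unfolding y' matching_code_def matching_decode_def prod.case
    by (simp only: mixed_radix[OF b(1)] mixed_radix[OF b(2)])
qed

lemma matching_code_decode: "matching_code n q (matching_decode n q x) = x"
  unfolding matching_code_def matching_decode_def prod.case div_mult_mod_eq ..

lemma matching_code_image:
  "matching_code n q ` matching_vertices n q = {..<n * (2 * n + 1) * (3 + 2 * q)}"
proof (intro equalityI subsetI)
  fix x assume "x \<in> matching_code n q ` matching_vertices n q"
  then obtain v w j where "v < n" "w < 2 * n + 1" "j < 3 + 2 * q" "x = (v * (2 * n + 1) + w) * (3 + 2 * q) + j"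
    by (auto simp: matching_vertices_def matching_code_def)
  then show "x \<in> {..<n * (2 * n + 1) * (3 + 2 * q)}"
    using mixed_radix_less[of j "3 + 2 * q", OF _ mixed_radix_less[of w "2 * n + 1" v n]] by simp
next
  fix x assume "x \<in> {..<n * (2 * n + 1) * (3 + 2 * q)}"
  then have "x div (3 + 2 * q) < n * (2 * n + 1)" by (simp add: less_mult_imp_div_less)
  then have "x div (3 + 2 * q) div (2 * n + 1) < n" by (rule less_mult_imp_div_less)
  then have "matching_decode n q x \<in> matching_vertices n q"
    by (simp add: matching_decode_def matching_vertices_def)
  then show "x \<in> matching_code n q ` matching_vertices n q"
    using matching_code_decode[of n q x] by (metis imageI)
qed

lemma inj_on_matching_code: "inj_on (matching_code n q) (matching_vertices n q)"
  by (rule inj_on_inverseI[of _ "matching_decode n q"]) (rule matching_decode_code)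

text \<open>One direction of adjacency, in terms that \<open>comp\<close> covers. As
  \<open>p\<close> and \<open>q\<close> are constants of the reduction, the weight gadget enters as
  a finite table. The guard \<open>w < n\<close> is there because positions in a chain run up to
  \<open>2 * n\<close>, where \<open>adj\<close> has no meaning.\<close>

definition matching_arc ::
    "nat \<Rightarrow> nat \<Rightarrow> nat \<Rightarrow> (nat \<Rightarrow> nat \<Rightarrow> bool) \<Rightarrow> nat \<Rightarrow> nat \<Rightarrow> nat \<Rightarrow> nat \<Rightarrow> nat \<Rightarrow> nat \<Rightarrow> bool" where
  "matching_arc n p q adj v w j v' w' j' \<longleftrightarrow>
     v = v' \<and> w = w' \<and> j < 3 \<and> j' < 3 \<and> j \<noteq> j' \<or>
     v = v' \<and> w' = w + 1 \<and> j = 2 \<and> j' = 0 \<or>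
     v = v' \<and> w = w' \<and> 3 \<le> j \<and> 3 \<le> j' \<and> (j - 3, j' - 3) \<in> {(a, b). {a, b} \<in> weight_edges p q} \<or>
     v = v' \<and> w = w' \<and> j = 3 \<and> j' = 1 \<and> v < w \<and> w < n \<and> adj v w \<or>
     v' = w \<and> w' = v \<and> j = 4 \<and> j' = 1 \<and> v < w \<and> w < n \<and> adj v w"

lemma chain_pair_iff:
  assumes "w < m" "w' < m" "j < 3" "j' < 3"
  shows "{3 * w + j, 3 * w' + j'} \<in> chain_edges m \<longleftrightarrow>
    w = w' \<and> j \<noteq> j' \<or> w' = w + 1 \<and> j = 2 \<and> j' = 0 \<or> w = w' + 1 \<and> j' = 2 \<and> j = 0"
proof -
  have j: "j = 0 \<or> j = 1 \<or> j = 2" "j' = 0 \<or> j' = 1 \<or> j' = 2" using assms by auto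
  have dm: "(3 * a + b) div 3 = a" if "b < 3" for a b :: nat using that by simp
  have eq: "3 * a + b = 3 * a' + b' \<longleftrightarrow> a = a' \<and> b = b'" if "b < 3" "b' < 3" for a a' b b' :: nat
    using dm[OF that(1), of a] dm[OF that(2), of a'] by (metis add_left_cancel)
  have d: "{3 * w + j, 3 * w' + j'} = {3 * x + a, 3 * y + b} \<longleftrightarrow>
      w = x \<and> j = a \<and> w' = y \<and> j' = b \<or> w = y \<and> j = b \<and> w' = x \<and> j' = a" if "a < 3" "b < 3" for x y a b
    unfolding doubleton_eq_iff eq[OF assms(3) that(1)] eq[OF assms(3) that(2)]
      eq[OF assms(4) that(1)] eq[OF assms(4) that(2)] by (simp only: conj_assoc)
  have m: "e \<in> chain_edges m \<longleftrightarrow>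
    (\<exists>x<m. e = {3 * x + 0, 3 * x + 1} \<or> e = {3 * x + 1, 3 * x + 2} \<or> e = {3 * x + 0, 3 * x + 2}) \<or>
    (\<exists>x. e = {3 * x + 2, 3 * (x + 1) + 0} \<and> x + 1 < m)" for e
  proof -
    have "(\<Union>w\<in>{1..<m}. {{3 * w - 1, 3 * w}}) = {{3 * x + 2, 3 * (x + 1) + 0} | x. x + 1 < m}"
    proof (intro equalityI subsetI)
      fix e assume "e \<in> (\<Union>w\<in>{1..<m}. {{3 * w - 1, 3 * w}})"
      then obtain w where w: "1 \<le> w" "w < m" "e = {3 * w - 1, 3 * w}" by auto
      then obtain x where "w = x + 1" by (metis add.commute le_Suc_ex plus_1_eq_Suc)
      then have "x + 1 < m" "e = {3 * x + 2, 3 * (x + 1) + 0}" using w by auto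
      then show "e \<in> {{3 * x + 2, 3 * (x + 1) + 0} | x. x + 1 < m}" by blast
    next
      fix e assume "e \<in> {{3 * x + 2, 3 * (x + 1) + 0} | x. x + 1 < m}"
      then obtain x where x: "x + 1 < m" "e = {3 * x + 2, 3 * (x + 1) + 0}" by blast
      then have "e = {3 * (x + 1) - 1, 3 * (x + 1)}" by simp
      then show "e \<in> (\<Union>w\<in>{1..<m}. {{3 * w - 1, 3 * w}})" using x(1) by force
    qed
    then show ?thesis unfolding chain_edges_def
      by (simp only: Un_iff UN_iff insert_iff empty_iff Bex_def lessThan_iff mem_Collect_eq simp_thms add_0_right)
  qed
  have less: "0 < (3::nat)" "1 < (3::nat)" "2 < (3::nat)" by simp_all
  show ?thesis
    unfolding m d[OF less(1,2)] d[OF less(2,3)] d[OF less(1,3)] d[OF less(3,1)]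
    using j by (elim disjE) (use assms(1,2) in auto)
qed

lemma matching_edges_iff:
  assumes G: "finite_graph {..<n} E" and adj: "\<And>i j. i < n \<Longrightarrow> j < n \<Longrightarrow> adj i j \<longleftrightarrow> {i, j} \<in> E"
    and x: "(v, w, j) \<in> matching_vertices n q" and y: "(v', w', j') \<in> matching_vertices n q"
  shows "{(v, w, j), (v', w', j')} \<in> matching_edges n E p q \<longleftrightarrow>
    matching_arc n p q adj v w j v' w' j' \<or> matching_arc n p q adj v' w' j' v w j"
proof -
  let ?e = "{(v, w, j), (v', w', j')}"
  have b: "v < n" "w < 2 * n + 1" "j < 3 + 2 * q" "v' < n" "w' < 2 * n + 1" "j' < 3 + 2 * q"
    using x y by (auto simp: matching_vertices_def)
  have chain: "?e \<in> (\<Union>v\<in>{..<n}. (`) (chain_vertex v) ` chain_edges (2 * n + 1)) \<longleftrightarrow>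
    v = v' \<and> j < 3 \<and> j' < 3 \<and> {3 * w + j, 3 * w' + j'} \<in> chain_edges (2 * n + 1)"
  proof
    assume "?e \<in> (\<Union>v\<in>{..<n}. (`) (chain_vertex v) ` chain_edges (2 * n + 1))"
    then obtain a f where f: "?e = chain_vertex a ` f" "f \<in> chain_edges (2 * n + 1)" by auto
    then have "(v, w, j) \<in> chain_vertex a ` f" "(v', w', j') \<in> chain_vertex a ` f" by blast+
    then have s: "v = a" "v' = a" "j < 3" "j' < 3" by (auto simp: chain_vertex_def)
    then have "?e = chain_vertex a ` {3 * w + j, 3 * w' + j'}" by (simp add: chain_vertex_def)
    then have "f = {3 * w + j, 3 * w' + j'}" using f(1) inj_image_eq_iff[OF inj_chain_vertex] by metis
    then show "v = v' \<and> j < 3 \<and> j' < 3 \<and> {3 * w + j, 3 * w' + j'} \<in> chain_edges (2 * n + 1)"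
      using f(2) s by simp
  next
    assume *: "v = v' \<and> j < 3 \<and> j' < 3 \<and> {3 * w + j, 3 * w' + j'} \<in> chain_edges (2 * n + 1)"
    then have "?e = chain_vertex v ` {3 * w + j, 3 * w' + j'}" by (simp add: chain_vertex_def)
    then show "?e \<in> (\<Union>v\<in>{..<n}. (`) (chain_vertex v) ` chain_edges (2 * n + 1))" using * b(1) by blast
  qed
  have weight: "?e \<in> (\<Union>x\<in>{..<n} \<times> {..<2 * n + 1}. (`) (weight_vertex x) ` weight_edges p q) \<longleftrightarrow>
    v = v' \<and> w = w' \<and> 3 \<le> j \<and> 3 \<le> j' \<and> {j - 3, j' - 3} \<in> weight_edges p q"
  proof
    assume "?e \<in> (\<Union>x\<in>{..<n} \<times> {..<2 * n + 1}. (`) (weight_vertex x) ` weight_edges p q)"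
    then obtain a f where f: "?e = weight_vertex a ` f" "f \<in> weight_edges p q" by auto
    then have "(v, w, j) \<in> weight_vertex a ` f" "(v', w', j') \<in> weight_vertex a ` f" by blast+
    then have s: "(v, w) = a" "(v', w') = a" "3 \<le> j" "3 \<le> j'" by (auto simp: weight_vertex_def)
    then have "?e = weight_vertex a ` {j - 3, j' - 3}" by (auto simp: weight_vertex_def)
    then have "f = {j - 3, j' - 3}" using f(1) inj_image_eq_iff[OF inj_weight_vertex] by metis
    then show "v = v' \<and> w = w' \<and> 3 \<le> j \<and> 3 \<le> j' \<and> {j - 3, j' - 3} \<in> weight_edges p q"
      using f(2) s by auto
  next
    assume *: "v = v' \<and> w = w' \<and> 3 \<le> j \<and> 3 \<le> j' \<and> {j - 3, j' - 3} \<in> weight_edges p q"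
    then have "?e = weight_vertex (v, w) ` {j - 3, j' - 3}" by (auto simp: weight_vertex_def)
    then show "?e \<in> (\<Union>x\<in>{..<n} \<times> {..<2 * n + 1}. (`) (weight_vertex x) ` weight_edges p q)"
      using * b(1,2) by blast
  qed
  have lu: "?e \<in> lower_connector ` E \<union> upper_connector ` E \<longleftrightarrow>
    (\<exists>a c. a < c \<and> c < n \<and> {a, c} \<in> E \<and> (?e = {(a, c, 3), (a, c, 1)} \<or> ?e = {(a, c, 4), (c, a, 1)}))"
  proof
    assume "?e \<in> lower_connector ` E \<union> upper_connector ` E"
    then obtain f where f: "f \<in> E" "?e = lower_connector f \<or> ?e = upper_connector f" by auto
    note p = finite_graph_pair[OF G f(1)]
    have "{Min f, Max f} \<in> E" using p(1) f(1) by simp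
    then show "\<exists>a c. a < c \<and> c < n \<and> {a, c} \<in> E \<and> (?e = {(a, c, 3), (a, c, 1)} \<or> ?e = {(a, c, 4), (c, a, 1)})"
      using p(2,3) f(2) unfolding lower_connector_def upper_connector_def by blast
  next
    assume "\<exists>a c. a < c \<and> c < n \<and> {a, c} \<in> E \<and> (?e = {(a, c, 3), (a, c, 1)} \<or> ?e = {(a, c, 4), (c, a, 1)})"
    then obtain a c where ac: "a < c" "{a, c} \<in> E" "?e = {(a, c, 3), (a, c, 1)} \<or> ?e = {(a, c, 4), (c, a, 1)}" by blast
    have "Min {a, c} = a" "Max {a, c} = c" using ac(1) by auto
    then have "?e = lower_connector {a, c} \<or> ?e = upper_connector {a, c}"
      using ac(3) by (simp add: lower_connector_def upper_connector_def)
    then show "?e \<in> lower_connector ` E \<union> upper_connector ` E" using ac(2) by blast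
  qed
  have conn: "?e \<in> lower_connector ` E \<union> upper_connector ` E \<longleftrightarrow>
     v = v' \<and> w = w' \<and> j = 3 \<and> j' = 1 \<and> v < w \<and> w < n \<and> adj v w \<or>
     v' = w \<and> w' = v \<and> j = 4 \<and> j' = 1 \<and> v < w \<and> w < n \<and> adj v w \<or>
     v = v' \<and> w = w' \<and> j' = 3 \<and> j = 1 \<and> v < w \<and> w < n \<and> adj v w \<or>
     v' = w \<and> w' = v \<and> j' = 4 \<and> j = 1 \<and> w < v \<and> v < n \<and> adj w v"
    (is "_ \<longleftrightarrow> ?R")
  proof
    assume "?e \<in> lower_connector ` E \<union> upper_connector ` E"
    then obtain a c where ac: "a < c" "c < n" "{a, c} \<in> E" "?e = {(a, c, 3), (a, c, 1)} \<or> ?e = {(a, c, 4), (c, a, 1)}"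
      unfolding lu by blast
    then have "adj a c" using adj[of a c] by simp
    with ac(1,2,4) show ?R unfolding doubleton_eq_iff prod.inject by (elim disjE conjE) simp_all
  next
    assume ?R
    then show "?e \<in> lower_connector ` E \<union> upper_connector ` E"
    proof (elim disjE conjE, goal_cases)
      case 1
      then show ?case unfolding lu using adj[of v w] b by (intro exI[of _ v] exI[of _ w]) simp
    next
      case 2
      then show ?case unfolding lu using adj[of v w] b by (intro exI[of _ v] exI[of _ w]) simp
    next
      case 3
      then show ?case unfolding lu using adj[of v w] b by (intro exI[of _ v] exI[of _ w]) (simp add: insert_commute)
    next
      case 4
      then show ?case unfolding lu using adj[of w v] b by (intro exI[of _ w] exI[of _ v]) (simp add: insert_commute)
    qed
  qed
  have "?e \<in> matching_edges n E p q \<longleftrightarrow>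
      (v = v' \<and> j < 3 \<and> j' < 3 \<and> {3 * w + j, 3 * w' + j'} \<in> chain_edges (2 * n + 1)) \<or>
      (v = v' \<and> w = w' \<and> 3 \<le> j \<and> 3 \<le> j' \<and> {j - 3, j' - 3} \<in> weight_edges p q) \<or>
      ?e \<in> lower_connector ` E \<union> upper_connector ` E"
    unfolding matching_edges_def gadget_edges_def Un_iff[of ?e] chain weight by blast
  also have "\<dots> \<longleftrightarrow> matching_arc n p q adj v w j v' w' j' \<or> matching_arc n p q adj v' w' j' v w j"
  proof -
    let ?A = "v = v' \<and> w = w' \<and> j < 3 \<and> j' < 3 \<and> j \<noteq> j'"
    let ?W = "v = v' \<and> w = w' \<and> 3 \<le> j \<and> 3 \<le> j' \<and> {j - 3, j' - 3} \<in> weight_edges p q"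
    have 1: "(v = v' \<and> j < 3 \<and> j' < 3 \<and> {3 * w + j, 3 * w' + j'} \<in> chain_edges (2 * n + 1)) \<longleftrightarrow>
        ?A \<or> (v = v' \<and> w' = w + 1 \<and> j = 2 \<and> j' = 0) \<or> (v = v' \<and> w = w' + 1 \<and> j' = 2 \<and> j = 0)"
      using chain_pair_iff[OF b(2,5), of j j'] by auto
    have 2: "matching_arc n p q adj v w j v' w' j' \<longleftrightarrow> ?A \<or> (v = v' \<and> w' = w + 1 \<and> j = 2 \<and> j' = 0) \<or> ?W \<or>
        (v = v' \<and> w = w' \<and> j = 3 \<and> j' = 1 \<and> v < w \<and> w < n \<and> adj v w) \<or>
        (v' = w \<and> w' = v \<and> j = 4 \<and> j' = 1 \<and> v < w \<and> w < n \<and> adj v w)"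
      unfolding matching_arc_def mem_Collect_eq prod.case ..
    have 3: "matching_arc n p q adj v' w' j' v w j \<longleftrightarrow> ?A \<or> (v = v' \<and> w = w' + 1 \<and> j' = 2 \<and> j = 0) \<or> ?W \<or>
        (v = v' \<and> w = w' \<and> j' = 3 \<and> j = 1 \<and> v < w \<and> w < n \<and> adj v w) \<or>
        (v' = w \<and> w' = v \<and> j' = 4 \<and> j = 1 \<and> w < v \<and> v < n \<and> adj w v)"
      unfolding matching_arc_def mem_Collect_eq prod.case insert_commute[of "j' - 3" "j - 3"]
      by (intro arg_cong2[where f = "(\<or>)"]) auto
    show ?thesis unfolding 1 2 3 conn by (simp only: disj_ac disj_absorb disj_left_absorb)
  qed
  finally show ?thesis .
qed

subsection \<open>The graph for the Ising model\<close>

text \<open>The vertices replacing one \<open>v\<close>: \<open>n\<close> blocks of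
  \<open>2 * (k + 1)\<close>, followed by the end \<open>(v, n, 0, 0)\<close> of its path.\<close>

definition ising_row :: "nat \<Rightarrow> nat \<Rightarrow> nat" where
  "ising_row n k = 2 * n * (k + 1) + 1"

definition ising_code :: "nat \<Rightarrow> nat \<Rightarrow> ising_vertex \<Rightarrow> nat" where
  "ising_code n k = (\<lambda>(v, w, i, c). v * ising_row n k + (w * (2 * (k + 1)) + (i * 2 + c)))"

definition ising_decode :: "nat \<Rightarrow> nat \<Rightarrow> nat \<Rightarrow> ising_vertex" where
  "ising_decode n k x = (x div ising_row n k, x mod ising_row n k div (2 * (k + 1)),
     x mod ising_row n k mod (2 * (k + 1)) div 2, x mod ising_row n k mod (2 * (k + 1)) mod 2)"

lemma ising_column_bounds:
  assumes "(v, w, i, c) \<in> ising_vertices n k"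
  shows "v < n" "c < 2" "i * 2 + c < 2 * (k + 1)" "w * (2 * (k + 1)) + (i * 2 + c) < ising_row n k"
proof -
  show 1: "v < n" "c < 2" "i * 2 + c < 2 * (k + 1)" using assms by (auto simp: ising_vertices_def)
  show "w * (2 * (k + 1)) + (i * 2 + c) < ising_row n k"
  proof (cases "w < n")
    case True
    then show ?thesis using mixed_radix_less[OF 1(3), of w n] by (simp add: ising_row_def)
  next
    case False
    then have "w = n" "i = 0" "c = 0" using assms by (auto simp: ising_vertices_def)
    then show ?thesis by (simp add: ising_row_def)
  qed
qed

lemma ising_decode_code: "y \<in> ising_vertices n k \<Longrightarrow> ising_decode n k (ising_code n k y) = y"
proof -
  assume y: "y \<in> ising_vertices n k"
  obtain v w i c where y': "y = (v, w, i, c)" by (cases y)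
  note b = ising_column_bounds[OF y[unfolded y']]
  show ?thesis unfolding y' ising_code_def ising_decode_def prod.case
    by (simp only: mixed_radix[OF b(4)] mixed_radix[OF b(3)] mixed_radix[OF b(2)])
qed

lemma ising_code_decode: "ising_code n k (ising_decode n k x) = x"
  unfolding ising_code_def ising_decode_def prod.case div_mult_mod_eq ..

lemma ising_decode_vertex:
  assumes "x < n * ising_row n k"
  shows "ising_decode n k x \<in> ising_vertices n k"
proof -
  have v: "x div ising_row n k < n" using assms by (rule less_mult_imp_div_less)
  have pos: "0 < ising_row n k" by (simp add: ising_row_def)
  let ?j = "x mod ising_row n k"
  have "?j < ising_row n k" using pos by simp
  then have "?j < n * (2 * (k + 1)) + 1" unfolding ising_row_def by (simp only: mult.assoc mult.left_commute[of 2])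
  then have j: "?j \<le> n * (2 * (k + 1))" by simp
  show ?thesis
  proof (cases "?j = n * (2 * (k + 1))")
    case True
    have "n * (2 * (k + 1)) div (2 * (k + 1)) = n" by (rule nonzero_mult_div_cancel_right) simp
    then have "ising_decode n k x = (x div ising_row n k, n, 0, 0)"
      unfolding ising_decode_def True by (simp only: mod_mult_self2_is_0 div_0 mod_0)
    then show ?thesis using v by (simp add: ising_vertices_def)
  next
    case False
    then have w: "?j div (2 * (k + 1)) < n" using j by (intro less_mult_imp_div_less) simp
    have "?j mod (2 * (k + 1)) < (k + 1) * 2"
      by (rule order.strict_trans2[OF mod_less_divisor]) simp_all
    then have "?j mod (2 * (k + 1)) div 2 < k + 1" by (rule less_mult_imp_div_less)
    then show ?thesis using v w by (simp add: ising_vertices_def ising_decode_def)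
  qed
qed

lemma ising_code_image: "ising_code n k ` ising_vertices n k = {..<n * ising_row n k}"
proof (intro equalityI subsetI)
  fix x assume "x \<in> ising_code n k ` ising_vertices n k"
  then obtain v w i c where y: "(v, w, i, c) \<in> ising_vertices n k" "x = ising_code n k (v, w, i, c)" by auto
  then show "x \<in> {..<n * ising_row n k}"
    using ising_column_bounds[OF y(1)] mixed_radix_less by (simp add: ising_code_def)
next
  fix x assume "x \<in> {..<n * ising_row n k}"
  then show "x \<in> ising_code n k ` ising_vertices n k"
    using ising_decode_vertex[of x n k] ising_code_decode[of n k x] by (metis imageI lessThan_iff)
qed

lemma inj_on_ising_code: "inj_on (ising_code n k) (ising_vertices n k)"
  by (rule inj_on_inverseI[of _ "ising_decode n k"]) (rule ising_decode_code)

definition ising_arc ::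
    "nat \<Rightarrow> nat \<Rightarrow> (nat \<Rightarrow> nat \<Rightarrow> bool) \<Rightarrow> nat \<Rightarrow> nat \<Rightarrow> nat \<Rightarrow> nat \<Rightarrow> nat \<Rightarrow> nat \<Rightarrow> nat \<Rightarrow> nat \<Rightarrow> bool" where
  "ising_arc n k adj v w i c v' w' i' c' \<longleftrightarrow>
     v = v' \<and> w = w' \<and> i = i' \<and> c = 0 \<and> c' = 1 \<or>
     v = v' \<and> w' = w + 1 \<and> i = 0 \<and> i' = 0 \<and> c = 1 \<and> c' = 0 \<or>
     v = v' \<and> w = w' \<and> i' = i + 1 \<and> c = 0 \<and> c' = 0 \<or>
     v' = w \<and> w' = v \<and> i = k \<and> i' = k \<and> c = 0 \<and> c' = 0 \<and> w < n \<and> adj v w"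

lemma ising_edges_iff:
  assumes G: "finite_graph {..<n} E" and adj: "\<And>i j. i < n \<Longrightarrow> j < n \<Longrightarrow> adj i j \<longleftrightarrow> {i, j} \<in> E"
    and x: "(v, w, i, c) \<in> ising_vertices n k" and y: "(v', w', i', c') \<in> ising_vertices n k"
  shows "{(v, w, i, c), (v', w', i', c')} \<in> ising_edges n k E \<longleftrightarrow>
    ising_arc n k adj v w i c v' w' i' c' \<or> ising_arc n k adj v' w' i' c' v w i c"
proof -
  let ?e = "{(v, w, i, c), (v', w', i', c')}"
  have b: "v < n" "v' < n" "w \<le> n" "w' \<le> n" "i \<le> k" "i' \<le> k"
    "w = n \<Longrightarrow> i = 0 \<and> c = 0" "w' = n \<Longrightarrow> i' = 0 \<and> c' = 0" "w < n \<or> w = n \<and> i = 0 \<and> c = 0" "w' < n \<or> w' = n \<and> i' = 0 \<and> c' = 0"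
    using x y by (auto simp: ising_vertices_def)
  have leaf: "?e \<in> leaf_edge ` ({..<n} \<times> {..<n} \<times> {..k}) \<longleftrightarrow>
      v = v' \<and> w = w' \<and> i = i' \<and> (c = 0 \<and> c' = 1 \<or> c = 1 \<and> c' = 0)"
    using b by (auto simp: leaf_edge_def image_iff doubleton_eq_iff)
  have backe: "?e \<in> back_edge ` ({..<n} \<times> {..<n}) \<longleftrightarrow>
      v = v' \<and> i = 0 \<and> i' = 0 \<and> (w' = w + 1 \<and> c = 1 \<and> c' = 0 \<or> w = w' + 1 \<and> c' = 1 \<and> c = 0)"
    using b by (auto simp: back_edge_def image_iff doubleton_eq_iff)
  have stub: "?e \<in> stub_edge ` ({..<n} \<times> {..<n} \<times> {..<k}) \<longleftrightarrow>
      v = v' \<and> w = w' \<and> c = 0 \<and> c' = 0 \<and> (i' = i + 1 \<or> i = i' + 1)"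
  proof
    assume "?e \<in> stub_edge ` ({..<n} \<times> {..<n} \<times> {..<k})"
    then show "v = v' \<and> w = w' \<and> c = 0 \<and> c' = 0 \<and> (i' = i + 1 \<or> i = i' + 1)"
      by (auto simp: stub_edge_def doubleton_eq_iff)
  next
    assume "v = v' \<and> w = w' \<and> c = 0 \<and> c' = 0 \<and> (i' = i + 1 \<or> i = i' + 1)"
    then have "w < n" "?e = stub_edge (v, w, i) \<and> i < k \<or> ?e = stub_edge (v, w, i') \<and> i' < k"
      using b by (auto simp: stub_edge_def insert_commute)
    then show "?e \<in> stub_edge ` ({..<n} \<times> {..<n} \<times> {..<k})" using b(1) by blast
  qed
  have tip: "?e \<in> tip_edge k ` E \<longleftrightarrow> v' = w \<and> w' = v \<and> i = k \<and> i' = k \<and> c = 0 \<and> c' = 0 \<and> {v, w} \<in> E"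
  proof
    assume "?e \<in> tip_edge k ` E"
    then obtain f where f: "f \<in> E" "?e = tip_edge k f" by auto
    note p = finite_graph_pair[OF G f(1)]
    have "?e = {(Min f, Max f, k, 0), (Max f, Min f, k, 0)}" using f(2) by (simp add: tip_edge_def)
    then have "(v = Min f \<and> w = Max f \<and> v' = Max f \<and> w' = Min f \<or> v = Max f \<and> w = Min f \<and> v' = Min f \<and> w' = Max f) \<and>
        i = k \<and> i' = k \<and> c = 0 \<and> c' = 0" by (auto simp: doubleton_eq_iff)
    moreover have "{Min f, Max f} \<in> E" using p(1) f(1) by simp
    ultimately show "v' = w \<and> w' = v \<and> i = k \<and> i' = k \<and> c = 0 \<and> c' = 0 \<and> {v, w} \<in> E"
      by (auto simp: insert_commute)
  next
    assume *: "v' = w \<and> w' = v \<and> i = k \<and> i' = k \<and> c = 0 \<and> c' = 0 \<and> {v, w} \<in> E"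
    have "?e = tip_edge k {v, w}" using * by (auto simp: tip_edge_def min_def max_def)
    then show "?e \<in> tip_edge k ` E" using * by blast
  qed
  have tipn: "{v, w} \<in> E \<longleftrightarrow> w < n \<and> adj v w" if "v' = w"
    using adj[of v w] b that by auto
  have "?e \<in> ising_edges n k E \<longleftrightarrow>
      (v = v' \<and> w = w' \<and> i = i' \<and> (c = 0 \<and> c' = 1 \<or> c = 1 \<and> c' = 0)) \<or>
      (v = v' \<and> i = 0 \<and> i' = 0 \<and> (w' = w + 1 \<and> c = 1 \<and> c' = 0 \<or> w = w' + 1 \<and> c' = 1 \<and> c = 0)) \<or>
      (v = v' \<and> w = w' \<and> c = 0 \<and> c' = 0 \<and> (i' = i + 1 \<or> i = i' + 1)) \<or>
      (v' = w \<and> w' = v \<and> i = k \<and> i' = k \<and> c = 0 \<and> c' = 0 \<and> {v, w} \<in> E)"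
    by (simp only: ising_edges_def select_edges_def Un_iff leaf backe stub tip disj_assoc)
  also have "\<dots> \<longleftrightarrow> ising_arc n k adj v w i c v' w' i' c' \<or> ising_arc n k adj v' w' i' c' v w i c"
  proof -
    let ?T = "v' = w \<and> w' = v \<and> i = k \<and> i' = k \<and> c = 0 \<and> c' = 0 \<and> {v, w} \<in> E"
    have t: "v' = w \<and> w' = v \<and> i = k \<and> i' = k \<and> c = 0 \<and> c' = 0 \<and> w < n \<and> adj v w \<longleftrightarrow> ?T"
      using adj[of v w] b(1,2) by auto
    have t': "v = w' \<and> w = v' \<and> i' = k \<and> i = k \<and> c' = 0 \<and> c = 0 \<and> w' < n \<and> adj v' w' \<longleftrightarrow> ?T"
      using adj[of w v] b(1,2) by (auto simp: insert_commute)
    have 1: "ising_arc n k adj v w i c v' w' i' c' \<longleftrightarrow>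
        (v = v' \<and> w = w' \<and> i = i' \<and> c = 0 \<and> c' = 1) \<or>
        (v = v' \<and> w' = w + 1 \<and> i = 0 \<and> i' = 0 \<and> c = 1 \<and> c' = 0) \<or>
        (v = v' \<and> w = w' \<and> i' = i + 1 \<and> c = 0 \<and> c' = 0) \<or> ?T"
      unfolding ising_arc_def t ..
    have 2: "ising_arc n k adj v' w' i' c' v w i c \<longleftrightarrow>
        (v = v' \<and> w = w' \<and> i = i' \<and> c = 1 \<and> c' = 0) \<or>
        (v = v' \<and> w = w' + 1 \<and> i = 0 \<and> i' = 0 \<and> c = 0 \<and> c' = 1) \<or>
        (v = v' \<and> w = w' \<and> i = i' + 1 \<and> c = 0 \<and> c' = 0) \<or> ?T"
      unfolding ising_arc_def t' by (intro arg_cong2[where f = "(\<or>)"] refl) auto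
    show ?thesis unfolding 1 2 by (rule iffI; elim disjE conjE; simp)
  qed
  finally show ?thesis .
qed

section \<open>Computability of the constructed graphs\<close>

section \<open>Computing the constructions\<close>

text \<open>The pairs with \<open>j < i\<close> count every edge once. The result is needed as an
  exponent in the scaling factors.\<close>

definition edge_count :: "bool list \<Rightarrow> nat" where
  "edge_count u = (\<Sum>i<graph_size u. \<Sum>j<i. of_bool (graph_edge u i j))"

lemma comp_edge_count: "comp (\<lambda>u \<rho>. edge_count u)"
  unfolding edge_count_def
proof (rule comp_sum[OF comp_graph_size, of "\<lambda>u \<rho> i. \<Sum>j<i. of_bool (graph_edge u i j)"])
  show "comp (\<lambda>u \<rho>. \<Sum>j<\<rho> 0. of_bool (graph_edge u (\<rho> 0) j))"
    by (rule comp_sum[of "\<lambda>u \<rho>. \<rho> 0" "\<lambda>u \<rho> j. of_bool (graph_edge u (\<rho> 0) j)"])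
      (intro comp_intros comp_graph_edge)+
qed

lemma edge_count_encode:
  assumes G: "finite_graph {..<n} E"
  shows "edge_count (encode_graph (n, E)) = card E"
proof -
  let ?S = "SIGMA i:{..<n}. {j. j < i \<and> {i, j} \<in> E}"
  have "(\<Sum>j<i. of_bool (graph_edge (encode_graph (n, E)) i j)) = card {j. j < i \<and> {i, j} \<in> E}" if "i < n" for i
  proof -
    have "(\<Sum>j<i. of_bool (graph_edge (encode_graph (n, E)) i j)) = (\<Sum>j<i. of_bool ({i, j} \<in> E) :: nat)"
      using that by (intro sum.cong refl) (simp add: graph_edge_encode)
    also have "\<dots> = card {j. j < i \<and> {i, j} \<in> E}" by (simp add: Int_def)
    finally show ?thesis .
  qed
  then have "edge_count (encode_graph (n, E)) = (\<Sum>i<n. card {j. j < i \<and> {i, j} \<in> E})"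
    unfolding edge_count_def graph_size_encode by (intro sum.cong refl) simp
  also have "\<dots> = card ?S" by (subst card_SigmaI) auto
  also have "card ?S = card E"
  proof (rule bij_betw_same_card, rule bij_betw_imageI)
    show "inj_on (\<lambda>(i, j). {i, j}) ?S" by (auto simp: inj_on_def doubleton_eq_iff)
    show "(\<lambda>(i, j). {i, j}) ` ?S = E"
    proof (intro equalityI subsetI)
      fix e assume e: "e \<in> E"
      note p = finite_graph_pair[OF G e]
      have "e = {Max e, Min e}" using p(1) by (simp add: insert_commute)
      moreover have "(Max e, Min e) \<in> ?S" using p(2,3) e \<open>e = {Max e, Min e}\<close> by auto
      ultimately show "e \<in> (\<lambda>(i, j). {i, j}) ` ?S" by (metis (mono_tags, lifting) image_eqI prod.case)
    qed auto
  qed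
  finally show ?thesis .
qed

text \<open>Lookup in a fixed finite table, such as the adjacency of the weight gadget.\<close>

lemma comp_mem_finite:
  assumes "finite S" "comp f" "comp g"
  shows "comp (\<lambda>u \<rho>. of_bool ((f u \<rho>, g u \<rho>) \<in> S))"
  using assms(1)
proof (induction S rule: finite_induct)
  case empty
  show ?case using comp_const[of 0] by simp
next
  case (insert x S)
  have "(f u \<rho>, g u \<rho>) \<in> insert x S \<longleftrightarrow> f u \<rho> = fst x \<and> g u \<rho> = snd x \<or> (f u \<rho>, g u \<rho>) \<in> S" for u \<rho>
    by (auto simp: prod_eq_iff)
  then show ?case by (simp only:) (intro comp_disj comp_conj comp_eq assms(2,3) comp_const insert.IH)
qed

lemma comp_matching_arc:
  assumes "1 \<le> q" "comp n" "comp v" "comp w" "comp j" "comp v'" "comp w'" "comp j'"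
  shows "comp (\<lambda>u \<rho>. of_bool (matching_arc (n u \<rho>) p q (graph_edge u)
    (v u \<rho>) (w u \<rho>) (j u \<rho>) (v' u \<rho>) (w' u \<rho>) (j' u \<rho>)))"
proof -
  have "finite {(a, b). {a, b} \<in> weight_edges p q}"
  proof (rule finite_subset)
    show "{(a, b). {a, b} \<in> weight_edges p q} \<subseteq> {..<2 * q} \<times> {..<2 * q}"
      using weight_edges_bound[OF assms(1), of _ p] by blast
  qed simp
  then show ?thesis
    unfolding matching_arc_def by (intro comp_intros comp_graph_edge comp_mem_finite assms)
qed

lemma comp_ising_arc:
  assumes "comp n" "comp k" "comp v" "comp w" "comp i" "comp c" "comp v'" "comp w'" "comp i'" "comp c'"
  shows "comp (\<lambda>u \<rho>. of_bool (ising_arc (n u \<rho>) (k u \<rho>) (graph_edge u)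
    (v u \<rho>) (w u \<rho>) (i u \<rho>) (c u \<rho>) (v' u \<rho>) (w' u \<rho>) (i' u \<rho>) (c' u \<rho>)))"
  unfolding ising_arc_def by (intro comp_intros comp_graph_edge assms)

text \<open>\<open>matching_decode\<close> is written out here, so that only operations known to
  \<open>comp\<close> occur.\<close>

definition matching_adj :: "nat \<Rightarrow> nat \<Rightarrow> nat \<Rightarrow> (nat \<Rightarrow> nat \<Rightarrow> bool) \<Rightarrow> nat \<Rightarrow> nat \<Rightarrow> bool" where
  "matching_adj n p q adj x y \<longleftrightarrow>
     matching_arc n p q adj (x div (3 + 2 * q) div (2 * n + 1)) (x div (3 + 2 * q) mod (2 * n + 1)) (x mod (3 + 2 * q))
       (y div (3 + 2 * q) div (2 * n + 1)) (y div (3 + 2 * q) mod (2 * n + 1)) (y mod (3 + 2 * q)) \<or>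
     matching_arc n p q adj (y div (3 + 2 * q) div (2 * n + 1)) (y div (3 + 2 * q) mod (2 * n + 1)) (y mod (3 + 2 * q))
       (x div (3 + 2 * q) div (2 * n + 1)) (x div (3 + 2 * q) mod (2 * n + 1)) (x mod (3 + 2 * q))"

lemma comp_matching_adj:
  assumes "1 \<le> q" "comp n" "comp x" "comp y"
  shows "comp (\<lambda>u \<rho>. of_bool (matching_adj (n u \<rho>) p q (graph_edge u) (x u \<rho>) (y u \<rho>)))"
  unfolding matching_adj_def
  by (intro comp_disj comp_matching_arc comp_div comp_mod comp_add comp_mult comp_const assms)

lemma finite_graph_matching:
  assumes G: "finite_graph {..<n} E" and q: "1 \<le> q"
  shows "finite_graph (matching_vertices n q) (matching_edges n E p q)"
proof -
  have c: "chain_vertex v ` f \<subseteq> matching_vertices n q \<and> card (chain_vertex v ` f) = 2"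
    if "v < n" "f \<in> chain_edges (2 * n + 1)" for v f
  proof -
    have "x div 3 < 2 * n + 1" if "x \<in> f" for x
      using chain_edges_bound[OF \<open>f \<in> _\<close>] that by (intro less_mult_imp_div_less) (auto simp: mult.commute)
    moreover have "x mod 3 < 3 + 2 * q" for x :: nat by (rule order.strict_trans2[OF mod_less_divisor]) simp_all
    ultimately have "chain_vertex v ` f \<subseteq> matching_vertices n q"
      using that(1) unfolding matching_vertices_def chain_vertex_def by blast
    then show ?thesis unfolding card_image[OF inj_on_subset[OF inj_chain_vertex subset_UNIV]]
      using chain_edges_edges that(2) by (simp add: edges_def)
  qed
  have w: "weight_vertex x ` f \<subseteq> matching_vertices n q \<and> card (weight_vertex x ` f) = 2"
    if "x \<in> {..<n} \<times> {..<2 * n + 1}" "f \<in> weight_edges p q" for x f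
  proof -
    have "z < 2 * q" if "z \<in> f" for z using weight_edges_bound[OF q \<open>f \<in> _\<close>] that by auto
    then have "weight_vertex x z \<in> matching_vertices n q" if "z \<in> f" for z
      using that \<open>x \<in> _\<close> by (simp add: matching_vertices_def weight_vertex_def mem_Times_iff)
    then have "weight_vertex x ` f \<subseteq> matching_vertices n q" by blast
    then show ?thesis unfolding card_image[OF inj_on_subset[OF inj_weight_vertex subset_UNIV]]
      using weight_edges_edges that(2) by (simp add: edges_def)
  qed
  have l: "lower_connector f \<subseteq> matching_vertices n q \<and> card (lower_connector f) = 2"
    "upper_connector f \<subseteq> matching_vertices n q \<and> card (upper_connector f) = 2" if "f \<in> E" for f
    using finite_graph_pair(2,3)[OF G that] q
    by (auto simp: lower_connector_def upper_connector_def matching_vertices_def)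
  have "e \<subseteq> matching_vertices n q \<and> card e = 2" if "e \<in> matching_edges n E p q" for e
    using that unfolding matching_edges_def gadget_edges_def
    by (elim UnE UN_E imageE) (simp_all only: c w l lessThan_iff)
  moreover have "finite (matching_vertices n q)" by (simp add: matching_vertices_def)
  ultimately show ?thesis by (auto simp: finite_graph_def)
qed

lemma matching_adj_iff:
  assumes G: "finite_graph {..<n} E" and q: "1 \<le> q" and adj: "\<And>i j. i < n \<Longrightarrow> j < n \<Longrightarrow> adj i j \<longleftrightarrow> {i, j} \<in> E"
    and x: "x < n * (2 * n + 1) * (3 + 2 * q)" and y: "y < n * (2 * n + 1) * (3 + 2 * q)"
  shows "matching_adj n p q adj x y \<longleftrightarrow> {x, y} \<in> (`) (matching_code n q) ` matching_edges n E p q"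
proof -
  have d: "matching_decode n q z \<in> matching_vertices n q" if "z < n * (2 * n + 1) * (3 + 2 * q)" for z
    using that matching_code_image[of n q] matching_decode_code by (metis imageE lessThan_iff)
  have "{matching_code n q (matching_decode n q x), matching_code n q (matching_decode n q y)} \<in>
      (`) (matching_code n q) ` matching_edges n E p q \<longleftrightarrow>
      {matching_decode n q x, matching_decode n q y} \<in> matching_edges n E p q"
    using finite_graph_matching[OF G q, of p]
    by (intro image_pair_mem[OF inj_on_matching_code d[OF x] d[OF y]]) (auto simp: finite_graph_def)
  also have "\<dots> \<longleftrightarrow> matching_adj n p q adj x y"
    unfolding matching_adj_def matching_decode_def
    by (rule matching_edges_iff[OF G _ d[OF x, unfolded matching_decode_def] d[OF y, unfolded matching_decode_def]])
      (rule adj)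
  finally show ?thesis unfolding matching_code_decode ..
qed

definition ising_adj :: "nat \<Rightarrow> nat \<Rightarrow> (nat \<Rightarrow> nat \<Rightarrow> bool) \<Rightarrow> nat \<Rightarrow> nat \<Rightarrow> bool" where
  "ising_adj n k adj x y \<longleftrightarrow>
     ising_arc n k adj (x div ising_row n k) (x mod ising_row n k div (2 * (k + 1)))
       (x mod ising_row n k mod (2 * (k + 1)) div 2) (x mod ising_row n k mod (2 * (k + 1)) mod 2)
       (y div ising_row n k) (y mod ising_row n k div (2 * (k + 1)))
       (y mod ising_row n k mod (2 * (k + 1)) div 2) (y mod ising_row n k mod (2 * (k + 1)) mod 2) \<or>
     ising_arc n k adj (y div ising_row n k) (y mod ising_row n k div (2 * (k + 1)))
       (y mod ising_row n k mod (2 * (k + 1)) div 2) (y mod ising_row n k mod (2 * (k + 1)) mod 2)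
       (x div ising_row n k) (x mod ising_row n k div (2 * (k + 1)))
       (x mod ising_row n k mod (2 * (k + 1)) div 2) (x mod ising_row n k mod (2 * (k + 1)) mod 2)"

lemma comp_ising_adj:
  assumes "comp n" "comp k" "comp x" "comp y"
  shows "comp (\<lambda>u \<rho>. of_bool (ising_adj (n u \<rho>) (k u \<rho>) (graph_edge u) (x u \<rho>) (y u \<rho>)))"
  unfolding ising_adj_def ising_row_def
  by (intro comp_disj comp_ising_arc comp_div comp_mod comp_add comp_mult comp_const assms)

lemma ising_adj_iff:
  assumes G: "finite_graph {..<n} E" and adj: "\<And>i j. i < n \<Longrightarrow> j < n \<Longrightarrow> adj i j \<longleftrightarrow> {i, j} \<in> E"
    and x: "x < n * ising_row n k" and y: "y < n * ising_row n k"
  shows "ising_adj n k adj x y \<longleftrightarrow> {x, y} \<in> (`) (ising_code n k) ` ising_edges n k E"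
proof -
  note d = ising_decode_vertex[OF x] ising_decode_vertex[OF y]
  have "{ising_code n k (ising_decode n k x), ising_code n k (ising_decode n k y)} \<in>
      (`) (ising_code n k) ` ising_edges n k E \<longleftrightarrow> {ising_decode n k x, ising_decode n k y} \<in> ising_edges n k E"
    using finite_graph_ising[OF G, of k]
    by (intro image_pair_mem[OF inj_on_ising_code d]) (auto simp: finite_graph_def)
  also have "\<dots> \<longleftrightarrow> ising_adj n k adj x y"
    unfolding ising_adj_def ising_decode_def
    by (rule ising_edges_iff[OF G _ d[unfolded ising_decode_def]]) (rule adj)
  finally show ?thesis unfolding ising_code_decode ..
qed

section \<open>Size bounds and the dominance of perfect matchings\<close>

section \<open>Estimates\<close>

text \<open>Bounds the oracle's answer and with it the number of digits to be read.\<close>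

lemma card_perfect_matchings_le:
  assumes "finite_graph {..<n} E"
  shows "card (perfect_matchings {..<n} E) \<le> 2 ^ (n * n)"
proof -
  have f: "finite E" using assms by (rule finite_graph_finite_edges)
  have "card (perfect_matchings {..<n} E) \<le> card (Pow E)"
    using f by (intro card_mono) (auto simp: perfect_matchings_def)
  also have "\<dots> = 2 ^ card E" using f by (rule card_Pow)
  also have "\<dots> \<le> 2 ^ (n * n)" using card_edges_le[OF assms] by (intro power_increasing) auto
  finally show ?thesis .
qed

lemma abs_ising_Z_le:
  fixes b :: real
  assumes "0 \<le> b" "b \<le> 1" "finite V"
  shows "\<bar>ising_Z V E (-1) b\<bar> \<le> 2 ^ card V"
proof -
  have "\<bar>ising_Z V E (-1) b\<bar> \<le> (\<Sum>\<sigma>\<in>V \<rightarrow>\<^sub>E (UNIV :: spin set). \<bar>(-1) ^ num_plus V \<sigma> * b ^ num_cut E \<sigma>\<bar>)"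
    unfolding ising_Z_def by (rule sum_abs)
  also have "\<dots> \<le> (\<Sum>\<sigma>\<in>V \<rightarrow>\<^sub>E (UNIV :: spin set). 1)"
    using assms by (intro sum_mono) (simp add: abs_mult power_abs power_le_one)
  also have "\<dots> = 2 ^ card V" using assms(3) by (simp add: card_PiE UNIV_spin)
  finally show ?thesis .
qed

text \<open>If all degrees are odd, they are at least 1, so there are at least
  \<open>card V div 2\<close> edges, with equality exactly for perfect matchings. Every other odd
  subgraph carries at least one further factor \<open>T\<close>, and there are at most
  \<open>2 ^ card E\<close> of them.\<close>

lemma sum_odd_subgraphs_perfect_matchings:
  fixes T :: real
  assumes G: "finite_graph V E" and T: "0 \<le> T" "T \<le> 1"
  shows "\<exists>\<eta>::real. (\<Sum>A\<in>odd_subgraphs V E. T ^ card A) = T ^ (card V div 2) * (card (perfect_matchings V E) + \<eta>) \<and>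
    0 \<le> \<eta> \<and> \<eta> \<le> 2 ^ card E * T"
proof (cases "even (card V)")
  case False
  have "edges E" using G finite_graph_finite_edges[OF G] by (auto simp: edges_def finite_graph_def)
  then have "card (perfect_matchings V E) = 0"
    using num_pm_odd[of V E] False G by (simp add: num_pm_graph finite_graph_def)
  then show ?thesis using T(1) by (intro exI[of _ 0]) (simp add: odd_subgraphs_odd_card[OF G False])
next
  case True
  let ?n = "card V div 2" and ?O = "odd_subgraphs V E" and ?P = "perfect_matchings V E"
  have fV: "finite V" using G by (simp add: finite_graph_def)
  have fE: "finite E" by (rule finite_graph_finite_edges[OF G])
  have fO: "finite ?O" by (rule finite_odd_subgraphs[OF G])
  have P: "card A = ?n \<and> A \<in> ?O" if AP: "A \<in> ?P" for A
  proof -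
    have A: "A \<subseteq> E" using AP by (simp add: perfect_matchings_def)
    have d: "degree A v = 1" if "v \<in> V" for v by (rule perfect_matchings_degree[OF AP that])
    have "2 * card A = card V" using sum_degree[OF G A] d by simp
    then show ?thesis using A d by (simp add: odd_subgraphs_def)
  qed
  have O: "?n < card A" if AO: "A \<in> ?O - ?P" for A
  proof -
    have A: "A \<subseteq> E" "\<And>v. v \<in> V \<Longrightarrow> odd (degree A v)" using AO by (auto simp: odd_subgraphs_def)
    have pos: "1 \<le> degree A v" if "v \<in> V" for v using A(2)[OF that] by (cases "degree A v") auto
    have "\<exists>v\<in>V. degree A v \<noteq> 1"
    proof (rule ccontr)
      assume *: "\<not> (\<exists>v\<in>V. degree A v \<noteq> 1)"
      have "\<exists>!e. e \<in> A \<and> v \<in> e" if "v \<in> V" for v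
      proof -
        have "card {e\<in>A. v \<in> e} = 1" using that * by (simp add: degree_def)
        then obtain e where "{e\<in>A. v \<in> e} = {e}" by (auto simp: card_1_singleton_iff)
        then show ?thesis by (intro ex1I[of _ e]) blast+
      qed
      then have "A \<in> ?P" using A(1) unfolding perfect_matchings_def by blast
      then show False using AO by blast
    qed
    then obtain v where v: "v \<in> V" "1 < degree A v" using pos by (metis le_neq_implies_less)
    have "(\<Sum>v\<in>V. 1) < (\<Sum>v\<in>V. degree A v)"
      using v by (intro sum_strict_mono_ex1 fV ballI pos) auto
    then have "card V < 2 * card A" using sum_degree[OF G A(1)] by simp
    then show ?thesis by linarith
  qed
  let ?\<eta> = "\<Sum>A\<in>?O - ?P. T ^ (card A - ?n)"
  have sub: "?P \<subseteq> ?O" using P by blast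
  have "(\<Sum>A\<in>?O. T ^ card A) = (\<Sum>A\<in>?O - ?P. T ^ card A) + (\<Sum>A\<in>?P. T ^ card A)"
    by (rule sum.subset_diff[OF sub fO])
  also have "(\<Sum>A\<in>?P. T ^ card A) = card ?P * T ^ ?n" using P by simp
  also have "(\<Sum>A\<in>?O - ?P. T ^ card A) = T ^ ?n * ?\<eta>"
    unfolding sum_distrib_left using O by (intro sum.cong refl) (simp add: power_add[symmetric] less_imp_le)
  finally have "(\<Sum>A\<in>?O. T ^ card A) = T ^ ?n * (card ?P + ?\<eta>)" by (simp add: algebra_simps)
  moreover have "0 \<le> ?\<eta>" using T(1) by (intro sum_nonneg) simp
  moreover have "?\<eta> \<le> 2 ^ card E * T"
  proof -
    have "T ^ (card A - ?n) \<le> T" if "A \<in> ?O - ?P" for A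
      using power_decreasing[of 1 "card A - ?n" T] O[OF that] T by simp
    then have "?\<eta> \<le> card (?O - ?P) * T" by (rule sum_bounded_above)
    also have "card (?O - ?P) \<le> card (Pow E)" using fE by (intro card_mono) (auto simp: odd_subgraphs_def)
    then have "card (?O - ?P) * T \<le> 2 ^ card E * T"
      using T(1) by (intro mult_right_mono) (simp_all add: card_Pow[OF fE] numeral_power_le_of_nat_cancel_iff of_nat_le_numeral_power_cancel_iff)
    finally show ?thesis .
  qed
  ultimately show ?thesis by blast
qed

section \<open>The parameters of the two reductions\<close>

section \<open>The reductions\<close>

text \<open>Here \<open>\<eta> = 0\<close>. With \<open>m\<close> edges a nonzero value is at least
  \<open>(1 / (2 * s)) ^ m\<close>, which is at least \<open>2 ^ -(2 * q * m)\<close> because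
  \<open>2 * s \<le> 2 * q\<close>; the summand 5 in \<open>D\<close> stands for 32, which exceeds
  24. The additional \<open>graph_size u\<close> in \<open>K\<close> accounts for the factor
  \<open>2 ^ n\<close> of the Ising sum. The remaining factor \<open>(q / (2 * s)) ^ m\<close> and
  the \<open>q ^ J\<close> of the matching count go into \<open>ms\<close> and
  \<open>ds\<close>.\<close>

lemma IsingNorm_reducible:
  assumes rs: "0 < r" "r < s" and b: "b = real r / real s"
  shows "IsingNorm (-1) b \<Delta> \<le>\<^sub>A\<^sub>P PerfectMatchings"
proof -
  define p q where "p = s - r" and "q = s + r"
  have pq: "1 \<le> p" "p < q" "1 \<le> q" "q \<le> 2 * s" "2 * s \<le> 2 * q" using rs by (auto simp: p_def q_def)
  have b01: "0 < b" "b < 1" using rs by (simp_all add: b)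
  have "1 - b = real p / real s" "1 + b = real q / real s"
    using rs by (simp_all add: b p_def q_def of_nat_diff diff_divide_distrib add_divide_distrib)
  then have t: "(1 - b) / (1 + b) = real p / real q" and hb: "(1 + b) / 2 = real q / real (2 * s)"
    using rs by simp_all
  show ?thesis
  proof (rule AP_reducible_by_scaling[where N = "\<lambda>u l. graph_size u * (2 * graph_size u + 1) * (3 + 2 * q)"
      and D = "\<lambda>u l. 2 * q * edge_count u + l + 5" and K = "\<lambda>u l. 2 * q * edge_count u + l + 5 + graph_size u"
      and adj = "\<lambda>u l x. matching_adj (graph_size u) p q (graph_edge u)
        (x div (graph_size u * (2 * graph_size u + 1) * (3 + 2 * q)))
        (x mod (graph_size u * (2 * graph_size u + 1) * (3 + 2 * q)))"
      and ms = "[(q, \<lambda>u l. edge_count u)]"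
      and ds = "[(2 * s, \<lambda>u l. edge_count u), (q, \<lambda>u l. graph_size u * (2 * graph_size u + 1))]"], goal_cases)
    case 1
    show ?case by (simp add: IsingNorm_def)
  next
    case 2
    show ?case by (simp add: PerfectMatchings_def)
  next
    case 3
    show ?case by (intro comp_intros comp_graph_size)
  next
    case 4
    show ?case by (intro comp_intros comp_graph_size comp_edge_count)
  next
    case 5
    show ?case by (intro comp_intros comp_edge_count)
  next
    case 6
    show ?case using pq(3) by (intro comp_matching_adj comp_intros comp_graph_size)
  next
    case (7 a f)
    have "comp (\<lambda>u \<rho>. edge_count u)" "comp (\<lambda>u \<rho>. graph_size u * (2 * graph_size u + 1))"
      by (intro comp_intros comp_graph_size comp_edge_count)+
    then show ?case using 7 pq(3) rs by auto
  next
    case (8 x u l)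
    obtain n E where x: "x = (n, E)" by (cases x)
    have G: "finite_graph {..<n} E" using 8(1) by (simp add: x IsingNorm_def)
    have u: "graph_size u = n" "edge_count u = card E" "\<And>i j. i < n \<Longrightarrow> j < n \<Longrightarrow> graph_edge u i j \<longleftrightarrow> {i, j} \<in> E"
      using 8(2) by (simp_all add: x graph_size_encode edge_count_encode[OF G] graph_edge_encode)
    define m where "m = card E"
    define J where "J = n * (2 * n + 1)"
    define N where "N = J * (3 + 2 * q)"
    define F where "F = (`) (matching_code n q) ` matching_edges n E p q"
    define S where "S = (\<Sum>A\<in>odd_subgraphs {..<n} E. (real p / real q) ^ card A)"
    note GM = finite_graph_matching[OF G pq(3), of p]
    have GF: "finite_graph {..<N} F"
      using finite_graph_image[OF inj_on_matching_code GM] by (simp only: matching_code_image N_def J_def F_def)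
    have mJ: "m \<le> J" using card_edges_le[OF G] unfolding m_def J_def by (simp add: algebra_simps)
    have fE: "finite E" by (rule finite_graph_finite_edges[OF G])
    have cA: "card A \<le> m" if "A \<in> odd_subgraphs {..<n} E" for A
      unfolding m_def using that fE by (intro card_mono) (auto simp: odd_subgraphs_def)
    have "num_pm {..<N} F = num_pm (matching_vertices n q) (matching_edges n E p q)"
      unfolding F_def N_def J_def matching_code_image[symmetric]
      using GM by (intro num_pm_image[OF inj_on_matching_code]) (auto simp: finite_graph_def)
    then have "real (num_pm {..<N} F) = (\<Sum>A\<in>odd_subgraphs {..<n} E. real p ^ card A * real q ^ (J - card A))"
      by (simp add: num_pm_matching_graph[OF G pq(1,2)] J_def)
    also have "\<dots> = real q ^ J * S"
      unfolding S_def sum_distrib_left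
    proof (rule sum.cong[OF refl])
      fix A assume "A \<in> odd_subgraphs {..<n} E"
      then have "card A \<le> J" using cA mJ by fastforce
      then have "real q ^ J = real q ^ (J - card A) * real q ^ card A" by (simp add: power_add[symmetric])
      then show "real p ^ card A * real q ^ (J - card A) = real q ^ J * (real p / real q) ^ card A"
        using pq(3) by (simp add: power_divide)
    qed
    finally have aQ: "answer PerfectMatchings (N, F) = real q ^ J * S"
      by (simp add: PerfectMatchings_def num_pm_graph[OF GF])
    have aP: "answer (IsingNorm (-1) b \<Delta>) x = 2 ^ n * (real q / real (2 * s)) ^ m * S"
      using abs_ising_Z[OF b01 G] by (simp add: x IsingNorm_def t hb S_def m_def)
    have pow: "a ^ i \<le> 2 ^ (2 * q * i)" if "a \<le> 2 * q" for a i :: nat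
    proof -
      have "a \<le> 2 ^ (2 * q)" using that less_exp[of "2 * q"] by (meson le_less_trans less_imp_le)
      then have "a ^ i \<le> (2 ^ (2 * q)) ^ i" by (rule power_mono) simp
      then show ?thesis by (simp add: power_mult)
    qed
    have S0: "0 \<le> S" unfolding S_def by (intro sum_nonneg) simp
    \<comment> \<open>A single odd subgraph contributes at least \<open>(p / q) ^ m\<close>, which
      times the factor \<open>(q / (2 * s)) ^ m\<close> is at least
      \<open>(1 / (2 * s)) ^ m\<close>.\<close>
    have low: "24 * 2 ^ l \<le> answer (IsingNorm (-1) b \<Delta>) x * 2 ^ (2 * q * m + l + 5)" if "S \<noteq> 0"
    proof -
      obtain A where A: "A \<in> odd_subgraphs {..<n} E" using \<open>S \<noteq> 0\<close> unfolding S_def by (meson sum.not_neutral_contains_not_neutral)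
      have "(real p / real q) ^ m \<le> (real p / real q) ^ card A"
        using cA[OF A] pq by (intro power_decreasing) auto
      also have "\<dots> \<le> S" unfolding S_def
        by (rule member_le_sum[OF A]) (simp_all add: finite_odd_subgraphs[OF G])
      finally have "(real p / real q) ^ m \<le> S" .
      then have "1 * (real q / real (2 * s)) ^ m * (real p / real q) ^ m \<le> answer (IsingNorm (-1) b \<Delta>) x"
        unfolding aP by (intro mult_mono) auto
      moreover have "(real q / real (2 * s)) ^ m * (real p / real q) ^ m = (real p / real (2 * s)) ^ m"
        using pq(3) by (simp add: power_mult_distrib[symmetric])
      moreover have "(1 / real (2 * s)) ^ m \<le> (real p / real (2 * s)) ^ m"
        using pq(1) by (intro power_mono divide_right_mono) auto
      ultimately have 1: "(1 / real (2 * s)) ^ m \<le> answer (IsingNorm (-1) b \<Delta>) x" by simp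
      have "real ((2 * s) ^ m) \<le> real (2 ^ (2 * q * m))" using pow[OF pq(5)] by (simp only: of_nat_le_iff)
      then have "1 \<le> (1 / real (2 * s)) ^ m * 2 ^ (2 * q * m)" using rs by (simp add: power_divide field_simps)
      also have "\<dots> \<le> answer (IsingNorm (-1) b \<Delta>) x * 2 ^ (2 * q * m)" by (rule mult_right_mono[OF 1]) simp
      finally have "1 * (32 * 2 ^ l) \<le> answer (IsingNorm (-1) b \<Delta>) x * 2 ^ (2 * q * m) * (32 * 2 ^ l)"
        by (rule mult_right_mono) simp
      then have "32 * 2 ^ l \<le> answer (IsingNorm (-1) b \<Delta>) x * 2 ^ (2 * q * m + l + 5)"
        by (simp add: power_add mult_ac)
      moreover have "24 * 2 ^ l \<le> 32 * (2 ^ l :: real)" by simp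
      ultimately show ?thesis by linarith
    qed
    have ms: "q ^ m \<le> 2 ^ (2 * q * m)" by (rule pow) simp
    have "q ^ m * 1 \<le> (2 * s) ^ m * q ^ J" using pq(3,4) by (intro mult_mono power_mono) auto
    then have md: "q ^ m \<le> (2 * s) ^ m * q ^ J" by simp
    have ms': "q ^ m \<le> 2 ^ (2 * q * m + l + 5 + n)"
      using ms by (rule order_trans) (rule power_increasing, simp_all)
    show ?case unfolding u N_def[symmetric] m_def[symmetric] J_def[symmetric] factor_prod_simps
    proof (rule exI[of _ F], rule exI[of _ 0], intro conjI allI impI, goal_cases)
      case 1
      show ?case using GF by (simp add: PerfectMatchings_def)
    next
      case (2 i)
      then have "0 < N" by (cases N) auto
      with 2 have "i div N < N" "i mod N < N" by (auto intro: less_mult_imp_div_less)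
      then show ?case unfolding F_def N_def J_def by (intro matching_adj_iff[OF G pq(3)] u(3))
    next
      case 3
      show ?case by (simp add: aQ S0)
    next
      case 4
      show ?case using card_perfect_matchings_le[OF GF] by (simp add: PerfectMatchings_def flip: of_nat_le_iff)
    next
      case 5
      show ?case unfolding aP aQ using rs pq(3) by (simp add: power_add power_divide field_simps)
    next
      case 8
      show ?case by (simp add: aP S0)
    next
      case 9
      show ?case using low by (cases "S = 0") (simp_all add: aP)
    next
      case 10
      show ?case using md by simp
    next
      case 11
      show ?case using ms' by simp
    qed simp_all
  qed
qed

text \<open>The value is a natural number, so if nonzero it is at least 1, and
  \<open>24 * 2 ^ l \<le> 2 ^ (l + 5)\<close> makes \<open>D = l + 5\<close> sufficient.\<close>

lemma PerfectMatchings_reducible: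
  assumes rs: "0 < r" "r < s" and b: "b = real r / real s" and \<Delta>: "3 \<le> \<Delta>"
  shows "PerfectMatchings \<le>\<^sub>A\<^sub>P IsingNorm (-1) b \<Delta>"
proof -
  define p q where "p = s - r" and "q = s + r"
  have pq: "1 \<le> p" "p < q" "1 \<le> q" "2 * s \<le> 2 * q" using rs by (auto simp: p_def q_def)
  have b01: "0 < b" "b < 1" using rs by (simp_all add: b)
  have "1 - b = real p / real s" "1 + b = real q / real s"
    using rs by (simp_all add: b p_def q_def of_nat_diff diff_divide_distrib add_divide_distrib)
  then have t: "(1 - b) / (1 + b) = real p / real q" and hb: "(1 + b) / 2 = real q / real (2 * s)"
    using rs by simp_all
  define tt where "tt = real p / real q"
  have t01: "0 < tt" "tt < 1" using pq by (auto simp: tt_def)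
  obtain h where h: "tt ^ h < 1 / 2" using real_arch_pow_inv[of "1 / 2" tt] t01 by auto
  \<comment> \<open>Every \<open>h\<close> factors of \<open>t\<close> gain a factor 1/2. Hence
    \<open>t ^ (2 * k + 1)\<close> is at most \<open>2 ^ -(n * n + l + 7)\<close>: the summand
    \<open>n * n\<close> outweighs the number of edge subsets, and \<open>l + 7\<close> brings
    \<open>\<eta> * 2 ^ (l + 6)\<close> down to 1/2.\<close>
  define k where "k = (\<lambda>u l. h * (graph_size u * graph_size u + l + 7))"
  define N where "N = (\<lambda>u l. graph_size u * ising_row (graph_size u) (k u l))"
  \<comment> \<open>\<open>M\<close> is the number of edges of the constructed graph and
    \<open>\<tau>\<close> the exponent of \<open>t\<close> shared by all perfect matchings.\<close>
  define M where "M = (\<lambda>u l. graph_size u * graph_size u * (2 * k u l + 2) + edge_count u)"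
  define \<tau> where "\<tau> = (\<lambda>u l. graph_size u * graph_size u * (k u l + 1) + (2 * k u l + 1) * (graph_size u div 2))"
  \<comment> \<open>\<open>2 ^ e\<close> bounds the multiplier
    \<open>(2 * s) ^ M * q ^ \<tau>\<close>. It is put into the divisor to keep the scaling factor
    at most 1, and \<open>K\<close> makes up for it.\<close>
  define e where "e = (\<lambda>u l. 2 * q * (M u l + \<tau> u l))"
  have ck: "comp (\<lambda>u \<rho>. k u (f u \<rho>))" if "comp f" for f
    unfolding k_def using that by (intro comp_intros comp_graph_size)
  have cN: "comp (\<lambda>u \<rho>. N u (f u \<rho>))" if "comp f" for f
    unfolding N_def ising_row_def using ck[OF that] by (intro comp_add comp_mult comp_const comp_graph_size)
  have cM: "comp (\<lambda>u \<rho>. M u (f u \<rho>))" if "comp f" for f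
    unfolding M_def using ck[OF that] by (intro comp_add comp_mult comp_const comp_graph_size comp_edge_count)
  have c\<tau>: "comp (\<lambda>u \<rho>. \<tau> u (f u \<rho>))" if "comp f" for f
    unfolding \<tau>_def using ck[OF that] by (intro comp_add comp_mult comp_div comp_const comp_graph_size)
  have ce: "comp (\<lambda>u \<rho>. e u (f u \<rho>))" if "comp f" for f
    unfolding e_def using cM[OF that] c\<tau>[OF that] by (intro comp_add comp_mult comp_const)
  show ?thesis
  proof (rule AP_reducible_by_scaling[where N = N and D = "\<lambda>u l. l + 5" and K = "\<lambda>u l. l + 5 + e u l"
      and adj = "\<lambda>u l x. ising_adj (graph_size u) (k u l) (graph_edge u) (x div N u l) (x mod N u l)"
      and ms = "[(2 * s, M), (q, \<tau>)]" and ds = "[(2, \<lambda>u l. N u l + e u l), (q, M), (p, \<tau>)]"], goal_cases)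
    case 1
    show ?case by (simp add: PerfectMatchings_def)
  next
    case 2
    show ?case by (simp add: IsingNorm_def)
  next
    case 3
    show ?case by (rule cN[OF comp_var])
  next
    case 4
    show ?case by (intro comp_add comp_const ce comp_var)
  next
    case 5
    show ?case by (intro comp_add comp_const comp_var)
  next
    case 6
    show ?case by (intro comp_ising_adj comp_div comp_mod ck cN comp_var comp_graph_size)
  next
    case (7 a f)
    have "comp (\<lambda>u \<rho>. N u (\<rho> 0) + e u (\<rho> 0))" by (intro comp_add cN ce comp_var)
    then show ?case using 7 pq rs cM[OF comp_var[of 0]] c\<tau>[OF comp_var[of 0]] by auto
  next
    case (8 x u l)
    obtain n E where x: "x = (n, E)" by (cases x)
    have G: "finite_graph {..<n} E" using 8(1) by (simp add: x PerfectMatchings_def)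
    have u: "graph_size u = n" "edge_count u = card E" "\<And>i j. i < n \<Longrightarrow> j < n \<Longrightarrow> graph_edge u i j \<longleftrightarrow> {i, j} \<in> E"
      using 8(2) by (simp_all add: x graph_size_encode edge_count_encode[OF G] graph_edge_encode)
    define kk where "kk = k u l"
    define NN where "NN = N u l"
    define MM where "MM = M u l"
    define TT where "TT = \<tau> u l"
    define ee where "ee = e u l"
    have kk: "kk = h * (n * n + l + 7)" and NN: "NN = n * ising_row n kk"
      and MM: "MM = n * n * (2 * kk + 2) + card E" and TT: "TT = n * n * (kk + 1) + (2 * kk + 1) * (n div 2)"
      and ee: "ee = 2 * q * (MM + TT)"
      by (simp_all add: kk_def NN_def MM_def TT_def ee_def k_def N_def M_def \<tau>_def e_def u)
    define F where "F = (`) (ising_code n kk) ` ising_edges n kk E"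
    define T where "T = tt ^ (2 * kk + 1)"
    define c where "c = real (card (perfect_matchings {..<n} E))"
    note GI = finite_graph_ising[OF G, of kk]
    have GF: "finite_graph {..<NN} F"
      using finite_graph_image[OF inj_on_ising_code GI] by (simp only: ising_code_image NN F_def)
    have T01: "0 \<le> T" "T \<le> 1"
      unfolding T_def using t01 zero_le_power[of tt] power_le_one[of tt] by (simp_all only: less_imp_le)
    obtain \<eta> :: real where \<eta>: "(\<Sum>A\<in>odd_subgraphs {..<n} E. T ^ card A) = T ^ (n div 2) * (c + \<eta>)"
      "0 \<le> \<eta>" "\<eta> \<le> 2 ^ card E * T"
      using sum_odd_subgraphs_perfect_matchings[OF G T01] by (auto simp: c_def)
    have cF: "card F = MM" unfolding F_def MM
      by (simp only: card_edges_image[OF inj_on_ising_code GI subset_refl] card_ising_edges[OF G])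
    have "(\<Sum>A\<in>odd_subgraphs {..<NN} F. tt ^ card A) = (\<Sum>A\<in>odd_subgraphs (ising_vertices n kk) (ising_edges n kk E). tt ^ card A)"
      unfolding F_def NN ising_code_image[symmetric] by (rule sum_odd_subgraphs_image[OF inj_on_ising_code GI])
    also have "\<dots> = tt ^ (n * n * (kk + 1)) * (T ^ (n div 2) * (c + \<eta>))"
      unfolding sum_odd_ising[OF G] T_def[symmetric] \<eta>(1) ..
    also have "\<dots> = tt ^ TT * (c + \<eta>)"
      unfolding TT T_def power_add[of tt "n * n * (kk + 1)"] power_mult[of tt "2 * kk + 1" "n div 2"]
      by (rule mult.assoc[symmetric])
    finally have aQ: "answer (IsingNorm (-1) b \<Delta>) (NN, F) = 2 ^ NN * (real q / real (2 * s)) ^ MM * (tt ^ TT * (c + \<eta>))"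
      using abs_ising_Z[OF b01 GF] by (simp add: IsingNorm_def t hb cF tt_def)
    have aP: "answer PerfectMatchings x = c" by (simp add: x PerfectMatchings_def c_def)
    have c0: "0 \<le> c" by (simp add: c_def)
    have pow: "a ^ i \<le> 2 ^ (2 * q * i)" if "a \<le> 2 * q" for a i :: nat
    proof -
      have "a \<le> 2 ^ (2 * q)" using that less_exp[of "2 * q"] by (meson le_less_trans less_imp_le)
      then have "a ^ i \<le> (2 ^ (2 * q)) ^ i" by (rule power_mono) simp
      then show ?thesis by (simp add: power_mult)
    qed
    have "(2 * s) ^ MM * q ^ TT \<le> 2 ^ (2 * q * MM) * 2 ^ (2 * q * TT)"
      using pq(4) by (intro mult_mono pow) auto
    then have ms: "(2 * s) ^ MM * q ^ TT \<le> 2 ^ ee" by (simp add: ee power_add algebra_simps)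
    have "2 ^ ee * 1 \<le> 2 ^ (NN + ee) * (q ^ MM * p ^ TT)"
      using pq by (intro mult_mono power_increasing) auto
    then have md: "(2 * s) ^ MM * q ^ TT \<le> 2 ^ (NN + ee) * (q ^ MM * p ^ TT)" using ms by linarith
    have mK: "(2 * s) ^ MM * q ^ TT \<le> 2 ^ (l + 5 + ee)"
      using ms by (rule order_trans) (rule power_increasing, simp_all)
    have small: "\<eta> * 2 ^ (l + 5 + 1) < 1"
    proof -
      have "T \<le> tt ^ kk" unfolding T_def using t01 by (intro power_decreasing) auto
      also have "\<dots> = (tt ^ h) ^ (n * n + l + 7)" by (simp add: kk power_mult)
      also have "\<dots> \<le> (1 / 2) ^ (n * n + l + 7)" using h t01 by (intro power_mono) auto
      finally have T: "T \<le> (1 / 2) ^ (n * n + l + 7)" .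
      have "2 ^ card E \<le> (2 :: real) ^ (n * n)" using card_edges_le[OF G] by (intro power_increasing) auto
      then have "\<eta> \<le> 2 ^ (n * n) * (1 / 2) ^ (n * n + l + 7)"
        using \<eta>(3) T T01 by (meson mult_mono order_trans zero_le_power zero_le_numeral)
      also have "\<dots> = (1 / 2) ^ (l + 7)" by (simp add: power_add power_divide)
      finally have "\<eta> * 2 ^ (l + 5 + 1) \<le> (1 / 2) ^ (l + 7) * 2 ^ (l + 5 + 1)" by (rule mult_right_mono) simp
      also have "\<dots> = 1 / 2" by (simp add: power_add power_divide)
      finally show ?thesis by simp
    qed
    have deg: "degree F v \<le> \<Delta>" if "v < NN" for v
    proof -
      have "v \<in> ising_code n kk ` ising_vertices n kk" using that by (simp only: ising_code_image NN lessThan_iff)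
      then obtain y where y: "y \<in> ising_vertices n kk" "v = ising_code n kk y" by blast
      have "degree F v = degree (ising_edges n kk E) y"
        unfolding F_def y(2) by (rule degree_image[OF inj_on_ising_code GI subset_refl y(1)])
      then show ?thesis using degree_ising[OF G y(1)] \<Delta> by linarith
    qed
    show ?case unfolding factor_prod_simps NN_def[symmetric] MM_def[symmetric] TT_def[symmetric]
        ee_def[symmetric] kk_def[symmetric] u
    proof (rule exI[of _ F], rule exI[of _ \<eta>], intro conjI allI impI, goal_cases)
      case 1
      show ?case using GF deg by (simp add: IsingNorm_def)
    next
      case (2 i)
      then have "0 < NN" by (cases NN) auto
      with 2 have "i div NN < NN" "i mod NN < NN" by (auto intro: less_mult_imp_div_less)
      then show ?case unfolding F_def NN by (intro ising_adj_iff[OF G] u(3))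
    next
      case 3
      show ?case by (simp add: IsingNorm_def)
    next
      case 4
      have "2 ^ NN \<le> (2 :: real) ^ (NN * NN)" by (intro power_increasing) (cases NN, auto)
      moreover have "\<bar>ising_Z {..<NN} F (-1) b\<bar> \<le> 2 ^ NN" using abs_ising_Z_le[of b "{..<NN}" F] b01 by simp
      ultimately have "\<bar>ising_Z {..<NN} F (-1) b\<bar> \<le> 2 ^ (NN * NN)" by linarith
      then show ?case by (simp add: IsingNorm_def)
    next
      case 5
      show ?case unfolding aP aQ using rs pq by (simp add: tt_def power_add power_divide field_simps)
    next
      case 6
      show ?case by (rule \<eta>(2))
    next
      case 7
      show ?case by (rule small)
    next
      case 8
      show ?case by (simp add: aP c0)
    next
      case 9
      have "c = 0 \<or> 1 \<le> c" by (auto simp: c_def)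
      then show ?case
      proof
        assume "1 \<le> c"
        then have "24 * 2 ^ l \<le> c * (32 * 2 ^ l)" by simp
        then show ?thesis by (simp add: aP power_add mult_ac)
      qed (simp add: aP)
    next
      case 10
      show ?case using md by simp
    next
      case 11
      show ?case using mK by simp
    qed simp_all
  qed
qed

theorem theorem40:
  fixes b :: real
  assumes "b \<in> \<rat>" and "0 < b" and "b < 1"
  shows "(\<forall>(V :: 'a set) E. connected_graph V E \<longrightarrow>
            (even (card V) \<longrightarrow> ising_Z V E (-1) b > 0) \<and>
            (odd (card V) \<longrightarrow> ising_Z V E (-1) b = 0)) \<and>
         (\<forall>\<Delta> \<ge> 3. IsingNorm (-1) b \<Delta> \<equiv>\<^sub>A\<^sub>P PerfectMatchings)"
proof (intro conjI)
  show "\<forall>(V :: 'a set) E. connected_graph V E \<longrightarrow>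
      (even (card V) \<longrightarrow> ising_Z V E (-1) b > 0) \<and> (odd (card V) \<longrightarrow> ising_Z V E (-1) b = 0)"
    using ising_Z_connected[OF assms(2,3)] by blast
  obtain r s :: nat where rs: "s \<noteq> 0" "\<bar>b\<bar> = real r / real s" using Rats_abs_nat_div_natE[OF assms(1)] by metis
  then have b: "b = real r / real s" using assms(2) by simp
  have "0 < r" using assms(2) by (cases r) (simp_all add: b)
  moreover have "r < s" using assms(3) rs(1) by (simp add: b divide_less_eq)
  ultimately show "\<forall>\<Delta> \<ge> 3. IsingNorm (-1) b \<Delta> \<equiv>\<^sub>A\<^sub>P PerfectMatchings"
    unfolding AP_equivalent_def using IsingNorm_reducible PerfectMatchings_reducible b by blast
qed

end
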